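(* For every $S^0\in L^2_{st}$ there is a unique global mild solution of the strain-vorticity interaction model equation with initial data $S^0$, $$S\in C\left([0,+\infty);L^2_{st}\right)\cap C\left((0,+\infty);H^\infty\right).$$ Furthermore, if $S^0\in H^1_{st}$, then for all $0<t<+\infty$ $$\frac12\|S(\cdot,t)\|_{\dot H^1}^2+\int_0^t\|-\Delta S(\cdot,\tau)\|_{L^2}^2\,d\tau=\frac12\left\|S^0\right\|_{\dot H^1}^2 .$$
   Context: All functions are on $\mathbb{R}^3$. For a vector field $v$, $(\nabla_{sym}v)_{ij}=\frac12(\partial_iv_j+\partial_jv_i)$. Homogeneous Sobolev norms are normalized so that $\|f\|_{\dot H^1}=\|\nabla f\|_{L^2}$ and $\|f\|_{\dot H^2}=\|-\Delta f\|_{L^2}$; for matrix-valued functions the pointwise norm is the Frobenius norm. $\dot H^1_{df}$ is the space of divergence free vector fields $u:\mathbb{R}^3\to\mathbb{R}^3$ in $\dot H^1$. The space of strain matrices is $L^2_{st}=\{\nabla_{sym}u: u\in\dot H^1_{df}\}$, and $H^s_{st}=L^2_{st}\cap H^s$ for $s\ge 0$. $H^\infty=\bigcap_{k\ge0}H^k$. For $S\in L^2_{st}$, $u=-2\operatorname{div}(-\Delta)^{-1}S$ is the divergence free velocity with $S=\nabla_{sym}u$ (here $(\operatorname{div}S)_i=\sum_j\partial_jS_{ij}$), and the associated vorticity is $\omega=\nabla\times u=-2\nabla\times\operatorname{div}(-\Delta)^{-1}S$. $(\omega\otimes\omega)_{ij}=\omega_i\omega_j$. $P_{st}$ is the orthogonal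 projection of $L^2(\mathbb{R}^3;\{\text{symmetric }3\times3\text{ matrices}\})$ onto $L^2_{st}$; it is the zero-order Fourier multiplier $\widehat{P_{st}M}(\xi)=|\xi|^{-2}\left(\xi\otimes\Pi_\xi\hat M\xi+\Pi_\xi\hat M\xi\otimes\xi\right)$, $\Pi_\xi=I_3-\frac{\xi\otimes\xi}{|\xi|^2}$, and it commutes with the heat semigroup $e^{t\Delta}$. The strain-vorticity interaction model equation is $\partial_tS-\Delta S-\frac12P_{st}(\omega\otimes\omega)=0$. A mild solution on $[0,T)$ with initial data $S^0\in L^2_{st}$ is $S\in C([0,T);L^2_{st})$ such that for all $0<t<T$ $$S(\cdot,t)=e^{t\Delta}S^0+\frac12\int_0^te^{(t-\tau)\Delta}P_{st}(\omega\otimes\omega)(\cdot,\tau)\,d\tau .$$ It is global if $T=+\infty$. *)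

theory Defs
  imports "HOL-Analysis.Analysis"
begin

section \<open>The Hilbert space of square integrable functions on R^3\<close>

definition square_integrable :: "(real^3 \<Rightarrow> 'b::euclidean_space) \<Rightarrow> bool" where
  "square_integrable f \<longleftrightarrow>
     f \<in> borel_measurable lborel \<and> integrable lborel (\<lambda>x. (norm (f x))\<^sup>2)"

definition l2_rel :: "(real^3 \<Rightarrow> 'b::euclidean_space) \<Rightarrow> (real^3 \<Rightarrow> 'b) \<Rightarrow> bool" where
  "l2_rel f g \<longleftrightarrow> square_integrable f \<and> square_integrable g \<and> (AE x in lborel. f x = g x)"

lemma square_integrable_0: "square_integrable (\<lambda>x. 0)"
  by (simp add: square_integrable_def)

lemma square_integrable_scaleR:
  assumes "square_integrable f"
  shows "square_integrable (\<lambda>x. c *\<^sub>R f x)"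
  using assms by (auto simp: square_integrable_def power_mult_distrib)

lemma square_integrable_add:
  assumes "square_integrable f" "square_integrable g"
  shows "square_integrable (\<lambda>x. f x + g x)"
proof -
  have [measurable]: "f \<in> borel_measurable lborel" "g \<in> borel_measurable lborel"
    using assms by (auto simp: square_integrable_def)
  have "integrable lborel (\<lambda>x. (norm (f x + g x))\<^sup>2)"
  proof (rule Bochner_Integration.integrable_bound)
    show "integrable lborel (\<lambda>x. 2 * (norm (f x))\<^sup>2 + 2 * (norm (g x))\<^sup>2)"
      using assms by (auto simp: square_integrable_def)
    have "(norm (f x + g x))\<^sup>2 \<le> 2 * (norm (f x))\<^sup>2 + 2 * (norm (g x))\<^sup>2" for x
    proof -
      have "(norm (f x + g x))\<^sup>2 \<le> (norm (f x) + norm (g x))\<^sup>2"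
        by (intro power_mono norm_triangle_ineq) auto
      also have "\<dots> \<le> 2 * (norm (f x))\<^sup>2 + 2 * (norm (g x))\<^sup>2"
        using sum_squares_bound[of "norm (f x)" "norm (g x)"] by (simp add: power2_sum)
      finally show ?thesis .
    qed
    then show "AE x in lborel. norm ((norm (f x + g x))\<^sup>2)
        \<le> norm (2 * (norm (f x))\<^sup>2 + 2 * (norm (g x))\<^sup>2)"
      by (intro AE_I2) (simp add: abs_of_nonneg)
  qed auto
  then show ?thesis by (simp add: square_integrable_def)
qed

lemma square_integrable_uminus:
  "square_integrable f \<Longrightarrow> square_integrable (\<lambda>x. - f x)"
  using square_integrable_scaleR[of f "-1"] by simp

lemma square_integrable_diff:
  "square_integrable f \<Longrightarrow> square_integrable g \<Longrightarrow> square_integrable (\<lambda>x. f x - g x)"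
  using square_integrable_add[of f "\<lambda>x. - g x"] square_integrable_uminus[of g] by simp

lemma square_integrable_inner:
  assumes "square_integrable f" "square_integrable g"
  shows "integrable lborel (\<lambda>x. f x \<bullet> g x)"
proof -
  have [measurable]: "f \<in> borel_measurable lborel" "g \<in> borel_measurable lborel"
    using assms by (auto simp: square_integrable_def)
  show ?thesis
  proof (rule Bochner_Integration.integrable_bound)
    show "integrable lborel (\<lambda>x. (norm (f x))\<^sup>2 + (norm (g x))\<^sup>2)"
      using assms by (auto simp: square_integrable_def)
    have "\<bar>f x \<bullet> g x\<bar> \<le> (norm (f x))\<^sup>2 + (norm (g x))\<^sup>2" for x
      using Cauchy_Schwarz_ineq2[of "f x" "g x"] sum_squares_bound[of "norm (f x)" "norm (g x)"]
        mult_nonneg_nonneg[of "norm (f x)" "norm (g x)"] by simp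
    then show "AE x in lborel. norm (f x \<bullet> g x) \<le> norm ((norm (f x))\<^sup>2 + (norm (g x))\<^sup>2)"
      by auto
  qed auto
qed

quotient_type (overloaded) 'b l2 = "real^3 \<Rightarrow> 'b::euclidean_space" / partial: l2_rel
proof (rule part_equivpI)
  show "\<exists>f. l2_rel f (f :: real^3 \<Rightarrow> 'b)"
    by (rule exI[of _ "\<lambda>x. 0"]) (simp add: l2_rel_def square_integrable_0)
  show "symp (l2_rel :: (real^3 \<Rightarrow> 'b) \<Rightarrow> _)"
    by (rule sympI) (auto simp: l2_rel_def elim: AE_mp)
  show "transp (l2_rel :: (real^3 \<Rightarrow> 'b) \<Rightarrow> _)"
    by (rule transpI) (auto simp: l2_rel_def)
qed

instantiation l2 :: (euclidean_space) real_inner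
begin

lift_definition zero_l2 :: "'a l2" is "\<lambda>x. 0"
  by (simp add: l2_rel_def square_integrable_0)

lift_definition plus_l2 :: "'a l2 \<Rightarrow> 'a l2 \<Rightarrow> 'a l2" is "\<lambda>f g x. f x + g x"
  by (auto simp: l2_rel_def square_integrable_add)

lift_definition minus_l2 :: "'a l2 \<Rightarrow> 'a l2 \<Rightarrow> 'a l2" is "\<lambda>f g x. f x - g x"
  by (auto simp: l2_rel_def square_integrable_diff)

lift_definition uminus_l2 :: "'a l2 \<Rightarrow> 'a l2" is "\<lambda>f x. - f x"
  by (auto simp: l2_rel_def square_integrable_uminus)

lift_definition scaleR_l2 :: "real \<Rightarrow> 'a l2 \<Rightarrow> 'a l2" is "\<lambda>c f x. c *\<^sub>R f x"
  by (auto simp: l2_rel_def square_integrable_scaleR)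

lift_definition inner_l2 :: "'a l2 \<Rightarrow> 'a l2 \<Rightarrow> real" is "\<lambda>f g. \<integral>x. f x \<bullet> g x \<partial>lborel"
proof -
  fix f f' g g' :: "real^3 \<Rightarrow> 'a"
  assume *: "l2_rel f f'" "l2_rel g g'"
  then have [measurable]: "f \<in> borel_measurable lborel" "g \<in> borel_measurable lborel"
    "f' \<in> borel_measurable lborel" "g' \<in> borel_measurable lborel"
    by (auto simp: l2_rel_def square_integrable_def)
  show "(\<integral>x. f x \<bullet> g x \<partial>lborel) = (\<integral>x. f' x \<bullet> g' x \<partial>lborel)"
    by (rule integral_cong_AE) (use * in \<open>auto simp: l2_rel_def\<close>)
qed

definition norm_l2 :: "'a l2 \<Rightarrow> real" where
  "norm_l2 f = sqrt (f \<bullet> f)"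

definition dist_l2 :: "'a l2 \<Rightarrow> 'a l2 \<Rightarrow> real" where
  "dist_l2 f g = norm (f - g)"

definition sgn_l2 :: "'a l2 \<Rightarrow> 'a l2" where
  "sgn_l2 f = scaleR (inverse (norm f)) f"

definition uniformity_l2 :: "('a l2 \<times> 'a l2) filter" where
  "uniformity_l2 = (INF e\<in>{0<..}. principal {(f, g). dist f g < e})"

definition open_l2 :: "'a l2 set \<Rightarrow> bool" where
  "open_l2 U \<longleftrightarrow> (\<forall>f\<in>U. eventually (\<lambda>(f', g). f' = f \<longrightarrow> g \<in> U) uniformity)"

instance
proof
  fix f g h :: "'a l2" and a b :: real
  show "f + g + h = f + (g + h)"
    by transfer (auto simp: l2_rel_def square_integrable_add algebra_simps)
  show "f + g = g + f"
    by transfer (auto simp: l2_rel_def square_integrable_add algebra_simps)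
  show "0 + f = f"
    by transfer (auto simp: l2_rel_def)
  show "- f + f = 0"
    by transfer (auto simp: l2_rel_def square_integrable_0)
  show "f - g = f + - g"
    by transfer (auto simp: l2_rel_def square_integrable_diff)
  show "a *\<^sub>R (f + g) = a *\<^sub>R f + a *\<^sub>R g"
    by transfer (auto simp: l2_rel_def square_integrable_add square_integrable_scaleR
        scaleR_add_right)
  show "(a + b) *\<^sub>R f = a *\<^sub>R f + b *\<^sub>R f"
    by transfer (auto simp: l2_rel_def square_integrable_add square_integrable_scaleR
        scaleR_add_left)
  show "a *\<^sub>R b *\<^sub>R f = (a * b) *\<^sub>R f"
    by transfer (auto simp: l2_rel_def square_integrable_scaleR)
  show "1 *\<^sub>R f = f"
    by transfer (auto simp: l2_rel_def)
  show "f \<bullet> g = g \<bullet> f"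
    by transfer (simp add: inner_commute)
  show "(f + g) \<bullet> h = f \<bullet> h + g \<bullet> h"
    by transfer (simp add: l2_rel_def inner_add_left square_integrable_inner)
  show "(a *\<^sub>R f) \<bullet> g = a * (f \<bullet> g)"
    by transfer (simp add: l2_rel_def)
  show "0 \<le> f \<bullet> f"
    by transfer simp
  show "f \<bullet> f = 0 \<longleftrightarrow> f = 0"
  proof transfer
    fix f :: "real^3 \<Rightarrow> 'a"
    assume "l2_rel f f"
    then have f: "square_integrable f" by (simp add: l2_rel_def)
    have "(\<integral>x. f x \<bullet> f x \<partial>lborel) = 0 \<longleftrightarrow> (AE x in lborel. f x \<bullet> f x = 0)"
      by (rule integral_nonneg_eq_0_iff_AE) (use f in \<open>auto simp: square_integrable_inner\<close>)
    then show "(\<integral>x. f x \<bullet> f x \<partial>lborel) = 0 \<longleftrightarrow> l2_rel f (\<lambda>x. 0)"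
      using f by (simp add: l2_rel_def square_integrable_0)
  qed
qed (simp_all add: norm_l2_def dist_l2_def sgn_l2_def uniformity_l2_def open_l2_def)

end

lemma rep_l2_rel: "l2_rel (rep_l2 f) (rep_l2 f)"
  by (rule Quotient3_rep_reflp[OF Quotient3_l2])

lemma abs_rep_l2: "abs_l2 (rep_l2 f) = f"
  by (rule Quotient3_abs_rep[OF Quotient3_l2])

lemma square_integrable_rep_l2: "square_integrable (rep_l2 f)"
  using rep_l2_rel by (simp add: l2_rel_def)

lemma rep_abs_l2:
  assumes "square_integrable f"
  shows "AE x in lborel. rep_l2 (abs_l2 f) x = f x"
proof -
  have "l2_rel (rep_l2 (abs_l2 f)) f"
    by (rule rep_abs_rsp_left[OF Quotient3_l2]) (use assms in \<open>auto simp: l2_rel_def\<close>)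
  then show ?thesis by (simp add: l2_rel_def)
qed

lemma norm_abs_l2:
  assumes "square_integrable f"
  shows "(norm (abs_l2 f))\<^sup>2 = (\<integral>x. (norm (f x))\<^sup>2 \<partial>lborel)"
proof -
  have "l2_rel f f" using assms by (simp add: l2_rel_def)
  then have "abs_l2 f \<bullet> abs_l2 f = (\<integral>x. f x \<bullet> f x \<partial>lborel)"
    by (simp add: inner_l2.abs_eq)
  then show ?thesis by (simp add: power2_norm_eq_inner)
qed

lemma nn_norm_diff_l2:
  assumes "square_integrable f" "square_integrable g"
  shows "(\<integral>\<^sup>+x. ennreal ((norm (f x - g x))\<^sup>2) \<partial>lborel) = ennreal ((norm (abs_l2 f - abs_l2 g))\<^sup>2)"
proof -
  have d: "square_integrable (\<lambda>x. f x - g x)"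
    using assms by (rule square_integrable_diff)
  have "abs_l2 f - abs_l2 g = abs_l2 (\<lambda>x. f x - g x)"
    using assms by (simp add: minus_l2.abs_eq l2_rel_def)
  then have "(norm (abs_l2 f - abs_l2 g))\<^sup>2 = (\<integral>x. (norm (f x - g x))\<^sup>2 \<partial>lborel)"
    using norm_abs_l2[OF d] by simp
  moreover have "integrable lborel (\<lambda>x. (norm (f x - g x))\<^sup>2)"
    using d by (simp add: square_integrable_def)
  ultimately show ?thesis by (simp add: nn_integral_eq_integral)
qed

instance l2 :: (euclidean_space) banach
proof
  fix X :: "nat \<Rightarrow> 'a l2"
  assume X: "Cauchy X"
  have "\<exists>N. \<forall>m\<ge>N. \<forall>n\<ge>N. dist (X m) (X n) < (1/2)^k" for k :: nat
    using X by (simp add: Cauchy_def)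
  then obtain N where N: "\<And>k m n. m \<ge> N k \<Longrightarrow> n \<ge> N k \<Longrightarrow> dist (X m) (X n) < (1/2)^k"
    by metis
  define r where "r k = (\<Sum>i\<le>k. N i) + k" for k
  have rN: "r k \<ge> N j" if "j \<le> k" for j k
    using member_le_sum[of j "{..k}" N] that by (simp add: r_def)
  have sm: "strict_mono r"
    by (rule strict_mono_Suc_iff[THEN iffD2]) (simp add: r_def)
  define f where "f k = rep_l2 (X (r k))" for k
  have sq: "square_integrable (f k)" for k
    by (simp add: f_def square_integrable_rep_l2)
  have [measurable]: "f k \<in> borel_measurable lborel" for k
    using sq[of k] by (simp add: square_integrable_def)
  have absf: "abs_l2 (f k) = X (r k)" for k
    by (simp add: f_def abs_rep_l2)
  have close: "(\<integral>\<^sup>+x. ennreal ((norm (f j x - f k x))\<^sup>2) \<partial>lborel) \<le> ennreal (((1/2)^i)\<^sup>2)"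
    if "i \<le> j" "i \<le> k" for i j k
  proof -
    have "norm (X (r j) - X (r k)) \<le> (1/2)^i"
      using N[OF rN[OF that(1)] rN[OF that(2)]] by (simp add: dist_norm)
    then show ?thesis
      by (subst nn_norm_diff_l2[OF sq sq]) (auto simp: absf intro!: ennreal_leI power_mono)
  qed
  define h where "h k x = 2^k * (norm (f (Suc k) x - f k x))\<^sup>2" for k x
  have [measurable]: "h k \<in> borel_measurable lborel" for k
    unfolding h_def by measurable
  have "(\<integral>\<^sup>+x. (\<Sum>k. ennreal (h k x)) \<partial>lborel) = (\<Sum>k. \<integral>\<^sup>+x. ennreal (h k x) \<partial>lborel)"
    by (rule nn_integral_suminf) measurable
  also have "\<dots> \<le> (\<Sum>k. ennreal ((1/2)^k))"
  proof (rule suminf_le)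
    fix k
    have "(\<integral>\<^sup>+x. ennreal (h k x) \<partial>lborel)
        = ennreal (2^k) * (\<integral>\<^sup>+x. ennreal ((norm (f (Suc k) x - f k x))\<^sup>2) \<partial>lborel)"
      by (subst nn_integral_cmult[symmetric]) (auto simp: h_def ennreal_mult)
    also have "\<dots> \<le> ennreal (2^k) * ennreal (((1/2)^k)\<^sup>2)"
      by (intro mult_left_mono close) auto
    also have "\<dots> = ennreal ((1/2)^k)"
      by (simp add: ennreal_mult[symmetric] power2_eq_square power_divide)
    finally show "(\<integral>\<^sup>+x. ennreal (h k x) \<partial>lborel) \<le> ennreal ((1/2)^k)" .
  qed auto
  also have "\<dots> < \<infinity>"
    by (subst suminf_ennreal2) (auto simp: summable_geometric)
  finally have "(\<integral>\<^sup>+x. (\<Sum>k. ennreal (h k x)) \<partial>lborel) \<noteq> \<infinity>" by simp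
  then have "AE x in lborel. (\<Sum>k. ennreal (h k x)) \<noteq> \<infinity>"
    by (intro nn_integral_noteq_infinite) auto
  then have conv: "AE x in lborel. (\<lambda>k. f k x) \<longlonglongrightarrow> lim (\<lambda>k. f k x)"
  proof (rule AE_mp, intro AE_I2 impI)
    fix x
    assume "(\<Sum>k. ennreal (h k x)) \<noteq> \<infinity>"
    then have "summable (\<lambda>k. h k x)"
      by (intro summable_suminf_not_top) (auto simp: h_def)
    then have s: "summable (\<lambda>k. (1/2)^k + h k x)"
      by (intro summable_add summable_geometric) auto
    have "summable (\<lambda>k. f (Suc k) x - f k x)"
    proof (rule summable_comparison_test'[OF s])
      fix k :: nat
      define a where "a = norm (f (Suc k) x - f k x)"
      have "0 \<le> ((1/2)^k) * ((2^k * a - 1)\<^sup>2 + 2^k * a)"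
        by (intro mult_nonneg_nonneg add_nonneg_nonneg) (auto simp: a_def)
      also have "\<dots> = (1/2)^k + 2^k * a\<^sup>2 - a"
        by (simp add: power2_eq_square field_simps)
      finally show "norm (f (Suc k) x - f k x) \<le> (1/2)^k + h k x"
        by (simp add: h_def a_def)
    qed
    then have "convergent (\<lambda>n. \<Sum>k<n. f (Suc k) x - f k x)"
      by (simp add: summable_iff_convergent)
    then have "convergent (\<lambda>n. f n x - f 0 x)"
      by (simp only: sum_lessThan_telescope[of "\<lambda>k. f k x"])
    then have "convergent (\<lambda>n. (f n x - f 0 x) + f 0 x)"
      by (intro convergent_add convergent_const)
    then show "(\<lambda>k. f k x) \<longlonglongrightarrow> lim (\<lambda>k. f k x)"
      by (simp add: convergent_LIMSEQ_iff)
  qed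
  define F where "F x = lim (\<lambda>k. f k x)" for x
  have [measurable]: "F \<in> borel_measurable lborel"
    unfolding F_def by (rule borel_measurable_lim_metric) auto
  have Fk: "(\<integral>\<^sup>+x. ennreal ((norm (F x - f k x))\<^sup>2) \<partial>lborel) \<le> ennreal (((1/2)^k)\<^sup>2)" for k
  proof -
    have "(\<integral>\<^sup>+x. ennreal ((norm (F x - f k x))\<^sup>2) \<partial>lborel)
        = (\<integral>\<^sup>+x. liminf (\<lambda>j. ennreal ((norm (f j x - f k x))\<^sup>2)) \<partial>lborel)"
    proof (rule nn_integral_cong_AE, rule AE_mp[OF conv], intro AE_I2 impI)
      fix x
      assume "(\<lambda>k. f k x) \<longlonglongrightarrow> lim (\<lambda>k. f k x)"
      then have "(\<lambda>j. ennreal ((norm (f j x - f k x))\<^sup>2)) \<longlonglongrightarrow> ennreal ((norm (F x - f k x))\<^sup>2)"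
        unfolding F_def by (intro tendsto_intros)
      then show "ennreal ((norm (F x - f k x))\<^sup>2)
          = liminf (\<lambda>j. ennreal ((norm (f j x - f k x))\<^sup>2))"
        by (rule lim_imp_Liminf[OF sequentially_bot, symmetric])
    qed
    also have "\<dots> \<le> liminf (\<lambda>j. \<integral>\<^sup>+x. ennreal ((norm (f j x - f k x))\<^sup>2) \<partial>lborel)"
      by (rule nn_integral_liminf) measurable
    also have "\<dots> \<le> liminf (\<lambda>j. ennreal (((1/2)^k)\<^sup>2))"
      by (rule Liminf_mono) (auto intro!: eventually_sequentiallyI[of k] close)
    finally show ?thesis by (simp add: Liminf_const)
  qed
  have d: "square_integrable (\<lambda>x. F x - f 0 x)"
    unfolding square_integrable_def
  proof
    show "integrable lborel (\<lambda>x. (norm (F x - f 0 x))\<^sup>2)"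
      by (rule integrableI_bounded) (use Fk[of 0] in \<open>auto intro: le_less_trans\<close>)
  qed measurable
  have sF: "square_integrable F"
    using square_integrable_add[OF d sq[of 0]] by simp
  have le: "norm (X (r k) - abs_l2 F) \<le> (1/2)^k" for k
  proof -
    have "ennreal ((norm (abs_l2 F - X (r k)))\<^sup>2) \<le> ennreal (((1/2)^k)\<^sup>2)"
      using Fk[of k] nn_norm_diff_l2[OF sF sq[of k]] by (simp add: absf)
    then have "(norm (abs_l2 F - X (r k)))\<^sup>2 \<le> ((1/2)^k)\<^sup>2"
      by (simp add: ennreal_le_iff)
    then show ?thesis
      by (metis norm_minus_commute power2_le_imp_le zero_le_divide_1_iff zero_le_numeral
          zero_le_power)
  qed
  have "(\<lambda>k. X (r k) - abs_l2 F) \<longlonglongrightarrow> 0"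
    by (rule Lim_null_comparison[of _ "\<lambda>k. (1/2)^k"])
      (auto simp: le intro: LIMSEQ_power_zero)
  then have "(X \<circ> r) \<longlonglongrightarrow> abs_l2 F"
    by (simp add: LIM_zero_iff o_def)
  then show "convergent X"
    using Cauchy_converges_subseq[OF X sm] by (auto intro: convergentI)
qed

text \<open>\<open>rep_l2 f\<close> is some square integrable function in the class \<open>f\<close>; nothing below depends on the
  choice. For matrices the norm of \<open>real^3^3\<close> is the Frobenius norm.\<close>

type_synonym vector_l2 = "(real^3) l2"
type_synonym matrix_l2 = "(real^3^3) l2"


section \<open>Schwartz functions, distributional derivatives and Fourier transforms\<close>

definition partial :: "3 \<Rightarrow> (real^3 \<Rightarrow> 'b::real_normed_vector) \<Rightarrow> real^3 \<Rightarrow> 'b" where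
  "partial i f x = frechet_derivative f (at x) (axis i 1)"

primrec partials :: "3 list \<Rightarrow> (real^3 \<Rightarrow> 'b::real_normed_vector) \<Rightarrow> real^3 \<Rightarrow> 'b" where
  "partials [] f = f"
| "partials (i # is) f = partial i (partials is f)"

definition schwartz :: "(real^3 \<Rightarrow> 'b::real_normed_vector) \<Rightarrow> bool" where
  "schwartz \<phi> \<longleftrightarrow> (\<forall>is. partials is \<phi> differentiable_on UNIV \<and>
     (\<forall>n::nat. bounded (range (\<lambda>x. norm x ^ n *\<^sub>R partials is \<phi> x))))"

text \<open>\<open>has_partial i f g\<close>: the function \<open>g\<close> is the derivative \<open>\<partial>\<^sub>i f\<close> in the sense of tempered
  distributions.\<close>

definition has_partial ::
    "3 \<Rightarrow> (real^3 \<Rightarrow> 'b::euclidean_space) \<Rightarrow> (real^3 \<Rightarrow> 'b) \<Rightarrow> bool" where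
  "has_partial i f g \<longleftrightarrow> (\<forall>\<phi>::real^3 \<Rightarrow> real. schwartz \<phi> \<longrightarrow>
     integrable lborel (\<lambda>x. \<phi> x *\<^sub>R g x) \<and> integrable lborel (\<lambda>x. partial i \<phi> x *\<^sub>R f x) \<and>
     (\<integral>x. \<phi> x *\<^sub>R g x \<partial>lborel) = - (\<integral>x. partial i \<phi> x *\<^sub>R f x \<partial>lborel))"

text \<open>The transform of integrable functions is unnormalized, so \<open>\<partial>\<^sub>j\<close> has symbol \<open>\<i> \<xi>\<^sub>j\<close> and
  \<open>-\<Delta>\<close> has symbol \<open>|\<xi>|\<^sup>2\<close>.\<close>

definition fourier_L1 :: "(real^3 \<Rightarrow> complex) \<Rightarrow> real^3 \<Rightarrow> complex" where
  "fourier_L1 \<phi> \<xi> = (\<integral>x. \<phi> x * exp (- (\<i> * complex_of_real (\<xi> \<bullet> x))) \<partial>lborel)"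

text \<open>\<open>has_fourier f F\<close>: the tempered distribution given by \<open>f\<close> has as Fourier transform the
  function \<open>F\<close>. This applies to functions in \<open>L\<^sup>1\<close>, in \<open>L\<^sup>2\<close> and in the homogeneous space of
  order 1 alike, and determines \<open>f\<close> and \<open>F\<close> from each other almost everywhere.\<close>

definition has_fourier :: "(real^3 \<Rightarrow> complex) \<Rightarrow> (real^3 \<Rightarrow> complex) \<Rightarrow> bool" where
  "has_fourier f F \<longleftrightarrow> (\<forall>\<phi>::real^3 \<Rightarrow> complex. schwartz \<phi> \<longrightarrow>
     integrable lborel (\<lambda>\<xi>. F \<xi> * \<phi> \<xi>) \<and> integrable lborel (\<lambda>x. f x * fourier_L1 \<phi> x) \<and>
     (\<integral>\<xi>. F \<xi> * \<phi> \<xi> \<partial>lborel) = (\<integral>x. f x * fourier_L1 \<phi> x \<partial>lborel))"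

definition has_fourier_vec :: "(real^3 \<Rightarrow> real^3) \<Rightarrow> (real^3 \<Rightarrow> complex^3) \<Rightarrow> bool" where
  "has_fourier_vec u U \<longleftrightarrow>
     (\<forall>i. has_fourier (\<lambda>x. complex_of_real (u x $ i)) (\<lambda>\<xi>. U \<xi> $ i))"

definition has_fourier_mat :: "(real^3 \<Rightarrow> real^3^3) \<Rightarrow> (real^3 \<Rightarrow> complex^3^3) \<Rightarrow> bool" where
  "has_fourier_mat M N \<longleftrightarrow>
     (\<forall>i j. has_fourier (\<lambda>x. complex_of_real (M x $ i $ j)) (\<lambda>\<xi>. N \<xi> $ i $ j))"

definition fourier_mat :: "(real^3 \<Rightarrow> real^3^3) \<Rightarrow> real^3 \<Rightarrow> complex^3^3" where
  "fourier_mat M = (SOME N. has_fourier_mat M N)"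


section \<open>Sobolev spaces and norms\<close>

definition Hs :: "real \<Rightarrow> matrix_l2 set" where
  "Hs s = {f. integrable lborel
     (\<lambda>\<xi>. (1 + (norm \<xi>)\<^sup>2) powr s * (norm (fourier_mat (rep_l2 f) \<xi>))\<^sup>2)}"

definition Hs_norm :: "real \<Rightarrow> matrix_l2 \<Rightarrow> real" where
  "Hs_norm s f =
     sqrt (\<integral>\<xi>. (1 + (norm \<xi>)\<^sup>2) powr s * (norm (fourier_mat (rep_l2 f) \<xi>))\<^sup>2 \<partial>lborel)"

text \<open>The intersection of all \<open>H\<^sup>k\<close> carries the topology given by all the \<open>H\<^sup>k\<close> norms.\<close>

definition continuous_on_Hinf :: "real set \<Rightarrow> (real \<Rightarrow> matrix_l2) \<Rightarrow> bool" where
  "continuous_on_Hinf I S \<longleftrightarrow> (\<forall>k::nat.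
     (\<forall>t\<in>I. S t \<in> Hs (real k)) \<and>
     (\<forall>t\<in>I. ((\<lambda>s. Hs_norm (real k) (S s - S t)) \<longlongrightarrow> 0) (at t within I)))"

definition l2_partial :: "3 \<Rightarrow> 'b::euclidean_space l2 \<Rightarrow> 'b l2" where
  "l2_partial i f = (THE g. has_partial i (rep_l2 f) (rep_l2 g))"

definition l2_laplacian :: "'b::euclidean_space l2 \<Rightarrow> 'b l2" where
  "l2_laplacian f = (\<Sum>i\<in>UNIV. l2_partial i (l2_partial i f))"

definition Hdot1_norm :: "'b::euclidean_space l2 \<Rightarrow> real" where
  "Hdot1_norm f = sqrt (\<Sum>i\<in>UNIV. (norm (l2_partial i f))\<^sup>2)"

definition Hdot1_vec :: "(real^3 \<Rightarrow> real^3) set" where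
  "Hdot1_vec = {u. u \<in> borel_measurable lborel \<and>
     (\<exists>U. has_fourier_vec u U \<and> integrable lborel (\<lambda>\<xi>. (norm \<xi>)\<^sup>2 * (norm (U \<xi>))\<^sup>2))}"


section \<open>Strain matrices\<close>

definition divergence_free :: "(real^3 \<Rightarrow> real^3) \<Rightarrow> bool" where
  "divergence_free u \<longleftrightarrow> (\<exists>g. (\<forall>i. has_partial i u (g i)) \<and>
     (AE x in lborel. (\<Sum>i\<in>UNIV. g i x $ i) = 0))"

definition has_sym_grad :: "(real^3 \<Rightarrow> real^3) \<Rightarrow> (real^3 \<Rightarrow> real^3^3) \<Rightarrow> bool" where
  "has_sym_grad u M \<longleftrightarrow> (\<exists>g. (\<forall>i. has_partial i u (g i)) \<and>
     (AE x in lborel. M x = (\<chi> i j. (g i x $ j + g j x $ i) / 2)))"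

definition has_curl :: "(real^3 \<Rightarrow> real^3) \<Rightarrow> (real^3 \<Rightarrow> real^3) \<Rightarrow> bool" where
  "has_curl u w \<longleftrightarrow> (\<exists>g. (\<forall>i. has_partial i u (g i)) \<and>
     (AE x in lborel. w x =
        vector [g 2 x $ 3 - g 3 x $ 2, g 3 x $ 1 - g 1 x $ 3, g 1 x $ 2 - g 2 x $ 1]))"

definition Hdot1_df :: "(real^3 \<Rightarrow> real^3) set" where
  "Hdot1_df = {u \<in> Hdot1_vec. divergence_free u}"

definition L2_st :: "matrix_l2 set" where
  "L2_st = {S. \<exists>u\<in>Hdot1_df. has_sym_grad u (rep_l2 S)}"

definition Hs_st :: "real \<Rightarrow> matrix_l2 set" where
  "Hs_st s = L2_st \<inter> Hs s"

text \<open>The velocity \<open>u = -2 div (-\<Delta>)\<^sup>-\<^sup>1 S\<close> is defined through its Fourier transform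
  \<open>-2 |\<xi>|\<^sup>-\<^sup>2 \<Sum>\<^sub>j \<i> \<xi>\<^sub>j S\<^sub>i\<^sub>j(\<xi>)\<close>; it is a function, but in general not in \<open>L\<^sup>2\<close>.\<close>

definition is_velocity :: "matrix_l2 \<Rightarrow> (real^3 \<Rightarrow> real^3) \<Rightarrow> bool" where
  "is_velocity S u \<longleftrightarrow> u \<in> borel_measurable lborel \<and>
     has_fourier_vec u (\<lambda>\<xi>. \<chi> i. - 2 *
       (\<Sum>j\<in>UNIV. \<i> * complex_of_real (\<xi> $ j) * fourier_mat (rep_l2 S) \<xi> $ i $ j)
         / complex_of_real ((norm \<xi>)\<^sup>2))"

definition vorticity :: "matrix_l2 \<Rightarrow> vector_l2" where
  "vorticity S = (THE w. \<exists>u. is_velocity S u \<and> has_curl u (rep_l2 w))"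


section \<open>The heat semigroup and the projection onto strain matrices\<close>

definition outer :: "'c::times^3 \<Rightarrow> 'c^3 \<Rightarrow> 'c^3^3" where
  "outer a b = (\<chi> i j. a $ i * b $ j)"

definition complex_vec :: "real^3 \<Rightarrow> complex^3" where
  "complex_vec \<xi> = (\<chi> i. complex_of_real (\<xi> $ i))"

definition Pi_symbol :: "real^3 \<Rightarrow> complex^3^3" where
  "Pi_symbol \<xi> = mat 1 - (1 / (norm \<xi>)\<^sup>2) *\<^sub>R outer (complex_vec \<xi>) (complex_vec \<xi>)"

definition Pst_symbol :: "real^3 \<Rightarrow> complex^3^3 \<Rightarrow> complex^3^3" where
  "Pst_symbol \<xi> A = (1 / (norm \<xi>)\<^sup>2) *\<^sub>R
     (outer (complex_vec \<xi>) (Pi_symbol \<xi> *v (A *v complex_vec \<xi>)) +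
      outer (Pi_symbol \<xi> *v (A *v complex_vec \<xi>)) (complex_vec \<xi>))"

definition heat_symbol :: "real \<Rightarrow> real^3 \<Rightarrow> complex^3^3 \<Rightarrow> complex^3^3" where
  "heat_symbol t \<xi> A = exp (- t * (norm \<xi>)\<^sup>2) *\<^sub>R A"

definition multiplier ::
    "(real^3 \<Rightarrow> complex^3^3 \<Rightarrow> complex^3^3) \<Rightarrow> (real^3 \<Rightarrow> real^3^3) \<Rightarrow> matrix_l2" where
  "multiplier \<sigma> M =
     (THE N. has_fourier_mat (rep_l2 N) (\<lambda>\<xi>. \<sigma> \<xi> (fourier_mat M \<xi>)))"

definition heat :: "real \<Rightarrow> matrix_l2 \<Rightarrow> matrix_l2" where
  "heat t S = multiplier (heat_symbol t) (rep_l2 S)"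

text \<open>The operator \<open>e\<^sup>t\<^sup>\<Delta> P\<^sub>s\<^sub>t\<close>. It has to be applied to \<open>\<omega> \<otimes> \<omega>\<close>, which is only in \<open>L\<^sup>1\<close> when the
  strain is in \<open>L\<^sup>2\<close>. There \<open>P\<^sub>s\<^sub>t\<close> alone yields a distribution in general, but for \<open>t > 0\<close> the
  composition yields a function in \<open>L\<^sup>2\<close>; hence the symbols are composed.\<close>

definition heat_Pst :: "real \<Rightarrow> (real^3 \<Rightarrow> real^3^3) \<Rightarrow> matrix_l2" where
  "heat_Pst t M = multiplier (\<lambda>\<xi> A. heat_symbol t \<xi> (Pst_symbol \<xi> A)) M"


section \<open>Mild solutions\<close>

definition vort_tensor :: "matrix_l2 \<Rightarrow> real^3 \<Rightarrow> real^3^3" where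
  "vort_tensor S x = outer (rep_l2 (vorticity S) x) (rep_l2 (vorticity S) x)"

text \<open>The time integral is a vector-valued one in \<open>L\<^sup>2\<close>. The value of the integrand at the endpoint
  \<open>\<tau> = t\<close> is irrelevant. The initial condition \<open>S 0 = S\<^sub>0\<close> follows from the equation and
  continuity.\<close>

definition mild_solution :: "ereal \<Rightarrow> matrix_l2 \<Rightarrow> (real \<Rightarrow> matrix_l2) \<Rightarrow> bool" where
  "mild_solution T S\<^sub>0 S \<longleftrightarrow>
     (\<forall>t. 0 \<le> t \<and> ereal t < T \<longrightarrow> S t \<in> L2_st) \<and>
     continuous_on {t. 0 \<le> t \<and> ereal t < T} S \<and>
     (\<forall>t. 0 < t \<and> ereal t < T \<longrightarrow>
        (\<lambda>\<tau>. heat_Pst (t - \<tau>) (vort_tensor (S \<tau>))) integrable_on {0..t} \<and>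
        S t = heat t S\<^sub>0 +
          (1 / 2) *\<^sub>R integral {0..t} (\<lambda>\<tau>. heat_Pst (t - \<tau>) (vort_tensor (S \<tau>))))"

end

(* On the Fourier side the solution operator is a heat factor times a bounded symbol applied to the
  convolution of two vorticities, which is bounded when the strains are square integrable. As the heat
  kernel of time t has L^2 norm of order t^(-3/4), the Duhamel integral converges in L^2 and a
  contraction argument gives local solutions whose life span depends only on the L^2 norm. Trading the
  spare t^(1/8) for a weight |xi|^(1/4) at a time, the solution is smooth for positive times. The
  interaction term is orthogonal to the Laplacian of S, because div omega = 0 and
  (omega . grad) omega = grad |omega|^2 / 2 - omega x curl omega. Hence the energy equality holds and the
  H^1 norm does not increase. Low frequencies of the Duhamel term are controlled by |xi| S, linearly
  in the L^2 norm of S, so the L^2 norm grows at most exponentially and the solution is global. *)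
theory Submission
  imports Defs "HOL-Probability.Probability"
begin

section \<open>Schwartz functions and the Fourier transform on the space of integrable functions\<close>

text \<open>No time derivative of S is taken in the equation: P_st of omega (x) omega need not lie
  in L^2, and only its product with the heat factor does. The equation is used in integrated form
  throughout, and the energy balance comes from increments over [t, t'] whose error is o(t' - t);
  the cancellation is exact for the state at each intermediate time, so that only the deviation of
  the heat factor from 1 remains there. Regularity is not presupposed either: powers of |xi|^(1/4)
  are cut off at a height R, which makes them bounded operators that commute with the time integral,
  and bounds independent of R pass to the limit by Fatou's lemma. The exponent 1/4 leaves room
  because -3/4 - 1/8 > -1. The obstacle to global existence is that the local life span is governed
  by the L^2 norm, while the controlled quantity is the homogeneous H^1 norm, which is weak at low
  frequencies. Continuation therefore advances by steps whose length depends on the H^1 bound alone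
  and within which the L^2 norm at most doubles; that bound is taken at a positive time, since the
  datum is only in L^2.\<close>

abbreviation cor :: "real \<Rightarrow> complex" where "cor \<equiv> complex_of_real"

section \<open>Closure properties of the Schwartz class\<close>

lemma partials_append: "partials (is @ js) f = partials is (partials js f)"
  by (induction "is") auto

text \<open>Iterated derivatives of products and compositions have unwieldy closed forms. It
  suffices instead to exhibit a class that is closed under a single derivative and whose members
  satisfy the conditions of order zero.\<close>

lemma schwartz_coinduct:
  assumes "P phi"
    and diff: "\<And>\<psi>. P \<psi> \<Longrightarrow> \<psi> differentiable_on UNIV"
    and bd: "\<And>\<psi> n. P \<psi> \<Longrightarrow> bounded (range (\<lambda>x. norm x ^ n *\<^sub>R \<psi> x))"
    and step: "\<And>\<psi> i. P \<psi> \<Longrightarrow> P (partial i \<psi>)"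
  shows "schwartz phi"
proof -
  have "P (partials is phi)" for "is"
    by (induction "is") (auto simp: assms)
  then show ?thesis
    by (auto simp: schwartz_def diff bd)
qed

lemma schwartz_partial: "schwartz phi \<Longrightarrow> schwartz (partial i phi)"
  unfolding schwartz_def using partials_append[of _ "[i]" phi] by (metis partials.simps)

lemma schwartz_differentiable_on: "schwartz phi \<Longrightarrow> phi differentiable_on UNIV"
  unfolding schwartz_def by (metis partials.simps(1))

lemma schwartz_differentiable: "schwartz phi \<Longrightarrow> phi differentiable (at x)"
  using schwartz_differentiable_on by (auto simp: differentiable_on_def)

lemma schwartz_bounded: "schwartz phi \<Longrightarrow> bounded (range (\<lambda>x. norm x ^ n *\<^sub>R phi x))"
  unfolding schwartz_def by (metis partials.simps(1))

lemma schwartz_bound: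
  assumes "schwartz phi"
  obtains C where "C \<ge> 0" "\<And>x. norm x ^ n * norm (phi x) \<le> C"
proof -
  obtain C where "\<And>x. norm (norm x ^ n *\<^sub>R phi x) \<le> C"
    using schwartz_bounded[OF assms, of n] by (auto simp: bounded_iff)
  then have "\<And>x. norm x ^ n * norm (phi x) \<le> C" by simp
  moreover from this[of 0] have "C \<ge> 0"
    by (meson mult_nonneg_nonneg norm_ge_zero order_trans zero_le_power)
  ultimately show ?thesis by (rule that[rotated])
qed

lemma partial_eqI: "(f has_derivative D) (at x) \<Longrightarrow> partial i f x = D (axis i 1)"
  unfolding partial_def by (metis frechet_derivative_at)

lemma bounded_range_norm_add:
  fixes f g :: "'a::real_normed_vector \<Rightarrow> 'b::real_normed_vector"
  assumes "bounded (range (\<lambda>x. norm x ^ n *\<^sub>R f x))" "bounded (range (\<lambda>x. norm x ^ n *\<^sub>R g x))"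
  shows "bounded (range (\<lambda>x. norm x ^ n *\<^sub>R (f x + g x)))"
  using bounded_plus_comp[of "\<lambda>x. norm x ^ n *\<^sub>R f x" UNIV "\<lambda>x. norm x ^ n *\<^sub>R g x"] assms
  by (simp add: scaleR_add_right)

lemma schwartz_add:
  assumes "schwartz phi" "schwartz \<psi>"
  shows "schwartz (\<lambda>x. phi x + \<psi> x)"
proof (rule schwartz_coinduct[where P="\<lambda>f. \<exists>phi \<psi>. schwartz phi \<and> schwartz \<psi> \<and> f = (\<lambda>x. phi x + \<psi> x)"])
  fix f :: "real^3 \<Rightarrow> 'a" and i
  assume "\<exists>phi \<psi>. schwartz phi \<and> schwartz \<psi> \<and> f = (\<lambda>x. phi x + \<psi> x)"
  then obtain phi \<psi> where s: "schwartz phi" "schwartz \<psi>" "f = (\<lambda>x. phi x + \<psi> x)" by auto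
  have "partial i f = (\<lambda>x. partial i phi x + partial i \<psi> x)"
  proof
    fix x
    show "partial i f x = partial i phi x + partial i \<psi> x"
      unfolding s(3)
      by (subst partial_eqI[OF has_derivative_add[OF s(1)[THEN schwartz_differentiable, unfolded frechet_derivative_works]
        s(2)[THEN schwartz_differentiable, unfolded frechet_derivative_works]]]) (simp add: partial_def)
  qed
  then show "\<exists>phi \<psi>. schwartz phi \<and> schwartz \<psi> \<and> partial i f = (\<lambda>x. phi x + \<psi> x)"
    using s schwartz_partial by blast
next
  show "\<exists>phi' \<psi>'. schwartz phi' \<and> schwartz \<psi>' \<and> (\<lambda>x. phi x + \<psi> x) = (\<lambda>x. phi' x + \<psi>' x)"
    using assms by blast
next
  fix f :: "real^3 \<Rightarrow> 'a" and n
  assume "\<exists>phi \<psi>. schwartz phi \<and> schwartz \<psi> \<and> f = (\<lambda>x. phi x + \<psi> x)"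
  then obtain phi \<psi> where s: "schwartz phi" "schwartz \<psi>" "f = (\<lambda>x. phi x + \<psi> x)" by auto
  show "f differentiable_on UNIV"
    unfolding s(3) by (intro differentiable_on_add schwartz_differentiable_on s)
  show "bounded (range (\<lambda>x. norm x ^ n *\<^sub>R f x))"
    unfolding s(3) by (intro bounded_range_norm_add schwartz_bounded s)
qed

lemma schwartz_linear:
  assumes L: "bounded_linear L" and "schwartz phi"
  shows "schwartz (\<lambda>x. L (phi x))"
proof (rule schwartz_coinduct[where P="\<lambda>f. \<exists>phi. schwartz phi \<and> f = (\<lambda>x. L (phi x))"])
  interpret bounded_linear L by fact
  fix f assume "\<exists>phi. schwartz phi \<and> f = (\<lambda>x. L (phi x))"
  then obtain phi where s: "schwartz phi" "f = (\<lambda>x. L (phi x))" by auto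
  note D = has_derivative_compose[OF s(1)[THEN schwartz_differentiable, unfolded frechet_derivative_works] bounded_linear.has_derivative[OF L has_derivative_ident]]
  show "f differentiable_on UNIV"
    using D unfolding s(2) differentiable_on_def by (auto simp: differentiable_def)
  show "bounded (range (\<lambda>x. norm x ^ n *\<^sub>R f x))" for n
    using bounded_linear_image[OF schwartz_bounded[OF s(1)] L] by (simp add: s(2) image_image scaleR)
  have "partial i f = (\<lambda>x. L (partial i phi x))" for i
    unfolding s(2) by (rule ext, subst partial_eqI[OF D]) (simp add: partial_def)
  then show "\<exists>phi. schwartz phi \<and> partial i f = (\<lambda>x. L (phi x))" for i
    using s schwartz_partial by blast
qed (use assms in auto)

lemma schwartz_coord:
  assumes "schwartz phi"
  shows "schwartz (\<lambda>x. x $ i *\<^sub>R phi x)"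
\<comment> \<open>The product rule produces an additional summand \<open>phi\<close>; the free
  Schwartz summand in the invariant absorbs it.\<close>
proof (rule schwartz_coinduct[where P="\<lambda>f. \<exists>phi \<psi>. schwartz phi \<and> schwartz \<psi> \<and> f = (\<lambda>x. x $ i *\<^sub>R phi x + \<psi> x)"])
  have "schwartz (\<lambda>x. 0 *\<^sub>R phi x)"
    using schwartz_linear[OF bounded_linear_scaleR_right assms] .
  then show "\<exists>phi' \<psi>. schwartz phi' \<and> schwartz \<psi> \<and> (\<lambda>x. x $ i *\<^sub>R phi x) = (\<lambda>x. x $ i *\<^sub>R phi' x + \<psi> x)"
    using assms by (intro exI[of _ phi] exI[of _ "\<lambda>x. 0"]) auto
next
  fix f :: "real^3 \<Rightarrow> 'a"
  assume "\<exists>phi \<psi>. schwartz phi \<and> schwartz \<psi> \<and> f = (\<lambda>x. x $ i *\<^sub>R phi x + \<psi> x)"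
  then obtain phi \<psi> where s: "schwartz phi" "schwartz \<psi>" "f = (\<lambda>x. x $ i *\<^sub>R phi x + \<psi> x)" by auto
  have D: "(f has_derivative (\<lambda>h. x $ i *\<^sub>R frechet_derivative phi (at x) h + h $ i *\<^sub>R phi x + frechet_derivative \<psi> (at x) h)) (at x)" for x
    unfolding s(3)
    by (intro has_derivative_add has_derivative_scaleR bounded_linear.has_derivative[OF bounded_linear_vec_nth] has_derivative_ident
      s(1)[THEN schwartz_differentiable, unfolded frechet_derivative_works]
        s(2)[THEN schwartz_differentiable, unfolded frechet_derivative_works])
  show "f differentiable_on UNIV"
    using D unfolding differentiable_on_def by (auto simp: differentiable_def)
  show "bounded (range (\<lambda>x. norm x ^ n *\<^sub>R f x))" for n
    unfolding s(3)
  proof (rule bounded_range_norm_add)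
    obtain C where C: "\<And>x. norm x ^ (Suc n) * norm (phi x) \<le> C" using schwartz_bound[OF s(1)] by blast
    have "norm (norm x ^ n *\<^sub>R x $ i *\<^sub>R phi x) \<le> C" for x
    proof -
      have "norm (norm x ^ n *\<^sub>R x $ i *\<^sub>R phi x) = \<bar>x $ i\<bar> * (norm x ^ n * norm (phi x))"
        by (simp add: abs_mult)
      also have "\<dots> \<le> norm x * (norm x ^ n * norm (phi x))"
        by (intro mult_right_mono component_le_norm_cart) auto
      also have "\<dots> \<le> C" using C[of x] by (simp add: mult.assoc)
      finally show ?thesis .
    qed
    then show "bounded (range (\<lambda>x. norm x ^ n *\<^sub>R x $ i *\<^sub>R phi x))" by (auto simp: bounded_iff)
  qed (rule schwartz_bounded[OF s(2)])
  fix j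
  have "partial j f = (\<lambda>x. x $ i *\<^sub>R partial j phi x + ((if i = j then 1 else 0) *\<^sub>R phi x + partial j \<psi> x))"
    by (rule ext, subst partial_eqI[OF D]) (auto simp: partial_def axis_def)
  moreover have "schwartz (\<lambda>x. (if i = j then 1 else 0) *\<^sub>R phi x + partial j \<psi> x)"
    by (intro schwartz_add schwartz_linear[OF bounded_linear_scaleR_right] s schwartz_partial)
  ultimately show "\<exists>phi \<psi>. schwartz phi \<and> schwartz \<psi> \<and> partial j f = (\<lambda>x. x $ i *\<^sub>R phi x + \<psi> x)"
    using schwartz_partial[OF s(1)] by blast
qed

section \<open>Integrability from decay, and integrals of derivatives\<close>

lemma prod_Basis3: "(\<Prod>b\<in>(Basis::(real^3) set). f b) = (\<Prod>i\<in>UNIV. f (axis i 1))"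
proof -
  have "(Basis::(real^3) set) = (\<lambda>i. axis i 1) ` UNIV"
    by (auto simp: Basis_vec_def)
  moreover have inj: "inj (\<lambda>i::3. axis i (1::real))"
    by (auto simp: inj_on_def axis_eq_axis)
  ultimately show ?thesis using prod.reindex[OF inj, of f] by (simp only: o_def)
qed

text \<open>The cube leaves one factor 1 / (1 + |x|^2) per coordinate, so that the weight lies below
  a product of three one-dimensional kernels and is integrable.\<close>

definition decay_weight :: "real^3 \<Rightarrow> real" where
  "decay_weight x = inverse ((1 + (norm x)\<^sup>2) ^ 3)"

lemma decay_weight_pos: "decay_weight x > 0"
  by (simp add: decay_weight_def add_pos_nonneg)

lemma borel_measurable_decay_weight[measurable]: "decay_weight \<in> borel_measurable borel"
  unfolding decay_weight_def[abs_def] by measurable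

lemma integrable_decay_weight: "integrable lborel decay_weight"
proof (rule Bochner_Integration.integrable_bound)
  have fin: "(\<integral>\<^sup>+x. ennreal (inverse (1 + x\<^sup>2)) \<partial>lborel) < \<infinity>"
  proof -
    have "integrable lborel (\<lambda>x::real. inverse (1 + x\<^sup>2))"
      using integrable_inverse_1_plus_square by (simp add: set_integrable_def)
    then show ?thesis by (subst (asm) integrable_iff_bounded) auto
  qed
  show "integrable lborel (\<lambda>x::real^3. \<Prod>b\<in>Basis. inverse (1 + (x \<bullet> b)\<^sup>2))"
    unfolding integrable_iff_bounded
  proof
    have "(\<integral>\<^sup>+x. ennreal (norm (\<Prod>b\<in>Basis. inverse (1 + (x \<bullet> b)\<^sup>2))) \<partial>(lborel::(real^3) measure))
      = (\<integral>\<^sup>+x. (\<Prod>b\<in>Basis. ennreal (inverse (1 + (x \<bullet> b)\<^sup>2))) \<partial>(lborel::(real^3) measure))"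
      by (rule nn_integral_cong) (simp add: prod_ennreal abs_prod)
    also have "\<dots> = (\<Prod>b\<in>(Basis::(real^3) set). \<integral>\<^sup>+x. ennreal (inverse (1 + x\<^sup>2)) \<partial>lborel)"
      by (rule nn_integral_lborel_prod) auto
    also have "\<dots> < \<infinity>" using fin by (simp add: power_less_top_ennreal)
    finally show "(\<integral>\<^sup>+x. ennreal (norm (\<Prod>b\<in>Basis. inverse (1 + (x \<bullet> b)\<^sup>2))) \<partial>(lborel::(real^3) measure)) < \<infinity>" .
  qed measurable
  show "AE x in lborel. norm (decay_weight x) \<le> norm (\<Prod>b\<in>Basis. inverse (1 + (x \<bullet> b)\<^sup>2))"
  proof (rule AE_I2)
    fix x :: "real^3"
    have "(\<Prod>b\<in>(Basis::(real^3) set). inverse (1 + (norm x)\<^sup>2)) \<le> (\<Prod>b\<in>Basis. inverse (1 + (x \<bullet> b)\<^sup>2))"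
    proof (rule prod_mono)
      fix b :: "real^3" assume b: "b \<in> Basis"
      have "(x \<bullet> b)\<^sup>2 \<le> (norm x)\<^sup>2"
        using Basis_le_norm[OF b, of x] by (metis abs_ge_zero power2_abs power_mono)
      then show "0 \<le> inverse (1 + (norm x)\<^sup>2) \<and> inverse (1 + (norm x)\<^sup>2) \<le> inverse (1 + (x \<bullet> b)\<^sup>2)"
        by (auto intro!: le_imp_inverse_le add_pos_nonneg)
    qed
    moreover have "decay_weight x = (\<Prod>b\<in>(Basis::(real^3) set). inverse (1 + (norm x)\<^sup>2))"
      by (simp add: decay_weight_def power_inverse)
    ultimately show "norm (decay_weight x) \<le> norm (\<Prod>b\<in>Basis. inverse (1 + (x \<bullet> b)\<^sup>2))"
      using decay_weight_pos[of x] by simp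
  qed
qed measurable

lemma schwartz_decay:
  assumes "schwartz phi"
  obtains C where "C \<ge> 0" "\<And>x. norm (phi x) \<le> C * decay_weight x"
proof -
  obtain C0 where C0: "C0 \<ge> 0" "\<And>x. norm x ^ 0 * norm (phi x) \<le> C0" using schwartz_bound[OF assms] by metis
  obtain C2 where C2: "C2 \<ge> 0" "\<And>x. norm x ^ 2 * norm (phi x) \<le> C2" using schwartz_bound[OF assms] by metis
  obtain C4 where C4: "C4 \<ge> 0" "\<And>x. norm x ^ 4 * norm (phi x) \<le> C4" using schwartz_bound[OF assms] by metis
  obtain C6 where C6: "C6 \<ge> 0" "\<And>x. norm x ^ 6 * norm (phi x) \<le> C6" using schwartz_bound[OF assms] by metis
  \<comment> \<open>The coefficients are those of the expansion of (1 + |x|^2)^3.\<close>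
  have "norm (phi x) \<le> (C0 + 3 * C2 + 3 * C4 + C6) * decay_weight x" for x
  proof -
    have "(1 + (norm x)\<^sup>2)^3 * norm (phi x) = norm x ^ 0 * norm (phi x) + 3 * (norm x ^ 2 * norm (phi x))
      + 3 * (norm x ^ 4 * norm (phi x)) + norm x ^ 6 * norm (phi x)"
      by (simp add: power2_eq_square power3_eq_cube power4_eq_xxxx field_simps eval_nat_numeral)
    also have "\<dots> \<le> C0 + 3 * C2 + 3 * C4 + C6"
      using C0(2)[of x] C2(2)[of x] C4(2)[of x] C6(2)[of x] by linarith
    finally have "(1 + (norm x)\<^sup>2)^3 * norm (phi x) \<le> C0 + 3 * C2 + 3 * C4 + C6" .
    moreover have "(1 + (norm x)\<^sup>2)^3 > 0" by (simp add: add_pos_nonneg)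
    ultimately show ?thesis unfolding decay_weight_def
      by (simp add: field_simps)
  qed
  then show ?thesis using that C0(1) C2(1) C4(1) C6(1) by (metis add_nonneg_nonneg mult_nonneg_nonneg zero_le_numeral)
qed

lemma schwartz_continuous: "schwartz phi \<Longrightarrow> continuous_on A phi"
  using differentiable_imp_continuous_on[OF schwartz_differentiable_on] continuous_on_subset by blast

lemma schwartz_measurable[measurable_dest]:
  fixes phi :: "real^3 \<Rightarrow> 'b::euclidean_space"
  shows "schwartz phi \<Longrightarrow> phi \<in> borel_measurable borel"
  using schwartz_continuous borel_measurable_continuous_onI by blast

lemma integrable_decay:
  fixes f :: "real^3 \<Rightarrow> 'b::euclidean_space"
  assumes [measurable]: "f \<in> borel_measurable borel" and "\<And>x. norm (f x) \<le> C * decay_weight x"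
  shows "integrable lborel f"
  by (rule Bochner_Integration.integrable_bound[OF integrable_mult_right[OF integrable_decay_weight, of C]])
    (use assms in \<open>auto intro: order_trans[OF _ abs_ge_self]\<close>)

lemma schwartz_integrable:
  fixes phi :: "real^3 \<Rightarrow> 'b::euclidean_space"
  assumes "schwartz phi"
  shows "integrable lborel phi"
  using schwartz_decay[OF assms] integrable_decay schwartz_measurable[OF assms] by metis

lemma decay_weight_le_1: "decay_weight x \<le> 1"
  unfolding decay_weight_def using one_le_power[of "1 + (norm x)\<^sup>2" 3] by (simp add: inverse_le_1_iff)

lemma schwartz_square_integrable:
  fixes phi :: "real^3 \<Rightarrow> 'b::euclidean_space"
  assumes "schwartz phi"
  shows "square_integrable phi"
proof -
  have [measurable]: "phi \<in> borel_measurable borel" using assms by measurable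
  obtain C where C: "C \<ge> 0" "\<And>x. norm (phi x) \<le> C * decay_weight x" using schwartz_decay[OF assms] by metis
  have "norm (phi x) ^ 2 \<le> C\<^sup>2 * decay_weight x" for x
  proof -
    have "norm (phi x) ^ 2 \<le> (C * decay_weight x)^2" using C by (intro power_mono) auto
    also have "\<dots> = C\<^sup>2 * (decay_weight x * decay_weight x)" by (simp add: power2_eq_square)
    also have "\<dots> \<le> C\<^sup>2 * (decay_weight x * 1)"
      by (intro mult_left_mono) (use decay_weight_le_1 less_imp_le[OF decay_weight_pos] in auto)
    finally show ?thesis by simp
  qed
  then have "integrable lborel (\<lambda>x. norm (phi x) ^ 2)"
    by (intro integrable_decay[of _ "C\<^sup>2"]) auto
  then show ?thesis by (simp add: square_integrable_def)
qed

text \<open>One dominating function serves all difference quotients with step at most 1. The factor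
  is 3^3, from 1 + |x|^2 <= 3 (1 + |y|^2).\<close>

lemma decay_weight_shift:
  assumes "norm (y - x) \<le> 1"
  shows "decay_weight y \<le> 27 * decay_weight x"
proof -
  have "norm x \<le> norm y + norm (y - x)" by (metis norm_minus_commute norm_triangle_sub)
  then have "(norm x)\<^sup>2 \<le> (norm y + 1)\<^sup>2" using assms by (intro power_mono) auto
  also have "\<dots> \<le> 2 * (norm y)\<^sup>2 + 2" using sum_squares_bound[of "norm y" 1] by (simp add: power2_sum)
  finally have "1 + (norm x)\<^sup>2 \<le> 3 * (1 + (norm y)\<^sup>2)"
    using zero_le_power2[of "norm y"] unfolding distrib_left by linarith
  then have "(1 + (norm x)\<^sup>2)^3 \<le> (3 * (1 + (norm y)\<^sup>2))^3"
    by (intro power_mono) auto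
  also have "\<dots> = 27 * (1 + (norm y)\<^sup>2)^3" unfolding power_mult_distrib by simp
  finally have "(1 + (norm x)\<^sup>2)^3 \<le> 27 * (1 + (norm y)\<^sup>2)^3" .
  moreover have "(1 + (norm x)\<^sup>2)^3 > 0" "(1 + (norm y)\<^sup>2)^3 > 0" by (simp_all add: add_pos_nonneg)
  ultimately show ?thesis unfolding decay_weight_def by (simp add: field_simps)
qed

lemma lborel_translate:
  fixes f :: "real^3 \<Rightarrow> 'b::euclidean_space"
  assumes "f \<in> borel_measurable borel"
  shows "integral\<^sup>L lborel (\<lambda>x. f (c + x)) = integral\<^sup>L lborel f"
  using integral_distr[of "(+) c" lborel borel f] assms by (simp add: lborel_distr_plus)

lemma lborel_translate_integrable:
  fixes f :: "real^3 \<Rightarrow> 'b::euclidean_space"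
  assumes "f \<in> borel_measurable borel"
  shows "integrable lborel (\<lambda>x. f (c + x)) \<longleftrightarrow> integrable lborel f"
  using integrable_distr_eq[of "(+) c" lborel borel f] assms by (simp add: lborel_distr_plus)

text \<open>Translation invariance makes every difference quotient integrate to zero. By the mean
  value theorem and the decay of the derivative the quotients share an integrable majorant, so their
  limit integrates to zero as well. This is the integration by parts used for Fourier
  transforms.\<close>

lemma
  fixes f :: "real^3 \<Rightarrow> 'b::euclidean_space"
  assumes diff: "\<And>x. f differentiable (at x)"
    and f: "\<And>x. norm (f x) \<le> C * decay_weight x"
    and f': "\<And>x. norm (partial i f x) \<le> C * decay_weight x"
  shows integrable_partial: "integrable lborel (partial i f)"
    and integral_partial_zero: "integral\<^sup>L lborel (partial i f) = 0"
proof -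
  have cont: "continuous_on UNIV f"
    using diff by (intro differentiable_imp_continuous_on) (auto simp: differentiable_on_def)
  then have [measurable]: "f \<in> borel_measurable borel" by (rule borel_measurable_continuous_onI)
  have C: "C \<ge> 0"
    using f[of 0] decay_weight_pos[of 0] by (metis linorder_not_le mult_neg_pos norm_ge_zero order_trans)
  have int: "integrable lborel f" by (rule integrable_decay) (use f in auto)
  define e :: "real^3" where "e = axis i 1"
  have ne: "norm e = 1" by (simp add: e_def)
  \<comment> \<open>Difference quotients with step 1 / (n + 1), which never exceeds the 1 allowed by
    \<open>decay_weight_shift\<close>.\<close>
  define s where "s n x = real (Suc n) *\<^sub>R (f ((1 / real (Suc n)) *\<^sub>R e + x) - f x)" for n x
  have dv: "((\<lambda>r. f (r *\<^sub>R e + x)) has_derivative (\<lambda>r. r *\<^sub>R partial i f (r0 *\<^sub>R e + x))) (at r0)" for x r0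
  proof -
    have "((\<lambda>r. f (r *\<^sub>R e + x)) has_derivative (\<lambda>r. frechet_derivative f (at (r0 *\<^sub>R e + x)) (r *\<^sub>R e))) (at r0)"
      by (rule has_derivative_compose[OF _ diff[unfolded frechet_derivative_works]])
        (auto intro!: derivative_eq_intros)
    moreover have "frechet_derivative f (at (r0 *\<^sub>R e + x)) (r *\<^sub>R e) = r *\<^sub>R partial i f (r0 *\<^sub>R e + x)" for r
      unfolding partial_def e_def
      by (rule linear_scale[OF has_derivative_linear[OF diff[unfolded frechet_derivative_works]]])
    ultimately show ?thesis by simp
  qed
  have [measurable]: "s n \<in> borel_measurable lborel" for n unfolding s_def by measurable
  have lim: "(\<lambda>n. s n x) \<longlonglongrightarrow> partial i f x" for x
  proof -
    have "((\<lambda>h. norm (f (h *\<^sub>R e + x) - f x - h *\<^sub>R partial i f x) / norm h) \<longlongrightarrow> 0) (at 0)"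
      using dv[of x 0] by (simp add: has_derivative_at)
    then have "((\<lambda>h. norm ((f (h *\<^sub>R e + x) - f x) /\<^sub>R h - partial i f x)) \<longlongrightarrow> 0) (at 0)"
    proof (rule Lim_transform_eventually)
      have "norm (f (h *\<^sub>R e + x) - f x - h *\<^sub>R partial i f x) / norm h = norm ((f (h *\<^sub>R e + x) - f x) /\<^sub>R h - partial i f x)" if "h \<noteq> 0" for h
      proof -
        have "(f (h *\<^sub>R e + x) - f x) /\<^sub>R h - partial i f x = (f (h *\<^sub>R e + x) - f x - h *\<^sub>R partial i f x) /\<^sub>R h"
          using that by (simp add: scaleR_diff_right)
        then show ?thesis by (simp add: divide_inverse mult.commute)
      qed
      then show "\<forall>\<^sub>F h in at 0. norm (f (h *\<^sub>R e + x) - f x - h *\<^sub>R partial i f x) / norm h = norm ((f (h *\<^sub>R e + x) - f x) /\<^sub>R h - partial i f x)"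
        by (auto simp: eventually_at_filter)
    qed
    then have "((\<lambda>h. (f (h *\<^sub>R e + x) - f x) /\<^sub>R h) \<longlongrightarrow> partial i f x) (at 0)"
      by (rule LIM_zero_cancel[OF tendsto_norm_zero_cancel])
    then have "(\<lambda>n. (f ((1 / real (Suc n)) *\<^sub>R e + x) - f x) /\<^sub>R (1 / real (Suc n))) \<longlonglongrightarrow> partial i f x"
      by (rule tendsto_at_iff_sequentially[THEN iffD1, rule_format, unfolded o_def])
        (use LIMSEQ_inverse_real_of_nat in \<open>auto simp: inverse_eq_divide\<close>)
    then show ?thesis by (simp add: s_def inverse_eq_divide)
  qed
  have bound: "norm (s n x) \<le> 27 * C * decay_weight x" for n x
  proof -
    define h where "h = 1 / real (Suc n)"
    have h: "0 < h" "h \<le> 1" by (auto simp: h_def)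
    have "norm (f (h *\<^sub>R e + x) - f (0 *\<^sub>R e + x)) \<le> (27 * C * decay_weight x) * norm (h - 0)"
    proof (rule differentiable_bound[where S="{0..h}" and f'="\<lambda>r0 r. r *\<^sub>R partial i f (r0 *\<^sub>R e + x)"])
      fix r assume "r \<in> {0..h}"
      then have "norm ((r *\<^sub>R e + x) - x) \<le> 1" using h by (simp add: ne)
      then have "decay_weight (r *\<^sub>R e + x) \<le> 27 * decay_weight x" by (rule decay_weight_shift)
      then have "norm (partial i f (r *\<^sub>R e + x)) \<le> C * (27 * decay_weight x)"
        using f'[of "r *\<^sub>R e + x"] C by (meson mult_left_mono order_trans)
      then show "onorm (\<lambda>ra. ra *\<^sub>R partial i f (r *\<^sub>R e + x)) \<le> 27 * C * decay_weight x"
        by (subst onorm_scaleR_left) (auto simp: onorm_id bounded_linear_ident)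
    qed (use h dv in \<open>auto intro: has_derivative_at_withinI\<close>)
    then have "real (Suc n) * norm (f (h *\<^sub>R e + x) - f x) \<le> real (Suc n) * ((27 * C * decay_weight x) * h)"
      using h by (intro mult_left_mono) auto
    then show ?thesis by (simp add: s_def h_def)
  qed
  have wint: "integrable lborel (\<lambda>x. 27 * C * decay_weight x)" using integrable_decay_weight by auto
  have meas: "partial i f \<in> borel_measurable lborel"
    by (rule borel_measurable_LIMSEQ_metric[where f=s]) (use lim in auto)
  show "integrable lborel (partial i f)"
    by (rule integrable_dominated_convergence[OF meas _ wint, where s=s]) (use lim bound in auto)
  have "(\<lambda>n. integral\<^sup>L lborel (s n)) \<longlonglongrightarrow> integral\<^sup>L lborel (partial i f)"
    by (rule integral_dominated_convergence[OF meas _ wint]) (use lim bound in auto)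
  moreover have "integral\<^sup>L lborel (s n) = 0" for n
    unfolding s_def using int
    by (subst Bochner_Integration.integral_scaleR_right, subst Bochner_Integration.integral_diff)
      (auto simp: lborel_translate lborel_translate_integrable)
  ultimately show "integral\<^sup>L lborel (partial i f) = 0"
    by (simp add: LIMSEQ_const_iff)
qed

lemma lint_norm_bound:
  fixes f :: "'a \<Rightarrow> 'b::{banach, second_countable_topology}"
  assumes "integrable M g" and "\<And>x. norm (f x) \<le> g x"
  shows "norm (integral\<^sup>L M f) \<le> integral\<^sup>L M g"
  by (rule order_trans[OF integral_norm_bound integral_mono'])
    (use assms order_trans[OF norm_ge_zero] in auto)

section \<open>The transform on Schwartz functions\<close>

abbreviation cexp :: "real \<Rightarrow> complex" where
  "cexp a \<equiv> exp (- (\<i> * cor a))"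

lemma norm_cexp[simp]: "norm (cexp a) = 1"
  using norm_exp_i_times[of "- a"] by simp

lemma cnj_cexp: "cnj (cexp a) = cexp (- a)"
  by (simp add: exp_cnj)

lemma cexp_add: "cexp (a + b) = cexp a * cexp b"
  by (simp add: exp_add[symmetric] algebra_simps)

lemma fourier_L1_integrable:
  assumes "integrable lborel phi"
  shows "integrable lborel (\<lambda>x. phi x * cexp (xi \<bullet> x))"
  by (rule Bochner_Integration.integrable_bound[OF assms]) (use assms in \<open>auto simp: norm_mult\<close>)

lemma fourier_L1_bound:
  assumes "integrable lborel phi"
  shows "norm (fourier_L1 phi xi) \<le> (LBINT x. norm (phi x))"
  unfolding fourier_L1_def
  by (rule order_trans[OF integral_norm_bound]) (simp add: norm_mult)

lemma fourier_L1_measurable: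
  assumes "integrable lborel phi"
  shows "fourier_L1 phi \<in> borel_measurable borel"
proof -
  have [measurable]: "phi \<in> borel_measurable borel" using assms by auto
  show ?thesis
    unfolding fourier_L1_def[abs_def] by measurable
qed

lemma schwartz_cmult: "schwartz (phi :: real^3 \<Rightarrow> complex) \<Longrightarrow> schwartz (\<lambda>x. c * phi x)"
  by (rule schwartz_linear[OF bounded_linear_mult_right])

lemma schwartz_coord': "schwartz (phi :: real^3 \<Rightarrow> complex) \<Longrightarrow> schwartz (\<lambda>x. cor (x $ i) * phi x)"
  using schwartz_coord[of phi i] by (simp add: scaleR_conv_of_real)

lemma cexp_approx: "norm (cexp a - 1 + \<i> * cor a) \<le> a\<^sup>2 / 2"
  using iexp_approx1[of "- a" 1] by (simp add: power2_eq_square algebra_simps)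

text \<open>The remainder of the exponential to second order is at most (h . x)^2 / 2, so the error
  is bounded by |h|^2 times the second absolute moment of \<open>phi\<close>.\<close>

lemma fourier_L1_has_derivative:
  assumes phi: "schwartz phi"
  shows "(fourier_L1 phi has_derivative
    (\<lambda>h. \<Sum>i\<in>UNIV. h $ i *\<^sub>R fourier_L1 (\<lambda>x. - \<i> * (cor (x $ i) * phi x)) xi)) (at xi)"
proof -
  let ?D = "\<lambda>h. \<Sum>i\<in>UNIV. h $ i *\<^sub>R fourier_L1 (\<lambda>x. - \<i> * (cor (x $ i) * phi x)) xi"
  have [measurable]: "phi \<in> borel_measurable borel" using phi by measurable
  have int: "integrable lborel (\<lambda>x. - \<i> * (cor (x $ i) * phi x))" for i
    by (intro schwartz_integrable schwartz_cmult schwartz_coord' phi)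
  obtain C where C: "C \<ge> 0" "\<And>x. norm x ^ 2 * norm (phi x) \<le> C" using schwartz_bound[OF phi] by metis
  have sq: "integrable lborel (\<lambda>x. (norm x)\<^sup>2 * norm (phi x))"
  proof -
    have "integrable lborel (\<lambda>x. \<Sum>i\<in>UNIV. norm (cor (x $ i) * (cor (x $ i) * phi x)))"
      by (intro Bochner_Integration.integrable_sum integrable_norm schwartz_integrable schwartz_coord' phi)
    moreover have "(\<Sum>i\<in>UNIV. norm (cor (x $ i) * (cor (x $ i) * phi x))) = (norm x)\<^sup>2 * norm (phi x)" for x
      by (simp add: norm_mult sum_distrib_right[symmetric] mult.assoc[symmetric] power2_eq_square[symmetric]
        norm_vec_def L2_set_def sum_nonneg norm_power)
    ultimately show ?thesis by simp
  qed
  define K where "K = (LBINT x. (norm x)\<^sup>2 * norm (phi x))"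
  have main: "norm (fourier_L1 phi y - fourier_L1 phi xi - ?D (y - xi)) \<le> (norm (y - xi))\<^sup>2 * K" for y
  proof -
    define h where "h = y - xi"
    have "fourier_L1 phi y - fourier_L1 phi xi - ?D h
      = (LBINT x. phi x * cexp (xi \<bullet> x) * (cexp (h \<bullet> x) - 1 + \<i> * cor (h \<bullet> x)))"
    proof -
      have "?D h = (\<integral>x. (\<Sum>i\<in>UNIV. h $ i *\<^sub>R (- \<i> * (cor (x $ i) * phi x) * cexp (xi \<bullet> x))) \<partial>lborel)"
        unfolding fourier_L1_def
        by (subst Bochner_Integration.integral_sum; (intro integrable_scaleR_right fourier_L1_integrable int)?) simp
      moreover have i3: "integrable lborel (\<lambda>x. (\<Sum>i\<in>UNIV. h $ i *\<^sub>R (- \<i> * (cor (x $ i) * phi x) * cexp (xi \<bullet> x))))"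
        by (intro Bochner_Integration.integrable_sum integrable_scaleR_right fourier_L1_integrable int)
      ultimately have "fourier_L1 phi y - fourier_L1 phi xi - ?D h
        = (LBINT x. phi x * cexp (y \<bullet> x) - phi x * cexp (xi \<bullet> x) - (\<Sum>i\<in>UNIV. h $ i *\<^sub>R (- \<i> * (cor (x $ i) * phi x) * cexp (xi \<bullet> x))))"
      proof (elim ssubst)
        note i1 = fourier_L1_integrable[OF schwartz_integrable[OF phi]]
        show "fourier_L1 phi y - fourier_L1 phi xi - (\<integral>x. (\<Sum>i\<in>UNIV. h $ i *\<^sub>R (- \<i> * (cor (x $ i) * phi x) * cexp (xi \<bullet> x))) \<partial>lborel)
        = (LBINT x. phi x * cexp (y \<bullet> x) - phi x * cexp (xi \<bullet> x) - (\<Sum>i\<in>UNIV. h $ i *\<^sub>R (- \<i> * (cor (x $ i) * phi x) * cexp (xi \<bullet> x))))"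
          unfolding fourier_L1_def
          by (subst Bochner_Integration.integral_diff[OF Bochner_Integration.integrable_diff[OF i1 i1] i3],
              subst Bochner_Integration.integral_diff[OF i1 i1], rule refl)
      qed
      also have "\<dots> = (LBINT x. phi x * cexp (xi \<bullet> x) * (cexp (h \<bullet> x) - 1 + \<i> * cor (h \<bullet> x)))"
      proof (rule Bochner_Integration.integral_cong[OF refl])
        fix x
        have y: "cexp (y \<bullet> x) = cexp (xi \<bullet> x) * cexp (h \<bullet> x)"
          unfolding cexp_add[symmetric] h_def by (simp add: inner_diff_left)
        have S0: "(\<Sum>i\<in>UNIV. h $ i *\<^sub>R (- \<i> * (cor (x $ i) * a) * E)) = - (\<i> * a * E * cor (h \<bullet> x))" for a E
          by (simp add: inner_vec_def scaleR_conv_of_real sum_distrib_left sum_negf[symmetric] mult_ac)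
        have alg: "a * (E * H) - a * E - - (\<i> * a * E * c) = a * E * (H - 1 + \<i> * c)" for a E H c :: complex
          by (simp add: algebra_simps)
        show "phi x * cexp (y \<bullet> x) - phi x * cexp (xi \<bullet> x) - (\<Sum>i\<in>UNIV. h $ i *\<^sub>R (- \<i> * (cor (x $ i) * phi x) * cexp (xi \<bullet> x)))
          = phi x * cexp (xi \<bullet> x) * (cexp (h \<bullet> x) - 1 + \<i> * cor (h \<bullet> x))"
          unfolding y S0 by (rule alg)
      qed
      finally show ?thesis .
    qed
    also have "norm \<dots> \<le> (LBINT x. (norm h)\<^sup>2 * ((norm x)\<^sup>2 * norm (phi x)))"
    proof (rule lint_norm_bound)
      show "norm (phi x * cexp (xi \<bullet> x) * (cexp (h \<bullet> x) - 1 + \<i> * cor (h \<bullet> x)))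
          \<le> (norm h)\<^sup>2 * ((norm x)\<^sup>2 * norm (phi x))" for x
      proof -
        have "norm (cexp (h \<bullet> x) - 1 + \<i> * cor (h \<bullet> x)) \<le> (h \<bullet> x)\<^sup>2 / 2" by (rule cexp_approx)
        also have "\<dots> \<le> (h \<bullet> x)\<^sup>2" by simp
        also have "\<dots> \<le> (norm h * norm x)\<^sup>2"
          using Cauchy_Schwarz_ineq2[of h x] by (metis abs_ge_zero power2_abs power_mono)
        finally have "norm (phi x) * norm (cexp (h \<bullet> x) - 1 + \<i> * cor (h \<bullet> x)) \<le> norm (phi x) * (norm h * norm x)\<^sup>2"
          by (rule mult_left_mono) auto
        then show ?thesis by (simp add: norm_mult power_mult_distrib mult_ac)
      qed
      show "integrable lborel (\<lambda>x. (norm h)\<^sup>2 * ((norm x)\<^sup>2 * norm (phi x)))" using sq by simp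
    qed
    finally show ?thesis by (simp add: h_def K_def)
  qed
  show ?thesis
  proof (rule has_derivativeI_sandwich[where e=1 and H="\<lambda>y. norm (y - xi) * K"])
    show "bounded_linear ?D"
      by (intro bounded_linear_sum bounded_linear_scaleR_left[THEN bounded_linear_compose] bounded_linear_vec_nth)
    show "((\<lambda>y. norm (y - xi) * K) \<longlongrightarrow> 0) (at xi)"
      by (auto intro!: tendsto_eq_intros)
    fix y assume "y \<noteq> xi"
    then show "norm (fourier_L1 phi y - fourier_L1 phi xi - ?D (y - xi)) / norm (y - xi) \<le> norm (y - xi) * K"
      using main[of y] by (simp add: divide_simps power2_eq_square mult_ac)
  qed auto
qed

lemma partial_fourier_L1:
  assumes "schwartz phi"
  shows "partial i (fourier_L1 phi) = fourier_L1 (\<lambda>x. - \<i> * (cor (x $ i) * phi x))"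
  by (rule ext, subst partial_eqI[OF fourier_L1_has_derivative[OF assms]])
    (simp add: axis_def if_distrib[of "\<lambda>r. r *\<^sub>R _"] sum.delta cong: if_cong)

lemma has_derivative_cexp: "((\<lambda>x::real^3. cexp (xi \<bullet> x)) has_derivative (\<lambda>h. - \<i> * cor (xi \<bullet> h) * cexp (xi \<bullet> x))) (at x)"
proof -
  have "((\<lambda>x::real^3. - (\<i> * cor (xi \<bullet> x))) has_derivative (\<lambda>h. - (\<i> * cor (xi \<bullet> h)))) (at x)"
    by (intro bounded_linear_imp_has_derivative bounded_linear_minus bounded_linear_const_mult bounded_linear_of_real[THEN bounded_linear_compose] bounded_linear_inner_right)
  from has_derivative_compose[OF this DERIV_exp[unfolded has_field_derivative_def]]
  show ?thesis by (simp add: mult_ac)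
qed

text \<open>The derivative of \<open>phi\<close> times the exponential has integral zero, and the
  product rule splits that integral into the two sides.\<close>

lemma fourier_L1_partial:
  assumes phi: "schwartz phi"
  shows "fourier_L1 (partial i phi) xi = \<i> * cor (xi $ i) * fourier_L1 phi xi"
proof -
  define f where "f x = phi x * cexp (xi \<bullet> x)" for x
  have D: "(f has_derivative (\<lambda>h. phi x * (- \<i> * cor (xi \<bullet> h) * cexp (xi \<bullet> x)) + frechet_derivative phi (at x) h * cexp (xi \<bullet> x))) (at x)" for x
    unfolding f_def
    by (intro has_derivative_mult has_derivative_cexp phi[THEN schwartz_differentiable, unfolded frechet_derivative_works])
  have pf: "partial i f x = partial i phi x * cexp (xi \<bullet> x) - \<i> * cor (xi $ i) * (phi x * cexp (xi \<bullet> x))" for x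
    by (subst partial_eqI[OF D]) (simp add: partial_def inner_axis algebra_simps)
  obtain C where C: "C \<ge> 0" "\<And>x. norm (phi x) \<le> C * decay_weight x" using schwartz_decay[OF phi] by metis
  obtain C' where C': "C' \<ge> 0" "\<And>x. norm (partial i phi x) \<le> C' * decay_weight x"
    using schwartz_decay[OF schwartz_partial[OF phi]] by metis
  define K where "K = C' + \<bar>xi $ i\<bar> * C + C"
  have w: "decay_weight x \<ge> 0" for x using decay_weight_pos[of x] by simp
  have "integral\<^sup>L lborel (partial i f) = 0"
  proof (rule integral_partial_zero)
    show "f differentiable (at x)" for x using D by (auto simp: differentiable_def)
    show "norm (f x) \<le> K * decay_weight x" for x
    proof -
      have "norm (f x) \<le> C * decay_weight x" using C by (simp add: f_def norm_mult)
      also have "\<dots> \<le> K * decay_weight x" using C(1) C'(1) by (intro mult_right_mono w) (simp add: K_def)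
      finally show ?thesis .
    qed
    show "norm (partial i f x) \<le> K * decay_weight x" for x
    proof -
      have "norm (partial i f x) \<le> norm (partial i phi x) + \<bar>xi $ i\<bar> * norm (phi x)"
        unfolding pf by (rule order_trans[OF norm_triangle_ineq4]) (simp add: norm_mult)
      also have "\<dots> \<le> C' * decay_weight x + \<bar>xi $ i\<bar> * (C * decay_weight x)"
        by (intro add_mono mult_left_mono C C') auto
      also have "\<dots> \<le> K * decay_weight x"
        using mult_nonneg_nonneg[OF C(1) w[of x]] by (simp add: K_def algebra_simps)
      finally show ?thesis .
    qed
  qed
  moreover have "integral\<^sup>L lborel (partial i f) = fourier_L1 (partial i phi) xi - \<i> * cor (xi $ i) * fourier_L1 phi xi"
    unfolding pf[abs_def] fourier_L1_def
    by (subst Bochner_Integration.integral_diff; (intro integrable_mult_right fourier_L1_integrable schwartz_integrable schwartz_partial phi)?) simp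
  ultimately show ?thesis by simp
qed

lemma norm_power_le_sum_coords: "norm (x::real^3) ^ n \<le> 3 ^ n * (\<Sum>i\<in>UNIV. \<bar>x $ i\<bar> ^ n)"
proof -
  have ne: "\<exists>j. \<forall>i. \<bar>x $ i\<bar> \<le> \<bar>x $ j\<bar>"
  proof -
    have "Max (range (\<lambda>i. \<bar>x $ i\<bar>)) \<in> range (\<lambda>i. \<bar>x $ i\<bar>)" by (rule Max_in) auto
    then obtain j where "Max (range (\<lambda>i. \<bar>x $ i\<bar>)) = \<bar>x $ j\<bar>" by (metis imageE)
    then show ?thesis by (metis Max_ge finite_imageI finite_code rangeI)
  qed
  then obtain j where j: "\<And>i. \<bar>x $ i\<bar> \<le> \<bar>x $ j\<bar>" by blast
  have "norm x \<le> (\<Sum>i\<in>UNIV. \<bar>x $ i\<bar>)" by (rule norm_le_l1_cart)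
  also have "\<dots> \<le> 3 * \<bar>x $ j\<bar>" using sum_bounded_above[of UNIV "\<lambda>i. \<bar>x $ i\<bar>" "\<bar>x $ j\<bar>"] j by simp
  finally have "norm x ^ n \<le> (3 * \<bar>x $ j\<bar>) ^ n" by (intro power_mono) auto
  also have "\<dots> = 3 ^ n * \<bar>x $ j\<bar> ^ n" by (simp add: power_mult_distrib)
  also have "\<dots> \<le> 3 ^ n * (\<Sum>i\<in>UNIV. \<bar>x $ i\<bar> ^ n)"
    by (intro mult_left_mono member_le_sum) auto
  finally show ?thesis .
qed

text \<open>A power of a coordinate times the transform is, up to a factor of modulus one, the
  transform of a derivative, hence bounded; powers of the norm are dominated by powers of the
  coordinates. Derivatives of the transform are again transforms, which closes the
  coinduction.\<close>

lemma schwartz_fourier_L1: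
  assumes "schwartz phi"
  shows "schwartz (fourier_L1 phi)"
proof (rule schwartz_coinduct[where P="\<lambda>f. \<exists>phi. schwartz phi \<and> f = fourier_L1 phi"])
  fix f :: "real^3 \<Rightarrow> complex" assume "\<exists>phi. schwartz phi \<and> f = fourier_L1 phi"
  then obtain phi where s: "schwartz phi" "f = fourier_L1 phi" by auto
  show "f differentiable_on UNIV"
    using fourier_L1_has_derivative[OF s(1)] unfolding s(2) differentiable_on_def differentiable_def by blast
  show "\<exists>phi. schwartz phi \<and> partial i f = fourier_L1 phi" for i
    using partial_fourier_L1[OF s(1), of i] s schwartz_cmult[OF schwartz_coord'[OF s(1)]] by metis
  fix n
  have "\<exists>C. \<forall>xi. \<bar>xi $ i\<bar> ^ n * norm (f xi) \<le> C" for i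
  proof -
    have "\<exists>\<psi>. schwartz \<psi> \<and> (\<forall>xi. \<bar>xi $ i\<bar> ^ n * norm (f xi) = norm (fourier_L1 \<psi> xi))"
    proof (induction n)
      case (Suc n)
      then obtain \<psi> where \<psi>: "schwartz \<psi>" "\<And>xi. \<bar>xi $ i\<bar> ^ n * norm (f xi) = norm (fourier_L1 \<psi> xi)" by blast
      show ?case
        using \<psi> by (intro exI[of _ "partial i \<psi>"]) (auto simp: schwartz_partial fourier_L1_partial norm_mult)
    qed (use s in auto)
    then show ?thesis using fourier_L1_bound schwartz_integrable by metis
  qed
  then obtain C where C: "\<And>i xi. \<bar>xi $ i\<bar> ^ n * norm (f xi) \<le> C i" by metis
  have "norm (norm xi ^ n *\<^sub>R f xi) \<le> 3 ^ n * (\<Sum>i\<in>UNIV. C i)" for xi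
  proof -
    have "norm (norm xi ^ n *\<^sub>R f xi) \<le> 3 ^ n * (\<Sum>i\<in>UNIV. \<bar>xi $ i\<bar> ^ n) * norm (f xi)"
      by (simp add: mult_right_mono norm_power_le_sum_coords)
    also have "\<dots> = 3 ^ n * (\<Sum>i\<in>UNIV. \<bar>xi $ i\<bar> ^ n * norm (f xi))"
      by (simp add: sum_distrib_right mult.assoc)
    also have "\<dots> \<le> 3 ^ n * (\<Sum>i\<in>UNIV. C i)" by (intro mult_left_mono sum_mono C) auto
    finally show ?thesis .
  qed
  then show "bounded (range (\<lambda>x. norm x ^ n *\<^sub>R f x))" by (auto simp: bounded_iff)
qed (use assms in auto)

text \<open>Polynomials times exp (- |x|^2 / 2 + b . x). Allowing a complex \<open>b\<close> treats
  modulated Gaussians (imaginary \<open>b\<close>) and translated ones (real \<open>b\<close>, up to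
  a constant factor) at once.\<close>

inductive poly_gauss :: "complex^3 \<Rightarrow> (real^3 \<Rightarrow> complex) \<Rightarrow> bool" for b where
  base: "poly_gauss b (\<lambda>x. exp (- cor ((norm x)\<^sup>2 / 2) + (\<Sum>i\<in>UNIV. b $ i * cor (x $ i))))"
| coord: "poly_gauss b f \<Longrightarrow> poly_gauss b (\<lambda>x. cor (x $ i) * f x)"
| cmult: "poly_gauss b f \<Longrightarrow> poly_gauss b (\<lambda>x. c * f x)"
| add: "poly_gauss b f \<Longrightarrow> poly_gauss b g \<Longrightarrow> poly_gauss b (\<lambda>x. f x + g x)"

lemma poly_gauss_derivative:
  assumes "poly_gauss b f"
  shows "(\<forall>x. f differentiable (at x)) \<and> (\<forall>i. poly_gauss b (partial i f))"
  using assms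
proof induction
  case base
  let ?g = "\<lambda>x. exp (- cor ((norm x)\<^sup>2 / 2) + (\<Sum>i\<in>UNIV. b $ i * cor (x $ i)))"
  have D: "(?g has_derivative (\<lambda>h. ?g x * (- cor (x \<bullet> h) + (\<Sum>i\<in>UNIV. b $ i * cor (h $ i))))) (at x)" for x
  proof -
    have "((\<lambda>x. - cor ((norm x)\<^sup>2 / 2) + (\<Sum>i\<in>UNIV. b $ i * cor (x $ i))) has_derivative
      (\<lambda>h. - cor ((x \<bullet> h + h \<bullet> x) / 2) + (\<Sum>i\<in>UNIV. b $ i * cor (h $ i)))) (at x)"
      unfolding power2_norm_eq_inner
      by (intro has_derivative_add has_derivative_minus has_derivative_of_real has_derivative_sum has_derivative_mult_right
        bounded_linear.has_derivative[OF bounded_linear_divide] has_derivative_inner has_derivative_ident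
        bounded_linear.has_derivative[OF bounded_linear_vec_nth])
    from has_derivative_compose[OF this DERIV_exp[unfolded has_field_derivative_def]]
    show ?thesis by (simp add: inner_commute)
  qed
  have ia: "x \<bullet> (\<chi> j. if j = i then 1 else 0) = x $ i" for x :: "real^3" and i
    using inner_axis[of x i "1::real"] unfolding axis_def by simp
  have "partial i ?g = (\<lambda>x. (- 1) * (cor (x $ i) * ?g x) + b $ i * ?g x)" for i
    by (rule ext, subst partial_eqI[OF D])
      (simp add: ia axis_def algebra_simps if_distrib[of cor] if_distrib[of "\<lambda>r. _ * r"] sum.delta cong: if_cong)
  then have "poly_gauss b (partial i ?g)" for i
    by (simp only:) (intro poly_gauss.intros)
  then show ?case using D by (auto simp: differentiable_def)
next
  case (coord f j)
  have D: "((\<lambda>x. cor (x $ j) * f x) has_derivative (\<lambda>h. cor (x $ j) * frechet_derivative f (at x) h + cor (h $ j) * f x)) (at x)" for x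
    using coord
    by (intro has_derivative_mult bounded_linear.has_derivative[OF bounded_linear_vec_nth] has_derivative_of_real has_derivative_ident)
      (auto simp: frechet_derivative_works)
  have "partial i (\<lambda>x. cor (x $ j) * f x) = (\<lambda>x. cor (x $ j) * partial i f x + (if i = j then 1 else 0) * f x)" for i
    by (rule ext, subst partial_eqI[OF D]) (auto simp: partial_def axis_def)
  then have "poly_gauss b (partial i (\<lambda>x. cor (x $ j) * f x))" for i
    using coord by (auto intro!: poly_gauss.intros simp del: mult_zero_left)
  then show ?case using D by (auto simp: differentiable_def)
next
  case (cmult f c)
  have D: "((\<lambda>x. c * f x) has_derivative (\<lambda>h. c * frechet_derivative f (at x) h)) (at x)" for x
    using cmult by (intro has_derivative_mult_right) (auto simp: frechet_derivative_works)
  have "partial i (\<lambda>x. c * f x) = (\<lambda>x. c * partial i f x)" for i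
    by (rule ext, subst partial_eqI[OF D]) (auto simp: partial_def)
  then have "poly_gauss b (partial i (\<lambda>x. c * f x))" for i
    using cmult by (auto intro!: poly_gauss.intros)
  then show ?case using D by (auto simp: differentiable_def)
next
  case (add f g)
  have D: "((\<lambda>x. f x + g x) has_derivative (\<lambda>h. frechet_derivative f (at x) h + frechet_derivative g (at x) h)) (at x)" for x
    using add by (intro has_derivative_add) (auto simp: frechet_derivative_works)
  have "partial i (\<lambda>x. f x + g x) = (\<lambda>x. partial i f x + partial i g x)" for i
    by (rule ext, subst partial_eqI[OF D]) (auto simp: partial_def)
  then have "poly_gauss b (partial i (\<lambda>x. f x + g x))" for i
    using add by (auto intro!: poly_gauss.intros)
  then show ?case using D by (auto simp: differentiable_def)
qed

text \<open>Since s^n <= n! exp s, it remains to complete the square in the exponent.\<close>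

lemma power_exp_bound:
  fixes s :: real assumes "s \<ge> 0"
  shows "s ^ n * exp (- s\<^sup>2 / 2 + B * s) \<le> fact n * exp ((B + 1)\<^sup>2 / 2)"
proof -
  have "s ^ n \<le> fact n * exp s" using exp_ge_one_plus_x_over_n_power_n
  proof -
    have "s ^ n /\<^sub>R fact n \<le> (\<Sum>k. s ^ k /\<^sub>R fact k)"
      using sum_le_suminf[OF summable_exp_generic[of s], of "{n}"] assms by auto
    then show ?thesis by (simp add: exp_def field_simps)
  qed
  then have "s ^ n * exp (- s\<^sup>2 / 2 + B * s) \<le> fact n * exp s * exp (- s\<^sup>2 / 2 + B * s)"
    by (rule mult_right_mono) auto
  also have "\<dots> = fact n * exp (s + (- s\<^sup>2 / 2 + B * s))" by (simp add: exp_add)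
  also have "s + (- s\<^sup>2 / 2 + B * s) \<le> (B + 1)\<^sup>2 / 2"
    using zero_le_power2[of "s - (B + 1)"] by (simp add: power2_eq_square field_simps)
  finally show ?thesis by simp
qed

lemma poly_gauss_bound:
  assumes "poly_gauss b f"
  shows "\<forall>n. \<exists>C. \<forall>x. norm x ^ n * norm (f x) \<le> C"
  using assms
proof induction
  case base
  define B where "B = (\<Sum>i\<in>UNIV. norm (b $ i))"
  have "norm x ^ n * norm (exp (- cor ((norm x)\<^sup>2 / 2) + (\<Sum>i\<in>UNIV. b $ i * cor (x $ i)))) \<le> fact n * exp ((B + 1)\<^sup>2 / 2)" for n and x :: "real^3"
  proof -
    have "Re (\<Sum>i\<in>UNIV. b $ i * cor (x $ i)) \<le> norm (\<Sum>i\<in>UNIV. b $ i * cor (x $ i))" by (rule complex_Re_le_cmod)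
    also have "\<dots> \<le> (\<Sum>i\<in>UNIV. norm (b $ i) * norm x)"
      by (rule order_trans[OF norm_sum]) (auto intro!: sum_mono mult_left_mono component_le_norm_cart simp: norm_mult)
    also have "\<dots> = B * norm x" by (simp add: B_def sum_distrib_right)
    finally have "norm (exp (- cor ((norm x)\<^sup>2 / 2) + (\<Sum>i\<in>UNIV. b $ i * cor (x $ i)))) \<le> exp (- (norm x)\<^sup>2 / 2 + B * norm x)"
      by simp
    then have "norm x ^ n * norm (exp (- cor ((norm x)\<^sup>2 / 2) + (\<Sum>i\<in>UNIV. b $ i * cor (x $ i)))) \<le> norm x ^ n * exp (- (norm x)\<^sup>2 / 2 + B * norm x)"
      by (rule mult_left_mono) auto
    also have "\<dots> \<le> fact n * exp ((B + 1)\<^sup>2 / 2)" by (rule power_exp_bound) auto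
    finally show ?thesis .
  qed
  then show ?case by blast
next
  case (coord f i)
  show ?case
  proof
    fix n
    obtain C where C: "\<And>x. norm x ^ (Suc n) * norm (f x) \<le> C" using coord by blast
    have "norm x ^ n * norm (cor (x $ i) * f x) \<le> C" for x
    proof -
      have "norm x ^ n * norm (cor (x $ i) * f x) = \<bar>x $ i\<bar> * (norm x ^ n * norm (f x))"
        by (simp add: norm_mult)
      also have "\<dots> \<le> norm x * (norm x ^ n * norm (f x))"
        by (intro mult_right_mono component_le_norm_cart) auto
      finally show ?thesis using C[of x] by (simp add: mult.assoc)
    qed
    then show "\<exists>C. \<forall>x. norm x ^ n * norm (cor (x $ i) * f x) \<le> C" by blast
  qed
next
  case (cmult f c)
  show ?case
  proof
    fix n
    obtain C where C: "\<And>x. norm x ^ n * norm (f x) \<le> C" using cmult by blast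
    have "norm x ^ n * norm (c * f x) \<le> norm c * C" for x
      using mult_left_mono[OF C[of x], of "norm c"] by (simp add: norm_mult mult_ac)
    then show "\<exists>C. \<forall>x. norm x ^ n * norm (c * f x) \<le> C" by blast
  qed
next
  case (add f g)
  show ?case
  proof
    fix n
    obtain C where C: "\<And>x. norm x ^ n * norm (f x) \<le> C" using add by blast
    obtain C' where C': "\<And>x. norm x ^ n * norm (g x) \<le> C'" using add by blast
    have "norm x ^ n * norm (f x + g x) \<le> C + C'" for x
      using mult_left_mono[OF norm_triangle_ineq[of "f x" "g x"], of "norm x ^ n"] C[of x] C'[of x] by (simp add: distrib_left)
    then show "\<exists>C. \<forall>x. norm x ^ n * norm (f x + g x) \<le> C" by blast
  qed
qed

lemma poly_gauss_schwartz:
  assumes "poly_gauss b f"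
  shows "schwartz f"
proof (rule schwartz_coinduct[where P="poly_gauss b"])
  fix f assume f: "poly_gauss b f"
  show "f differentiable_on UNIV"
    using poly_gauss_derivative[OF f] by (auto simp: differentiable_on_def)
  show "poly_gauss b (partial i f)" for i
    using poly_gauss_derivative[OF f] by auto
  show "bounded (range (\<lambda>x. norm x ^ n *\<^sub>R f x))" for n
    using poly_gauss_bound[OF f] by (auto simp: bounded_iff)
qed fact

definition gauss :: "real^3 \<Rightarrow> real" where "gauss x = exp (- (norm x)\<^sup>2 / 2)"

lemma schwartz_gauss_cexp: "schwartz (\<lambda>x. cor (gauss x) * cexp (y \<bullet> x))"
proof -
  have "cor (gauss x) * cexp (y \<bullet> x) =
    exp (- cor ((norm x)\<^sup>2 / 2) + (\<Sum>i\<in>UNIV. (\<chi> i. - \<i> * cor (y $ i)) $ i * cor (x $ i)))" for x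
  proof -
    have "(\<Sum>i\<in>UNIV. (\<chi> i. - \<i> * cor (y $ i)) $ i * cor (x $ i)) = - (\<i> * cor (y \<bullet> x))"
      by (simp add: inner_vec_def sum_distrib_left sum_negf mult_ac)
    moreover have "cor (gauss x) = exp (- cor ((norm x)\<^sup>2 / 2))"
      unfolding gauss_def exp_of_real[symmetric] by simp
    ultimately show ?thesis by (simp only: exp_add)
  qed
  then show ?thesis using poly_gauss_schwartz[OF poly_gauss.base] by presburger
qed

lemma schwartz_gauss_shift: "schwartz (\<lambda>x. cor (gauss (x - y)))"
proof -
  have "cor (gauss (x - y)) = cor (gauss y) *
    exp (- cor ((norm x)\<^sup>2 / 2) + (\<Sum>i\<in>UNIV. (\<chi> i. cor (y $ i)) $ i * cor (x $ i)))" for x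
  proof -
    have "(norm (x - y))\<^sup>2 = (norm x)\<^sup>2 + (norm y)\<^sup>2 - 2 * (x \<bullet> y)"
      by (simp add: power2_norm_eq_inner algebra_simps inner_commute)
    then have "- (norm (x - y))\<^sup>2 / 2 = - (norm y)\<^sup>2 / 2 + (- (norm x)\<^sup>2 / 2 + y \<bullet> x)" by (simp add: inner_commute)
    then have "gauss (x - y) = gauss y * exp (- (norm x)\<^sup>2 / 2 + y \<bullet> x)"
      unfolding gauss_def by (simp only: exp_add)
    then show ?thesis by (simp add: inner_vec_def flip: exp_of_real)
  qed
  then show ?thesis using schwartz_cmult[OF poly_gauss_schwartz[OF poly_gauss.base]] by presburger
qed

section \<open>Gaussian integrals, mollification and injectivity on integrable functions\<close>

lemma cnj_borel_measurable[measurable]: "cnj \<in> borel_measurable borel"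
  by (intro borel_measurable_continuous_onI continuous_intros)

lemma lborel_scale:
  fixes f :: "real^3 \<Rightarrow> 'b::euclidean_space"
  assumes [measurable]: "f \<in> borel_measurable borel" and c: "c \<noteq> 0"
  shows "integral\<^sup>L lborel (\<lambda>x. f (c *\<^sub>R x)) = (1 / \<bar>c\<bar> ^ 3) *\<^sub>R integral\<^sup>L lborel f"
proof -
  have "integral\<^sup>L lborel f = integral\<^sup>L (density (distr lborel borel (\<lambda>x. 0 + c *\<^sub>R x)) (\<lambda>_. \<bar>c\<bar> ^ DIM(real^3))) f"
    using lborel_affine[OF c, of "0::real^3"] by simp
  also have "\<dots> = \<bar>c\<bar> ^ 3 *\<^sub>R integral\<^sup>L lborel (\<lambda>x. f (c *\<^sub>R x))"
    by (subst integral_density) (auto simp: integral_distr)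
  finally show ?thesis using c by simp
qed

lemma lborel_scale_integrable:
  fixes f :: "real^3 \<Rightarrow> 'b::euclidean_space"
  assumes f: "integrable lborel f" and c: "c \<noteq> 0"
  shows "integrable lborel (\<lambda>x. f (c *\<^sub>R x))"
proof -
  have [measurable]: "f \<in> borel_measurable borel" using f by auto
  have "integrable (density (distr lborel borel (\<lambda>x. 0 + c *\<^sub>R x)) (\<lambda>_. \<bar>c\<bar> ^ DIM(real^3))) f"
    using lborel_affine[OF c, of "0::real^3"] f by simp
  then have "integrable lborel (\<lambda>x. \<bar>c\<bar> ^ 3 *\<^sub>R f (c *\<^sub>R x))"
    by (subst (asm) integrable_density) (auto simp: integrable_distr_eq)
  from integrable_scaleR_right[OF this, of "1 / \<bar>c\<bar> ^ 3"] show ?thesis using c by simp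
qed

lemma lborel_reflect:
  fixes f :: "real^3 \<Rightarrow> 'b::euclidean_space"
  assumes "f \<in> borel_measurable borel"
  shows "integral\<^sup>L lborel (\<lambda>x. f (- x)) = integral\<^sup>L lborel f"
  using lborel_scale[OF assms, of "-1"] by simp

lemma lborel_reflect_integrable:
  fixes f :: "real^3 \<Rightarrow> 'b::euclidean_space"
  assumes "integrable lborel f"
  shows "integrable lborel (\<lambda>x. f (- x))"
  using lborel_scale_integrable[OF assms, of "-1"] by simp

lemma lborel_integral_prod:
  fixes h :: "real^3 \<Rightarrow> real \<Rightarrow> complex"
  assumes h: "\<And>b. b \<in> Basis \<Longrightarrow> integrable lborel (h b)"
  shows "(LBINT x. (\<Prod>b\<in>Basis. h b (x \<bullet> b))) = (\<Prod>b\<in>Basis. \<integral>s. h b s \<partial>lborel)"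
proof -
  interpret product_sigma_finite "\<lambda>_::real^3. lborel::real measure" by standard
  have [measurable]: "h b \<in> borel_measurable borel" if "b \<in> Basis" for b
    using h[OF that] by auto
  have "(LBINT x. (\<Prod>b\<in>Basis. h b (x \<bullet> b)))
    = (\<integral>f. (\<Prod>b\<in>Basis. h b ((\<Sum>b\<in>Basis. f b *\<^sub>R b) \<bullet> b)) \<partial>(\<Pi>\<^sub>M b\<in>(Basis::(real^3) set). (lborel::real measure)))"
    by (subst lborel_eq, subst integral_distr) auto
  also have "\<dots> = (\<integral>f. (\<Prod>b\<in>Basis. h b (f b)) \<partial>(\<Pi>\<^sub>M b\<in>(Basis::(real^3) set). (lborel::real measure)))"
    by (intro Bochner_Integration.integral_cong refl prod.cong) simp
  also have "\<dots> = (\<Prod>b\<in>Basis. \<integral>s. h b s \<partial>lborel)"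
    by (rule product_integral_prod) (use h in auto)
  finally show ?thesis .
qed

text \<open>The integral of the Gaussian \<open>gauss\<close>, that is (2 pi)^(3/2). It is also the
  factor by which the unnormalized transform scales L^2 norms.\<close>

definition cG :: real where "cG = sqrt (2 * pi) ^ 3"

lemma cG_pos: "cG > 0" by (simp add: cG_def)

lemma gauss_pos: "gauss x > 0" by (simp add: gauss_def)
lemma gauss_le_1: "gauss x \<le> 1" by (simp add: gauss_def)
lemma gauss_0[simp]: "gauss 0 = 1" by (simp add: gauss_def)
lemma gauss_uminus[simp]: "gauss (- x) = gauss x" by (simp add: gauss_def)
lemma gauss_nonneg[simp]: "0 \<le> gauss x" by (simp add: gauss_def)
lemma gauss_measurable[measurable]: "gauss \<in> borel_measurable borel"
  unfolding gauss_def[abs_def] by measurable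

lemma integrable_gauss: "integrable lborel gauss"
proof -
  have "integrable lborel (\<lambda>x. cor (gauss x))"
    using schwartz_integrable[OF schwartz_gauss_cexp[of 0]] by simp
  then show ?thesis by (simp only: complex_of_real_integrable_eq)
qed

text \<open>This is the characteristic function of the standard normal distribution, freed of its
  normalization.\<close>

lemma fourier_std_normal:
  shows "integrable lborel (\<lambda>s. cor (exp (- s\<^sup>2 / 2)) * cexp (t * s))"
    and "(LBINT s. cor (exp (- s\<^sup>2 / 2)) * cexp (t * s)) = cor (sqrt (2 * pi) * exp (- t\<^sup>2 / 2))"
proof -
  have "char std_normal_distribution (- t) = (LBINT s. cor (std_normal_density s) * cexp (t * s))"
    unfolding char_def by (subst integral_density) (auto simp: scaleR_conv_of_real)
  then have e: "(LBINT s. cor (std_normal_density s) * cexp (t * s)) = exp (- t\<^sup>2 / 2)"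
    unfolding char_std_normal_distribution by simp
  have i: "integrable lborel (\<lambda>s. cor (std_normal_density s) * cexp (t * s))"
    by (rule Bochner_Integration.integrable_bound[OF integrable_std_normal_moment[of 0]]) (auto simp: norm_mult)
  have eq: "cor (exp (- s\<^sup>2 / 2)) * cexp (t * s) = cor (sqrt (2 * pi)) * (cor (std_normal_density s) * cexp (t * s))" for s
    by (simp add: std_normal_density_def)
  show "integrable lborel (\<lambda>s. cor (exp (- s\<^sup>2 / 2)) * cexp (t * s))"
    unfolding eq by (intro integrable_mult_right i)
  show "(LBINT s. cor (exp (- s\<^sup>2 / 2)) * cexp (t * s)) = cor (sqrt (2 * pi) * exp (- t\<^sup>2 / 2))"
    unfolding eq using e by simp
qed

lemma gauss_prod: "gauss x = (\<Prod>b\<in>Basis. exp (- (x \<bullet> b)\<^sup>2 / 2))"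
proof -
  have "(norm x)\<^sup>2 = (\<Sum>b\<in>Basis. (x \<bullet> b)\<^sup>2)"
    unfolding power2_norm_eq_inner by (subst euclidean_inner) (simp add: power2_eq_square)
  then have "- (norm x)\<^sup>2 / 2 = (\<Sum>b\<in>Basis. - (x \<bullet> b)\<^sup>2 / 2)"
    by (simp add: sum_negf sum_divide_distrib)
  then show ?thesis unfolding gauss_def by (simp only: exp_sum[OF finite_Basis])
qed

lemma fourier_gauss: "fourier_L1 (\<lambda>x. cor (gauss x)) xi = cor (cG * gauss xi)"
proof -
  have c: "cexp (xi \<bullet> x) = (\<Prod>b\<in>Basis. cexp ((xi \<bullet> b) * (x \<bullet> b)))" for x
    unfolding exp_sum[OF finite_Basis, symmetric]
    by (subst euclidean_inner) (simp add: sum_distrib_left sum_negf)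
  have "fourier_L1 (\<lambda>x. cor (gauss x)) xi
    = (LBINT x. (\<Prod>b\<in>Basis. cor (exp (- (x \<bullet> b)\<^sup>2 / 2)) * cexp ((xi \<bullet> b) * (x \<bullet> b))))"
    unfolding fourier_L1_def c gauss_prod of_real_prod by (simp only: prod.distrib)
  also have "\<dots> = (\<Prod>b\<in>(Basis::(real^3) set). \<integral>s. cor (exp (- s\<^sup>2 / 2)) * cexp ((xi \<bullet> b) * s) \<partial>lborel)"
    by (rule lborel_integral_prod) (rule fourier_std_normal)
  also have "\<dots> = (\<Prod>b\<in>(Basis::(real^3) set). cor (sqrt (2 * pi) * exp (- (xi \<bullet> b)\<^sup>2 / 2)))"
    by (simp only: fourier_std_normal)
  also have "\<dots> = cor (cG * gauss xi)"
    unfolding of_real_prod[symmetric] prod.distrib gauss_prod cG_def by simp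
  finally show ?thesis .
qed

lemma integral_gauss: "integral\<^sup>L lborel gauss = cG"
proof -
  have "cor (integral\<^sup>L lborel gauss) = cor cG"
    using fourier_gauss[of 0] by (simp add: fourier_L1_def)
  then show ?thesis by (simp only: of_real_eq_iff)
qed

text \<open>Its transform is a Gaussian of width \<open>e\<close> centred at \<open>a\<close> whose
  mass does not depend on \<open>e\<close>: an approximate identity that is itself a Fourier
  transform.\<close>

definition gauss_wave :: "real \<Rightarrow> real^3 \<Rightarrow> real^3 \<Rightarrow> complex" where
  "gauss_wave e a \<zeta> = cor (gauss (e *\<^sub>R \<zeta>)) * cexp (- (\<zeta> \<bullet> a))"

lemma integrable_gauss_wave:
  assumes "e > 0" shows "integrable lborel (gauss_wave e a)"
  by (rule Bochner_Integration.integrable_bound[OF lborel_scale_integrable[OF integrable_gauss, of e]])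
    (use assms in \<open>auto simp: gauss_wave_def[abs_def] norm_mult\<close>)

lemma fourier_gauss_wave:
  assumes e: "e > 0"
  shows "fourier_L1 (gauss_wave e a) x = cor (cG / e ^ 3 * gauss ((1 / e) *\<^sub>R (x - a)))"
proof -
  have "fourier_L1 (gauss_wave e a) x = (LBINT \<zeta>. (\<lambda>eta. cor (gauss eta) * cexp (((1 / e) *\<^sub>R (x - a)) \<bullet> eta)) (e *\<^sub>R \<zeta>))"
    unfolding fourier_L1_def gauss_wave_def mult.assoc cexp_add[symmetric]
    using e by (intro Bochner_Integration.integral_cong refl arg_cong2[where f="(*)"] arg_cong[where f=cexp])
      (simp add: inner_diff_left inner_diff_right inner_commute)
  also have "\<dots> = (1 / \<bar>e\<bar> ^ 3) *\<^sub>R fourier_L1 (\<lambda>x. cor (gauss x)) ((1 / e) *\<^sub>R (x - a))"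
    unfolding fourier_L1_def by (rule lborel_scale) (use e in auto)
  also have "\<dots> = cor (cG / e ^ 3 * gauss ((1 / e) *\<^sub>R (x - a)))"
    unfolding fourier_gauss using e by (simp add: scaleR_conv_of_real)
  finally show ?thesis .
qed

lemma integrable_pair_prod:
  fixes f g :: "real^3 \<Rightarrow> complex" and K :: "(real^3) \<times> (real^3) \<Rightarrow> complex"
  assumes f: "integrable lborel f" and g: "integrable lborel g"
    and [measurable]: "K \<in> borel_measurable borel" and K: "\<And>z. norm (K z) \<le> 1"
  shows "integrable (lborel \<Otimes>\<^sub>M lborel) (\<lambda>(x, y). f x * g y * K (x, y))"
proof (rule lborel_pair.Fubini_integrable)
  have [measurable]: "f \<in> borel_measurable borel" "g \<in> borel_measurable borel"
    using f g by auto
  have [measurable]: "K \<in> borel_measurable (borel \<Otimes>\<^sub>M borel)" by (simp add: borel_prod)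
  have [measurable]: "K \<in> borel_measurable (lborel \<Otimes>\<^sub>M lborel)" by (simp add: lborel_prod)
  show "(\<lambda>(x, y). f x * g y * K (x, y)) \<in> borel_measurable (lborel \<Otimes>\<^sub>M lborel)" by measurable
  have le: "norm (f x * g y * K (x, y)) \<le> norm (f x) * norm (g y)" for x y
    using mult_left_mono[OF K[of "(x, y)"], of "norm (f x) * norm (g y)"] by (simp add: norm_mult)
  have iy: "integrable lborel (\<lambda>y. f x * g y * K (x, y))" for x
    by (rule Bochner_Integration.integrable_bound[OF integrable_mult_right[OF integrable_norm[OF g], of "norm (f x)"]])
      (use le in \<open>auto simp: abs_mult\<close>)
  then show "AE x in lborel. integrable lborel (\<lambda>y. case (x, y) of (x, y) \<Rightarrow> f x * g y * K (x, y))" by simp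
  show "integrable lborel (\<lambda>x. \<integral>y. norm (case (x, y) of (x, y) \<Rightarrow> f x * g y * K (x, y)) \<partial>lborel)"
  proof (rule Bochner_Integration.integrable_bound)
    show "integrable lborel (\<lambda>x. norm (f x) * (LBINT y. norm (g y)))" using f by simp
    have "(LBINT y. norm (f x * g y * K (x, y))) \<le> norm (f x) * (LBINT y. norm (g y))" for x
      unfolding integral_mult_right_zero[symmetric]
      by (rule integral_mono) (use iy g le in auto)
    then show "AE x in lborel. norm (LBINT y. norm (case (x, y) of (x, y) \<Rightarrow> f x * g y * K (x, y)))
        \<le> norm (norm (f x) * (LBINT y. norm (g y)))"
      by (auto simp: integral_nonneg_AE abs_mult)
  qed measurable
qed

lemma Fubini_pair_prod:
  fixes f g :: "real^3 \<Rightarrow> complex" and K :: "(real^3) \<times> (real^3) \<Rightarrow> complex"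
  assumes f: "integrable lborel f" and g: "integrable lborel g"
    and K: "K \<in> borel_measurable borel" "\<And>z. norm (K z) \<le> 1"
  shows "(LBINT y. (LBINT x. f x * g y * K (x, y))) = (LBINT x. (LBINT y. f x * g y * K (x, y)))"
  using lborel_pair.Fubini_integral[OF integrable_pair_prod[OF assms]] by simp

text \<open>Fubini's theorem for the kernel exp (- i x . y), which is symmetric in its two
  arguments.\<close>

lemma fourier_L1_multiplication:
  assumes f: "integrable lborel f" and g: "integrable lborel g"
  shows "(LBINT x. f x * fourier_L1 g x) = (LBINT xi. fourier_L1 f xi * g xi)"
proof -
  have "(LBINT x. f x * fourier_L1 g x) = (LBINT x. (LBINT y. f x * g y * cexp (x \<bullet> y)))"
    unfolding fourier_L1_def integral_mult_right_zero[symmetric] by (simp only: mult.assoc)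
  also have "\<dots> = (LBINT y. (LBINT x. f x * g y * cexp (x \<bullet> y)))"
    by (rule Fubini_pair_prod[OF f g, of "\<lambda>z. cexp (fst z \<bullet> snd z)", unfolded fst_conv snd_conv, symmetric])
      (auto intro!: borel_measurable_continuous_onI continuous_intros)
  also have "\<dots> = (LBINT xi. fourier_L1 f xi * g xi)"
    unfolding fourier_L1_def integral_mult_left_zero[symmetric]
    by (intro Bochner_Integration.integral_cong refl) (simp add: inner_commute mult_ac)
  finally show ?thesis .
qed

lemma fourier_L1_times_integrable:
  assumes f: "integrable lborel f" and g: "integrable lborel g"
  shows "integrable lborel (\<lambda>x. f x * fourier_L1 g x)"
proof (rule Bochner_Integration.integrable_bound)
  show "integrable lborel (\<lambda>x. f x * cor (LBINT y. norm (g y)))" using f by simp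
  have [measurable]: "f \<in> borel_measurable borel" "fourier_L1 g \<in> borel_measurable borel"
    using f g fourier_L1_measurable by auto
  show "(\<lambda>x. f x * fourier_L1 g x) \<in> borel_measurable lborel" by measurable
  show "AE x in lborel. norm (f x * fourier_L1 g x) \<le> norm (f x * cor (LBINT y. norm (g y)))"
    using fourier_L1_bound[OF g] by (auto simp: norm_mult integral_nonneg_AE intro!: mult_left_mono)
qed

lemma has_fourier_L1:
  assumes "integrable lborel f"
  shows "has_fourier f (fourier_L1 f)"
  unfolding has_fourier_def
  using fourier_L1_multiplication[OF assms schwartz_integrable] fourier_L1_times_integrable[OF assms schwartz_integrable]
    fourier_L1_times_integrable[OF schwartz_integrable assms]
  by (auto simp: mult.commute)

text \<open>A measurable function is almost everywhere a limit of continuous ones; composing these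
  with the radial retraction \<open>P\<close> onto the ball of radius \<open>M\<close> keeps the
  limit, which already lies in that ball, and restores the bound.\<close>

lemma bounded_continuous_approx:
  fixes f :: "real^3 \<Rightarrow> 'b::euclidean_space"
  assumes [measurable]: "f \<in> borel_measurable borel" and M: "M > 0" and f: "\<And>x. norm (f x) \<le> M"
  obtains g where "\<And>n. continuous_on UNIV (g n)" "\<And>n x. norm (g n x) \<le> M"
    "AE x in lborel. (\<lambda>n. g n x) \<longlonglongrightarrow> f x"
proof -
  have "f \<in> borel_measurable lebesgue" by (rule measurable_completion) simp
  then have "f measurable_on UNIV" by (rule lebesgue_measurable_imp_measurable_on) auto
  then obtain N g where N: "negligible N" and g: "\<And>n. continuous_on UNIV (g n)"
    and lim: "\<And>x. x \<notin> N \<Longrightarrow> (\<lambda>n. g n x) \<longlonglongrightarrow> f x"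
    unfolding measurable_on_def by auto
  define P :: "'b \<Rightarrow> 'b" where "P z = (M / max M (norm z)) *\<^sub>R z" for z
  have P1: "norm (P z) \<le> M" for z
    using M by (simp add: P_def divide_simps max_def)
  have cP: "continuous_on UNIV P"
    unfolding P_def using M by (intro continuous_intros) (auto simp: max_def)
  have P2: "P (f x) = f x" for x using f[of x] M by (simp add: P_def max_def)
  show ?thesis
  proof (rule that[of "\<lambda>n x. P (g n x)"])
    show "continuous_on UNIV (\<lambda>x. P (g n x))" for n
      by (rule continuous_on_compose2[OF cP g]) auto
    show "norm (P (g n x)) \<le> M" for n x by (rule P1)
    have "AE x in lebesgue. x \<notin> N" using N by (simp add: negligible_iff_null_sets AE_not_in)
    then have "AE x in lborel. x \<notin> N" by (simp add: AE_completion_iff)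
    then show "AE x in lborel. (\<lambda>n. P (g n x)) \<longlonglongrightarrow> f x"
    proof eventually_elim
      case (elim x)
      have "isCont P (f x)" using cP by (simp add: continuous_on_eq_continuous_at)
      from isCont_tendsto_compose[OF this lim[OF elim]] show ?case by (simp add: P2)
    qed
  qed
qed

text \<open>The mollified function is only tested against an integrable \<open>h\<close>, so
  pointwise convergence and a uniform bound suffice. Injectivity and Plancherel's identity both rest
  on this limit.\<close>

lemma gauss_mollify:
  fixes f :: "real^3 \<Rightarrow> complex"
  assumes f: "continuous_on UNIV f" and B: "\<And>x. norm (f x) \<le> B" and h: "integrable lborel h"
  shows "(\<lambda>n. \<integral>x. h x * (LBINT z. cor (gauss z) * f (x + (1 / real (Suc n)) *\<^sub>R z)) \<partial>lborel)
    \<longlonglongrightarrow> cG * (LBINT x. h x * f x)"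
proof -
  have [measurable]: "f \<in> borel_measurable borel" "h \<in> borel_measurable borel"
    using f h borel_measurable_continuous_onI by auto
  have B0: "B \<ge> 0" using B[of 0] norm_ge_zero order_trans by blast
  define A where "A n x = (LBINT z. cor (gauss z) * f (x + (1 / real (Suc n)) *\<^sub>R z))" for n x
  have [measurable]: "A n \<in> borel_measurable borel" for n unfolding A_def by measurable
  have "(\<lambda>n. A n x) \<longlonglongrightarrow> (LBINT z. cor (gauss z) * f x)" for x
    unfolding A_def
  proof (rule integral_dominated_convergence[where w="\<lambda>z. gauss z * B"])
    show "integrable lborel (\<lambda>z. gauss z * B)" using integrable_gauss by simp
    show "AE z in lborel. (\<lambda>n. cor (gauss z) * f (x + (1 / real (Suc n)) *\<^sub>R z)) \<longlonglongrightarrow> cor (gauss z) * f x"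
    proof (intro AE_I2 tendsto_mult tendsto_const)
      fix z
      have "(\<lambda>n. x + (1 / real (Suc n)) *\<^sub>R z) \<longlonglongrightarrow> x + 0 *\<^sub>R z"
        by (intro tendsto_intros) (use LIMSEQ_inverse_real_of_nat in \<open>simp add: inverse_eq_divide\<close>)
      moreover have "isCont f x" using f by (simp add: continuous_on_eq_continuous_at)
      ultimately show "(\<lambda>n. f (x + (1 / real (Suc n)) *\<^sub>R z)) \<longlonglongrightarrow> f x"
        using isCont_tendsto_compose[of x f "\<lambda>n. x + (1 / real (Suc n)) *\<^sub>R z" sequentially] by simp
    qed
  qed (auto simp: norm_mult intro!: mult_left_mono B)
  then have lim: "(\<lambda>n. A n x) \<longlonglongrightarrow> cG * f x" for x
    by (simp add: integral_gauss)
  have bound: "norm (A n x) \<le> cG * B" for n x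
  proof -
    have "norm (A n x) \<le> (LBINT z. gauss z * B)"
      unfolding A_def using integrable_gauss
      by (intro lint_norm_bound) (auto simp: norm_mult intro!: mult_left_mono B)
    then show ?thesis by (simp add: integral_gauss)
  qed
  have "(\<lambda>n. \<integral>x. h x * A n x \<partial>lborel) \<longlonglongrightarrow> (LBINT x. h x * (cG * f x))"
  proof (rule integral_dominated_convergence[where w="\<lambda>x. norm (h x) * (cG * B)"])
    show "AE x in lborel. (\<lambda>n. h x * A n x) \<longlonglongrightarrow> h x * (cG * f x)"
      by (intro AE_I2 tendsto_intros lim)
  qed (use h bound in \<open>auto simp: norm_mult intro!: mult_left_mono\<close>)
  then show ?thesis unfolding A_def by (simp add: mult.left_commute)
qed

lemma gauss_mollify_eq:
  fixes f :: "real^3 \<Rightarrow> complex"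
  assumes [measurable]: "f \<in> borel_measurable borel" and e: "e > 0"
  shows "(LBINT z. cor (gauss z) * f (x + e *\<^sub>R z))
    = cor (1 / e ^ 3) * (LBINT a. cor (gauss ((1 / e) *\<^sub>R (a - x))) * f a)"
proof -
  have "(LBINT z. cor (gauss z) * f (x + e *\<^sub>R z))
    = (LBINT z. (\<lambda>y. cor (gauss ((1 / e) *\<^sub>R y)) * f (x + y)) (e *\<^sub>R z))"
    using e by simp
  also have "\<dots> = (1 / \<bar>e\<bar> ^ 3) *\<^sub>R (LBINT y. cor (gauss ((1 / e) *\<^sub>R y)) * f (x + y))"
    by (rule lborel_scale) (use e in auto)
  also have "(LBINT y. cor (gauss ((1 / e) *\<^sub>R y)) * f (x + y))
    = (LBINT y. (\<lambda>a. cor (gauss ((1 / e) *\<^sub>R (a - x))) * f a) (x + y))" by simp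
  also have "\<dots> = (LBINT a. cor (gauss ((1 / e) *\<^sub>R (a - x))) * f a)"
    by (rule lborel_translate) measurable
  finally show ?thesis using e by (simp add: scaleR_conv_of_real)
qed

text \<open>The multiplication formula makes \<open>h\<close> orthogonal to every translated and
  scaled Gaussian, hence by Fubini to Gaussian mollifications of compactly supported continuous
  functions, hence to these functions and to bounded continuous ones, and finally to the conjugate
  phase of \<open>h\<close> itself.\<close>

lemma fourier_L1_inj:
  assumes h: "integrable lborel h" and z: "\<And>xi. fourier_L1 h xi = 0"
  shows "AE x in lborel. h x = 0"
proof -
  have [measurable]: "h \<in> borel_measurable borel" using h by auto
  have g0: "(LBINT x. h x * cor (gauss ((1 / e) *\<^sub>R (a - x)))) = 0" if "e > 0" for a e
  proof -
    have "(LBINT x. h x * fourier_L1 (gauss_wave e a) x) = 0"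
      using fourier_L1_multiplication[OF h integrable_gauss_wave[OF that, of a]] z by simp
    moreover have "h x * fourier_L1 (gauss_wave e a) x = cor (cG / e ^ 3) * (h x * cor (gauss ((1 / e) *\<^sub>R (a - x))))" for x
      unfolding fourier_gauss_wave[OF that] using gauss_uminus[of "(1 / e) *\<^sub>R (a - x)"] by (simp add: scaleR_diff_right)
    ultimately show ?thesis using cG_pos that by simp
  qed
  have zero: "(LBINT x. h x * f x) = 0" if f: "continuous_on UNIV f" and B: "\<And>x. norm (f x) \<le> B" for f B
  proof -
    \<comment> \<open>The cutoff makes the test function integrable, as the exchange of integrals
      demands; it is removed afterwards by dominated convergence.\<close>
    define r where "r n x = max 0 (min 1 (real n - norm (x::real^3)))" for n x
    have [measurable]: "f \<in> borel_measurable borel" using f borel_measurable_continuous_onI by auto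
    have r01: "0 \<le> r n x" "r n x \<le> 1" for n x by (auto simp: r_def)
    have B0: "B \<ge> 0" using B[of 0] norm_ge_zero order_trans by blast
    have "(LBINT x. h x * (cor (r k x) * f x)) = 0" for k
    proof -
      define F where "F x = cor (r k x) * f x" for x
      have contF: "continuous_on UNIV F" unfolding F_def r_def by (intro continuous_intros f)
      have [measurable]: "F \<in> borel_measurable borel" using contF borel_measurable_continuous_onI by auto
      have BF: "norm (F x) \<le> B" for x
        using mult_mono[OF r01(2) B, of x k x] r01(1) by (simp add: F_def norm_mult)
      have iF: "integrable lborel F"
      proof (rule Bochner_Integration.integrable_bound)
        show "integrable lborel (\<lambda>x::real^3. B * indicator (cball 0 (real k)) x)"
          by (intro integrable_mult_right integrable_real_indicator) (use emeasure_bounded_finite[OF bounded_cball] in \<open>auto simp: top.not_eq_extremum\<close>)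
        have "norm (F x) \<le> B * indicator (cball 0 (real k)) x" for x
        proof (cases "x \<in> cball 0 (real k)")
          case False
          then have "F x = 0" by (simp add: F_def r_def)
          then show ?thesis using B0 by simp
        qed (use BF in auto)
        then show "AE x in lborel. norm (F x) \<le> norm (B * indicator (cball 0 (real k)) x)"
          by (auto intro: order_trans[OF _ abs_ge_self])
      qed measurable
      have "(\<lambda>n. \<integral>x. h x * (LBINT z. cor (gauss z) * F (x + (1 / real (Suc n)) *\<^sub>R z)) \<partial>lborel) \<longlonglongrightarrow> cG * (LBINT x. h x * F x)"
        by (rule gauss_mollify[OF contF BF h])
      moreover have "(LBINT x. h x * (LBINT z. cor (gauss z) * F (x + e *\<^sub>R z))) = 0" if e: "e > 0" for e
      proof -
        have "(LBINT x. h x * (LBINT z. cor (gauss z) * F (x + e *\<^sub>R z)))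
          = cor (1 / e ^ 3) * (LBINT x. (LBINT a. h x * F a * cor (gauss ((1 / e) *\<^sub>R (a - x)))))"
          unfolding gauss_mollify_eq[OF \<open>F \<in> borel_measurable borel\<close> e] integral_mult_right_zero[symmetric] by (simp only: mult_ac)
        also have "(LBINT x. (LBINT a. h x * F a * cor (gauss ((1 / e) *\<^sub>R (a - x)))))
          = (LBINT a. (LBINT x. h x * F a * cor (gauss ((1 / e) *\<^sub>R (a - x)))))"
          by (rule Fubini_pair_prod[OF h iF, of "\<lambda>z. cor (gauss ((1 / e) *\<^sub>R (snd z - fst z)))", unfolded fst_conv snd_conv, symmetric])
            (use e in \<open>auto intro!: borel_measurable_continuous_onI continuous_intros simp: gauss_le_1 gauss_def[abs_def]\<close>)
        also have "\<dots> = (LBINT a. F a * (LBINT x. h x * cor (gauss ((1 / e) *\<^sub>R (a - x)))))"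
          unfolding integral_mult_right_zero[symmetric] by (simp only: mult_ac)
        also have "\<dots> = 0" using g0[OF e] by simp
        finally show ?thesis by simp
      qed
      ultimately have "(\<lambda>n. 0) \<longlonglongrightarrow> cG * (LBINT x. h x * F x)" by simp
      then show ?thesis using cG_pos by (simp add: LIMSEQ_const_iff F_def)
    qed
    moreover have "(\<lambda>k. \<integral>x. h x * (cor (r k x) * f x) \<partial>lborel) \<longlonglongrightarrow> (LBINT x. h x * f x)"
    proof (rule integral_dominated_convergence[where w="\<lambda>x. norm (h x) * B"])
      have [measurable]: "r k \<in> borel_measurable borel" for k unfolding r_def by measurable
      show "(\<lambda>x. h x * (cor (r k x) * f x)) \<in> borel_measurable lborel" for k by measurable
      have "(\<lambda>k. h x * (cor (r k x) * f x)) \<longlonglongrightarrow> h x * f x" for x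
      proof (rule tendsto_eventually)
        obtain N where N: "norm x + 1 \<le> real N" using real_arch_simple by blast
        have "h x * (cor (r k x) * f x) = h x * f x" if "k \<ge> N" for k
          using N that by (simp add: r_def)
        then show "\<forall>\<^sub>F k in sequentially. h x * (cor (r k x) * f x) = h x * f x"
          unfolding eventually_sequentially by blast
      qed
      then show "AE x in lborel. (\<lambda>k. h x * (cor (r k x) * f x)) \<longlonglongrightarrow> h x * f x" by simp
      have "norm (cor (r k x) * f x) \<le> B" for k x
        using mult_mono[OF r01(2) B, of x k x] r01(1) by (simp add: norm_mult)
      then show "AE x in lborel. norm (h x * (cor (r k x) * f x)) \<le> norm (h x) * B" for k
        by (auto simp: norm_mult intro!: mult_left_mono)
    qed (use h in auto)
    ultimately show ?thesis by (simp add: LIMSEQ_const_iff)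
  qed
  \<comment> \<open>The conjugate phase of \<open>h\<close>, with value 0 where \<open>h\<close>
    vanishes because division by zero yields 0. Its product with \<open>h\<close> is the modulus of
    \<open>h\<close>.\<close>
  define s where "s x = cnj (h x) / cor (norm (h x))" for x
  have [measurable]: "s \<in> borel_measurable borel" unfolding s_def by measurable
  have "norm (s x) \<le> 1" for x by (simp add: s_def norm_divide)
  then obtain g where g: "\<And>n. continuous_on UNIV (g n)" "\<And>n x. norm (g n x) \<le> 1" "AE x in lborel. (\<lambda>n. g n x) \<longlonglongrightarrow> s x"
    using bounded_continuous_approx[of s 1] by auto
  have "(\<lambda>n. \<integral>x. h x * g n x \<partial>lborel) \<longlonglongrightarrow> (LBINT x. h x * s x)"
  proof (rule integral_dominated_convergence[where w="\<lambda>x. norm (h x)"])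
    show "(\<lambda>x. h x * g n x) \<in> borel_measurable lborel" for n
      using borel_measurable_continuous_onI[OF g(1)[of n]] by measurable
    show "AE x in lborel. (\<lambda>n. h x * g n x) \<longlonglongrightarrow> h x * s x"
      using g(3) by eventually_elim (intro tendsto_intros)
    show "AE x in lborel. norm (h x * g n x) \<le> norm (h x)" for n
      using mult_left_mono[OF g(2), of "norm (h _)" n] by (auto simp: norm_mult)
  qed (use h in auto)
  then have "(LBINT x. h x * s x) = 0" using zero[OF g(1) g(2)] by (simp add: LIMSEQ_const_iff)
  moreover have "h x * s x = cor (norm (h x))" for x
    by (cases "h x = 0") (auto simp: s_def complex_norm_square[symmetric] power2_eq_square mult.assoc[symmetric])
  ultimately have "(LBINT x. norm (h x)) = 0" by simp
  then have "AE x in lborel. norm (h x) = 0"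
    by (subst (asm) integral_nonneg_eq_0_iff_AE) (use h in auto)
  then show ?thesis by simp
qed

section \<open>Plancherel's theorem\<close>

definition l2norm :: "(real^3 \<Rightarrow> 'b::euclidean_space) \<Rightarrow> real" where
  "l2norm f = sqrt (LBINT x. (norm (f x))\<^sup>2)"

lemma square_integrableD:
  assumes "square_integrable f"
  shows "f \<in> borel_measurable borel" "integrable lborel (\<lambda>x. (norm (f x))\<^sup>2)"
  using assms by (auto simp: square_integrable_def)

lemma l2norm_nonneg[simp]: "0 \<le> l2norm f"
  by (simp add: l2norm_def)

lemma l2norm_power2: "(l2norm f)\<^sup>2 = (LBINT x. (norm (f x))\<^sup>2)"
  by (simp add: l2norm_def)

lemma norm_abs_l2_eq: "square_integrable f \<Longrightarrow> norm (abs_l2 f) = l2norm f"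
  using norm_abs_l2[of f] by (metis l2norm_def norm_ge_zero real_sqrt_abs abs_of_nonneg)

lemma l2norm_rep: "l2norm (rep_l2 f) = norm f"
  using norm_abs_l2_eq[OF square_integrable_rep_l2[of f]] by (simp add: abs_rep_l2)

lemma abs_l2_add: "square_integrable f \<Longrightarrow> square_integrable g \<Longrightarrow> abs_l2 f + abs_l2 g = abs_l2 (\<lambda>x. f x + g x)"
  by (simp add: plus_l2.abs_eq l2_rel_def)

lemma abs_l2_diff: "square_integrable f \<Longrightarrow> square_integrable g \<Longrightarrow> abs_l2 f - abs_l2 g = abs_l2 (\<lambda>x. f x - g x)"
  by (simp add: minus_l2.abs_eq l2_rel_def)

lemma l2norm_triangle:
  assumes "square_integrable f" "square_integrable g"
  shows "l2norm (\<lambda>x. f x + g x) \<le> l2norm f + l2norm g"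
  using norm_triangle_ineq[of "abs_l2 f" "abs_l2 g"] assms
  by (simp add: abs_l2_add norm_abs_l2_eq square_integrable_add)

lemma l2norm_cong_AE:
  assumes "AE x in lborel. norm (f x) = norm (g x)" "f \<in> borel_measurable borel" "g \<in> borel_measurable borel"
  shows "l2norm f = l2norm g"
proof -
  have "(LBINT x. (norm (f x))\<^sup>2) = (LBINT x. (norm (g x))\<^sup>2)"
    by (rule integral_cong_AE) (use assms in auto)
  then show ?thesis by (simp add: l2norm_def)
qed

lemma square_integrable_bound:
  fixes f :: "real^3 \<Rightarrow> 'b::euclidean_space" and g :: "real^3 \<Rightarrow> 'c::euclidean_space"
  assumes "square_integrable g" and [measurable]: "f \<in> borel_measurable borel"
    and le: "AE x in lborel. norm (f x) \<le> norm (g x)"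
  shows "square_integrable f" "l2norm f \<le> l2norm g"
proof -
  have [measurable]: "g \<in> borel_measurable borel" and i: "integrable lborel (\<lambda>x. (norm (g x))\<^sup>2)"
    using square_integrableD[OF assms(1)] by auto
  have le2: "AE x in lborel. (norm (f x))\<^sup>2 \<le> (norm (g x))\<^sup>2"
    using le by eventually_elim (auto intro: power_mono)
  have j: "integrable lborel (\<lambda>x. (norm (f x))\<^sup>2)"
    by (rule Bochner_Integration.integrable_bound[OF i]) (use le2 in auto)
  show "square_integrable f" using j by (simp add: square_integrable_def)
  show "l2norm f \<le> l2norm g"
    unfolding l2norm_def by (intro real_sqrt_le_mono integral_mono_AE i j le2)
qed

lemma l2norm_Cauchy_Schwarz:
  fixes f :: "real^3 \<Rightarrow> 'b::euclidean_space" and g :: "real^3 \<Rightarrow> 'c::euclidean_space"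
  assumes "square_integrable f" "square_integrable g"
  shows "integrable lborel (\<lambda>x. norm (f x) * norm (g x))"
    and "(LBINT x. norm (f x) * norm (g x)) \<le> l2norm f * l2norm g"
proof -
  have [measurable]: "f \<in> borel_measurable borel" "g \<in> borel_measurable borel"
    using assms by (auto simp: square_integrable_def)
  have s: "square_integrable (\<lambda>x. norm (f x))" "square_integrable (\<lambda>x. norm (g x))"
    using assms by (auto simp: square_integrable_def)
  show "integrable lborel (\<lambda>x. norm (f x) * norm (g x))"
    using square_integrable_inner[OF s] by simp
  have "abs_l2 (\<lambda>x. norm (f x)) \<bullet> abs_l2 (\<lambda>x. norm (g x)) \<le> norm (abs_l2 (\<lambda>x. norm (f x))) * norm (abs_l2 (\<lambda>x. norm (g x)))"
    by (rule norm_cauchy_schwarz)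
  also have "abs_l2 (\<lambda>x. norm (f x)) \<bullet> abs_l2 (\<lambda>x. norm (g x)) = (LBINT x. norm (f x) * norm (g x))"
    using s by (subst inner_l2.abs_eq) (auto simp: l2_rel_def)
  finally show "(LBINT x. norm (f x) * norm (g x)) \<le> l2norm f * l2norm g"
    using s by (simp add: norm_abs_l2_eq) (simp add: l2norm_def)
qed

lemma l2_mult:
  fixes f g :: "real^3 \<Rightarrow> complex"
  assumes "square_integrable f" "square_integrable g"
  shows "integrable lborel (\<lambda>x. f x * g x)" "norm (LBINT x. f x * g x) \<le> l2norm f * l2norm g"
proof -
  have [measurable]: "f \<in> borel_measurable borel" "g \<in> borel_measurable borel"
    using assms by (auto simp: square_integrable_def)
  note cs = l2norm_Cauchy_Schwarz[OF assms]
  show "integrable lborel (\<lambda>x. f x * g x)"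
    by (rule Bochner_Integration.integrable_bound[OF cs(1)]) (auto simp: norm_mult)
  have "norm (LBINT x. f x * g x) \<le> (LBINT x. norm (f x) * norm (g x))"
    by (rule lint_norm_bound[OF cs(1)]) (simp add: norm_mult)
  then show "norm (LBINT x. f x * g x) \<le> l2norm f * l2norm g" using cs(2) by linarith
qed

lemma l2norm_tendsto_mult:
  fixes F :: "nat \<Rightarrow> real^3 \<Rightarrow> complex"
  assumes F: "\<And>n. square_integrable (F n)" "square_integrable G" "square_integrable h"
    and lim: "(\<lambda>n. l2norm (\<lambda>x. F n x - G x)) \<longlonglongrightarrow> 0"
  shows "(\<lambda>n. \<integral>x. F n x * h x \<partial>lborel) \<longlonglongrightarrow> (LBINT x. G x * h x)"
proof (rule LIM_zero_cancel, rule Lim_null_comparison)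
  have "norm ((LBINT x. F n x * h x) - (LBINT x. G x * h x)) \<le> l2norm (\<lambda>x. F n x - G x) * l2norm h" for n
  proof -
    have "(LBINT x. F n x * h x) - (LBINT x. G x * h x) = (LBINT x. (F n x - G x) * h x)"
      using l2_mult(1)[OF F(1) F(3)] l2_mult(1)[OF F(2) F(3)] by (simp add: left_diff_distrib)
    then show ?thesis using l2_mult(2)[OF square_integrable_diff[OF F(1) F(2)] F(3)] by simp
  qed
  then show "\<forall>\<^sub>F n in sequentially. norm ((LBINT x. F n x * h x) - (LBINT x. G x * h x)) \<le> l2norm (\<lambda>x. F n x - G x) * l2norm h"
    by simp
  show "(\<lambda>n. l2norm (\<lambda>x. F n x - G x) * l2norm h) \<longlonglongrightarrow> 0"
    using tendsto_mult_right[OF lim, of "l2norm h"] by simp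
qed

lemma l2norm_tendsto_abs:
  assumes "\<And>n. square_integrable (F n)" "square_integrable G"
  shows "(\<lambda>n. l2norm (\<lambda>x. F n x - G x)) \<longlonglongrightarrow> 0 \<longleftrightarrow> (\<lambda>n. abs_l2 (F n)) \<longlonglongrightarrow> abs_l2 G"
proof -
  have "l2norm (\<lambda>x. F n x - G x) = norm (abs_l2 (F n) - abs_l2 G)" for n
    using assms by (simp add: abs_l2_diff norm_abs_l2_eq square_integrable_diff)
  then show ?thesis by (simp only: tendsto_norm_zero_iff LIM_zero_iff)
qed

lemma dominated_l2:
  fixes F :: "nat \<Rightarrow> real^3 \<Rightarrow> 'b::euclidean_space"
  assumes [measurable]: "\<And>n. F n \<in> borel_measurable borel" "G \<in> borel_measurable borel"
    and lim: "AE x in lborel. (\<lambda>n. F n x) \<longlonglongrightarrow> G x"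
    and w: "integrable lborel w" "\<And>n. AE x in lborel. (norm (F n x - G x))\<^sup>2 \<le> w x"
  shows "(\<lambda>n. l2norm (\<lambda>x. F n x - G x)) \<longlonglongrightarrow> 0"
proof -
  have "(\<lambda>n. \<integral>x. (norm (F n x - G x))\<^sup>2 \<partial>lborel) \<longlonglongrightarrow> (\<integral>x. 0 \<partial>(lborel::(real^3) measure))"
  proof (rule integral_dominated_convergence[OF _ _ w(1)])
    show "AE x in lborel. (\<lambda>n. (norm (F n x - G x))\<^sup>2) \<longlonglongrightarrow> 0"
      using lim
    proof eventually_elim
      case (elim x)
      then have "(\<lambda>n. norm (F n x - G x)) \<longlonglongrightarrow> 0" by (simp add: LIM_zero tendsto_norm_zero)
      from tendsto_power[OF this, of 2] show ?case by simp
    qed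
    show "AE x in lborel. norm ((norm (F n x - G x))\<^sup>2) \<le> w x" for n
      using w(2)[of n] by simp
  qed auto
  from tendsto_real_sqrt[OF this] show ?thesis by (simp add: l2norm_def)
qed

text \<open>The class on which Plancherel's identity is proved directly: continuity and boundedness
  are what Gaussian mollification asks for, integrability what the transform integral asks
  for.\<close>

definition CBI :: "(real^3 \<Rightarrow> complex) \<Rightarrow> bool" where
  "CBI f \<longleftrightarrow> continuous_on UNIV f \<and> bounded (range f) \<and> integrable lborel f"

lemma CBI_square_integrable:
  assumes "CBI f" shows "square_integrable f"
proof -
  obtain B where B: "\<And>x. norm (f x) \<le> B" using assms by (auto simp: CBI_def bounded_iff)
  have i: "integrable lborel f" using assms by (simp add: CBI_def)
  then have [measurable]: "f \<in> borel_measurable borel" by auto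
  have "integrable lborel (\<lambda>x. (norm (f x))\<^sup>2)"
  proof (rule Bochner_Integration.integrable_bound)
    show "integrable lborel (\<lambda>x. B * norm (f x))" using i by simp
    have "(norm (f x))\<^sup>2 \<le> B * norm (f x)" for x
      using mult_right_mono[OF B[of x], of "norm (f x)"] by (simp add: power2_eq_square)
    then show "AE x in lborel. norm ((norm (f x))\<^sup>2) \<le> norm (B * norm (f x))"
      by (auto intro: order_trans[OF _ abs_ge_self])
  qed measurable
  then show ?thesis by (simp add: square_integrable_def)
qed

lemma CBI_diff: "CBI f \<Longrightarrow> CBI g \<Longrightarrow> CBI (\<lambda>x. f x - g x)"
  unfolding CBI_def using bounded_minus_comp[of f UNIV g] by (auto intro: continuous_on_diff)

lemma CBI_dense_aux:
  assumes f: "square_integrable f" and e: "e > 0"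
  obtains g where "CBI g" "l2norm (\<lambda>x. g x - f x) < e"
proof -
  have [measurable]: "f \<in> borel_measurable borel" and fi: "integrable lborel (\<lambda>x. (norm (f x))\<^sup>2)"
    using square_integrableD[OF f] by auto
  \<comment> \<open>Truncation both in space and in size, so that the result is bounded with bounded
    support and still converges to \<open>f\<close> in L^2.\<close>
  define t where "t N x = (if norm x \<le> real N \<and> norm (f x) \<le> real N then f x else 0)" for N x
  have [measurable]: "t N \<in> borel_measurable borel" for N unfolding t_def by measurable
  have "(\<lambda>N. l2norm (\<lambda>x. t N x - f x)) \<longlonglongrightarrow> 0"
  proof (rule dominated_l2[where w="\<lambda>x. (norm (f x))\<^sup>2"])
    have "(\<lambda>N. t N x) \<longlonglongrightarrow> f x" for x
    proof (rule tendsto_eventually)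
      obtain K where "max (norm x) (norm (f x)) \<le> real K" using real_arch_simple by blast
      then have "t N x = f x" if "N \<ge> K" for N using that by (simp add: t_def)
      then show "\<forall>\<^sub>F N in sequentially. t N x = f x" unfolding eventually_sequentially by blast
    qed
    then show "AE x in lborel. (\<lambda>N. t N x) \<longlonglongrightarrow> f x" by simp
    show "AE x in lborel. (norm (t N x - f x))\<^sup>2 \<le> (norm (f x))\<^sup>2" for N
      by (auto simp: t_def)
  qed (use fi in auto)
  then obtain N where N: "l2norm (\<lambda>x. t N x - f x) < e / 2"
    using e by (metis (no_types, lifting) LIMSEQ_D[of _ 0 "e/2"] diff_zero half_gt_zero le_refl real_norm_def abs_of_nonneg l2norm_nonneg)
  define M where "M = real (Suc N)"
  have "norm (t N x) \<le> M" for x by (simp add: t_def M_def)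
  moreover have "M > 0" by (simp add: M_def)
  ultimately obtain g where g: "\<And>n. continuous_on UNIV (g n)" "\<And>n x. norm (g n x) \<le> M" "AE x in lborel. (\<lambda>n. g n x) \<longlonglongrightarrow> t N x"
    using bounded_continuous_approx[of "t N" M] by auto
  \<comment> \<open>Equal to 1 for |x| <= N, where \<open>t N\<close> may be nonzero, and to 0 from
    N + 1 on; it gives the continuous approximations bounded support without changing the
    limit.\<close>
  define r where "r x = max 0 (min 1 (real (Suc N) - norm (x::real^3)))" for x
  have r01: "0 \<le> r x" "r x \<le> 1" for x by (auto simp: r_def)
  define G where "G n x = cor (r x) * g n x" for n x
  have contG: "continuous_on UNIV (G n)" for n unfolding G_def r_def by (intro continuous_intros g)
  then have [measurable]: "G n \<in> borel_measurable borel" for n by (rule borel_measurable_continuous_onI)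
  define I where "I x = (indicator (cball 0 (real (Suc N))) x :: real)" for x :: "real^3"
  have iI: "integrable lborel I"
    unfolding I_def by (intro integrable_real_indicator)
      (use emeasure_bounded_finite[OF bounded_cball] in \<open>auto simp: top.not_eq_extremum\<close>)
  have BG: "norm (G n x) \<le> M * I x" for n x
  proof (cases "x \<in> cball 0 (real (Suc N))")
    case True
    then show ?thesis using mult_mono[OF r01(2)[of x] g(2)[of n x]] r01(1) by (simp add: G_def I_def norm_mult)
  next
    case False
    then have "r x = 0" by (simp add: r_def)
    then show ?thesis using False by (simp add: G_def I_def)
  qed
  have Bt: "norm (t N x) \<le> M * I x" for x by (simp add: t_def M_def I_def indicator_def)
  have cbi: "CBI (G n)" for n
    unfolding CBI_def
  proof (intro conjI contG)
    have "norm (G n x) \<le> M" for x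
      using BG[of n x] by (cases "x \<in> cball 0 (real (Suc N))") (auto simp: I_def M_def)
    then show "bounded (range (G n))" by (auto simp: bounded_iff)
    show "integrable lborel (G n)"
      by (rule Bochner_Integration.integrable_bound[OF integrable_mult_right[OF iI, of M]])
        (use BG in \<open>auto intro: order_trans[OF _ abs_ge_self]\<close>)
  qed
  have "(\<lambda>n. l2norm (\<lambda>x. G n x - t N x)) \<longlonglongrightarrow> 0"
  proof (rule dominated_l2[where w="\<lambda>x. (2 * M)\<^sup>2 * I x"])
    show "AE x in lborel. (\<lambda>n. G n x) \<longlonglongrightarrow> t N x"
      using g(3)
    proof eventually_elim
      case (elim x)
      have "(\<lambda>n. G n x) \<longlonglongrightarrow> cor (r x) * t N x" unfolding G_def by (intro tendsto_intros elim)
      moreover have "cor (r x) * t N x = t N x" by (auto simp: t_def r_def)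
      ultimately show ?case by simp
    qed
    show "AE x in lborel. (norm (G n x - t N x))\<^sup>2 \<le> (2 * M)\<^sup>2 * I x" for n
    proof (rule AE_I2)
      fix x
      have "norm (G n x - t N x) \<le> 2 * M * I x"
        using norm_triangle_ineq4[of "G n x" "t N x"] BG[of n x] Bt[of x] by linarith
      then have "(norm (G n x - t N x))\<^sup>2 \<le> (2 * M * I x)\<^sup>2" by (intro power_mono) auto
      also have "\<dots> = (2 * M)\<^sup>2 * I x" by (simp add: power_mult_distrib I_def indicator_def)
      finally show "(norm (G n x - t N x))\<^sup>2 \<le> (2 * M)\<^sup>2 * I x" .
    qed
  qed (use iI in auto)
  then obtain n where n: "l2norm (\<lambda>x. G n x - t N x) < e / 2"
    using e by (metis (no_types, lifting) LIMSEQ_D[of _ 0 "e/2"] diff_zero half_gt_zero le_refl real_norm_def abs_of_nonneg l2norm_nonneg)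
  have st: "square_integrable (t N)"
    by (rule square_integrable_bound(1)[OF f]) (auto simp: t_def)
  have "l2norm (\<lambda>x. (G n x - t N x) + (t N x - f x)) \<le> l2norm (\<lambda>x. G n x - t N x) + l2norm (\<lambda>x. t N x - f x)"
    by (intro l2norm_triangle square_integrable_diff CBI_square_integrable cbi st f)
  then have "l2norm (\<lambda>x. G n x - f x) < e" using N n by simp
  then show ?thesis using that cbi by blast
qed

lemma CBI_dense:
  assumes "square_integrable f"
  obtains g where "\<And>n. CBI (g n)" "(\<lambda>n. l2norm (\<lambda>x. g n x - f x)) \<longlonglongrightarrow> 0"
proof -
  have "\<exists>g. CBI g \<and> l2norm (\<lambda>x. g x - f x) < 1 / real (Suc n)" for n
    using CBI_dense_aux[OF assms, of "1 / real (Suc n)"] by auto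
  then obtain g where g: "\<And>n. CBI (g n)" "\<And>n. l2norm (\<lambda>x. g n x - f x) < 1 / real (Suc n)" by metis
  have "(\<lambda>n. l2norm (\<lambda>x. g n x - f x)) \<longlonglongrightarrow> 0"
  proof (rule Lim_null_comparison)
    show "\<forall>\<^sub>F n in sequentially. norm (l2norm (\<lambda>x. g n x - f x)) \<le> 1 / real (Suc n)"
      using g(2) by (auto intro!: always_eventually less_imp_le)
    show "(\<lambda>n. 1 / real (Suc n)) \<longlonglongrightarrow> 0"
      using LIMSEQ_inverse_real_of_nat by (simp add: inverse_eq_divide)
  qed
  then show ?thesis using that g(1) by blast
qed

text \<open>A wide Gaussian factor regularizes the integral of the squared transform. By the
  multiplication formula the regularized integral is, up to conjugation, \<open>cG\<close> times the
  pairing of \<open>f\<close> with its own Gaussian mollification. Removing the regularization is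
  monotone convergence on one side and \<open>gauss_mollify\<close> on the other.\<close>

lemma plancherel_CBI:
  assumes f: "CBI f"
  shows "square_integrable (fourier_L1 f)" "l2norm (fourier_L1 f) = cG * l2norm f"
proof -
  have cont: "continuous_on UNIV f" and int: "integrable lborel f" using f by (auto simp: CBI_def)
  obtain B where B: "\<And>x. norm (f x) \<le> B" using f by (auto simp: CBI_def bounded_iff)
  have [measurable]: "f \<in> borel_measurable borel" using int by auto
  have [measurable]: "fourier_L1 f \<in> borel_measurable borel" by (rule fourier_L1_measurable[OF int])
  let ?e = "\<lambda>n. 1 / real (Suc n)"
  define u where "u n xi = (norm (fourier_L1 f xi))\<^sup>2 * gauss (?e n *\<^sub>R xi)" for n xi
  have ig: "integrable lborel (\<lambda>xi. gauss (?e n *\<^sub>R xi))" for n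
    by (rule lborel_scale_integrable[OF integrable_gauss]) auto
  define K where "K = (LBINT x. norm (f x))"
  have K: "norm (fourier_L1 f xi) \<le> K" for xi unfolding K_def by (rule fourier_L1_bound[OF int])
  have iu: "integrable lborel (u n)" for n
  proof (rule Bochner_Integration.integrable_bound[OF integrable_mult_right[OF ig, of "K\<^sup>2"]])
    show "AE xi in lborel. norm (u n xi) \<le> norm (K\<^sup>2 * gauss (?e n *\<^sub>R xi))"
      using K by (auto simp: u_def abs_mult intro!: mult_right_mono power_mono)
  qed (auto simp: u_def[abs_def])
  have iG: "integrable lborel (\<lambda>xi. cnj (fourier_L1 f xi) * cor (gauss (?e n *\<^sub>R xi)))" for n
  proof (rule Bochner_Integration.integrable_bound[OF integrable_mult_right[OF ig[of n], of "K"]])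
    have "norm (cnj (fourier_L1 f xi) * cor (gauss (?e n *\<^sub>R xi))) \<le> K * gauss (?e n *\<^sub>R xi)" for xi
      using mult_right_mono[OF K[of xi] gauss_nonneg[of "?e n *\<^sub>R xi"]] by (simp add: norm_mult)
    then show "AE xi in lborel. norm (cnj (fourier_L1 f xi) * cor (gauss (?e n *\<^sub>R xi))) \<le> norm (K * gauss (?e n *\<^sub>R xi))"
      by (intro AE_I2) (metis abs_ge_self order_trans real_norm_def)
  qed measurable
  define A where "A n x = (LBINT z. cor (gauss z) * f (x + ?e n *\<^sub>R z))" for n x
  have FG: "fourier_L1 (\<lambda>xi. cnj (fourier_L1 f xi) * cor (gauss (?e n *\<^sub>R xi))) x = cnj (cG * A n x)" for n x
  proof -
    have "cG * A n x = (LBINT y. f y * fourier_L1 (gauss_wave (?e n) x) y)"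
      unfolding A_def gauss_mollify_eq[OF \<open>f \<in> borel_measurable borel\<close>, of "?e n", simplified]
      using fourier_gauss_wave[of "?e n" x] by (subst gauss_mollify_eq) (auto simp: mult_ac simp flip: integral_mult_right_zero)
    also have "\<dots> = (LBINT xi. fourier_L1 f xi * gauss_wave (?e n) x xi)"
      by (rule fourier_L1_multiplication[OF int integrable_gauss_wave]) auto
    finally have "cnj (cG * A n x) = (LBINT xi. cnj (fourier_L1 f xi * gauss_wave (?e n) x xi))"
      by (simp only: Bochner_Integration.integral_cnj)
    also have "\<dots> = (LBINT xi. cnj (fourier_L1 f xi) * cor (gauss (?e n *\<^sub>R xi)) * cexp (x \<bullet> xi))"
      by (intro Bochner_Integration.integral_cong refl)
        (simp only: complex_cnj_mult gauss_wave_def cnj_cexp complex_cnj_complex_of_real minus_minus inner_commute mult_ac)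
    finally show ?thesis
      unfolding fourier_L1_def[of "\<lambda>xi. cnj (fourier_L1 f xi) * cor (gauss (?e n *\<^sub>R xi))"] by simp
  qed
  have Iu: "cor (LBINT xi. u n xi) = cnj (cG * (LBINT x. cnj (f x) * A n x))" for n
  proof -
    have "cor (LBINT xi. u n xi) = (LBINT xi. fourier_L1 f xi * (cnj (fourier_L1 f xi) * cor (gauss (?e n *\<^sub>R xi))))"
      unfolding integral_complex_of_real[symmetric] u_def
      by (intro Bochner_Integration.integral_cong refl) (simp add: complex_norm_square mult.assoc del: of_real_power)
    also have "\<dots> = (LBINT x. f x * cnj (cG * A n x))"
      unfolding FG[symmetric] by (rule fourier_L1_multiplication[OF int iG, symmetric])
    also have "\<dots> = cnj (cG * (LBINT x. cnj (f x) * A n x))"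
      unfolding complex_cnj_mult Bochner_Integration.integral_cnj[symmetric] complex_cnj_cnj
      by (simp add: mult_ac flip: integral_mult_right_zero)
    finally show ?thesis .
  qed
  have "(\<lambda>n. \<integral>x. cnj (f x) * A n x \<partial>lborel) \<longlonglongrightarrow> cG * (LBINT x. cnj (f x) * f x)"
    unfolding A_def by (rule gauss_mollify[OF cont B]) (use int in auto)
  then have "(\<lambda>n. cor (LBINT xi. u n xi)) \<longlonglongrightarrow> cnj (cG * (cG * (LBINT x. cnj (f x) * f x)))"
    unfolding Iu by (intro tendsto_intros)
  also have "(LBINT x. cnj (f x) * f x) = cor (LBINT x. (norm (f x))\<^sup>2)"
    unfolding integral_complex_of_real[symmetric]
    by (intro Bochner_Integration.integral_cong refl) (simp add: complex_norm_square mult.commute del: of_real_power)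
  finally have "(\<lambda>n. cor (LBINT xi. u n xi)) \<longlonglongrightarrow> cor (cG\<^sup>2 * (l2norm f)\<^sup>2)"
    unfolding l2norm_power2[symmetric] by (simp add: power2_eq_square mult.assoc)
  then have lim: "(\<lambda>n. \<integral>xi. u n xi \<partial>lborel) \<longlonglongrightarrow> cG\<^sup>2 * (l2norm f)\<^sup>2"
    by (simp only: tendsto_of_real_iff)
  have mono: "mono (\<lambda>n. u n xi)" for xi
  proof (rule monoI)
    fix m n :: nat assume "m \<le> n"
    then have "?e n \<le> ?e m" by (simp add: frac_le)
    then have "norm (?e n *\<^sub>R xi) \<le> norm (?e m *\<^sub>R xi)"
      unfolding norm_scaleR by (intro mult_right_mono) auto
    then have "(norm (?e n *\<^sub>R xi))\<^sup>2 \<le> (norm (?e m *\<^sub>R xi))\<^sup>2" by (rule power_mono) auto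
    then have "gauss (?e m *\<^sub>R xi) \<le> gauss (?e n *\<^sub>R xi)" unfolding gauss_def by simp
    then show "u m xi \<le> u n xi" unfolding u_def by (rule mult_left_mono) auto
  qed
  have ulim: "(\<lambda>n. u n xi) \<longlonglongrightarrow> (norm (fourier_L1 f xi))\<^sup>2" for xi
  proof -
    have "(\<lambda>n. (norm (fourier_L1 f xi))\<^sup>2 * exp (- (norm (?e n *\<^sub>R xi))\<^sup>2 / 2)) \<longlonglongrightarrow> (norm (fourier_L1 f xi))\<^sup>2 * exp (- (norm (0 *\<^sub>R xi))\<^sup>2 / 2)"
      by (intro tendsto_intros) (use LIMSEQ_inverse_real_of_nat in \<open>auto simp: inverse_eq_divide\<close>)
    then show ?thesis by (simp add: u_def gauss_def)
  qed
  have m: "integrable lborel (\<lambda>xi. (norm (fourier_L1 f xi))\<^sup>2)" "(LBINT xi. (norm (fourier_L1 f xi))\<^sup>2) = cG\<^sup>2 * (l2norm f)\<^sup>2"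
    by (rule integrable_monotone_convergence[of lborel u] integral_monotone_convergence[of lborel u];
      use iu mono ulim lim in auto)+
  show "square_integrable (fourier_L1 f)" using m(1) by (simp add: square_integrable_def)
  show "l2norm (fourier_L1 f) = cG * l2norm f"
    unfolding l2norm_def[of "fourier_L1 f"] m(2) using cG_pos by (simp add: real_sqrt_mult)
qed

lemma fourier_L1_diff:
  "integrable lborel f \<Longrightarrow> integrable lborel g \<Longrightarrow> fourier_L1 (\<lambda>x. f x - g x) xi = fourier_L1 f xi - fourier_L1 g xi"
  unfolding fourier_L1_def left_diff_distrib
  by (intro Bochner_Integration.integral_diff fourier_L1_integrable)

text \<open>The identity on the dense class makes the transforms of approximations a Cauchy
  sequence. Their limit is a transform in the distributional sense, because pairing with a Schwartz
  function is continuous in L^2.\<close>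

theorem plancherel:
  assumes f: "square_integrable f"
  obtains F where "square_integrable F" "has_fourier f F" "l2norm F = cG * l2norm f"
proof -
  obtain g where g: "\<And>n. CBI (g n)" "(\<lambda>n. l2norm (\<lambda>x. g n x - f x)) \<longlonglongrightarrow> 0"
    using CBI_dense[OF f] by metis
  have sg: "square_integrable (g n)" for n by (rule CBI_square_integrable[OF g(1)])
  have ig: "integrable lborel (g n)" for n using g(1)[of n] by (simp add: CBI_def)
  have sF: "square_integrable (fourier_L1 (g n))" for n by (rule plancherel_CBI(1)[OF g(1)])
  have lg: "(\<lambda>n. abs_l2 (g n)) \<longlonglongrightarrow> abs_l2 f"
    using g(2) l2norm_tendsto_abs[OF sg f] by simp
  have nd: "norm (abs_l2 (fourier_L1 (g m)) - abs_l2 (fourier_L1 (g n))) = cG * norm (abs_l2 (g m) - abs_l2 (g n))" for m n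
    unfolding abs_l2_diff[OF sF sF] abs_l2_diff[OF sg sg] fourier_L1_diff[OF ig ig, symmetric]
    using plancherel_CBI[OF CBI_diff[OF g(1) g(1)]]
    by (simp add: norm_abs_l2_eq square_integrable_diff sg)
  have "Cauchy (\<lambda>n. abs_l2 (fourier_L1 (g n)))"
  proof (rule metric_CauchyI)
    fix e :: real assume "e > 0"
    then have "e / cG > 0" using cG_pos by simp
    then obtain M where "\<And>m n. m \<ge> M \<Longrightarrow> n \<ge> M \<Longrightarrow> dist (abs_l2 (g m)) (abs_l2 (g n)) < e / cG"
      using metric_CauchyD[OF LIMSEQ_imp_Cauchy[OF lg]] by metis
    then show "\<exists>M. \<forall>m\<ge>M. \<forall>n\<ge>M. dist (abs_l2 (fourier_L1 (g m))) (abs_l2 (fourier_L1 (g n))) < e"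
      using cG_pos unfolding dist_norm nd by (auto simp: field_simps intro!: exI[of _ M])
  qed
  then obtain L where L: "(\<lambda>n. abs_l2 (fourier_L1 (g n))) \<longlonglongrightarrow> L"
    using Cauchy_convergent convergent_def by blast
  define F where "F = rep_l2 L"
  have F: "square_integrable F" "abs_l2 F = L" by (simp_all add: F_def square_integrable_rep_l2 abs_rep_l2)
  have lF: "(\<lambda>n. l2norm (\<lambda>x. fourier_L1 (g n) x - F x)) \<longlonglongrightarrow> 0"
    using L l2norm_tendsto_abs[OF sF F(1)] F(2) by simp
  have "has_fourier f F"
    unfolding has_fourier_def
  proof (intro allI impI conjI)
    fix phi :: "real^3 \<Rightarrow> complex" assume phi: "schwartz phi"
    have s: "square_integrable phi" "square_integrable (fourier_L1 phi)"
      using phi by (auto intro: schwartz_square_integrable schwartz_fourier_L1)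
    show "integrable lborel (\<lambda>xi. F xi * phi xi)" by (rule l2_mult(1)[OF F(1) s(1)])
    show "integrable lborel (\<lambda>x. f x * fourier_L1 phi x)" by (rule l2_mult(1)[OF f s(2)])
    have "(\<lambda>n. \<integral>xi. fourier_L1 (g n) xi * phi xi \<partial>lborel) \<longlonglongrightarrow> (LBINT xi. F xi * phi xi)"
      by (rule l2norm_tendsto_mult[OF sF F(1) s(1) lF])
    moreover have "(\<lambda>n. \<integral>xi. g n xi * fourier_L1 phi xi \<partial>lborel) \<longlonglongrightarrow> (LBINT xi. f xi * fourier_L1 phi xi)"
      by (rule l2norm_tendsto_mult[OF sg f s(2) g(2)])
    moreover have "(LBINT xi. g n xi * fourier_L1 phi xi) = (LBINT xi. fourier_L1 (g n) xi * phi xi)" for n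
      by (rule fourier_L1_multiplication[OF ig schwartz_integrable[OF phi]])
    ultimately show "(LBINT xi. F xi * phi xi) = (LBINT x. f x * fourier_L1 phi x)"
      by (simp add: LIMSEQ_unique)
  qed
  moreover have "l2norm F = cG * l2norm f"
  proof -
    have "(\<lambda>n. norm (abs_l2 (fourier_L1 (g n)))) \<longlonglongrightarrow> norm L" by (rule tendsto_norm[OF L])
    moreover have "(\<lambda>n. cG * norm (abs_l2 (g n))) \<longlonglongrightarrow> cG * norm (abs_l2 f)" by (intro tendsto_intros lg)
    moreover have "norm (abs_l2 (fourier_L1 (g n))) = cG * norm (abs_l2 (g n))" for n
      using plancherel_CBI[OF g(1)[of n]] sg by (simp add: norm_abs_l2_eq)
    ultimately have "norm L = cG * norm (abs_l2 f)" by (simp add: LIMSEQ_unique)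
    then show ?thesis using f F by (metis norm_abs_l2_eq)
  qed
  ultimately show ?thesis using that F(1) by blast
qed

section \<open>Fourier transforms of tempered functions\<close>

lemma add_power_le: "0 \<le> (a::real) \<Longrightarrow> 0 \<le> b \<Longrightarrow> (a + b) ^ n \<le> 2 ^ n * (a ^ n + b ^ n)"
proof -
  assume ab: "0 \<le> a" "0 \<le> b"
  have "(a + b) ^ n \<le> (2 * max a b) ^ n" using ab by (intro power_mono) auto
  also have "\<dots> = 2 ^ n * (max a b) ^ n" by (simp add: power_mult_distrib)
  also have "\<dots> \<le> 2 ^ n * (a ^ n + b ^ n)" using ab by (intro mult_left_mono) (auto simp: max_def)
  finally show ?thesis .
qed

text \<open>Covers translations (\<open>c = 1\<close>) and the reflection (\<open>c = - 1\<close>,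
  \<open>a = 0\<close>).\<close>

lemma schwartz_affine:
  fixes phi :: "real^3 \<Rightarrow> 'b::real_normed_vector"
  assumes "schwartz phi" and c: "\<bar>c\<bar> = 1"
  shows "schwartz (\<lambda>x. phi (a + c *\<^sub>R x))"
proof (rule schwartz_coinduct[where P="\<lambda>f. \<exists>phi. schwartz phi \<and> f = (\<lambda>x. phi (a + c *\<^sub>R x))"])
  fix f :: "real^3 \<Rightarrow> 'b"
  assume "\<exists>phi. schwartz phi \<and> f = (\<lambda>x. phi (a + c *\<^sub>R x))"
  then obtain phi where s: "schwartz phi" "f = (\<lambda>x. phi (a + c *\<^sub>R x))" by auto
  have D: "(f has_derivative (\<lambda>h. frechet_derivative phi (at (a + c *\<^sub>R x)) (c *\<^sub>R h))) (at x)" for x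
    unfolding s(2)
    by (rule has_derivative_compose[OF _ s(1)[THEN schwartz_differentiable, unfolded frechet_derivative_works]])
      (auto intro!: derivative_eq_intros)
  show "f differentiable_on UNIV" using D by (auto simp: differentiable_on_def differentiable_def)
  show "\<exists>phi. schwartz phi \<and> partial i f = (\<lambda>x. phi (a + c *\<^sub>R x))" for i
  proof -
    have "partial i f = (\<lambda>x. c *\<^sub>R partial i phi (a + c *\<^sub>R x))"
      by (rule ext, subst partial_eqI[OF D])
        (simp add: partial_def linear_scale[OF has_derivative_linear[OF s(1)[THEN schwartz_differentiable, unfolded frechet_derivative_works]]])
    then show ?thesis
      using schwartz_linear[OF bounded_linear_scaleR_right schwartz_partial[OF s(1), of i], of c]
      by (intro exI[of _ "\<lambda>x. c *\<^sub>R partial i phi x"]) simp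
  qed
  fix n
  obtain C where C: "\<And>x. norm x ^ n * norm (phi x) \<le> C" using schwartz_bound[OF s(1)] by metis
  obtain C0 where C0: "\<And>x. norm x ^ 0 * norm (phi x) \<le> C0" using schwartz_bound[OF s(1)] by metis
  have "norm (norm x ^ n *\<^sub>R f x) \<le> 2 ^ n * (C + norm a ^ n * C0)" for x
  proof -
    let ?y = "a + c *\<^sub>R x"
    have "norm x = norm (c *\<^sub>R x)" using c by simp
    also have "\<dots> \<le> norm ?y + norm a" using norm_triangle_ineq4[of ?y a] by simp
    finally have "norm x ^ n \<le> (norm ?y + norm a) ^ n" by (intro power_mono) auto
    also have "\<dots> \<le> 2 ^ n * (norm ?y ^ n + norm a ^ n)" by (intro add_power_le) auto
    finally have "norm x ^ n * norm (phi ?y) \<le> 2 ^ n * (norm ?y ^ n + norm a ^ n) * norm (phi ?y)"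
      by (rule mult_right_mono) auto
    also have "\<dots> = 2 ^ n * (norm ?y ^ n * norm (phi ?y) + norm a ^ n * (norm ?y ^ 0 * norm (phi ?y)))" by (simp add: algebra_simps)
    also have "\<dots> \<le> 2 ^ n * (C + norm a ^ n * C0)"
      by (intro mult_left_mono add_mono C C0) auto
    finally show ?thesis by (simp add: s(2))
  qed
  then show "bounded (range (\<lambda>x. norm x ^ n *\<^sub>R f x))" by (auto simp: bounded_iff)
qed (use assms in auto)

section \<open>Uniqueness and linearity of tempered transforms\<close>

lemma has_fourierD:
  assumes "has_fourier f F" "schwartz phi"
  shows "integrable lborel (\<lambda>xi. F xi * phi xi)" "integrable lborel (\<lambda>x. f x * fourier_L1 phi x)"
    "(LBINT xi. F xi * phi xi) = (LBINT x. f x * fourier_L1 phi x)"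
  using assms unfolding has_fourier_def by auto

lemma schwartz_gauss: "schwartz (\<lambda>x. cor (gauss x))"
  using schwartz_gauss_cexp[of 0] by simp

lemma fourier_L1_shift:
  assumes [measurable]: "phi \<in> borel_measurable borel"
  shows "fourier_L1 (\<lambda>x. phi (x - a)) y = cexp (y \<bullet> a) * fourier_L1 phi y"
proof -
  have "fourier_L1 (\<lambda>x. phi (x - a)) y = (LBINT x. (\<lambda>x. phi (x - a) * cexp (y \<bullet> x)) (a + x))"
    unfolding fourier_L1_def by (rule lborel_translate[symmetric]) measurable
  also have "\<dots> = (LBINT x. cexp (y \<bullet> a) * (phi x * cexp (y \<bullet> x)))"
    by (intro Bochner_Integration.integral_cong refl) (simp only: inner_add_right cexp_add add_diff_cancel_left' mult_ac)
  finally show ?thesis by (simp add: fourier_L1_def)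
qed

text \<open>The relation only provides integrability of products with test functions. A Gaussian and
  its transform vanish nowhere, so dividing by them recovers the functions themselves.\<close>

lemma has_fourier_measurable:
  assumes "has_fourier f F"
  shows "F \<in> borel_measurable borel" "f \<in> borel_measurable borel"
proof -
  have nz: "cor (gauss x) \<noteq> 0" for x using gauss_pos[of x] by simp
  have [measurable]: "(\<lambda>xi. F xi * cor (gauss xi)) \<in> borel_measurable borel"
    using has_fourierD(1)[OF assms schwartz_gauss] by auto
  have "(\<lambda>xi. F xi * cor (gauss xi) / cor (gauss xi)) \<in> borel_measurable borel" by measurable
  then show "F \<in> borel_measurable borel" using nz by simp
  have [measurable]: "(\<lambda>xi. f xi * cor (cG * gauss xi)) \<in> borel_measurable borel"
    using has_fourierD(2)[OF assms schwartz_gauss] unfolding fourier_gauss by auto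
  have "(\<lambda>xi. f xi * cor (cG * gauss xi) / cor (cG * gauss xi)) \<in> borel_measurable borel" by measurable
  then show "f \<in> borel_measurable borel" using nz cG_pos by simp
qed

text \<open>Testing with modulated Gaussians shows that the integrable function (F - G) times a
  Gaussian has zero transform.\<close>

lemma has_fourier_unique:
  assumes "has_fourier f F" "has_fourier f G"
  shows "AE xi in lborel. F xi = G xi"
proof -
  define h where "h xi = F xi * cor (gauss xi) - G xi * cor (gauss xi)" for xi
  have "AE xi in lborel. h xi = 0"
  proof (rule fourier_L1_inj)
    show "integrable lborel h" unfolding h_def
      by (intro Bochner_Integration.integrable_diff has_fourierD(1)[OF assms(1) schwartz_gauss] has_fourierD(1)[OF assms(2) schwartz_gauss])
    show "fourier_L1 h y = 0" for y
    proof -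
      note s = schwartz_gauss_cexp[of y]
      have "fourier_L1 h y = (LBINT xi. F xi * (cor (gauss xi) * cexp (y \<bullet> xi)) - G xi * (cor (gauss xi) * cexp (y \<bullet> xi)))"
        unfolding fourier_L1_def h_def by (simp only: left_diff_distrib mult.assoc)
      also have "\<dots> = 0"
        using has_fourierD[OF assms(1) s] has_fourierD[OF assms(2) s] by simp
      finally show ?thesis .
    qed
  qed
  then show ?thesis by eventually_elim (use gauss_pos in \<open>auto simp: h_def left_diff_distrib[symmetric] less_le\<close>)
qed

text \<open>The dual choice of test functions: the transform of a translated Gaussian is a modulated
  Gaussian, which now stands next to f and g.\<close>

lemma has_fourier_inj:
  assumes "has_fourier f F" "has_fourier g F"
  shows "AE xi in lborel. f xi = g xi"
proof -
  have s: "schwartz (\<lambda>x. cor (gauss (x - y)))" for y by (rule schwartz_gauss_shift)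
  have fs: "fourier_L1 (\<lambda>x. cor (gauss (x - y))) x = cexp (y \<bullet> x) * cor (cG * gauss x)" for x y
    using fourier_L1_shift[of "\<lambda>x. cor (gauss x)" y x] by (simp only: fourier_gauss inner_commute) simp
  define h where "h x = f x * cor (cG * gauss x) - g x * cor (cG * gauss x)" for x
  have "AE xi in lborel. h xi = 0"
  proof (rule fourier_L1_inj)
    show "integrable lborel h" unfolding h_def fourier_gauss[symmetric]
      by (intro Bochner_Integration.integrable_diff has_fourierD(2)[OF assms(1) schwartz_gauss] has_fourierD(2)[OF assms(2) schwartz_gauss])
    show "fourier_L1 h y = 0" for y
    proof -
      have "fourier_L1 h y = (LBINT x. f x * (cexp (y \<bullet> x) * cor (cG * gauss x)) - g x * (cexp (y \<bullet> x) * cor (cG * gauss x)))"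
        unfolding fourier_L1_def h_def by (simp only: left_diff_distrib right_diff_distrib mult_ac)
      also have "\<dots> = 0"
        using has_fourierD[OF assms(1) s[of y]] has_fourierD[OF assms(2) s[of y]] unfolding fs by simp
      finally show ?thesis .
    qed
  qed
  then show ?thesis by eventually_elim (use gauss_pos cG_pos in \<open>auto simp: h_def left_diff_distrib[symmetric] less_le\<close>)
qed

lemma has_fourier_cong:
  assumes "has_fourier f F" and f: "AE x in lborel. f x = f' x" and F: "AE x in lborel. F x = F' x"
    and [measurable]: "f' \<in> borel_measurable borel" "F' \<in> borel_measurable borel"
  shows "has_fourier f' F'"
  unfolding has_fourier_def
proof (intro allI impI)
  fix phi :: "real^3 \<Rightarrow> complex" assume phi: "schwartz phi"
  note h = has_fourierD[OF assms(1) phi]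
  have [measurable]: "f \<in> borel_measurable borel" "F \<in> borel_measurable borel" "phi \<in> borel_measurable borel" "fourier_L1 phi \<in> borel_measurable borel"
    using has_fourier_measurable[OF assms(1)] schwartz_measurable phi schwartz_fourier_L1[OF phi] by auto
  have a: "AE x in lborel. F x * phi x = F' x * phi x" using F by eventually_elim simp
  have b: "AE x in lborel. f x * fourier_L1 phi x = f' x * fourier_L1 phi x" using f by eventually_elim simp
  have "integrable lborel (\<lambda>xi. F' xi * phi xi)" using h(1) integrable_cong_AE[OF _ _ a] by simp
  moreover have "integrable lborel (\<lambda>x. f' x * fourier_L1 phi x)" using h(2) integrable_cong_AE[OF _ _ b] by simp
  moreover have "(LBINT xi. F' xi * phi xi) = (LBINT x. f' x * fourier_L1 phi x)"
    using h(3) integral_cong_AE[OF _ _ a] integral_cong_AE[OF _ _ b] by simp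
  ultimately show "integrable lborel (\<lambda>xi. F' xi * phi xi) \<and> integrable lborel (\<lambda>x. f' x * fourier_L1 phi x) \<and>
     (LBINT xi. F' xi * phi xi) = (LBINT x. f' x * fourier_L1 phi x)" by blast
qed

lemma has_fourier_add:
  assumes "has_fourier f F" "has_fourier g G"
  shows "has_fourier (\<lambda>x. f x + g x) (\<lambda>xi. F xi + G xi)"
  using assms unfolding has_fourier_def by (auto simp: distrib_right)

lemma has_fourier_cmult:
  assumes "has_fourier f F"
  shows "has_fourier (\<lambda>x. c * f x) (\<lambda>xi. c * F xi)"
  using assms unfolding has_fourier_def by (auto simp: mult.assoc)

lemma has_fourier_0: "has_fourier (\<lambda>x. 0) (\<lambda>xi. 0)"
  by (simp add: has_fourier_def)

lemma has_fourier_sum: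
  assumes "\<And>i. i \<in> I \<Longrightarrow> has_fourier (f i) (F i)"
  shows "has_fourier (\<lambda>x. \<Sum>i\<in>I. f i x) (\<lambda>xi. \<Sum>i\<in>I. F i xi)"
  using assms by (induction I rule: infinite_finite_induct) (auto simp: has_fourier_0 has_fourier_add)

lemma has_fourier_l2:
  assumes f: "square_integrable f" and F: "has_fourier f F"
  shows "square_integrable F" "l2norm F = cG * l2norm f"
proof -
  obtain G where G: "square_integrable G" "has_fourier f G" "l2norm G = cG * l2norm f"
    using plancherel[OF f] .
  have [measurable]: "F \<in> borel_measurable borel" "G \<in> borel_measurable borel"
    using has_fourier_measurable F G(2) by auto
  have eq: "AE x in lborel. F x = G x" by (rule has_fourier_unique[OF F G(2)])
  then have n: "AE x in lborel. norm (F x) = norm (G x)" by eventually_elim simp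
  then have le: "AE x in lborel. norm (F x) \<le> norm (G x)" by eventually_elim simp
  show "square_integrable F" by (rule square_integrable_bound(1)[OF G(1) _ le]) simp
  show "l2norm F = cG * l2norm f" using l2norm_cong_AE[OF n] G(3) by simp
qed

section \<open>Parseval, inversion, convolution and real-valued functions\<close>

lemma square_integrable_cmult: "square_integrable f \<Longrightarrow> square_integrable (\<lambda>x. (c::complex) * f x)"
  by (auto simp: square_integrable_def norm_mult power_mult_distrib)

lemma square_integrable_cnj: "square_integrable f \<Longrightarrow> square_integrable (\<lambda>x. cnj (f x))"
  by (auto simp: square_integrable_def)

lemma complex_polarization:
  "cor ((norm (z + 1 * w))\<^sup>2) - cor ((norm (z + (-1) * w))\<^sup>2)
    + \<i> * cor ((norm (z + \<i> * w))\<^sup>2) - \<i> * cor ((norm (z + (-\<i>) * w))\<^sup>2) = 4 * (z * cnj w)"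
  unfolding complex_norm_square by (simp add: algebra_simps)

lemma l2_polarization:
  assumes f: "square_integrable f" and g: "square_integrable g"
  shows "4 * (LBINT x. f x * cnj (g x)) = cor ((l2norm (\<lambda>x. f x + 1 * g x))\<^sup>2) - cor ((l2norm (\<lambda>x. f x + (-1) * g x))\<^sup>2)
    + \<i> * cor ((l2norm (\<lambda>x. f x + \<i> * g x))\<^sup>2) - \<i> * cor ((l2norm (\<lambda>x. f x + (-\<i>) * g x))\<^sup>2)"
proof -
  have i: "integrable lborel (\<lambda>x. cor ((norm (f x + c * g x))\<^sup>2))" for c
    using square_integrableD(2)[OF square_integrable_add[OF f square_integrable_cmult[OF g, of c]]]
    by (intro integrable_of_real)
  have l: "cor ((l2norm (\<lambda>x. f x + c * g x))\<^sup>2) = (LBINT x. cor ((norm (f x + c * g x))\<^sup>2))" for c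
    unfolding l2norm_power2 by (rule integral_complex_of_real[symmetric])
  show ?thesis
    unfolding l
    by (subst integral_mult_right_zero[symmetric], subst complex_polarization[symmetric],
      subst Bochner_Integration.integral_diff, intro Bochner_Integration.integrable_add Bochner_Integration.integrable_diff integrable_mult_right i,
      intro integrable_mult_right i,
      subst Bochner_Integration.integral_add, intro Bochner_Integration.integrable_diff i, intro integrable_mult_right i,
      subst Bochner_Integration.integral_diff[OF i i], simp only: integral_mult_right_zero)
qed

text \<open>Polarization of the norm identity, applied to f + c g for c = 1, -1, i, -i.\<close>

lemma parseval:
  assumes f: "square_integrable f" "has_fourier f F" and g: "square_integrable g" "has_fourier g G"
  shows "(LBINT xi. F xi * cnj (G xi)) = cG\<^sup>2 * (LBINT x. f x * cnj (g x))"
proof -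
  have n: "l2norm (\<lambda>xi. F xi + c * G xi) = cG * l2norm (\<lambda>x. f x + c * g x)" for c
    by (rule has_fourier_l2(2)) (intro square_integrable_add square_integrable_cmult f g has_fourier_add has_fourier_cmult)+
  have F: "square_integrable F" and G: "square_integrable G"
    using has_fourier_l2(1) f g by auto
  have "4 * (LBINT xi. F xi * cnj (G xi)) = 4 * (cor (cG\<^sup>2) * (LBINT x. f x * cnj (g x)))"
    unfolding l2_polarization[OF F G] mult.left_commute[of 4] l2_polarization[OF f(1) g(1)] n power_mult_distrib
    by (simp add: algebra_simps)
  then show ?thesis by simp
qed

lemma fourier_L1_cnj: "fourier_L1 (\<lambda>x. cnj (phi x)) y = cnj (fourier_L1 phi (- y))"
  unfolding fourier_L1_def Bochner_Integration.integral_cnj[symmetric]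
  by (simp only: complex_cnj_mult cnj_cexp inner_minus_left minus_minus)

lemma schwartz_cnj: "schwartz phi \<Longrightarrow> schwartz (\<lambda>x. cnj (phi x))"
  by (rule schwartz_linear[OF bounded_linear_cnj])

text \<open>Fourier inversion: up to the factor \<open>cG\<^sup>2\<close> the transform applied
  twice is the reflection. Parseval's identity against the conjugate of the test function verifies
  the defining pairing.\<close>

lemma has_fourier_inverse:
  assumes F: "square_integrable F" "has_fourier F k"
  shows "square_integrable (\<lambda>x. k (- x) / cor (cG\<^sup>2))" "has_fourier (\<lambda>x. k (- x) / cor (cG\<^sup>2)) F"
proof -
  note k = has_fourier_l2(1)[OF F] F(2)
  have [measurable]: "k \<in> borel_measurable borel" using square_integrableD[OF k(1)] by auto
  define f where "f x = k (- x) / cor (cG\<^sup>2)" for x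
  have sk: "square_integrable (\<lambda>x. k (- x))"
    using lborel_reflect_integrable[OF square_integrableD(2)[OF k(1)]] by (auto simp: square_integrable_def)
  have sf: "square_integrable f"
    using square_integrable_cmult[OF sk, of "1 / cor (cG\<^sup>2)"] unfolding f_def by simp
  then show "square_integrable (\<lambda>x. k (- x) / cor (cG\<^sup>2))" unfolding f_def .
  have "has_fourier f F"
    unfolding has_fourier_def
  proof (intro allI impI conjI)
    fix phi :: "real^3 \<Rightarrow> complex" assume phi: "schwartz phi"
    have s: "square_integrable phi" "square_integrable (fourier_L1 phi)"
      using phi by (auto intro: schwartz_square_integrable schwartz_fourier_L1)
    have [measurable]: "fourier_L1 phi \<in> borel_measurable borel" using square_integrableD(1)[OF s(2)] .
    show "integrable lborel (\<lambda>xi. F xi * phi xi)" by (rule l2_mult(1)[OF F(1) s(1)])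
    show "integrable lborel (\<lambda>x. f x * fourier_L1 phi x)" by (rule l2_mult(1)[OF sf s(2)])
    note c = schwartz_cnj[OF phi]
    have "(LBINT x. f x * fourier_L1 phi x) = (LBINT x. k (- x) * fourier_L1 phi x) / cor (cG\<^sup>2)"
      unfolding f_def by (simp only: times_divide_eq_left integral_divide_zero)
    also have "(LBINT x. k (- x) * fourier_L1 phi x) = (LBINT x. (\<lambda>x. k x * fourier_L1 phi (- x)) (- x))" by simp
    also have "\<dots> = (LBINT x. k x * fourier_L1 phi (- x))" by (rule lborel_reflect) measurable
    also have "\<dots> = (LBINT x. k x * cnj (fourier_L1 (\<lambda>x. cnj (phi x)) x))"
      unfolding fourier_L1_cnj by simp
    also have "\<dots> = cG\<^sup>2 * (LBINT x. F x * cnj (cnj (phi x)))"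
      by (rule parseval[OF F(1) k(2) schwartz_square_integrable[OF c] has_fourier_L1[OF schwartz_integrable[OF c]]])
    finally show "(LBINT xi. F xi * phi xi) = (LBINT x. f x * fourier_L1 phi x)"
      using cG_pos by simp
  qed
  then show "has_fourier (\<lambda>x. k (- x) / cor (cG\<^sup>2)) F" unfolding f_def .
qed

lemma has_fourier_surj:
  assumes "square_integrable F"
  obtains f where "square_integrable f" "has_fourier f F"
  using has_fourier_inverse[OF assms] plancherel[OF assms] by metis

lemma has_fourier_cnj:
  assumes h: "has_fourier f F"
  shows "has_fourier (\<lambda>x. cnj (f x)) (\<lambda>xi. cnj (F (- xi)))"
  unfolding has_fourier_def
proof (intro allI impI conjI)
  fix phi :: "real^3 \<Rightarrow> complex" assume phi: "schwartz phi"
  define \<psi> where "\<psi> xi = cnj (phi (- xi))" for xi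
  have \<psi>: "schwartz \<psi>"
    unfolding \<psi>_def using schwartz_cnj[OF schwartz_affine[OF phi, of "-1" 0]] by simp
  have [measurable]: "\<psi> \<in> borel_measurable borel" "phi \<in> borel_measurable borel" "F \<in> borel_measurable borel" "f \<in> borel_measurable borel"
    using schwartz_measurable[OF \<psi>] schwartz_measurable[OF phi] has_fourier_measurable[OF h] by auto
  have "fourier_L1 \<psi> x = cnj (fourier_L1 phi x)" for x
  proof -
    have "fourier_L1 \<psi> x = (LBINT y. (\<lambda>y. cnj (phi y * cexp (x \<bullet> y))) (- y))"
      unfolding fourier_L1_def \<psi>_def by (simp only: complex_cnj_mult cnj_cexp inner_minus_right minus_minus)
    also have "\<dots> = (LBINT y. cnj (phi y * cexp (x \<bullet> y)))" by (rule lborel_reflect) measurable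
    finally show ?thesis by (simp only: fourier_L1_def Bochner_Integration.integral_cnj)
  qed
  note e = this
  note h = has_fourierD[OF h \<psi>, unfolded e]
  have 1: "integrable lborel (\<lambda>xi. cnj (F xi * \<psi> xi))" by (intro integrable_cnj h)
  from lborel_reflect_integrable[OF 1]
  show "integrable lborel (\<lambda>xi. cnj (F (- xi)) * phi xi)" by (simp add: \<psi>_def)
  have "integrable lborel (\<lambda>x. cnj (f x * cnj (fourier_L1 phi x)))" by (intro integrable_cnj h)
  then show "integrable lborel (\<lambda>x. cnj (f x) * fourier_L1 phi x)" by simp
  have "(LBINT xi. cnj (F (- xi)) * phi xi) = (LBINT xi. (\<lambda>xi. cnj (F xi * \<psi> xi)) (- xi))" by (simp add: \<psi>_def)
  also have "\<dots> = (LBINT xi. cnj (F xi * \<psi> xi))" by (rule lborel_reflect) measurable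
  also have "\<dots> = cnj (LBINT x. f x * cnj (fourier_L1 phi x))" by (simp only: Bochner_Integration.integral_cnj h)
  also have "\<dots> = (LBINT x. cnj (f x) * fourier_L1 phi x)"
    unfolding Bochner_Integration.integral_cnj[symmetric] by simp
  finally show "(LBINT xi. cnj (F (- xi)) * phi xi) = (LBINT x. cnj (f x) * fourier_L1 phi x)" .
qed

lemma has_fourier_modulate:
  assumes h: "has_fourier f F"
  shows "has_fourier (\<lambda>x. f x * cexp (a \<bullet> x)) (\<lambda>xi. F (xi + a))"
  unfolding has_fourier_def
proof (intro allI impI conjI)
  fix phi :: "real^3 \<Rightarrow> complex" assume phi: "schwartz phi"
  have \<psi>: "schwartz (\<lambda>xi. phi (xi - a))"
    using schwartz_affine[OF phi, of 1 "- a"] by simp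
  have [measurable]: "phi \<in> borel_measurable borel" "F \<in> borel_measurable borel" "f \<in> borel_measurable borel"
    using schwartz_measurable[OF phi] has_fourier_measurable[OF h] by auto
  have e: "fourier_L1 (\<lambda>xi. phi (xi - a)) x = cexp (a \<bullet> x) * fourier_L1 phi x" for x
    by (subst fourier_L1_shift) (simp_all add: inner_commute)
  note h = has_fourierD[OF h \<psi>, unfolded e]
  have "integrable lborel (\<lambda>xi. (\<lambda>xi. F xi * phi (xi - a)) (a + xi))"
    by (subst lborel_translate_integrable) (use h in auto)
  then show "integrable lborel (\<lambda>xi. F (xi + a) * phi xi)" by (simp add: add.commute)
  show "integrable lborel (\<lambda>x. f x * cexp (a \<bullet> x) * fourier_L1 phi x)" using h(2) by (simp add: mult.assoc)
  have "(LBINT xi. F (xi + a) * phi xi) = (LBINT xi. (\<lambda>xi. F xi * phi (xi - a)) (a + xi))" by (simp add: add.commute)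
  also have "\<dots> = (LBINT xi. F xi * phi (xi - a))" by (rule lborel_translate) measurable
  finally show "(LBINT xi. F (xi + a) * phi xi) = (LBINT x. f x * cexp (a \<bullet> x) * fourier_L1 phi x)"
    using h(3) by (simp add: mult.assoc)
qed

lemma square_integrable_modulate: "square_integrable f \<Longrightarrow> square_integrable (\<lambda>x. f x * cexp (a \<bullet> x))"
  by (auto simp: square_integrable_def norm_mult)

text \<open>Parseval's identity for \<open>f\<close> times exp (- i xi . x) and the conjugate of
  \<open>g\<close>. The arguments \<open>eta + xi\<close> and \<open>- eta\<close> add up to
  \<open>xi\<close>, which is what later allows weights and derivatives to be shared between the
  factors.\<close>

theorem fourier_L1_convolution:
  assumes f: "square_integrable f" "has_fourier f F" and g: "square_integrable g" "has_fourier g G"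
  shows "cor (cG\<^sup>2) * fourier_L1 (\<lambda>x. f x * g x) xi = (LBINT eta. F (eta + xi) * G (- eta))"
proof -
  have "(LBINT eta. F (eta + xi) * cnj (cnj (G (- eta)))) = cG\<^sup>2 * (LBINT x. f x * cexp (xi \<bullet> x) * cnj (cnj (g x)))"
    by (rule parseval) (intro square_integrable_modulate square_integrable_cnj has_fourier_modulate has_fourier_cnj f g)+
  then show ?thesis unfolding fourier_L1_def by (simp add: mult_ac)
qed

lemma real_fourier_hermitian:
  assumes "has_fourier (\<lambda>x. cor (f x)) F"
  shows "AE xi in lborel. F (- xi) = cnj (F xi)"
proof -
  have "AE xi in lborel. F xi = cnj (F (- xi))"
    using has_fourier_unique[OF assms has_fourier_cnj[OF assms, simplified]] .
  then show ?thesis by eventually_elim (metis complex_cnj_cnj)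
qed

text \<open>By the symmetry of \<open>F\<close> the conjugate of \<open>f\<close> has the same
  transform as \<open>f\<close>, so \<open>f\<close> is real almost everywhere.\<close>

lemma has_fourier_real_part:
  assumes f: "has_fourier f F" and herm: "AE xi in lborel. F (- xi) = cnj (F xi)"
  shows "has_fourier (\<lambda>x. cor (Re (f x))) F"
proof -
  have [measurable]: "f \<in> borel_measurable borel" "F \<in> borel_measurable borel" using has_fourier_measurable[OF f] by auto
  have "has_fourier (\<lambda>x. cnj (f x)) F"
  proof (rule has_fourier_cong[OF has_fourier_cnj[OF f]])
    show "AE xi in lborel. cnj (F (- xi)) = F xi" using herm by eventually_elim simp
  qed auto
  then have "AE x in lborel. f x = cnj (f x)" by (rule has_fourier_inj[OF f])
  then have "AE x in lborel. f x = cor (Re (f x))"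
    by eventually_elim (metis Reals_cnj_iff of_real_Re)
  then show ?thesis
    by (intro has_fourier_cong[OF f]) auto
qed

lemma hermitian_fourier_surj:
  assumes F: "square_integrable F" and herm: "AE xi in lborel. F (- xi) = cnj (F xi)"
  obtains f :: "real^3 \<Rightarrow> real" where "square_integrable f" "has_fourier (\<lambda>x. cor (f x)) F"
proof -
  obtain f where f: "square_integrable f" "has_fourier f F" using has_fourier_surj[OF F] .
  have [measurable]: "f \<in> borel_measurable borel" using has_fourier_measurable[OF f(2)] by auto
  have "square_integrable (\<lambda>x. Re (f x))"
    by (rule square_integrable_bound(1)[OF f(1)]) (auto simp: abs_Re_le_cmod)
  then show ?thesis using that has_fourier_real_part[OF f(2) herm] by blast
qed

section \<open>Fourier multipliers on square integrable matrix fields\<close>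

lemma vec_borel_measurable_iff:
  fixes f :: "'a \<Rightarrow> ('b::euclidean_space)^'n"
  shows "f \<in> borel_measurable M \<longleftrightarrow> (\<forall>i. (\<lambda>x. f x $ i) \<in> borel_measurable M)"
proof
  assume f: "f \<in> borel_measurable M"
  have c: "(\<lambda>v::'b^'n. v $ i) \<in> borel_measurable borel" for i
    by (intro borel_measurable_continuous_onI continuous_intros)
  show "\<forall>i. (\<lambda>x. f x $ i) \<in> borel_measurable M"
    using measurable_compose[OF f c] by simp
next
  assume "\<forall>i. (\<lambda>x. f x $ i) \<in> borel_measurable M"
  then have [measurable]: "(\<lambda>x. f x $ i) \<in> borel_measurable M" for i by blast
  show "f \<in> borel_measurable M"
    by (subst borel_measurable_euclidean_space) (auto simp: Basis_vec_def inner_axis)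
qed

lemma norm_vec_power2: "(norm (A::('b::real_normed_vector)^'n))\<^sup>2 = (\<Sum>i\<in>UNIV. (norm (A $ i))\<^sup>2)"
  by (simp add: norm_vec_def L2_set_def sum_nonneg)

lemma norm_le_sum_vec: "norm (A::('b::real_normed_vector)^'n) \<le> (\<Sum>i\<in>UNIV. norm (A $ i))"
  unfolding norm_vec_def by (rule L2_set_le_sum) auto

lemma norm_mat_le_sum: "norm (A::('b::real_normed_vector)^'n^'m) \<le> (\<Sum>i\<in>UNIV. \<Sum>j\<in>UNIV. norm (A $ i $ j))"
  by (rule order_trans[OF norm_le_sum_vec sum_mono[OF norm_le_sum_vec]])

lemma norm_entry_le: "norm ((A::('b::real_normed_vector)^'n^'m) $ i $ j) \<le> norm A"
  by (rule order_trans[OF Finite_Cartesian_Product.norm_nth_le Finite_Cartesian_Product.norm_nth_le])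

lemma square_integrable_vec_iff:
  fixes f :: "real^3 \<Rightarrow> ('b::euclidean_space)^'n"
  shows "square_integrable f \<longleftrightarrow> (\<forall>i. square_integrable (\<lambda>x. f x $ i))"
proof
  assume f: "square_integrable f"
  then show "\<forall>i. square_integrable (\<lambda>x. f x $ i)"
    using square_integrableD(1)[OF f]
    by (intro allI square_integrable_bound(1)[OF f]) (auto simp: vec_borel_measurable_iff Finite_Cartesian_Product.norm_nth_le)
next
  assume "\<forall>i. square_integrable (\<lambda>x. f x $ i)"
  then show "square_integrable f"
    by (auto simp: square_integrable_def vec_borel_measurable_iff norm_vec_power2)
qed

lemma l2norm_vec:
  fixes f :: "real^3 \<Rightarrow> ('b::euclidean_space)^'n"
  assumes "square_integrable f"
  shows "(l2norm f)\<^sup>2 = (\<Sum>i\<in>UNIV. (l2norm (\<lambda>x. f x $ i))\<^sup>2)"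
  using assms unfolding square_integrable_vec_iff
  by (auto simp: l2norm_power2 norm_vec_power2 square_integrable_def)

lemma square_integrable_of_real: "square_integrable (\<lambda>x. cor (f x)) \<longleftrightarrow> square_integrable f"
  by (auto simp: square_integrable_def)
    (use measurable_compose[of "\<lambda>x. cor (f x)" borel borel Re borel] in auto)

lemma l2norm_of_real: "l2norm (\<lambda>x. cor (f x)) = l2norm f"
  by (simp add: l2norm_def)

lemma has_fourier_mat_unique:
  assumes "has_fourier_mat u U" "has_fourier_mat u V"
  shows "AE xi in lborel. U xi = V xi"
  using has_fourier_unique assms unfolding has_fourier_mat_def by (simp add: vec_eq_iff AE_all_countable) blast

lemma has_fourier_vec_inj:
  assumes "has_fourier_vec u U" "has_fourier_vec v U"
  shows "AE x in lborel. u x = v x"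
proof -
  have "AE x in lborel. cor (u x $ i) = cor (v x $ i)" for i
    using has_fourier_inj assms unfolding has_fourier_vec_def by blast
  then show ?thesis by (simp add: vec_eq_iff AE_all_countable)
qed

lemma has_fourier_mat_inj:
  assumes "has_fourier_mat u U" "has_fourier_mat v U"
  shows "AE x in lborel. u x = v x"
proof -
  have "AE x in lborel. cor (u x $ i $ j) = cor (v x $ i $ j)" for i j
    using has_fourier_inj assms unfolding has_fourier_mat_def by blast
  then show ?thesis by (simp add: vec_eq_iff AE_all_countable)
qed

lemma has_fourier_vec_measurable:
  assumes "has_fourier_vec u U"
  shows "U \<in> borel_measurable borel" "u \<in> borel_measurable borel"
proof -
  have m: "(\<lambda>xi. U xi $ i) \<in> borel_measurable borel" "(\<lambda>x. cor (u x $ i)) \<in> borel_measurable borel" for i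
    using assms has_fourier_measurable unfolding has_fourier_vec_def by blast+
  then show "U \<in> borel_measurable borel" by (simp add: vec_borel_measurable_iff)
  show "u \<in> borel_measurable borel"
    using measurable_compose[OF m(2), of Re borel] by (simp add: vec_borel_measurable_iff)
qed

lemma has_fourier_mat_measurable:
  assumes "has_fourier_mat u U"
  shows "U \<in> borel_measurable borel" "u \<in> borel_measurable borel"
proof -
  have m: "(\<lambda>xi. U xi $ i $ j) \<in> borel_measurable borel" "(\<lambda>x. cor (u x $ i $ j)) \<in> borel_measurable borel" for i j
    using assms has_fourier_measurable unfolding has_fourier_mat_def by blast+
  then show "U \<in> borel_measurable borel" by (simp add: vec_borel_measurable_iff)
  show "u \<in> borel_measurable borel"
    using measurable_compose[OF m(2), of Re borel] by (simp add: vec_borel_measurable_iff)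
qed

lemma has_fourier_vec_cong:
  assumes h: "has_fourier_vec f F" and f: "AE x in lborel. f x = f' x" and F: "AE x in lborel. F x = F' x"
    and m: "f' \<in> borel_measurable borel" "F' \<in> borel_measurable borel"
  shows "has_fourier_vec f' F'"
  unfolding has_fourier_vec_def
proof
  fix i
  have [measurable]: "(\<lambda>x. f' x $ i) \<in> borel_measurable borel" "(\<lambda>x. F' x $ i) \<in> borel_measurable borel"
    using m by (auto simp: vec_borel_measurable_iff)
  show "has_fourier (\<lambda>x. cor (f' x $ i)) (\<lambda>xi. F' xi $ i)"
  proof (rule has_fourier_cong)
    show "has_fourier (\<lambda>x. cor (f x $ i)) (\<lambda>xi. F xi $ i)" using h by (simp add: has_fourier_vec_def)
    show "AE x in lborel. cor (f x $ i) = cor (f' x $ i)" using f by eventually_elim simp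
    show "AE x in lborel. F x $ i = F' x $ i" using F by eventually_elim simp
  qed auto
qed

lemma has_fourier_mat_cong:
  assumes h: "has_fourier_mat f F" and f: "AE x in lborel. f x = f' x" and F: "AE x in lborel. F x = F' x"
    and m: "f' \<in> borel_measurable borel" "F' \<in> borel_measurable borel"
  shows "has_fourier_mat f' F'"
  unfolding has_fourier_mat_def
proof (intro allI)
  fix i j
  have [measurable]: "(\<lambda>x. f' x $ i $ j) \<in> borel_measurable borel" "(\<lambda>x. F' x $ i $ j) \<in> borel_measurable borel"
    using m by (auto simp: vec_borel_measurable_iff)
  show "has_fourier (\<lambda>x. cor (f' x $ i $ j)) (\<lambda>xi. F' xi $ i $ j)"
  proof (rule has_fourier_cong)
    show "has_fourier (\<lambda>x. cor (f x $ i $ j)) (\<lambda>xi. F xi $ i $ j)" using h by (simp add: has_fourier_mat_def)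
    show "AE x in lborel. cor (f x $ i $ j) = cor (f' x $ i $ j)" using f by eventually_elim simp
    show "AE x in lborel. F x $ i $ j = F' x $ i $ j" using F by eventually_elim simp
  qed auto
qed

definition cnj_mat :: "complex^3^3 \<Rightarrow> complex^3^3" where
  "cnj_mat A = (\<chi> i j. cnj (A $ i $ j))"

text \<open>The symmetry that singles out transforms of real fields; every symbol must preserve it
  for the result to be an element of \<open>matrix_l2\<close>.\<close>

definition hermitian_mat :: "(real^3 \<Rightarrow> complex^3^3) \<Rightarrow> bool" where
  "hermitian_mat N \<longleftrightarrow> (AE xi in lborel. N (- xi) = cnj_mat (N xi))"

lemma has_fourier_mat_hermitian:
  assumes "has_fourier_mat M N"
  shows "hermitian_mat N"
proof -
  have "AE xi in lborel. N (- xi) $ i $ j = cnj (N xi $ i $ j)" for i j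
    by (rule real_fourier_hermitian[OF assms[unfolded has_fourier_mat_def, rule_format]])
  then show ?thesis by (simp add: hermitian_mat_def cnj_mat_def vec_eq_iff AE_all_countable)
qed

lemma has_fourier_mat_ex:
  assumes "square_integrable M"
  shows "\<exists>N. has_fourier_mat M N"
proof -
  have "\<exists>F. has_fourier (\<lambda>x. cor (M x $ i $ j)) F" for i j
    using assms plancherel[of "\<lambda>x. cor (M x $ i $ j)"]
    unfolding square_integrable_of_real square_integrable_vec_iff by blast
  then obtain F where "\<And>i j. has_fourier (\<lambda>x. cor (M x $ i $ j)) (F i j)" by metis
  then show ?thesis by (intro exI[of _ "\<lambda>xi. \<chi> i j. F i j xi"]) (simp add: has_fourier_mat_def)
qed

lemma has_fourier_mat_l2:
  assumes M: "square_integrable M" and N: "has_fourier_mat M N"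
  shows "square_integrable N" "l2norm N = cG * l2norm M"
proof -
  have sM: "square_integrable (\<lambda>x. cor (M x $ i $ j))" for i j
    using M unfolding square_integrable_of_real square_integrable_vec_iff by blast
  note e = has_fourier_l2[OF sM N[unfolded has_fourier_mat_def, rule_format]]
  show sN: "square_integrable N" unfolding square_integrable_vec_iff using e(1) by blast
  have sNi: "square_integrable (\<lambda>x. N x $ i)" and sMi: "square_integrable (\<lambda>x. M x $ i)" for i
    using sN M unfolding square_integrable_vec_iff by blast+
  have "(l2norm N)\<^sup>2 = cG\<^sup>2 * (l2norm M)\<^sup>2"
    unfolding l2norm_vec[OF sN] l2norm_vec[OF M] l2norm_vec[OF sNi] l2norm_vec[OF sMi] e(2) l2norm_of_real
    by (simp add: power_mult_distrib sum_distrib_left)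
  then have "(l2norm N)\<^sup>2 = (cG * l2norm M)\<^sup>2" by (simp add: power_mult_distrib)
  then show "l2norm N = cG * l2norm M" using cG_pos by (simp add: power2_eq_iff_nonneg)
qed

lemma has_fourier_mat_fourier_mat:
  "has_fourier_mat M N \<Longrightarrow> has_fourier_mat M (fourier_mat M)"
  unfolding fourier_mat_def by (rule someI[of "has_fourier_mat M"])

text \<open>The transform underlying \<open>FM\<close> is chosen among functions that agree almost
  everywhere, so every identity between values of \<open>FM\<close> is an almost-everywhere
  statement.\<close>

definition FM :: "matrix_l2 \<Rightarrow> real^3 \<Rightarrow> complex^3^3" where
  "FM S = fourier_mat (rep_l2 S)"

lemma FM: "has_fourier_mat (rep_l2 S) (FM S)"
  unfolding FM_def using has_fourier_mat_ex[OF square_integrable_rep_l2] has_fourier_mat_fourier_mat by blast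

lemma square_integrable_FM: "square_integrable (FM S)"
  by (rule has_fourier_mat_l2[OF square_integrable_rep_l2 FM])

lemma l2norm_FM: "l2norm (FM S) = cG * norm S"
  using has_fourier_mat_l2(2)[OF square_integrable_rep_l2 FM, of S] by (simp add: l2norm_rep)

lemma FM_measurable[measurable]: "FM S \<in> borel_measurable borel"
  using has_fourier_mat_measurable[OF FM] by blast

lemma FM_hermitian: "hermitian_mat (FM S)"
  by (rule has_fourier_mat_hermitian[OF FM])

lemma rep_l2_eqI:
  assumes "AE x in lborel. rep_l2 S x = rep_l2 T x"
  shows "S = T"
proof -
  have "abs_l2 (rep_l2 S) = abs_l2 (rep_l2 T)"
    using Quotient3_rel_abs[OF Quotient3_l2, of "rep_l2 S" "rep_l2 T"] assms
    by (simp add: l2_rel_def square_integrable_rep_l2)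
  then show ?thesis by (simp add: abs_rep_l2)
qed

lemma FM_eqI:
  assumes "AE xi in lborel. FM S xi = FM T xi"
  shows "S = T"
proof (rule rep_l2_eqI, rule has_fourier_mat_inj[OF FM])
  have "AE xi in lborel. FM T xi = FM S xi" using assms by eventually_elim simp
  then show "has_fourier_mat (rep_l2 T) (FM S)"
    using has_fourier_mat_measurable[OF FM] by (intro has_fourier_mat_cong[OF FM]) auto
qed

lemma has_fourier_mat_FM:
  assumes "has_fourier_mat (rep_l2 S) N"
  shows "AE xi in lborel. FM S xi = N xi"
  by (rule has_fourier_mat_unique[OF FM assms])

lemma mat_fourier_surj:
  assumes N: "square_integrable N" and herm: "hermitian_mat N"
  obtains S :: matrix_l2 where "has_fourier_mat (rep_l2 S) N"
proof -
  have "\<exists>f. square_integrable f \<and> has_fourier (\<lambda>x. cor (f x)) (\<lambda>xi. N xi $ i $ j)" for i j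
  proof -
    have "square_integrable (\<lambda>xi. N xi $ i $ j)" using N unfolding square_integrable_vec_iff by blast
    moreover have "AE xi in lborel. N (- xi) $ i $ j = cnj (N xi $ i $ j)"
      using herm unfolding hermitian_mat_def by eventually_elim (simp add: cnj_mat_def)
    ultimately show ?thesis using hermitian_fourier_surj[of "\<lambda>xi. N xi $ i $ j"] by blast
  qed
  then obtain f where f: "\<And>i j. square_integrable (f i j)" "\<And>i j. has_fourier (\<lambda>x. cor (f i j x)) (\<lambda>xi. N xi $ i $ j)"
    by metis
  define M where "M x = (\<chi> i j. f i j x)" for x
  have M: "square_integrable M" unfolding square_integrable_vec_iff using f(1) by (simp add: M_def)
  have h: "has_fourier_mat M N" using f(2) by (simp add: has_fourier_mat_def M_def)
  have "has_fourier_mat (rep_l2 (abs_l2 M)) N"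
    by (rule has_fourier_mat_cong[OF h])
      (use rep_abs_l2[OF M] square_integrableD(1)[OF square_integrable_rep_l2] has_fourier_mat_measurable[OF h] in \<open>auto elim: AE_mp\<close>)
  then show ?thesis by (rule that)
qed

text \<open>These two conditions make the description in \<open>multiplier\<close> meaningful:
  square integrability and symmetry give a real field with this transform, and injectivity makes it
  the only one.\<close>

lemma multiplier_fourier:
  assumes N: "square_integrable (\<lambda>xi. \<sigma> xi (fourier_mat M xi))" and herm: "hermitian_mat (\<lambda>xi. \<sigma> xi (fourier_mat M xi))"
  shows "AE xi in lborel. FM (multiplier \<sigma> M) xi = \<sigma> xi (fourier_mat M xi)"
proof -
  let ?N = "\<lambda>xi. \<sigma> xi (fourier_mat M xi)"
  obtain S :: matrix_l2 where S: "has_fourier_mat (rep_l2 S) ?N" using mat_fourier_surj[OF N herm] .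
  have "has_fourier_mat (rep_l2 (multiplier \<sigma> M)) ?N"
    unfolding multiplier_def
  proof (rule theI[of _ S])
    fix T :: matrix_l2 assume "has_fourier_mat (rep_l2 T) ?N"
    then show "T = S" using has_fourier_mat_inj[OF _ S] rep_l2_eqI by blast
  qed (rule S)
  then show ?thesis by (rule has_fourier_mat_FM)
qed

section \<open>Linearity on the Fourier side, and scalar weights as operators\<close>

lemma FM_add: "AE xi in lborel. FM (S + T) xi = FM S xi + FM T xi"
proof (rule has_fourier_mat_FM)
  have eq: "AE x in lborel. rep_l2 S x + rep_l2 T x = rep_l2 (S + T) x"
    using rep_abs_l2[OF square_integrable_add[OF square_integrable_rep_l2[of S] square_integrable_rep_l2[of T]]]
      abs_l2_add[OF square_integrable_rep_l2[of S] square_integrable_rep_l2[of T]]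
    by (simp add: abs_rep_l2 eq_commute)
  have "has_fourier_mat (\<lambda>x. rep_l2 S x + rep_l2 T x) (\<lambda>xi. FM S xi + FM T xi)"
    using FM[of S] FM[of T] unfolding has_fourier_mat_def by (auto intro!: has_fourier_add)
  then show "has_fourier_mat (rep_l2 (S + T)) (\<lambda>xi. FM S xi + FM T xi)"
    by (rule has_fourier_mat_cong[OF _ eq]) (use square_integrableD(1)[OF square_integrable_rep_l2] in auto)
qed

lemma FM_scaleR: "AE xi in lborel. FM (c *\<^sub>R S) xi = c *\<^sub>R FM S xi"
proof (rule has_fourier_mat_FM)
  have "c *\<^sub>R abs_l2 (rep_l2 S) = abs_l2 (\<lambda>x. c *\<^sub>R rep_l2 S x)"
    by (simp add: scaleR_l2.abs_eq l2_rel_def square_integrable_rep_l2)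
  then have eq: "AE x in lborel. c *\<^sub>R rep_l2 S x = rep_l2 (c *\<^sub>R S) x"
    using rep_abs_l2[OF square_integrable_scaleR[OF square_integrable_rep_l2[of S], of c]]
    by (simp add: abs_rep_l2 eq_commute)
  have "has_fourier_mat (\<lambda>x. c *\<^sub>R rep_l2 S x) (\<lambda>xi. c *\<^sub>R FM S xi)"
    using has_fourier_cmult[OF FM[of S, unfolded has_fourier_mat_def, rule_format], of "cor c"]
    unfolding has_fourier_mat_def by (simp add: scaleR_conv_of_real[where 'a=complex])
  then show "has_fourier_mat (rep_l2 (c *\<^sub>R S)) (\<lambda>xi. c *\<^sub>R FM S xi)"
    by (rule has_fourier_mat_cong[OF _ eq]) (use square_integrableD(1)[OF square_integrable_rep_l2] in auto)
qed

lemma FM_diff: "AE xi in lborel. FM (S - T) xi = FM S xi - FM T xi"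
  using FM_add[of S "(-1) *\<^sub>R T"] FM_scaleR[of "-1" T] by eventually_elim simp

lemma FM_0: "AE xi in lborel. FM 0 xi = 0"
  using FM_scaleR[of 0 0] by simp

lemma inner_FM: "cG\<^sup>2 * (S \<bullet> T) = (LBINT xi. FM S xi \<bullet> FM T xi)"
proof -
  have a: "abs_l2 (FM S) + abs_l2 (FM T) = abs_l2 (FM (S + T))"
    unfolding abs_l2_add[OF square_integrable_FM square_integrable_FM]
    using FM_add[of S T] Quotient3_rel_abs[OF Quotient3_l2, of "\<lambda>x. FM S x + FM T x" "FM (S + T)"]
    by (simp add: l2_rel_def square_integrable_FM square_integrable_add eq_commute)
  have n: "norm (abs_l2 (FM S)) = cG * norm S" for S
    by (simp add: norm_abs_l2_eq square_integrable_FM l2norm_FM)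
  have "abs_l2 (FM S) \<bullet> abs_l2 (FM T) = cG\<^sup>2 * (S \<bullet> T)"
    unfolding dot_norm a n power_mult_distrib by (simp add: algebra_simps diff_divide_distrib)
  moreover have "abs_l2 (FM S) \<bullet> abs_l2 (FM T) = (LBINT xi. FM S xi \<bullet> FM T xi)"
    by (rule inner_l2.abs_eq) (auto simp: l2_rel_def square_integrable_FM)
  ultimately show ?thesis by simp
qed

text \<open>A real weight respects the Hermitian symmetry of transforms when it is even.\<close>

definition even_weight :: "(real^3 \<Rightarrow> real) \<Rightarrow> bool" where
  "even_weight m \<longleftrightarrow> m \<in> borel_measurable borel \<and> (\<forall>xi. m (- xi) = m xi)"

definition mul :: "(real^3 \<Rightarrow> real) \<Rightarrow> matrix_l2 \<Rightarrow> matrix_l2" where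
  "mul m S = multiplier (\<lambda>xi A. m xi *\<^sub>R A) (rep_l2 S)"

text \<open>Outside this domain the description behind \<open>mul\<close> has no witness, since
  transforms of elements of L^2 are square integrable. Hence the domain condition in the rules for
  \<open>mul\<close>.\<close>

definition mul_dom :: "(real^3 \<Rightarrow> real) \<Rightarrow> matrix_l2 \<Rightarrow> bool" where
  "mul_dom m S \<longleftrightarrow> square_integrable (\<lambda>xi. m xi *\<^sub>R FM S xi)"

lemma even_weightD[measurable_dest]: "even_weight m \<Longrightarrow> m \<in> borel_measurable borel"
  by (simp add: even_weight_def)

lemma hermitian_weight:
  assumes "even_weight m" "hermitian_mat N"
  shows "hermitian_mat (\<lambda>xi. m xi *\<^sub>R N xi)"
  using assms(2) unfolding hermitian_mat_def
  by eventually_elim (use assms(1) in \<open>simp add: even_weight_def cnj_mat_def vec_eq_iff\<close>)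

lemma FM_mul:
  assumes "even_weight m" "mul_dom m S"
  shows "AE xi in lborel. FM (mul m S) xi = m xi *\<^sub>R FM S xi"
  using multiplier_fourier[of "\<lambda>xi A. m xi *\<^sub>R A" "rep_l2 S", folded FM_def] assms
    hermitian_weight[OF assms(1) FM_hermitian] unfolding mul_def mul_dom_def by blast

lemma mul_dom_bounded:
  assumes m: "even_weight m" and le: "\<And>xi. \<bar>m xi\<bar> \<le> C"
  shows "mul_dom m S"
proof -
  have [measurable]: "m \<in> borel_measurable borel" using m by (rule even_weightD)
  have "C \<ge> 0" using le[of 0] by simp
  then show ?thesis
    unfolding mul_dom_def
    by (intro square_integrable_bound(1)[OF square_integrable_scaleR[OF square_integrable_FM[of S], of C]])
      (auto intro!: mult_right_mono le)
qed

lemma norm_mul: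
  assumes "even_weight m" "mul_dom m S"
  shows "cG * norm (mul m S) = l2norm (\<lambda>xi. m xi *\<^sub>R FM S xi)"
proof -
  have [measurable]: "m \<in> borel_measurable borel" using assms(1) by (rule even_weightD)
  have "AE xi in lborel. norm (FM (mul m S) xi) = norm (m xi *\<^sub>R FM S xi)"
    using FM_mul[OF assms] by eventually_elim simp
  then show ?thesis
    using l2norm_cong_AE[of "FM (mul m S)" "\<lambda>xi. m xi *\<^sub>R FM S xi"] by (simp add: l2norm_FM)
qed

lemma norm_mul_mono:
  assumes "even_weight m" "mul_dom m S" "even_weight k" and le: "AE xi in lborel. norm (k xi *\<^sub>R FM T xi) \<le> norm (m xi *\<^sub>R FM S xi)"
  shows "mul_dom k T" "norm (mul k T) \<le> norm (mul m S)"
proof -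
  have [measurable]: "m \<in> borel_measurable borel" "k \<in> borel_measurable borel" using assms by (auto dest: even_weightD)
  note b = square_integrable_bound[OF assms(2)[unfolded mul_dom_def] _ le]
  show d: "mul_dom k T" unfolding mul_dom_def by (rule b(1)) measurable
  have "cG * norm (mul k T) \<le> cG * norm (mul m S)"
    unfolding norm_mul[OF assms(3) d] norm_mul[OF assms(1,2)] by (rule b(2)) measurable
  then show "norm (mul k T) \<le> norm (mul m S)" using cG_pos by simp
qed

text \<open>Membership in the domain comes along, because the prospective value \<open>T\<close> is
  square integrable.\<close>

lemma mul_eqI:
  assumes "AE xi in lborel. FM T xi = m xi *\<^sub>R FM S xi" and m: "even_weight m"
  shows "mul m S = T" "mul_dom m S"
proof -
  have [measurable]: "m \<in> borel_measurable borel" using m by (rule even_weightD)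
  show d: "mul_dom m S"
    unfolding mul_dom_def by (rule square_integrable_bound(1)[OF square_integrable_FM[of T]]) (use assms(1) in \<open>auto elim: AE_mp\<close>)
  show "mul m S = T"
    by (rule FM_eqI) (use FM_mul[OF m d] assms(1) in eventually_elim, simp)
qed

lemma mul_1: "mul (\<lambda>xi. 1) S = S"
  by (rule mul_eqI) (auto simp: even_weight_def)

lemma norm_mul_bounded:
  assumes m: "even_weight m" and le: "\<And>xi. \<bar>m xi\<bar> \<le> C"
  shows "norm (mul m S) \<le> C * norm S"
proof -
  have [measurable]: "m \<in> borel_measurable borel" using m by (rule even_weightD)
  have C: "C \<ge> 0" using le[of 0] by simp
  have "cG * norm (mul m S) = l2norm (\<lambda>xi. m xi *\<^sub>R FM S xi)"
    by (rule norm_mul[OF m mul_dom_bounded[OF m le]])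
  also have "\<dots> \<le> l2norm (\<lambda>xi. C *\<^sub>R FM S xi)"
    using C le by (intro square_integrable_bound(2) square_integrable_scaleR square_integrable_FM) (auto intro!: mult_right_mono)
  also have "\<dots> = C * l2norm (FM S)"
    using C by (simp add: l2norm_def power_mult_distrib real_sqrt_mult)
  also have "\<dots> = cG * (C * norm S)" by (simp add: l2norm_FM)
  finally show ?thesis using cG_pos by simp
qed

lemma mul_add:
  assumes m: "even_weight m" and d: "mul_dom m S" "mul_dom m T"
  shows "mul m (S + T) = mul m S + mul m T" "mul_dom m (S + T)"
proof -
  have "AE xi in lborel. FM (mul m S + mul m T) xi = m xi *\<^sub>R FM (S + T) xi"
    using FM_mul[OF m d(1)] FM_mul[OF m d(2)] FM_add[of S T] FM_add[of "mul m S" "mul m T"]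
    by eventually_elim (simp add: scaleR_add_right)
  from mul_eqI[OF this m] show "mul m (S + T) = mul m S + mul m T" "mul_dom m (S + T)" by auto
qed

lemma mul_scaleR:
  assumes m: "even_weight m" and d: "mul_dom m S"
  shows "mul m (c *\<^sub>R S) = c *\<^sub>R mul m S" "mul_dom m (c *\<^sub>R S)"
proof -
  have "AE xi in lborel. FM (c *\<^sub>R mul m S) xi = m xi *\<^sub>R FM (c *\<^sub>R S) xi"
    using FM_mul[OF m d(1)] FM_scaleR[of c S] FM_scaleR[of c "mul m S"]
    by eventually_elim (simp add: mult.commute)
  from mul_eqI[OF this m] show "mul m (c *\<^sub>R S) = c *\<^sub>R mul m S" "mul_dom m (c *\<^sub>R S)" by auto
qed

lemma mul_diff:
  assumes m: "even_weight m" and d: "mul_dom m S" "mul_dom m T"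
  shows "mul m (S - T) = mul m S - mul m T" "mul_dom m (S - T)"
  using mul_add[OF m d(1) mul_scaleR(2)[OF m d(2), of "-1"]] mul_scaleR(1)[OF m d(2), of "-1"] by auto

lemma bounded_linear_mul:
  assumes m: "even_weight m" and le: "\<And>xi. \<bar>m xi\<bar> \<le> C"
  shows "bounded_linear (mul m)"
  using mul_add(1)[OF m mul_dom_bounded[OF m le] mul_dom_bounded[OF m le]] mul_scaleR(1)[OF m mul_dom_bounded[OF m le]]
    norm_mul_bounded[OF m le]
  by (intro bounded_linear_intro[of _ C]) (auto simp: mult.commute)

lemma inner_mul:
  assumes m: "even_weight m" and d: "mul_dom m S" "mul_dom m T"
  shows "mul m S \<bullet> T = S \<bullet> mul m T"
proof -
  have [measurable]: "m \<in> borel_measurable borel" using m by (rule even_weightD)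
  have "cG\<^sup>2 * (mul m S \<bullet> T) = cG\<^sup>2 * (S \<bullet> mul m T)"
    unfolding inner_FM
    by (rule integral_cong_AE, measurable) (use FM_mul[OF m d(1)] FM_mul[OF m d(2)] in eventually_elim, simp)
  then show ?thesis using cG_pos by simp
qed

lemma heat_eq_mul: "heat t = mul (\<lambda>xi. exp (- t * (norm xi)\<^sup>2))"
  by (rule ext) (simp add: heat_def mul_def heat_symbol_def[abs_def])

section \<open>Derivatives and homogeneous Sobolev functions\<close>

lemma AE_eq_continuous:
  fixes f g :: "real^3 \<Rightarrow> complex"
  assumes "continuous_on UNIV f" "continuous_on UNIV g" "AE x in lborel. f x = g x"
  shows "f x = g x"
proof (rule ccontr)
  assume ne: "f x \<noteq> g x"
  have op: "open {x. f x \<noteq> g x}" by (rule open_Collect_neq[OF assms(1,2)])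
  then have "{x. f x \<noteq> g x} \<in> null_sets lborel"
    using assms(3) AE_iff_null_sets[of "{x. f x \<noteq> g x}" lborel] by auto
  then have "negligible {x. f x \<noteq> g x}"
    by (simp add: negligible_iff_null_sets null_sets_completionI)
  then show False using open_not_negligible[OF op] ne by auto
qed

text \<open>Inversion in L^2 holds almost everywhere, and both sides are continuous. Thus every
  Schwartz function is the transform of one.\<close>

lemma schwartz_fourier_inversion:
  assumes phi: "schwartz phi"
  shows "schwartz (\<lambda>x. fourier_L1 phi (- x) / cor (cG\<^sup>2))"
    and "fourier_L1 (\<lambda>x. fourier_L1 phi (- x) / cor (cG\<^sup>2)) = phi"
proof -
  let ?\<psi> = "\<lambda>x. fourier_L1 phi (- x) / cor (cG\<^sup>2)"
  show s: "schwartz ?\<psi>"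
    using schwartz_cmult[OF schwartz_affine[OF schwartz_fourier_L1[OF phi], of "-1" 0], of "1 / cor (cG\<^sup>2)"] by simp
  have "has_fourier ?\<psi> phi"
    by (rule has_fourier_inverse(2)[OF schwartz_square_integrable[OF phi] has_fourier_L1[OF schwartz_integrable[OF phi]]])
  then have ae: "AE x in lborel. fourier_L1 ?\<psi> x = phi x"
    by (rule has_fourier_unique[OF has_fourier_L1[OF schwartz_integrable[OF s]]])
  show "fourier_L1 ?\<psi> = phi"
    by (rule ext, rule AE_eq_continuous[OF _ _ ae]) (intro schwartz_continuous schwartz_fourier_L1 s phi)+
qed

lemma has_partial_linear:
  assumes L: "bounded_linear L" and h: "has_partial i f g"
  shows "has_partial i (\<lambda>x. L (f x)) (\<lambda>x. L (g x))"
proof -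
  interpret bounded_linear L by fact
  show ?thesis
    using h unfolding has_partial_def
    by (auto simp: scaleR[symmetric] integral_bounded_linear[OF L] neg[symmetric] intro: integrable_bounded_linear[OF L])
qed

lemma has_partial_add:
  assumes "has_partial i f g" "has_partial i f' g'"
  shows "has_partial i (\<lambda>x. f x + f' x) (\<lambda>x. g x + g' x)"
  using assms unfolding has_partial_def by (auto simp: scaleR_add_right)

lemma has_partial_0: "has_partial i (\<lambda>x. 0) (\<lambda>x. 0)"
  by (simp add: has_partial_def)

lemma has_partial_sum:
  assumes "\<And>j. j \<in> J \<Longrightarrow> has_partial i (f j) (g j)"
  shows "has_partial i (\<lambda>x. \<Sum>j\<in>J. f j x) (\<lambda>x. \<Sum>j\<in>J. g j x)"
  using assms by (induction J rule: infinite_finite_induct) (auto simp: has_partial_0 has_partial_add)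

lemma bounded_linear_axis: "bounded_linear (axis j :: 'b::euclidean_space \<Rightarrow> 'b^'n)"
  by (intro linear_conv_bounded_linear[THEN iffD1] linearI) (auto simp: axis_def vec_eq_iff)

lemma has_partial_vec_iff:
  fixes f g :: "real^3 \<Rightarrow> ('b::euclidean_space)^'n"
  shows "has_partial i f g \<longleftrightarrow> (\<forall>j. has_partial i (\<lambda>x. f x $ j) (\<lambda>x. g x $ j))"
proof
  show "has_partial i f g \<Longrightarrow> \<forall>j. has_partial i (\<lambda>x. f x $ j) (\<lambda>x. g x $ j)"
    by (intro allI has_partial_linear[OF bounded_linear_vec_nth])
  assume "\<forall>j. has_partial i (\<lambda>x. f x $ j) (\<lambda>x. g x $ j)"
  then have "has_partial i (\<lambda>x. \<Sum>j\<in>UNIV. axis j (f x $ j)) (\<lambda>x. \<Sum>j\<in>UNIV. axis j (g x $ j))"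
    by (intro has_partial_sum has_partial_linear[OF bounded_linear_axis]) auto
  moreover have "(\<Sum>j\<in>UNIV. axis j (v $ j)) = v" for v :: "'b^'n"
    by (simp add: vec_eq_iff axis_def if_distrib sum.delta cong: if_cong)
  ultimately show "has_partial i f g" by simp
qed

lemma partial_linear:
  assumes L: "bounded_linear L" and "f differentiable (at x)"
  shows "partial i (\<lambda>x. L (f x)) x = L (partial i f x)"
  using partial_eqI[OF has_derivative_compose[OF assms(2)[unfolded frechet_derivative_works] bounded_linear.has_derivative[OF L has_derivative_ident]]]
  by (simp add: partial_def)

text \<open>Weak derivatives are tested with real functions, Fourier transforms with complex ones;
  real and imaginary parts mediate.\<close>

lemma has_partial_complex:
  fixes f g :: "real^3 \<Rightarrow> real"
  assumes h: "has_partial i f g" and \<rho>: "schwartz \<rho>"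
  shows "integrable lborel (\<lambda>x. cor (g x) * \<rho> x)" "integrable lborel (\<lambda>x. cor (f x) * partial i \<rho> x)"
    "(LBINT x. cor (g x) * \<rho> x) = - (LBINT x. cor (f x) * partial i \<rho> x)"
proof -
  have R: "schwartz (\<lambda>x. Re (\<rho> x))" and I: "schwartz (\<lambda>x. Im (\<rho> x))"
    using schwartz_linear[OF bounded_linear_Re \<rho>] schwartz_linear[OF bounded_linear_Im \<rho>] by auto
  have pR: "partial i (\<lambda>x. Re (\<rho> x)) x = Re (partial i \<rho> x)" and pI: "partial i (\<lambda>x. Im (\<rho> x)) x = Im (partial i \<rho> x)" for x
    using partial_linear[OF bounded_linear_Re] partial_linear[OF bounded_linear_Im] schwartz_differentiable[OF \<rho>] by auto
  note a = h[unfolded has_partial_def, rule_format, OF R, unfolded pR real_scaleR_def]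
  note b = h[unfolded has_partial_def, rule_format, OF I, unfolded pI real_scaleR_def]
  have e: "cor r * z = cor (Re z * r) + \<i> * cor (Im z * r)" for r z
    by (simp add: complex_eq_iff)
  show "integrable lborel (\<lambda>x. cor (g x) * \<rho> x)" "integrable lborel (\<lambda>x. cor (f x) * partial i \<rho> x)"
    unfolding e using a b by (intro Bochner_Integration.integrable_add integrable_mult_right integrable_of_real; blast)+
  have i: "integrable lborel (\<lambda>x. cor (Re (\<rho> x) * g x))" "integrable lborel (\<lambda>x. \<i> * cor (Im (\<rho> x) * g x))"
    "integrable lborel (\<lambda>x. cor (Re (partial i \<rho> x) * f x))" "integrable lborel (\<lambda>x. \<i> * cor (Im (partial i \<rho> x) * f x))"
    using a b by (intro integrable_mult_right integrable_of_real; blast)+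
  show "(LBINT x. cor (g x) * \<rho> x) = - (LBINT x. cor (f x) * partial i \<rho> x)"
    unfolding e Bochner_Integration.integral_add[OF i(1,2)] Bochner_Integration.integral_add[OF i(3,4)]
      integral_mult_right_zero integral_complex_of_real using a b by simp
qed

lemma has_partial_fourier:
  fixes f g :: "real^3 \<Rightarrow> real"
  assumes h: "has_partial i f g" and F: "has_fourier (\<lambda>x. cor (f x)) F"
  shows "has_fourier (\<lambda>x. cor (g x)) (\<lambda>xi. \<i> * cor (xi $ i) * F xi)"
  unfolding has_fourier_def
proof (intro allI impI)
  fix phi :: "real^3 \<Rightarrow> complex" assume phi: "schwartz phi"
  note c = has_partial_complex[OF h schwartz_fourier_L1[OF phi], unfolded partial_fourier_L1[OF phi]]
  note d = has_fourierD[OF F schwartz_cmult[OF schwartz_coord'[OF phi, of i], of "- \<i>"]]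
  have e: "\<i> * cor (xi $ i) * F xi * phi xi = - (F xi * (- \<i> * (cor (xi $ i) * phi xi)))" for xi
    by simp
  show "integrable lborel (\<lambda>xi. \<i> * cor (xi $ i) * F xi * phi xi) \<and>
     integrable lborel (\<lambda>x. cor (g x) * fourier_L1 phi x) \<and>
     (LBINT xi. \<i> * cor (xi $ i) * F xi * phi xi) = (LBINT x. cor (g x) * fourier_L1 phi x)"
    unfolding e Bochner_Integration.integral_minus using c d
    by (auto intro!: Bochner_Integration.integrable_minus simp del: mult_minus_left mult_minus_right)
qed

text \<open>An arbitrary test function has to be written as a transform before the hypotheses apply;
  \<open>schwartz_fourier_inversion\<close> does this.\<close>

lemma fourier_has_partial:
  fixes f g :: "real^3 \<Rightarrow> real"
  assumes F: "has_fourier (\<lambda>x. cor (f x)) F"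
    and G: "has_fourier (\<lambda>x. cor (g x)) (\<lambda>xi. \<i> * cor (xi $ i) * F xi)"
  shows "has_partial i f g"
  unfolding has_partial_def
proof (intro allI impI)
  fix phi :: "real^3 \<Rightarrow> real" assume phi: "schwartz phi"
  define \<rho> where "\<rho> x = cor (phi x)" for x
  have \<rho>: "schwartz \<rho>" unfolding \<rho>_def by (rule schwartz_linear[OF bounded_linear_of_real phi])
  obtain \<psi> where \<psi>: "schwartz \<psi>" "fourier_L1 \<psi> = \<rho>" using schwartz_fourier_inversion[OF \<rho>] by blast
  have p: "partial i \<rho> x = cor (partial i phi x)" for x
    unfolding \<rho>_def by (rule partial_linear[OF bounded_linear_of_real schwartz_differentiable[OF phi]])
  note c = has_fourierD[OF G \<psi>(1), unfolded \<psi>(2)]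
  note d = has_fourierD[OF F schwartz_cmult[OF schwartz_coord'[OF \<psi>(1), of i], of "- \<i>"], folded partial_fourier_L1[OF \<psi>(1)], unfolded \<psi>(2)]
  have e: "\<i> * cor (xi $ i) * F xi * \<psi> xi = - (F xi * (- \<i> * (cor (xi $ i) * \<psi> xi)))" for xi
    by simp
  have 1: "cor (g x) * \<rho> x = cor (phi x *\<^sub>R g x)" "cor (f x) * partial i \<rho> x = cor (partial i phi x *\<^sub>R f x)" for x
    by (simp_all add: p \<rho>_def mult.commute)
  have "cor (LBINT x. phi x *\<^sub>R g x) = - cor (LBINT x. partial i phi x *\<^sub>R f x)"
    using c(3) d(3) unfolding e Bochner_Integration.integral_minus 1 integral_complex_of_real by simp
  then have "(LBINT x. phi x *\<^sub>R g x) = - (LBINT x. partial i phi x *\<^sub>R f x)"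
    by (simp only: of_real_minus[symmetric] of_real_eq_iff)
  moreover have "integrable lborel (\<lambda>x. phi x *\<^sub>R g x)" "integrable lborel (\<lambda>x. partial i phi x *\<^sub>R f x)"
    using c(2) d(2) unfolding 1 complex_of_real_integrable_eq by auto
  ultimately show "integrable lborel (\<lambda>x. phi x *\<^sub>R g x) \<and> integrable lborel (\<lambda>x. partial i phi x *\<^sub>R f x) \<and>
     (LBINT x. phi x *\<^sub>R g x) = - (LBINT x. partial i phi x *\<^sub>R f x)" by blast
qed

section \<open>Low frequencies in three dimensions\<close>

lemma AE_coord_neq_0: "AE x in lborel. (x::real^3) $ i \<noteq> 0"
proof -
  have "negligible {x::real^3. x $ i = 0}" by (rule negligible_standard_hyperplane_cart)
  then have "AE x in lebesgue. x \<notin> {x::real^3. x $ i = 0}" by (simp only: negligible_iff_null_sets AE_not_in)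
  then show ?thesis by (simp add: AE_completion_iff)
qed

text \<open>The exponent is a third of -2: one such factor per coordinate is to bound
  |xi|^(-2).\<close>

lemma nn_integral_powr_unit: "(\<integral>\<^sup>+s. ennreal (indicator {-1..1} s * \<bar>s\<bar> powr (-2/3)) \<partial>lborel) < \<infinity>"
proof -
  have hi: "((\<lambda>x::real. x powr (-2/3)) has_integral (1 powr (-2/3 + 1) / (-2/3 + 1))) {0..1}"
    by (rule has_integral_powr_from_0) auto
  have 1: "(\<integral>\<^sup>+s. ennreal (indicator {0..1} s * \<bar>s\<bar> powr (-2/3)) \<partial>lborel) = ennreal 3"
  proof -
    have "((\<lambda>x::real. \<bar>x\<bar> powr (-2/3)) has_integral 3) {0..1}"
      using hi by (subst has_integral_cong[where g="\<lambda>x. x powr (-2/3)"]) auto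
    then have "((\<lambda>x::real. indicator {0..1} x * \<bar>x\<bar> powr (-2/3)) has_integral 3) UNIV"
    proof (subst (asm) has_integral_restrict_UNIV[symmetric])
      have "(\<lambda>x::real. if x \<in> {0..1} then \<bar>x\<bar> powr (-2/3) else 0) = (\<lambda>x::real. indicator {0..1} x * \<bar>x\<bar> powr (-2/3))"
        by auto
      then show "((\<lambda>x::real. if x \<in> {0..1} then \<bar>x\<bar> powr (-2/3) else 0) has_integral 3) UNIV \<Longrightarrow>
        ((\<lambda>x::real. indicator {0..1} x * \<bar>x\<bar> powr (-2/3)) has_integral 3) UNIV" by (simp only:)
    qed
    from nn_integral_has_integral_lborel[OF _ _ this] show ?thesis by simp
  qed
  have 2: "(\<integral>\<^sup>+s. ennreal (indicator {-1..0} s * \<bar>s\<bar> powr (-2/3)) \<partial>lborel) = ennreal 3"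
  proof -
    have "(\<integral>\<^sup>+s. ennreal (indicator {-1..0} s * \<bar>s\<bar> powr (-2/3)) \<partial>lborel)
      = (\<integral>\<^sup>+s. ennreal (indicator {-1..0} (0 + (-1) * s) * \<bar>0 + (-1) * s\<bar> powr (-2/3)) \<partial>lborel)"
      by (subst nn_integral_real_affine[where c="-1" and t=0]) auto
    also have "\<dots> = (\<integral>\<^sup>+s. ennreal (indicator {0..1} s * \<bar>s\<bar> powr (-2/3)) \<partial>lborel)"
      by (intro nn_integral_cong) (auto simp: indicator_def)
    finally show ?thesis using 1 by simp
  qed
  have "(\<integral>\<^sup>+s. ennreal (indicator {-1..1} s * \<bar>s\<bar> powr (-2/3)) \<partial>lborel)
    \<le> (\<integral>\<^sup>+s. ennreal (indicator {-1..0} s * \<bar>s\<bar> powr (-2/3)) + ennreal (indicator {0..1} s * \<bar>s\<bar> powr (-2/3)) \<partial>lborel)"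
    by (intro nn_integral_mono) (auto simp: indicator_def)
  also have "\<dots> = (\<integral>\<^sup>+s. ennreal (indicator {-1..0} s * \<bar>s\<bar> powr (-2/3)) \<partial>lborel) + (\<integral>\<^sup>+s. ennreal (indicator {0..1} s * \<bar>s\<bar> powr (-2/3)) \<partial>lborel)"
    by (rule nn_integral_add) auto
  also have "\<dots> = ennreal 3 + ennreal 3" by (simp only: 1 2)
  also have "\<dots> < \<infinity>" by simp
  finally show ?thesis .
qed

text \<open>As |xi_i| <= |xi|, the function |xi|^(-2) is at most the product of the three
  |xi_i|^(-2/3), off the coordinate planes, and on the ball this product lies below a product of
  one-dimensional integrable functions.\<close>

lemma integrable_inverse_norm_sq: "integrable lborel (\<lambda>xi::real^3. indicator (ball 0 1) xi * inverse ((norm xi)\<^sup>2))"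
  unfolding integrable_iff_bounded
proof
  have [measurable]: "ball (0::real^3) 1 \<in> sets borel" by simp
  define h where "h s = indicator {-1..1} s * \<bar>s\<bar> powr (-2/3)" for s :: real
  have [measurable]: "h \<in> borel_measurable borel" unfolding h_def by measurable
  have h0: "h s \<ge> 0" for s by (simp add: h_def)
  have "(\<integral>\<^sup>+xi. ennreal (norm (indicator (ball 0 1) xi * inverse ((norm xi)\<^sup>2))) \<partial>(lborel :: (real^3) measure))
    \<le> (\<integral>\<^sup>+xi. (\<Prod>b\<in>(Basis::(real^3) set). ennreal (h (xi \<bullet> b))) \<partial>lborel)"
  proof (rule nn_integral_mono_AE)
    have "AE xi in lborel. \<forall>i. (xi::real^3) $ i \<noteq> 0" by (simp add: AE_all_countable AE_coord_neq_0)
    then show "AE xi in lborel. ennreal (norm (indicator (ball 0 1) xi * inverse ((norm xi)\<^sup>2))) \<le> (\<Prod>b\<in>(Basis::(real^3) set). ennreal (h (xi \<bullet> b)))"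
    proof eventually_elim
      case (elim xi)
      show ?case
      proof (cases "norm xi < 1")
        case True
        have "xi \<noteq> 0" using elim by auto
        then have n0: "norm xi > 0" by simp
        have "norm xi powr (-2/3) \<le> h (xi \<bullet> axis i 1)" for i
        proof -
          have "\<bar>xi $ i\<bar> \<le> norm xi" by (rule component_le_norm_cart)
          moreover have "\<bar>xi $ i\<bar> > 0" using elim by simp
          ultimately have "norm xi powr (-2/3) \<le> \<bar>xi $ i\<bar> powr (-2/3)" by (intro powr_mono2') auto
          moreover have "xi $ i \<in> {-1..1}" using \<open>\<bar>xi $ i\<bar> \<le> norm xi\<close> True by auto
          ultimately show ?thesis by (simp add: h_def inner_axis)
        qed
        then have "(\<Prod>i\<in>(UNIV::3 set). norm xi powr (-2/3)) \<le> (\<Prod>i\<in>UNIV. h (xi \<bullet> axis i 1))"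
          by (intro prod_mono) auto
        moreover have "(\<Prod>i\<in>(UNIV::3 set). norm xi powr (-2/3)) = inverse ((norm xi)\<^sup>2)"
        proof -
          have "(\<Prod>i\<in>(UNIV::3 set). norm xi powr (-2/3)) = norm xi powr (-2/3) * norm xi powr (-2/3) * norm xi powr (-2/3)"
            by (simp add: power3_eq_cube)
          also have "\<dots> = norm xi powr (-2)" unfolding powr_add[symmetric] by simp
          also have "\<dots> = inverse ((norm xi)\<^sup>2)" using n0 by (simp add: powr_minus powr_numeral)
          finally show ?thesis .
        qed
        ultimately have "norm (indicator (ball 0 1) xi * inverse ((norm xi)\<^sup>2)) \<le> (\<Prod>b\<in>(Basis::(real^3) set). h (xi \<bullet> b))"
          using True by (simp add: prod_Basis3)
        then show ?thesis using h0 by (simp add: prod_ennreal ennreal_leI)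
      qed auto
    qed
  qed
  also have "\<dots> = (\<Prod>b\<in>(Basis::(real^3) set). \<integral>\<^sup>+s. ennreal (h s) \<partial>lborel)"
    by (rule nn_integral_lborel_prod) auto
  also have "\<dots> < \<infinity>" using nn_integral_powr_unit by (simp add: h_def power_less_top_ennreal)
  finally show "(\<integral>\<^sup>+xi. ennreal (norm (indicator (ball 0 1) xi * inverse ((norm xi)\<^sup>2))) \<partial>(lborel::(real^3) measure)) < \<infinity>" .
  show "(\<lambda>xi::real^3. indicator (ball 0 1) xi * inverse ((norm xi)\<^sup>2) :: real) \<in> borel_measurable lborel"
    by (intro borel_measurable_times borel_measurable_indicator borel_measurable_inverse borel_measurable_power borel_measurable_norm) auto
qed

lemma square_integrable_inverse_norm: "square_integrable (\<lambda>xi::real^3. indicator (ball 0 1) xi * inverse (norm xi))"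
proof -
  have "(norm (indicator (ball 0 1) xi * inverse (norm xi)))\<^sup>2 = indicator (ball 0 1) xi * inverse ((norm xi)\<^sup>2)" for xi :: "real^3"
    by (simp add: power_mult_distrib indicator_def power_inverse)
  moreover have [measurable]: "ball (0::real^3) 1 \<in> sets borel" by simp
  moreover have "(\<lambda>xi::real^3. indicator (ball 0 1) xi * inverse (norm xi) :: real) \<in> borel_measurable borel" by measurable
  ultimately show ?thesis using integrable_inverse_norm_sq by (simp add: square_integrable_def)
qed

lemma has_fourier_inverse_L1:
  assumes F: "integrable lborel F"
  shows "has_fourier (\<lambda>x. fourier_L1 F (- x) / cor (cG\<^sup>2)) F"
  unfolding has_fourier_def
proof (intro allI impI conjI)
  fix phi :: "real^3 \<Rightarrow> complex" assume phi: "schwartz phi"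
  define \<psi> where "\<psi> x = fourier_L1 phi (- x) / cor (cG\<^sup>2)" for x
  have \<psi>: "schwartz \<psi>" "fourier_L1 \<psi> = phi" using schwartz_fourier_inversion[OF phi] unfolding \<psi>_def by auto
  have i\<psi>: "integrable lborel \<psi>" by (rule schwartz_integrable[OF \<psi>(1)])
  have [measurable]: "\<psi> \<in> borel_measurable borel" "fourier_L1 F \<in> borel_measurable borel"
    using i\<psi> fourier_L1_measurable[OF F] by auto
  show "integrable lborel (\<lambda>xi. F xi * phi xi)"
    using fourier_L1_times_integrable[OF F i\<psi>] \<psi>(2) by simp
  have e: "fourier_L1 F (- x) / cor (cG\<^sup>2) * fourier_L1 phi x = (\<lambda>x. fourier_L1 F x * \<psi> x) (- x)" for x
    by (simp add: \<psi>_def)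
  have i: "integrable lborel (\<lambda>x. fourier_L1 F x * \<psi> x)"
    using fourier_L1_times_integrable[OF i\<psi> F] by (simp add: mult.commute)
  show "integrable lborel (\<lambda>x. fourier_L1 F (- x) / cor (cG\<^sup>2) * fourier_L1 phi x)"
    unfolding e by (rule lborel_reflect_integrable[OF i])
  have "(LBINT x. fourier_L1 F (- x) / cor (cG\<^sup>2) * fourier_L1 phi x) = (LBINT x. fourier_L1 F x * \<psi> x)"
    unfolding e by (rule lborel_reflect) measurable
  also have "\<dots> = (LBINT x. F x * fourier_L1 \<psi> x)" by (rule fourier_L1_multiplication[OF F i\<psi>, symmetric])
  finally show "(LBINT xi. F xi * phi xi) = (LBINT x. fourier_L1 F (- x) / cor (cG\<^sup>2) * fourier_L1 phi x)"
    by (simp add: \<psi>(2))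
qed

text \<open>\<open>F\<close> need not be square integrable near the origin. Inside the unit ball it
  is integrable by Cauchy-Schwarz, because 1 / |xi| is square integrable there; outside it is square
  integrable. The two parts are inverted separately.\<close>

lemma homogeneous_fourier_surj:
  assumes F: "square_integrable (\<lambda>xi. norm xi *\<^sub>R F xi)" and [measurable]: "F \<in> borel_measurable borel"
    and herm: "AE xi in lborel. F (- xi) = cnj (F xi)"
  obtains f :: "real^3 \<Rightarrow> real" where "has_fourier (\<lambda>x. cor (f x)) F"
proof -
  define F1 where "F1 xi = indicator (ball 0 1) xi *\<^sub>R F xi" for xi
  define F2 where "F2 xi = indicator (- ball 0 1) xi *\<^sub>R F xi" for xi
  have [measurable]: "ball (0::real^3) 1 \<in> sets borel" "- ball (0::real^3) 1 \<in> sets borel" by simp_all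
  have [measurable]: "F1 \<in> borel_measurable borel" "F2 \<in> borel_measurable borel" unfolding F1_def F2_def by measurable
  have "integrable lborel F1"
  proof (rule Bochner_Integration.integrable_bound[OF l2norm_Cauchy_Schwarz(1)[OF square_integrable_inverse_norm F]])
    have "AE xi in lborel. (xi::real^3) \<noteq> 0" by (rule AE_lborel_singleton)
    then show "AE xi in lborel. norm (F1 xi) \<le> norm (norm (indicator (ball 0 1) xi * inverse (norm xi)) * norm (norm xi *\<^sub>R F xi))"
      by eventually_elim (simp add: F1_def indicator_def mult.assoc[symmetric])
  qed measurable
  then have 1: "has_fourier (\<lambda>x. fourier_L1 F1 (- x) / cor (cG\<^sup>2)) F1" by (rule has_fourier_inverse_L1)
  have "square_integrable F2"
  proof (rule square_integrable_bound(1)[OF F])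
    have "norm (F2 xi) \<le> norm (norm xi *\<^sub>R F xi)" for xi
      using mult_right_mono[of 1 "norm xi" "norm (F xi)"] by (auto simp: F2_def indicator_def)
    then show "AE xi in lborel. norm (F2 xi) \<le> norm (norm xi *\<^sub>R F xi)" by simp
  qed measurable
  then obtain f2 where 2: "has_fourier f2 F2" using has_fourier_surj by blast
  have "(\<lambda>xi. F1 xi + F2 xi) = F" by (auto simp: F1_def F2_def indicator_def)
  then have "has_fourier (\<lambda>x. fourier_L1 F1 (- x) / cor (cG\<^sup>2) + f2 x) F" using has_fourier_add[OF 1 2] by simp
  from that[OF has_fourier_real_part[OF this herm]] show ?thesis .
qed

section \<open>Strain matrices in Fourier space\<close>

lemma sum_coords_squared: "(\<Sum>k\<in>UNIV. cor (xi $ k) * cor (xi $ k)) = cor ((norm (xi::real^3))\<^sup>2)"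
proof -
  have "(norm xi)\<^sup>2 = (\<Sum>k\<in>UNIV. xi $ k * xi $ k)" by (simp add: power2_norm_eq_inner inner_vec_def)
  then show ?thesis by (simp only: of_real_sum of_real_mult)
qed

definition velocity_symbol :: "real^3 \<Rightarrow> complex^3^3 \<Rightarrow> complex^3" where
  "velocity_symbol xi A = (\<chi> i. - 2 * (\<Sum>j\<in>UNIV. \<i> * cor (xi $ j) * A $ i $ j) / cor ((norm xi)\<^sup>2))"

definition curl_symbol :: "real^3 \<Rightarrow> complex^3 \<Rightarrow> complex^3" where
  "curl_symbol xi U = vector [\<i> * cor (xi $ 2) * U $ 3 - \<i> * cor (xi $ 3) * U $ 2,
     \<i> * cor (xi $ 3) * U $ 1 - \<i> * cor (xi $ 1) * U $ 3,
     \<i> * cor (xi $ 1) * U $ 2 - \<i> * cor (xi $ 2) * U $ 1]"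

definition vort_symbol :: "real^3 \<Rightarrow> complex^3^3 \<Rightarrow> complex^3" where
  "vort_symbol xi A = curl_symbol xi (velocity_symbol xi A)"

lemma is_velocity_FM: "is_velocity S u \<longleftrightarrow> u \<in> borel_measurable borel \<and> has_fourier_vec u (\<lambda>xi. velocity_symbol xi (FM S xi))"
  by (simp add: is_velocity_def velocity_symbol_def FM_def)

lemma mat_entry_measurable[measurable (raw)]:
  fixes f :: "'a \<Rightarrow> ('b::euclidean_space)^'n"
  assumes "f \<in> borel_measurable M"
  shows "(\<lambda>x. f x $ i) \<in> borel_measurable M"
  using assms vec_borel_measurable_iff by blast

lemma velocity_symbol_measurable[measurable]: "(\<lambda>xi. velocity_symbol xi (FM S xi)) \<in> borel_measurable borel"
  unfolding velocity_symbol_def vec_borel_measurable_iff by simp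

lemma velocity_symbol_bound: "norm xi * norm (velocity_symbol xi A $ i) \<le> 6 * norm A"
proof (cases "xi = 0")
  case False
  then have n: "norm xi > 0" by simp
  have "norm (\<Sum>j\<in>UNIV. \<i> * cor (xi $ j) * A $ i $ j) \<le> (\<Sum>j\<in>(UNIV::3 set). norm xi * norm A)"
    by (rule order_trans[OF norm_sum sum_mono])
      (auto simp: norm_mult intro!: mult_mono component_le_norm_cart norm_entry_le)
  then have "norm (\<Sum>j\<in>UNIV. \<i> * cor (xi $ j) * A $ i $ j) \<le> 3 * (norm xi * norm A)" by simp
  then show ?thesis using n
    by (simp add: velocity_symbol_def norm_mult norm_divide norm_power divide_simps power2_eq_square mult_ac)
qed simp

lemma velocity_symbol_hermitian: "velocity_symbol (- xi) (cnj_mat A) $ i = cnj (velocity_symbol xi A $ i)"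
  by (simp add: velocity_symbol_def cnj_mat_def sum_3)

text \<open>|xi| times the velocity symbol is bounded by the strain. Hence the velocity exists as a
  function by \<open>homogeneous_fourier_surj\<close>, and its gradient lies in L^2.\<close>

lemma velocity_data:
  fixes S defines "U \<equiv> \<lambda>xi. velocity_symbol xi (FM S xi)"
  obtains u :: "real^3 \<Rightarrow> real^3" and g :: "3 \<Rightarrow> real^3 \<Rightarrow> real^3" where "has_fourier_vec u U"
    "\<And>i. has_partial i u (g i)" "\<And>i j. has_fourier (\<lambda>x. cor (g i x $ j)) (\<lambda>xi. \<i> * cor (xi $ i) * U xi $ j)"
    "\<And>i. square_integrable (g i)"
proof -
  have [measurable]: "U \<in> borel_measurable borel" unfolding U_def by measurable
  have herm: "AE xi in lborel. U (- xi) $ i = cnj (U xi $ i)" for i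
    using FM_hermitian[of S] unfolding hermitian_mat_def
    by eventually_elim (simp add: U_def velocity_symbol_hermitian)
  have sq: "square_integrable (\<lambda>xi. 6 *\<^sub>R FM S xi)" by (intro square_integrable_scaleR square_integrable_FM)
  have "square_integrable (\<lambda>xi. norm xi *\<^sub>R U xi $ i)" for i
    by (rule square_integrable_bound(1)[OF sq]) (auto simp: U_def velocity_symbol_bound)
  then have "\<exists>f. has_fourier (\<lambda>x. cor (f x)) (\<lambda>xi. U xi $ i)" for i
    using homogeneous_fourier_surj[of "\<lambda>xi. U xi $ i"] herm[of i] by auto
  then obtain f where f: "\<And>i. has_fourier (\<lambda>x. cor (f i x)) (\<lambda>xi. U xi $ i)" by metis
  have le: "norm (\<i> * cor (xi $ i) * U xi $ j) \<le> norm (6 *\<^sub>R FM S xi)" for xi i j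
  proof -
    have "norm (\<i> * cor (xi $ i) * U xi $ j) \<le> norm xi * norm (U xi $ j)"
      by (simp add: norm_mult mult_right_mono component_le_norm_cart)
    then show ?thesis using velocity_symbol_bound[of xi "FM S xi" j] by (simp add: U_def)
  qed
  have "square_integrable (\<lambda>xi. \<i> * cor (xi $ i) * U xi $ j)" for i j
    by (rule square_integrable_bound(1)[OF sq]) (use le in auto)
  moreover have "AE xi in lborel. \<i> * cor ((- xi) $ i) * U (- xi) $ j = cnj (\<i> * cor (xi $ i) * U xi $ j)" for i j
    using herm[of j] by eventually_elim simp
  ultimately have "\<exists>h. square_integrable h \<and> has_fourier (\<lambda>x. cor (h x)) (\<lambda>xi. \<i> * cor (xi $ i) * U xi $ j)" for i j
    using hermitian_fourier_surj[of "\<lambda>xi. \<i> * cor (xi $ i) * U xi $ j"] by metis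
  then obtain h where h: "\<And>i j. square_integrable (h i j)" "\<And>i j. has_fourier (\<lambda>x. cor (h i j x)) (\<lambda>xi. \<i> * cor (xi $ i) * U xi $ j)"
    by metis
  show ?thesis
  proof (rule that[of "\<lambda>x. \<chi> i. f i x" "\<lambda>i x. \<chi> j. h i j x"])
    show "has_fourier_vec (\<lambda>x. \<chi> i. f i x) U" using f by (simp add: has_fourier_vec_def)
    show "has_partial i (\<lambda>x. \<chi> i. f i x) (\<lambda>x. \<chi> j. h i j x)" for i
      unfolding has_partial_vec_iff using fourier_has_partial[OF f h(2)] by simp
    show "square_integrable (\<lambda>x. \<chi> j. h i j x)" for i
      unfolding square_integrable_vec_iff using h(1) by simp
  qed (use h in simp)
qed

lemma velocity_data_ex: "\<exists>(u :: real^3 \<Rightarrow> real^3) (g :: 3 \<Rightarrow> real^3 \<Rightarrow> real^3). has_fourier_vec u (\<lambda>xi. velocity_symbol xi (FM S xi)) \<and>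
    (\<forall>i. has_partial i u (g i)) \<and> (\<forall>i j. has_fourier (\<lambda>x. cor (g i x $ j)) (\<lambda>xi. \<i> * cor (xi $ i) * velocity_symbol xi (FM S xi) $ j)) \<and>
    (\<forall>i. square_integrable (g i))"
  by (rule velocity_data[of S]) (intro exI conjI allI)

lemma gradient_fourier:
  assumes "\<And>i. has_partial i u (g i)" "has_fourier_vec u U"
  shows "has_fourier (\<lambda>x. cor (g i x $ j)) (\<lambda>xi. \<i> * cor (xi $ i) * U xi $ j)"
  using has_partial_fourier[OF assms(1)[of i, unfolded has_partial_vec_iff, rule_format] assms(2)[unfolded has_fourier_vec_def, rule_format]] .

lemma has_fourier_diff:
  assumes "has_fourier f F" "has_fourier g G"
  shows "has_fourier (\<lambda>x. f x - g x) (\<lambda>xi. F xi - G xi)"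
  using has_fourier_add[OF assms(1) has_fourier_cmult[OF assms(2), of "-1"]] by simp

lemma curl_fourier:
  assumes g: "\<And>i j. has_fourier (\<lambda>x. cor (g i x $ j)) (\<lambda>xi. \<i> * cor (xi $ i) * U xi $ j)"
  shows "has_fourier_vec (\<lambda>x. vector [g 2 x $ 3 - g 3 x $ 2, g 3 x $ 1 - g 1 x $ 3, g 1 x $ 2 - g 2 x $ 1]) (\<lambda>xi. curl_symbol xi (U xi))"
  unfolding has_fourier_vec_def forall_3 curl_symbol_def vector_3 of_real_diff
  by (intro conjI has_fourier_diff g)

lemma has_curl_fourier:
  assumes "has_curl u (rep_l2 w)" "has_fourier_vec u U"
  shows "has_fourier_vec (rep_l2 w) (\<lambda>xi. curl_symbol xi (U xi))"
proof -
  obtain g where g: "\<And>i. has_partial i u (g i)" and w: "AE x in lborel. rep_l2 w x =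
        vector [g 2 x $ 3 - g 3 x $ 2, g 3 x $ 1 - g 1 x $ 3, g 1 x $ 2 - g 2 x $ 1]"
    using assms(1) unfolding has_curl_def by blast
  have h: "has_fourier_vec (\<lambda>x. vector [g 2 x $ 3 - g 3 x $ 2, g 3 x $ 1 - g 1 x $ 3, g 1 x $ 2 - g 2 x $ 1]) (\<lambda>xi. curl_symbol xi (U xi))"
    by (rule curl_fourier[OF gradient_fourier[OF g assms(2)]])
  have w': "AE x in lborel. vector [g 2 x $ 3 - g 3 x $ 2, g 3 x $ 1 - g 1 x $ 3, g 1 x $ 2 - g 2 x $ 1] = rep_l2 w x"
    using w by eventually_elim simp
  show ?thesis
    by (rule has_fourier_vec_cong[OF h w'])
      (use square_integrableD(1)[OF square_integrable_rep_l2] has_fourier_vec_measurable[OF h] in auto)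
qed

text \<open>It must be shown that the description in \<open>vorticity\<close> has exactly one
  witness: \<open>velocity_data\<close> supplies one, and any other has the same transform.\<close>

theorem vorticity_fourier: "has_fourier_vec (rep_l2 (vorticity S)) (\<lambda>xi. vort_symbol xi (FM S xi))"
proof -
  obtain u :: "real^3 \<Rightarrow> real^3" and g :: "3 \<Rightarrow> real^3 \<Rightarrow> real^3" where u: "has_fourier_vec u (\<lambda>xi. velocity_symbol xi (FM S xi))"
    "\<And>i. has_partial i u (g i)" "\<And>i. square_integrable (g i)"
    using velocity_data[of S] by metis
  define c where "c x = (vector [g 2 x $ 3 - g 3 x $ 2, g 3 x $ 1 - g 1 x $ 3, g 1 x $ 2 - g 2 x $ 1] :: real^3)" for x
  have "square_integrable c"
    unfolding square_integrable_vec_iff forall_3 c_def vector_3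
    by (intro conjI square_integrable_diff u(3)[unfolded square_integrable_vec_iff, rule_format])
  then have "has_curl u (rep_l2 (abs_l2 c))"
    unfolding has_curl_def using u(2) rep_abs_l2[of c] by (intro exI[of _ g]) (auto simp: c_def)
  moreover have "is_velocity S u" using u(1) has_fourier_vec_measurable[OF u(1)] by (simp add: is_velocity_FM)
  ultimately have ex: "\<exists>u. is_velocity S u \<and> has_curl u (rep_l2 (abs_l2 c))" by blast
  have vf: "has_fourier_vec (rep_l2 w) (\<lambda>xi. vort_symbol xi (FM S xi))" if "\<exists>u. is_velocity S u \<and> has_curl u (rep_l2 w)" for w
    using that has_curl_fourier unfolding vort_symbol_def is_velocity_FM by blast
  have "\<exists>u. is_velocity S u \<and> has_curl u (rep_l2 (vorticity S))"
    unfolding vorticity_def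
  proof (rule theI[of _ "abs_l2 c"])
    fix w assume "\<exists>u. is_velocity S u \<and> has_curl u (rep_l2 w)"
    from has_fourier_vec_inj[OF vf[OF this] vf[OF ex]] show "w = abs_l2 c" by (rule rep_l2_eqI)
  qed (rule ex)
  then show ?thesis by (rule vf)
qed

text \<open>Here \<open>c\<close> is A xi and \<open>b\<close> is what remains of it after the
  projection that removes the direction of xi.\<close>

lemma Pst_symbol_nth:
  fixes xi :: "real^3" and A :: "complex^3^3"
  defines "x \<equiv> \<lambda>k. cor (xi $ k)" and "N \<equiv> cor ((norm xi)\<^sup>2)"
  defines "c \<equiv> \<lambda>i. \<Sum>j\<in>UNIV. A $ i $ j * x j"
  defines "b \<equiv> \<lambda>i. c i - x i * (\<Sum>k\<in>UNIV. x k * c k) / N"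
  shows "Pst_symbol xi A $ i $ j = (x i * b j + b i * x j) / N"
proof -
  have c: "(A *v complex_vec xi) $ i = c i" for i
    by (simp add: matrix_vector_mult_def complex_vec_def c_def x_def)
  have b: "(Pi_symbol xi *v (A *v complex_vec xi)) $ i = b i" for i
  proof -
    have "Pi_symbol xi $ i $ j = (if i = j then 1 else 0) - x i * x j / N" for j
      by (simp add: Pi_symbol_def mat_def outer_def complex_vec_def x_def N_def scaleR_conv_of_real[where 'a=complex] divide_inverse mult_ac)
    then have "(Pi_symbol xi *v (A *v complex_vec xi)) $ i = (\<Sum>j\<in>UNIV. (if i = j then c j else 0) - x i * x j / N * c j)"
      unfolding matrix_vector_mult_def[of "Pi_symbol xi"] using c
      by (simp add: left_diff_distrib if_distrib[of "\<lambda>r. r * _"] cong: if_cong)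
    also have "\<dots> = b i"
      by (simp add: sum_subtractf b_def sum_distrib_left sum_divide_distrib mult_ac)
    finally show ?thesis .
  qed
  show ?thesis
  proof -
    have "Pst_symbol xi A $ i $ j = (1 / (norm xi)\<^sup>2) *\<^sub>R (complex_vec xi $ i * (Pi_symbol xi *v (A *v complex_vec xi)) $ j
      + (Pi_symbol xi *v (A *v complex_vec xi)) $ i * complex_vec xi $ j)"
      by (simp add: Pst_symbol_def outer_def)
    also have "\<dots> = (1 / (norm xi)\<^sup>2) *\<^sub>R (x i * b j + b i * x j)"
      by (simp only: b) (simp add: complex_vec_def x_def)
    finally show ?thesis by (simp add: scaleR_conv_of_real N_def)
  qed
qed

text \<open>Only homogeneity of degree zero in xi matters; the constant is 24 for an entry, times
  nine entries.\<close>

lemma Pst_symbol_bound: "norm (Pst_symbol xi A) \<le> 216 * norm A"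
proof (cases "xi = 0")
  case True
  then have "Pst_symbol xi A = 0" by (simp add: Pst_symbol_def)
  then show ?thesis by simp
next
  case False
  then have n: "norm xi > 0" by simp
  define x where "x = (\<lambda>k. cor (xi $ k))"
  define N where "N = cor ((norm xi)\<^sup>2)"
  define c where "c i = (\<Sum>j\<in>UNIV. A $ i $ j * x j)" for i
  define s where "s = (\<Sum>k\<in>UNIV. x k * c k)"
  define b where "b i = c i - x i * s / N" for i
  have x: "norm (x k) \<le> norm xi" for k by (simp add: x_def component_le_norm_cart)
  have c: "norm (c i) \<le> 3 * (norm A * norm xi)" for i
  proof -
    have "norm (c i) \<le> (\<Sum>j\<in>(UNIV::3 set). norm A * norm xi)"
      unfolding c_def by (rule order_trans[OF norm_sum sum_mono]) (auto simp: norm_mult intro!: mult_mono x norm_entry_le)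
    then show ?thesis by simp
  qed
  have "norm s \<le> (\<Sum>k\<in>(UNIV::3 set). norm xi * (3 * (norm A * norm xi)))"
    unfolding s_def by (rule order_trans[OF norm_sum sum_mono]) (auto simp: norm_mult intro!: mult_mono x c)
  then have s: "norm s \<le> 9 * norm A * norm N" by (simp add: N_def norm_mult power2_eq_square mult_ac)
  have nN: "norm N > 0" using n by (simp add: N_def norm_power)
  have b: "norm (b i) \<le> 12 * (norm A * norm xi)" for i
  proof -
    have "norm (x i * s / N) \<le> norm xi * (9 * norm A)"
      using mult_mono[OF x[of i] s] nN by (simp add: norm_mult norm_divide divide_le_eq mult_ac)
    then show ?thesis using c[of i] norm_triangle_ineq4[of "c i" "x i * s / N"] by (simp add: b_def mult_ac)
  qed
  have e: "norm (Pst_symbol xi A $ i $ j) \<le> 24 * norm A" for i j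
  proof -
    have "norm (x i * b j + b i * x j) \<le> norm xi * (12 * (norm A * norm xi)) + 12 * (norm A * norm xi) * norm xi"
      unfolding norm_mult[symmetric]
      by (rule order_trans[OF norm_triangle_ineq], unfold norm_mult, intro add_mono mult_mono x b) auto
    also have "\<dots> = 24 * norm A * norm N" by (simp add: N_def norm_mult power2_eq_square)
    finally have "norm (x i * b j + b i * x j) / norm N \<le> 24 * norm A"
      using nN by (simp add: divide_le_eq)
    moreover have "Pst_symbol xi A $ i $ j = (x i * b j + b i * x j) / N"
      using Pst_symbol_nth[of xi A i j] by (simp only: x_def N_def c_def s_def b_def)
    ultimately show ?thesis by (simp add: norm_divide)
  qed
  have "norm (Pst_symbol xi A) \<le> (\<Sum>i\<in>(UNIV::3 set). \<Sum>j\<in>(UNIV::3 set). 24 * norm A)"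
    by (rule order_trans[OF norm_mat_le_sum]) (intro sum_mono e)
  then show ?thesis by simp
qed

lemma Pst_symbol_hermitian: "Pst_symbol (- xi) (cnj_mat A) = cnj_mat (Pst_symbol xi A)"
  by (simp add: vec_eq_iff Pst_symbol_nth cnj_mat_def sum_negf algebra_simps)

lemma Pst_symbol_add: "Pst_symbol xi (A + B) = Pst_symbol xi A + Pst_symbol xi B"
  by (simp add: Pst_symbol_def matrix_vector_mult_add_rdistrib matrix_vector_right_distrib outer_def vec_eq_iff algebra_simps)

lemma Pst_symbol_scaleR: "Pst_symbol xi (r *\<^sub>R A) = r *\<^sub>R Pst_symbol xi A"
  by (simp add: vec_eq_iff Pst_symbol_nth scaleR_conv_of_real[where 'a=complex] sum_3 algebra_simps add_divide_distrib diff_divide_distrib)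

lemma Pst_symbol_measurable[measurable]:
  assumes [measurable]: "N \<in> borel_measurable borel"
  shows "(\<lambda>xi. Pst_symbol xi (N xi)) \<in> borel_measurable borel"
  unfolding vec_borel_measurable_iff Pst_symbol_nth by (intro allI) measurable

text \<open>The symbol is determined by the vector A xi, of which it retains the transverse part.
  These two facts yield idempotence and the description of strain matrices.\<close>

lemma Pst_symbol_vec:
  assumes "xi \<noteq> 0"
  shows "(\<Sum>j\<in>UNIV. Pst_symbol xi A $ i $ j * cor (xi $ j))
      = (\<Sum>j\<in>UNIV. A $ i $ j * cor (xi $ j)) - cor (xi $ i) * (\<Sum>k\<in>UNIV. cor (xi $ k) * (\<Sum>j\<in>UNIV. A $ k $ j * cor (xi $ j))) / cor ((norm xi)\<^sup>2)"
    and "(\<Sum>i\<in>UNIV. cor (xi $ i) * (\<Sum>j\<in>UNIV. Pst_symbol xi A $ i $ j * cor (xi $ j))) = 0"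
proof -
  define x where "x = (\<lambda>k. cor (xi $ k))"
  define N where "N = cor ((norm xi)\<^sup>2)"
  define c where "c i = (\<Sum>j\<in>UNIV. A $ i $ j * x j)" for i
  define s where "s = (\<Sum>k\<in>UNIV. x k * c k)"
  define b where "b i = c i - x i * s / N" for i
  have N0: "N \<noteq> 0" using assms by (simp add: N_def)
  have xx: "(\<Sum>k\<in>UNIV. x k * x k) = N"
    unfolding N_def x_def by (rule sum_coords_squared)
  have P: "Pst_symbol xi A $ i $ j = (x i * b j + b i * x j) / N" for i j
    using Pst_symbol_nth[of xi A i j] by (simp only: x_def N_def c_def s_def b_def)
  have xb: "(\<Sum>k\<in>UNIV. x k * b k) = 0"
  proof -
    have "(\<Sum>k\<in>UNIV. x k * b k) = s - (\<Sum>k\<in>UNIV. x k * x k) * s / N"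
      by (simp add: b_def s_def right_diff_distrib sum_subtractf sum_distrib_right sum_divide_distrib mult.assoc)
    then show ?thesis using N0 by (simp add: xx)
  qed
  have v: "(\<Sum>j\<in>UNIV. Pst_symbol xi A $ i $ j * x j) = b i" for i
  proof -
    have "(\<Sum>j\<in>UNIV. Pst_symbol xi A $ i $ j * x j) = (x i * (\<Sum>j\<in>UNIV. x j * b j) + b i * (\<Sum>j\<in>UNIV. x j * x j)) / N"
      unfolding P by (simp add: sum_distrib_left sum_divide_distrib sum.distrib[symmetric] add_divide_distrib distrib_right distrib_left mult_ac)
    then show ?thesis using N0 by (simp add: xb xx)
  qed
  show "(\<Sum>j\<in>UNIV. Pst_symbol xi A $ i $ j * cor (xi $ j))
      = (\<Sum>j\<in>UNIV. A $ i $ j * cor (xi $ j)) - cor (xi $ i) * (\<Sum>k\<in>UNIV. cor (xi $ k) * (\<Sum>j\<in>UNIV. A $ k $ j * cor (xi $ j))) / cor ((norm xi)\<^sup>2)"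
    using v[of i] by (simp only: x_def N_def c_def s_def b_def)
  show "(\<Sum>i\<in>UNIV. cor (xi $ i) * (\<Sum>j\<in>UNIV. Pst_symbol xi A $ i $ j * cor (xi $ j))) = 0"
    using xb unfolding v[symmetric] by (simp only: x_def)
qed

lemma Pst_symbol_form:
  assumes "xi \<noteq> 0"
    and "(\<Sum>i\<in>UNIV. cor (xi $ i) * (\<Sum>j\<in>UNIV. A $ i $ j * cor (xi $ j))) = 0"
  shows "Pst_symbol xi A $ i $ j = (cor (xi $ i) * (\<Sum>k\<in>UNIV. A $ j $ k * cor (xi $ k)) +
    (\<Sum>k\<in>UNIV. A $ i $ k * cor (xi $ k)) * cor (xi $ j)) / cor ((norm xi)\<^sup>2)"
  using Pst_symbol_nth[of xi A i j] assms(2) by simp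

lemma Pst_symbol_idem: "Pst_symbol xi (Pst_symbol xi A) = Pst_symbol xi A"
proof (cases "xi = 0")
  case False
  then show ?thesis
    by (simp only: vec_eq_iff Pst_symbol_form[OF False Pst_symbol_vec(2)[OF False]] Pst_symbol_vec(1)[OF False])
      (simp only: Pst_symbol_nth simp_thms)
qed (simp add: Pst_symbol_def)

lemma AE_neq_0: "AE xi in lborel. (xi::real^3) \<noteq> 0"
  by (rule AE_lborel_singleton)

text \<open>Strain matrices are those whose transform has the form i (xi (x) U + U (x) xi) / 2 with
  xi . U = 0, and these are the fixed points of the symbol. Invariance under the heat flow and under
  time integrals thereby becomes pointwise algebra.\<close>

theorem L2_st_iff: "S \<in> L2_st \<longleftrightarrow> (AE xi in lborel. Pst_symbol xi (FM S xi) = FM S xi)"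
proof
  assume "S \<in> L2_st"
  \<comment> \<open>The divergence condition and the symmetric gradient each assert some weak
    gradient of \<open>u\<close>; both \<open>g\<close> and \<open>g'\<close> are kept, as their
    transforms agree.\<close>
  then obtain u U g g' where "has_fourier_vec u U" and g: "\<And>i. has_partial i u (g i)" "\<And>i. has_partial i u (g' i)"
    and div: "AE x in lborel. (\<Sum>i\<in>UNIV. g i x $ i) = 0"
    and S: "AE x in lborel. rep_l2 S x = (\<chi> i j. (g' i x $ j + g' j x $ i) / 2)"
    unfolding L2_st_def Hdot1_df_def Hdot1_vec_def divergence_free_def has_sym_grad_def by blast
  then have U: "has_fourier_vec u U" by simp
  note fg = gradient_fourier[OF g(1) U] and fg' = gradient_fourier[OF g(2) U]
  have "has_fourier (\<lambda>x. \<Sum>i\<in>UNIV. cor (g i x $ i)) (\<lambda>xi. \<Sum>i\<in>UNIV. \<i> * cor (xi $ i) * U xi $ i)"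
    by (intro has_fourier_sum fg)
  moreover have "AE x in lborel. (\<Sum>i\<in>UNIV. cor (g i x $ i)) = 0"
    using div by eventually_elim (simp flip: of_real_sum)
  ultimately have "has_fourier (\<lambda>x. 0) (\<lambda>xi. \<Sum>i\<in>UNIV. \<i> * cor (xi $ i) * U xi $ i)"
    by (rule has_fourier_cong) (use has_fourier_measurable \<open>has_fourier (\<lambda>x. \<Sum>i\<in>UNIV. _ i x) _\<close> in auto)
  then have d: "AE xi in lborel. (\<Sum>i\<in>UNIV. \<i> * cor (xi $ i) * U xi $ i) = 0"
    by (rule has_fourier_unique) (rule has_fourier_0)
  have "has_fourier_mat (rep_l2 S) (\<lambda>xi. \<chi> i j. (\<i> * cor (xi $ i) * U xi $ j + \<i> * cor (xi $ j) * U xi $ i) / 2)"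
  proof (rule has_fourier_mat_cong)
    show "has_fourier_mat (\<lambda>x. \<chi> i j. (g' i x $ j + g' j x $ i) / 2) (\<lambda>xi. \<chi> i j. (\<i> * cor (xi $ i) * U xi $ j + \<i> * cor (xi $ j) * U xi $ i) / 2)"
      unfolding has_fourier_mat_def
      using has_fourier_cmult[OF has_fourier_add[OF fg' fg'], of "1/2"] by simp
    then show "(\<lambda>xi. \<chi> i j. (\<i> * cor (xi $ i) * U xi $ j + \<i> * cor (xi $ j) * U xi $ i) / 2) \<in> borel_measurable borel"
      using has_fourier_mat_measurable by blast
    show "AE x in lborel. (\<chi> i j. (g' i x $ j + g' j x $ i) / 2) = rep_l2 S x" using S by eventually_elim simp
    show "rep_l2 S \<in> borel_measurable borel" using square_integrableD(1)[OF square_integrable_rep_l2] .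
  qed auto
  from has_fourier_mat_FM[OF this] d AE_neq_0
  show "AE xi in lborel. Pst_symbol xi (FM S xi) = FM S xi"
  proof eventually_elim
    case (elim xi)
    let ?N = "cor ((norm xi)\<^sup>2)"
    have xx: "(\<Sum>k\<in>UNIV. cor (xi $ k) * cor (xi $ k)) = ?N"
      by (rule sum_coords_squared)
    have N0: "?N \<noteq> 0" using elim by simp
    have xU: "(\<Sum>k\<in>UNIV. cor (xi $ k) * U xi $ k) = 0"
    proof -
      have "\<i> * (\<Sum>k\<in>UNIV. cor (xi $ k) * U xi $ k) = 0"
        using elim(2) by (simp only: sum_distrib_left mult.assoc)
      then show ?thesis by simp
    qed
    have A: "FM S xi $ i $ j = (\<i> * cor (xi $ i) * U xi $ j + \<i> * cor (xi $ j) * U xi $ i) / 2" for i j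
      using elim(1) by simp
    have c: "(\<Sum>k\<in>UNIV. FM S xi $ i $ k * cor (xi $ k)) = \<i> / 2 * ?N * U xi $ i" for i
    proof -
      have "(\<Sum>k\<in>UNIV. FM S xi $ i $ k * cor (xi $ k)) = \<i> / 2 * (cor (xi $ i) * (\<Sum>k\<in>UNIV. cor (xi $ k) * U xi $ k)
        + (\<Sum>k\<in>UNIV. cor (xi $ k) * cor (xi $ k)) * U xi $ i)"
        unfolding A by (simp add: sum_3 algebra_simps add_divide_distrib)
      then show ?thesis by (simp add: xU xx)
    qed
    have z: "(\<Sum>i\<in>UNIV. cor (xi $ i) * (\<Sum>j\<in>UNIV. FM S xi $ i $ j * cor (xi $ j))) = 0"
    proof -
      have "(\<Sum>i\<in>UNIV. cor (xi $ i) * (\<Sum>j\<in>UNIV. FM S xi $ i $ j * cor (xi $ j))) = \<i> / 2 * ?N * (\<Sum>k\<in>UNIV. cor (xi $ k) * U xi $ k)"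
        unfolding c sum_distrib_left by (simp only: mult_ac)
      then show ?thesis by (simp add: xU)
    qed
    have "Pst_symbol xi (FM S xi) $ i $ j = FM S xi $ i $ j" for i j
      unfolding Pst_symbol_form[OF elim(3) z] c unfolding A using N0 by (simp add: field_simps)
    then show ?case by (simp add: vec_eq_iff)
  qed
next
  assume P: "AE xi in lborel. Pst_symbol xi (FM S xi) = FM S xi"
  \<comment> \<open>The transform of the velocity -2 div (- Laplacian)^(-1) S, the only
    candidate.\<close>
  define U where "U xi = velocity_symbol xi (FM S xi)" for xi
  obtain u :: "real^3 \<Rightarrow> real^3" and g :: "3 \<Rightarrow> real^3 \<Rightarrow> real^3" where u: "has_fourier_vec u U"
    "\<And>i. has_partial i u (g i)" "\<And>i j. has_fourier (\<lambda>x. cor (g i x $ j)) (\<lambda>xi. \<i> * cor (xi $ i) * U xi $ j)"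
    "\<And>i. square_integrable (g i)"
    using velocity_data_ex[of S] unfolding U_def by blast
  have [measurable]: "U \<in> borel_measurable borel" unfolding U_def by measurable
  have sum_U: "U xi $ i = - 2 * \<i> * (\<Sum>j\<in>UNIV. FM S xi $ i $ j * cor (xi $ j)) / cor ((norm xi)\<^sup>2)" for xi i
    by (simp add: U_def velocity_symbol_def sum_3 algebra_simps)
  have "square_integrable (\<lambda>xi. norm xi *\<^sub>R U xi)"
    unfolding square_integrable_vec_iff
  proof
    fix i
    show "square_integrable (\<lambda>xi. (norm xi *\<^sub>R U xi) $ i)"
      by (rule square_integrable_bound(1)[OF square_integrable_scaleR[OF square_integrable_FM[of S], of 6]])
        (auto simp: U_def velocity_symbol_bound)
  qed
  then have "integrable lborel (\<lambda>xi. (norm xi)\<^sup>2 * (norm (U xi))\<^sup>2)"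
    by (simp add: square_integrable_def power_mult_distrib)
  then have "u \<in> Hdot1_vec"
    unfolding Hdot1_vec_def using u(1) has_fourier_vec_measurable(2)[OF u(1)] by auto
  moreover have "divergence_free u"
    unfolding divergence_free_def
  proof (intro exI[of _ g] conjI allI u(2))
    have h: "has_fourier (\<lambda>x. \<Sum>i\<in>UNIV. cor (g i x $ i)) (\<lambda>xi. \<Sum>i\<in>UNIV. \<i> * cor (xi $ i) * U xi $ i)"
      by (intro has_fourier_sum u)
    have [measurable]: "(\<lambda>x. \<Sum>i\<in>UNIV. cor (g i x $ i)) \<in> borel_measurable borel"
      using has_fourier_measurable[OF h] by auto
    have "AE xi in lborel. (\<Sum>i\<in>UNIV. \<i> * cor (xi $ i) * U xi $ i) = 0"
      using P AE_neq_0
    proof eventually_elim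
      case (elim xi)
      have "(\<Sum>i\<in>UNIV. \<i> * cor (xi $ i) * U xi $ i) = \<i> * (- 2 * \<i>) / cor ((norm xi)\<^sup>2) *
        (\<Sum>i\<in>UNIV. cor (xi $ i) * (\<Sum>j\<in>UNIV. FM S xi $ i $ j * cor (xi $ j)))"
        unfolding sum_U sum_distrib_left[of "\<i> * (- 2 * \<i>) / cor ((norm xi)\<^sup>2)"]
        by (intro sum.cong refl) (simp add: mult_ac)
      then show ?case using Pst_symbol_vec(2)[OF elim(2), of "FM S xi"] unfolding elim(1) by simp
    qed
    then have "has_fourier (\<lambda>x. \<Sum>i\<in>UNIV. cor (g i x $ i)) (\<lambda>xi. 0)"
      by (intro has_fourier_cong[OF h]) auto
    from has_fourier_inj[OF this has_fourier_0]
    show "AE x in lborel. (\<Sum>i\<in>UNIV. g i x $ i) = 0"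
      by eventually_elim (simp flip: of_real_sum)
  qed
  moreover have "has_sym_grad u (rep_l2 S)"
    unfolding has_sym_grad_def
  proof (intro exI[of _ g] conjI allI u(2))
    let ?M = "\<lambda>x. \<chi> i j. (g i x $ j + g j x $ i) / 2"
    have h: "has_fourier_mat ?M (\<lambda>xi. \<chi> i j. (\<i> * cor (xi $ i) * U xi $ j + \<i> * cor (xi $ j) * U xi $ i) / 2)"
      unfolding has_fourier_mat_def
      using has_fourier_cmult[OF has_fourier_add[OF u(3) u(3)], of "1/2"] by simp
    have "has_fourier_mat ?M (FM S)"
    proof (rule has_fourier_mat_cong[OF h])
      show "AE xi in lborel. (\<chi> i j. (\<i> * cor (xi $ i) * U xi $ j + \<i> * cor (xi $ j) * U xi $ i) / 2) = FM S xi"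
        using P AE_neq_0
      proof eventually_elim
        case (elim xi)
        have z: "(\<Sum>i\<in>UNIV. cor (xi $ i) * (\<Sum>j\<in>UNIV. FM S xi $ i $ j * cor (xi $ j))) = 0"
          using Pst_symbol_vec(2)[OF elim(2), of "FM S xi"] unfolding elim(1) .
        have "FM S xi $ i $ j = (\<i> * cor (xi $ i) * U xi $ j + \<i> * cor (xi $ j) * U xi $ i) / 2" for i j
          using Pst_symbol_form[OF elim(2) z, of i j] unfolding elim(1) sum_U by (simp add: algebra_simps add_divide_distrib)
        then show ?case by (simp add: vec_eq_iff)
      qed
    qed (use has_fourier_mat_measurable[OF h] in auto)
    from has_fourier_mat_inj[OF FM this]
    show "AE x in lborel. rep_l2 S x = ?M x" .
  qed
  ultimately show "S \<in> L2_st" unfolding L2_st_def Hdot1_df_def by blast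
qed

section \<open>The quadratic term\<close>

lemma rep_l2_measurable[measurable]: "rep_l2 f \<in> borel_measurable borel"
  using square_integrableD(1)[OF square_integrable_rep_l2] .

lemma vort_symbol_bound: "norm (vort_symbol xi A $ k) \<le> 12 * norm A"
proof -
  let ?U = "velocity_symbol xi A"
  have b: "norm (\<i> * cor (xi $ i) * ?U $ j) \<le> 6 * norm A" for i j
  proof -
    have "norm (\<i> * cor (xi $ i) * ?U $ j) \<le> norm xi * norm (?U $ j)"
      by (simp add: norm_mult mult_right_mono component_le_norm_cart)
    then show ?thesis using velocity_symbol_bound[of xi A j] by linarith
  qed
  have d: "norm (\<i> * cor (xi $ i) * ?U $ j - \<i> * cor (xi $ i') * ?U $ j') \<le> 12 * norm A" for i j i' j'
    using norm_triangle_ineq4[of "\<i> * cor (xi $ i) * ?U $ j" "\<i> * cor (xi $ i') * ?U $ j'"] b[of i j] b[of i' j'] by linarith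
  have "\<forall>k. norm (vort_symbol xi A $ k) \<le> 12 * norm A"
    unfolding forall_3 vort_symbol_def curl_symbol_def vector_3 using d by blast
  then show ?thesis by blast
qed

definition WV :: "matrix_l2 \<Rightarrow> real^3 \<Rightarrow> complex^3" where
  "WV S xi = vort_symbol xi (FM S xi)"

lemma WV: "has_fourier_vec (rep_l2 (vorticity S)) (WV S)"
  unfolding WV_def[abs_def] by (rule vorticity_fourier)

lemma WV_measurable[measurable]: "WV S \<in> borel_measurable borel"
  using has_fourier_vec_measurable[OF WV] by blast

lemma WV_bound: "norm (WV S xi $ k) \<le> 12 * norm (FM S xi)"
  unfolding WV_def by (rule vort_symbol_bound)

lemma velocity_symbol_add: "velocity_symbol xi (A + B) = velocity_symbol xi A + velocity_symbol xi B"
  by (simp add: velocity_symbol_def vec_eq_iff sum_3 algebra_simps add_divide_distrib diff_divide_distrib)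

lemma velocity_symbol_diff: "velocity_symbol xi (A - B) = velocity_symbol xi A - velocity_symbol xi B"
  using velocity_symbol_add[of xi "A - B" B] by simp

lemma vort_symbol_diff: "vort_symbol xi (A - B) = vort_symbol xi A - vort_symbol xi B"
  by (simp add: vort_symbol_def curl_symbol_def velocity_symbol_diff vec_eq_iff forall_3 vector_3 algebra_simps)

lemma vorticity_diff_rep: "AE x in lborel. rep_l2 (vorticity (S - T)) x = rep_l2 (vorticity S) x - rep_l2 (vorticity T) x"
proof (rule has_fourier_vec_inj[OF WV])
  have h: "has_fourier_vec (\<lambda>x. rep_l2 (vorticity S) x - rep_l2 (vorticity T) x) (\<lambda>xi. WV S xi - WV T xi)"
    using has_fourier_diff[OF WV[of S, unfolded has_fourier_vec_def, rule_format] WV[of T, unfolded has_fourier_vec_def, rule_format]]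
    by (simp add: has_fourier_vec_def)
  show "has_fourier_vec (\<lambda>x. rep_l2 (vorticity S) x - rep_l2 (vorticity T) x) (WV (S - T))"
  proof (rule has_fourier_vec_cong[OF h])
    show "AE xi in lborel. WV S xi - WV T xi = WV (S - T) xi"
      using FM_diff[of S T] by eventually_elim (simp add: WV_def vort_symbol_diff)
  qed (use has_fourier_vec_measurable[OF h] in auto)
qed

definition vprod :: "matrix_l2 \<Rightarrow> matrix_l2 \<Rightarrow> real^3 \<Rightarrow> real^3^3" where
  "vprod S T x = outer (rep_l2 (vorticity S) x) (rep_l2 (vorticity T) x)"

text \<open>Products of two functions in L^2 are integrable, so the transform is given by an
  integral at every xi; it is a representative of the merely chosen
  \<open>fourier_mat (vprod S T)\<close>.\<close>

definition PT :: "matrix_l2 \<Rightarrow> matrix_l2 \<Rightarrow> real^3 \<Rightarrow> complex^3^3" where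
  "PT S T xi = (\<chi> i j. fourier_L1 (\<lambda>x. cor (rep_l2 (vorticity S) x $ i) * cor (rep_l2 (vorticity T) x $ j)) xi)"

lemma square_integrable_vort: "square_integrable (\<lambda>x. cor (rep_l2 (vorticity S) x $ i))"
  using square_integrable_rep_l2[of "vorticity S"] unfolding square_integrable_of_real square_integrable_vec_iff by blast

lemma has_fourier_vort: "has_fourier (\<lambda>x. cor (rep_l2 (vorticity S) x $ i)) (\<lambda>xi. WV S xi $ i)"
  using WV unfolding has_fourier_vec_def by blast

lemma PT: "has_fourier_mat (vprod S T) (PT S T)"
  unfolding has_fourier_mat_def vprod_def outer_def PT_def
  using has_fourier_L1[OF l2_mult(1)[OF square_integrable_vort square_integrable_vort]] by simp

lemma PT_measurable[measurable]: "PT S T \<in> borel_measurable borel"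
  using has_fourier_mat_measurable[OF PT] by blast

lemma PT_fourier: "AE xi in lborel. fourier_mat (vprod S T) xi = PT S T xi"
  by (rule has_fourier_mat_unique[OF has_fourier_mat_fourier_mat[OF PT] PT])

lemma PT_diff_left: "PT (S - S') T xi = PT S T xi - PT S' T xi"
proof -
  have "fourier_L1 (\<lambda>x. cor (rep_l2 (vorticity (S - S')) x $ i) * cor (rep_l2 (vorticity T) x $ j)) xi
    = fourier_L1 (\<lambda>x. cor (rep_l2 (vorticity S) x $ i) * cor (rep_l2 (vorticity T) x $ j)
      - cor (rep_l2 (vorticity S') x $ i) * cor (rep_l2 (vorticity T) x $ j)) xi" for i j
  proof -
    show ?thesis unfolding fourier_L1_def
      by (rule integral_cong_AE, measurable) (use vorticity_diff_rep[of S S'] in eventually_elim, simp only: vector_minus_component of_real_diff left_diff_distrib right_diff_distrib)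
  qed
  then show ?thesis
    by (simp add: PT_def vec_eq_iff fourier_L1_diff l2_mult(1)[OF square_integrable_vort square_integrable_vort])
qed

lemma PT_diff_right: "PT S (T - T') xi = PT S T xi - PT S T' xi"
proof -
  have "fourier_L1 (\<lambda>x. cor (rep_l2 (vorticity S) x $ i) * cor (rep_l2 (vorticity (T - T')) x $ j)) xi
    = fourier_L1 (\<lambda>x. cor (rep_l2 (vorticity S) x $ i) * cor (rep_l2 (vorticity T) x $ j)
      - cor (rep_l2 (vorticity S) x $ i) * cor (rep_l2 (vorticity T') x $ j)) xi" for i j
  proof -
    show ?thesis unfolding fourier_L1_def
      by (rule integral_cong_AE, measurable) (use vorticity_diff_rep[of T T'] in eventually_elim, simp only: vector_minus_component of_real_diff left_diff_distrib right_diff_distrib)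
  qed
  then show ?thesis
    by (simp add: PT_def vec_eq_iff fourier_L1_diff l2_mult(1)[OF square_integrable_vort square_integrable_vort])
qed

text \<open>Subadditivity up to the factor \<open>c\<close> is what a convolution tolerates.
  Boundedness puts all of L^2 into the domain of the weight.\<close>

definition subadd_weight :: "real \<Rightarrow> (real^3 \<Rightarrow> real) \<Rightarrow> bool" where
  "subadd_weight c k \<longleftrightarrow> even_weight k \<and> (\<exists>C. \<forall>xi. k xi \<le> C) \<and> (\<forall>xi. 0 \<le> k xi) \<and> 0 \<le> c \<and> (\<forall>xi eta. k (xi + eta) \<le> c * (k xi + k eta))"

lemma subadd_weight_dom: "subadd_weight c k \<Longrightarrow> mul_dom k S"
  unfolding subadd_weight_def using mul_dom_bounded[of k] by (metis abs_of_nonneg)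

section \<open>Weighted bounds for the transform of the vorticity product\<close>

lemma square_integrable_shift:
  fixes f :: "real^3 \<Rightarrow> 'b::euclidean_space"
  assumes f: "square_integrable f"
  shows "square_integrable (\<lambda>eta. f (eta + a))" "l2norm (\<lambda>eta. f (eta + a)) = l2norm f"
proof -
  note m = square_integrableD[OF f]
  have [measurable]: "f \<in> borel_measurable borel" by (rule m)
  have "integrable lborel (\<lambda>eta. (\<lambda>eta. (norm (f eta))\<^sup>2) (a + eta))"
    by (subst lborel_translate_integrable) (use m in auto)
  then show "square_integrable (\<lambda>eta. f (eta + a))" by (simp add: square_integrable_def add.commute)
  have "(LBINT eta. (\<lambda>eta. (norm (f eta))\<^sup>2) (a + eta)) = (LBINT eta. (norm (f eta))\<^sup>2)"
    by (rule lborel_translate) measurable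
  then show "l2norm (\<lambda>eta. f (eta + a)) = l2norm f" by (simp add: l2norm_def add.commute)
qed

lemma square_integrable_reflect:
  fixes f :: "real^3 \<Rightarrow> 'b::euclidean_space"
  assumes f: "square_integrable f"
  shows "square_integrable (\<lambda>eta. f (- eta))" "l2norm (\<lambda>eta. f (- eta)) = l2norm f"
proof -
  note m = square_integrableD[OF f]
  have [measurable]: "f \<in> borel_measurable borel" by (rule m)
  show "square_integrable (\<lambda>eta. f (- eta))"
    using lborel_reflect_integrable[OF m(2)] by (simp add: square_integrable_def)
  have "(LBINT eta. (\<lambda>eta. (norm (f eta))\<^sup>2) (- eta)) = (LBINT eta. (norm (f eta))\<^sup>2)"
    by (rule lborel_reflect) measurable
  then show "l2norm (\<lambda>eta. f (- eta)) = l2norm f" by (simp add: l2norm_def)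
qed

lemma l2norm_scaled: "c \<ge> 0 \<Longrightarrow> l2norm (\<lambda>x. c *\<^sub>R f x) = c * l2norm f"
  by (simp add: l2norm_def power_mult_distrib real_sqrt_mult)

lemma weighted_WV:
  assumes k: "even_weight k" "mul_dom k S"
  shows "square_integrable (\<lambda>xi. k xi *\<^sub>R WV S xi $ i)" "l2norm (\<lambda>xi. k xi *\<^sub>R WV S xi $ i) \<le> 12 * cG * norm (mul k S)"
proof -
  have [measurable]: "k \<in> borel_measurable borel" by (rule even_weightD[OF k(1)])
  have s: "square_integrable (\<lambda>xi. 12 *\<^sub>R (k xi *\<^sub>R FM S xi))"
    using k(2) unfolding mul_dom_def by (rule square_integrable_scaleR)
  have le: "norm (k xi *\<^sub>R WV S xi $ i) \<le> norm (12 *\<^sub>R (k xi *\<^sub>R FM S xi))" for xi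
    using mult_left_mono[OF WV_bound[of S xi i], of "\<bar>k xi\<bar>"] by simp
  show "square_integrable (\<lambda>xi. k xi *\<^sub>R WV S xi $ i)"
    by (rule square_integrable_bound(1)[OF s]) (use le in auto)
  have "l2norm (\<lambda>xi. k xi *\<^sub>R WV S xi $ i) \<le> l2norm (\<lambda>xi. 12 *\<^sub>R (k xi *\<^sub>R FM S xi))"
    by (rule square_integrable_bound(2)[OF s]) (use le in auto)
  also have "\<dots> = 12 * (cG * norm (mul k S))" unfolding norm_mul[OF k] by (rule l2norm_scaled) simp
  finally show "l2norm (\<lambda>xi. k xi *\<^sub>R WV S xi $ i) \<le> 12 * cG * norm (mul k S)" by simp
qed

text \<open>A subadditive weight of \<open>xi = (eta + xi) + (-eta)\<close> can be distributed over the two factors of the convolution.\<close>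

lemma PT_weighted_bound:
  assumes k: "subadd_weight c k"
  shows "k xi * norm (PT S T xi) \<le> 1296 * c * (norm (mul k S) * norm T + norm S * norm (mul k T))"
proof -
  have ek: "even_weight k" and k0: "\<And>xi. 0 \<le> k xi" and c: "0 \<le> c" and sub: "\<And>xi eta. k (xi + eta) \<le> c * (k xi + k eta)"
    using k by (auto simp: subadd_weight_def)
  have e1: "even_weight (\<lambda>xi. 1)" by (simp add: even_weight_def)
  note kS = weighted_WV[OF ek subadd_weight_dom[OF k]]
  have d1: "mul_dom (\<lambda>xi. 1) S" for S by (rule mul_dom_bounded[OF e1, of 1]) simp
  note W = weighted_WV[OF e1 d1, unfolded mul_1 scaleR_one]
  \<comment> \<open>Each vorticity transform costs a factor 12 over the strain, whence 144; nine
    entries give 1296. The two factors \<open>cG\<close> from the L^2 norms cancel against the one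
    in the convolution formula.\<close>
  let ?B = "144 * c * (norm (mul k S) * norm T + norm S * norm (mul k T))"
  have e: "k xi * norm (PT S T xi $ i $ j) \<le> ?B" for i j
  proof -
    let ?F = "\<lambda>eta. WV S eta $ i" and ?G = "\<lambda>eta. WV T eta $ j"
    let ?h1 = "\<lambda>eta. norm (k (eta + xi) *\<^sub>R ?F (eta + xi)) * norm (?G (- eta))"
    let ?h2 = "\<lambda>eta. norm (?F (eta + xi)) * norm (k (- eta) *\<^sub>R ?G (- eta))"
    note cs1 = l2norm_Cauchy_Schwarz[OF square_integrable_shift(1)[OF kS(1)[where S=S and i=i], where a=xi] square_integrable_reflect(1)[OF W(1)[where S=T and i=j]]]
    note cs2 = l2norm_Cauchy_Schwarz[OF square_integrable_shift(1)[OF W(1)[where S=S and i=i], where a=xi] square_integrable_reflect(1)[OF kS(1)[where S=T and i=j]]]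
    have i: "integrable lborel (\<lambda>eta. c * (?h1 eta + ?h2 eta))"
      using cs1(1) cs2(1) by (intro integrable_mult_right Bochner_Integration.integrable_add)
    have "cor (cG\<^sup>2) * PT S T xi $ i $ j = (LBINT eta. ?F (eta + xi) * ?G (- eta))"
      unfolding PT_def using fourier_L1_convolution[OF square_integrable_vort has_fourier_vort square_integrable_vort has_fourier_vort] by simp
    then have "cG\<^sup>2 * (k xi * norm (PT S T xi $ i $ j)) = norm (LBINT eta. k xi *\<^sub>R (?F (eta + xi) * ?G (- eta)))"
      using k0[of xi] cG_pos by (simp add: norm_mult norm_power flip: \<open>cor (cG\<^sup>2) * _ = _\<close>)
    also have "\<dots> \<le> (LBINT eta. c * (?h1 eta + ?h2 eta))"
    proof (rule lint_norm_bound[OF i])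
      fix eta
      have "k xi \<le> c * (k (eta + xi) + k (- eta))" using sub[of "eta + xi" "- eta"] by simp
      then have "k xi * (norm (?F (eta + xi)) * norm (?G (- eta))) \<le> c * (k (eta + xi) + k (- eta)) * (norm (?F (eta + xi)) * norm (?G (- eta)))"
        by (rule mult_right_mono) auto
      then show "norm (k xi *\<^sub>R (?F (eta + xi) * ?G (- eta))) \<le> c * (?h1 eta + ?h2 eta)"
        using k0 by (simp add: norm_mult algebra_simps)
    qed
    also have "\<dots> = c * ((LBINT eta. ?h1 eta) + (LBINT eta. ?h2 eta))"
      using cs1(1) cs2(1) by simp
    also have "\<dots> \<le> c * ((12 * cG * norm (mul k S)) * (12 * cG * norm T) + (12 * cG * norm S) * (12 * cG * norm (mul k T)))"
    proof (intro mult_left_mono add_mono c)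
      show "(LBINT eta. ?h1 eta) \<le> (12 * cG * norm (mul k S)) * (12 * cG * norm T)"
        using cs1(2) unfolding square_integrable_shift(2)[OF kS(1)] square_integrable_reflect(2)[OF W(1)]
        by (rule order_trans) (intro mult_mono kS(2) W(2), use cG_pos in auto)
      show "(LBINT eta. ?h2 eta) \<le> (12 * cG * norm S) * (12 * cG * norm (mul k T))"
        using cs2(2) unfolding square_integrable_shift(2)[OF W(1)] square_integrable_reflect(2)[OF kS(1)]
        by (rule order_trans) (intro mult_mono kS(2) W(2), use cG_pos in auto)
    qed
    also have "\<dots> = cG\<^sup>2 * ?B" by (simp add: power2_eq_square algebra_simps)
    finally show ?thesis using cG_pos by simp
  qed
  have "k xi * norm (PT S T xi) \<le> k xi * (\<Sum>i\<in>UNIV. \<Sum>j\<in>UNIV. norm (PT S T xi $ i $ j))"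
    by (intro mult_left_mono norm_mat_le_sum k0)
  also have "\<dots> = (\<Sum>i\<in>UNIV. \<Sum>j\<in>UNIV. k xi * norm (PT S T xi $ i $ j))" by (simp add: sum_distrib_left)
  also have "\<dots> \<le> (\<Sum>i\<in>(UNIV::3 set). \<Sum>j\<in>(UNIV::3 set). ?B)" by (intro sum_mono e)
  also have "\<dots> = 1296 * c * (norm (mul k S) * norm T + norm S * norm (mul k T))" by simp
  finally show ?thesis .
qed

text \<open>The polarized interaction term, so that differences of the quadratic term can be
  telescoped.\<close>

definition Bil :: "real \<Rightarrow> matrix_l2 \<Rightarrow> matrix_l2 \<Rightarrow> matrix_l2" where
  "Bil t S T = heat_Pst t (vprod S T)"

lemma heat_Pst_vort_tensor: "heat_Pst t (vort_tensor S) = Bil t S S"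
  by (simp add: Bil_def vprod_def[abs_def] vort_tensor_def[abs_def])

lemma subadd_weight_1: "subadd_weight 1 (\<lambda>xi. 1)"
  by (auto simp: subadd_weight_def even_weight_def)

lemma heat_kernel_scale: "exp (- t * (norm xi)\<^sup>2) = gauss (sqrt (2 * t) *\<^sub>R xi)" if "t \<ge> 0"
  using that by (simp add: gauss_def power_mult_distrib)

text \<open>The squared kernel is a Gaussian scaled by sqrt (4 t). The power -3/4 exceeds -1, which
  is the source of all integrability in time.\<close>

lemma heat_kernel_l2:
  assumes t: "t > 0"
  shows "square_integrable (\<lambda>xi::real^3. exp (- t * (norm xi)\<^sup>2))" "l2norm (\<lambda>xi::real^3. exp (- t * (norm xi)\<^sup>2)) \<le> sqrt cG * t powr (-3/4)"
proof -
  have e: "(norm (exp (- t * (norm xi)\<^sup>2)))\<^sup>2 = gauss (sqrt (4 * t) *\<^sub>R xi)" for xi :: "real^3"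
  proof -
    have "(norm (exp (- t * (norm xi)\<^sup>2)))\<^sup>2 = exp (- (2 * t) * (norm xi)\<^sup>2)"
      by (simp add: power2_eq_square exp_add[symmetric])
    also have "\<dots> = gauss (sqrt (2 * (2 * t)) *\<^sub>R xi)" using t by (intro heat_kernel_scale) simp
    finally show ?thesis by simp
  qed
  have i: "integrable lborel (\<lambda>xi. gauss (sqrt (4 * t) *\<^sub>R xi))"
    using t by (intro lborel_scale_integrable integrable_gauss) simp
  show "square_integrable (\<lambda>xi::real^3. exp (- t * (norm xi)\<^sup>2))"
    unfolding square_integrable_def e using i by simp
  have "(LBINT xi. gauss (sqrt (4 * t) *\<^sub>R xi)) = (1 / \<bar>sqrt (4 * t)\<bar> ^ 3) *\<^sub>R integral\<^sup>L lborel gauss"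
    using t by (intro lborel_scale) auto
  also have "\<dots> = cG / (sqrt (4 * t)) ^ 3" using t by (simp add: integral_gauss)
  also have "\<dots> \<le> cG / (sqrt t) ^ 3"
    using t cG_pos by (intro divide_left_mono power_mono) auto
  also have "\<dots> = cG * t powr (-3/2)"
  proof -
    have "sqrt t ^ 3 = t powr (1/2) * t powr (1/2) * t powr (1/2)"
      using t by (simp add: powr_half_sqrt power3_eq_cube)
    also have "\<dots> = t powr (3/2)" unfolding powr_add[symmetric] by simp
    finally have e3: "sqrt t ^ 3 = t powr (3/2)" .
    have "t powr (-3/2) = 1 / t powr (3/2)" using powr_minus_divide[of t "3/2"] by simp
    then show ?thesis unfolding e3 by (simp only: times_divide_eq_right mult_1_right)
  qed
  finally have "l2norm (\<lambda>xi::real^3. exp (- t * (norm xi)\<^sup>2)) \<le> sqrt (cG * t powr (-3/2))"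
    unfolding l2norm_def e by (rule real_sqrt_le_mono)
  also have "\<dots> = sqrt cG * t powr (-3/4)"
  proof -
    have "sqrt (t powr (-3/2)) = (t powr (-3/2)) powr (1/2)" by (rule powr_half_sqrt[symmetric]) simp
    then show ?thesis by (simp add: real_sqrt_mult powr_powr)
  qed
  finally show "l2norm (\<lambda>xi::real^3. exp (- t * (norm xi)\<^sup>2)) \<le> sqrt cG * t powr (-3/4)" .
qed

text \<open>The transform of the product is merely bounded, but the heat factor is square integrable
  for t > 0, so their product is the transform of an element of L^2.\<close>

lemma FM_Bil:
  assumes t: "t > 0"
  shows "AE xi in lborel. FM (Bil t S T) xi = exp (- t * (norm xi)\<^sup>2) *\<^sub>R Pst_symbol xi (PT S T xi)"
proof -
  let ?N = "\<lambda>xi. exp (- t * (norm xi)\<^sup>2) *\<^sub>R Pst_symbol xi (PT S T xi)"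
  let ?N' = "\<lambda>xi. heat_symbol t xi (Pst_symbol xi (fourier_mat (vprod S T) xi))"
  have [measurable]: "fourier_mat (vprod S T) \<in> borel_measurable borel"
    using has_fourier_mat_measurable[OF has_fourier_mat_fourier_mat[OF PT]] by blast
  have eq: "AE xi in lborel. ?N' xi = ?N xi"
    using PT_fourier[of S T] by eventually_elim (simp add: heat_symbol_def)
  define C where "C = 216 * (1296 * (norm S * norm T + norm S * norm T))"
  have le: "norm (?N xi) \<le> norm (C *\<^sub>R exp (- t * (norm xi)\<^sup>2))" for xi
  proof -
    have "norm (PT S T xi) \<le> 1296 * (norm S * norm T + norm S * norm T)"
      using PT_weighted_bound[OF subadd_weight_1, where xi=xi and S=S and T=T] by (simp add: mul_1)
    then have "norm (Pst_symbol xi (PT S T xi)) \<le> C"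
      using Pst_symbol_bound[of xi "PT S T xi"] unfolding C_def by linarith
    moreover have "C \<ge> 0" by (simp add: C_def)
    ultimately show ?thesis by (simp add: mult.commute mult_left_mono)
  qed
  have sN: "square_integrable ?N"
    by (rule square_integrable_bound(1)[OF square_integrable_scaleR[OF heat_kernel_l2(1)[OF t], of C]]) (use le in auto)
  have "square_integrable ?N'"
    by (rule square_integrable_bound(1)[OF sN]) (use eq in \<open>auto simp: heat_symbol_def elim: AE_mp\<close>)
  moreover have "hermitian_mat ?N'"
    using has_fourier_mat_hermitian[OF has_fourier_mat_fourier_mat[OF PT], of S T] unfolding hermitian_mat_def
    by eventually_elim (simp add: heat_symbol_def Pst_symbol_hermitian, simp add: cnj_mat_def vec_eq_iff)
  ultimately have "AE xi in lborel. FM (Bil t S T) xi = ?N' xi"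
    unfolding Bil_def heat_Pst_def by (rule multiplier_fourier)
  with eq show ?thesis by eventually_elim simp
qed

text \<open>The weight \<open>m\<close> is shared out: \<open>p\<close> is charged to the heat
  kernel, whose L^2 norm carries the singularity in time, and \<open>k\<close> is distributed over
  the two vorticities. The estimates of \<open>Bil\<close> below are choices of \<open>m\<close>,
  \<open>k\<close> and \<open>p\<close>.\<close>

lemma Bil_weight:
  assumes t: "t > 0" and k: "subadd_weight c k" and m: "even_weight m"
    and p: "square_integrable (\<lambda>xi. p xi * exp (- t * (norm xi)\<^sup>2))" "\<And>xi. 0 \<le> p xi"
    and le: "AE xi in lborel. \<bar>m xi\<bar> \<le> p xi * k xi"
  shows "mul_dom m (Bil t S T)"
    and "norm (mul m (Bil t S T)) \<le> 216 * 1296 / cG * c * l2norm (\<lambda>xi. p xi * exp (- t * (norm xi)\<^sup>2)) *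
      (norm (mul k S) * norm T + norm S * norm (mul k T))"
proof -
  have [measurable]: "m \<in> borel_measurable borel" by (rule even_weightD[OF m])
  have c: "0 \<le> c" using k by (simp add: subadd_weight_def)
  define C where "C = 216 * (1296 * c * (norm (mul k S) * norm T + norm S * norm (mul k T)))"
  have C: "C \<ge> 0" using c by (simp add: C_def)
  let ?e = "\<lambda>xi. exp (- t * (norm xi)\<^sup>2)"
  have s: "square_integrable (\<lambda>xi. C *\<^sub>R (p xi * ?e xi))" by (rule square_integrable_scaleR[OF p(1)])
  have b: "AE xi in lborel. norm (m xi *\<^sub>R FM (Bil t S T) xi) \<le> norm (C *\<^sub>R (p xi * ?e xi))"
    using FM_Bil[OF t, of S T] le
  proof eventually_elim
    case (elim xi)
    have "norm (m xi *\<^sub>R FM (Bil t S T) xi) = \<bar>m xi\<bar> * (?e xi * norm (Pst_symbol xi (PT S T xi)))"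
      using elim(1) by (simp add: abs_mult)
    also have "\<dots> \<le> (p xi * k xi) * (?e xi * (216 * norm (PT S T xi)))"
      by (intro mult_mono elim(2) Pst_symbol_bound order_refl) (use p(2) k in \<open>auto simp: subadd_weight_def\<close>)
    also have "\<dots> = p xi * ?e xi * (216 * (k xi * norm (PT S T xi)))" by simp
    also have "\<dots> \<le> p xi * ?e xi * C" unfolding C_def
      by (intro mult_left_mono PT_weighted_bound[OF k] mult_nonneg_nonneg p(2)) auto
    finally show ?case using C p(2) by (simp add: mult.commute)
  qed
  show d: "mul_dom m (Bil t S T)"
    unfolding mul_dom_def by (rule square_integrable_bound(1)[OF s _ b]) measurable
  have "cG * norm (mul m (Bil t S T)) \<le> l2norm (\<lambda>xi. C *\<^sub>R (p xi * ?e xi))"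
    unfolding norm_mul[OF m d] by (rule square_integrable_bound(2)[OF s _ b]) measurable
  also have "\<dots> = C * l2norm (\<lambda>xi. p xi * ?e xi)" by (rule l2norm_scaled[OF C])
  finally show "norm (mul m (Bil t S T)) \<le> 216 * 1296 / cG * c * l2norm (\<lambda>xi. p xi * ?e xi) *
      (norm (mul k S) * norm T + norm S * norm (mul k T))"
    using cG_pos by (simp add: C_def field_simps)
qed

lemma Bil_diff_left: "t > 0 \<Longrightarrow> Bil t (S - S') T = Bil t S T - Bil t S' T"
proof (rule FM_eqI)
  assume t: "t > 0"
  have d: "Pst_symbol xi (A - B) = Pst_symbol xi A - Pst_symbol xi B" for xi A B
    using Pst_symbol_add[of xi "A - B" B] by simp
  show "AE xi in lborel. FM (Bil t (S - S') T) xi = FM (Bil t S T - Bil t S' T) xi"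
    using FM_Bil[OF t, of "S - S'" T] FM_Bil[OF t, of S T] FM_Bil[OF t, of S' T] FM_diff[of "Bil t S T" "Bil t S' T"]
    by eventually_elim (simp add: PT_diff_left d scaleR_diff_right)
qed

lemma Bil_diff_right: "t > 0 \<Longrightarrow> Bil t S (T - T') = Bil t S T - Bil t S T'"
proof (rule FM_eqI)
  assume t: "t > 0"
  have d: "Pst_symbol xi (A - B) = Pst_symbol xi A - Pst_symbol xi B" for xi A B
    using Pst_symbol_add[of xi "A - B" B] by simp
  show "AE xi in lborel. FM (Bil t S (T - T')) xi = FM (Bil t S T - Bil t S T') xi"
    using FM_Bil[OF t, of S "T - T'"] FM_Bil[OF t, of S T] FM_Bil[OF t, of S T'] FM_diff[of "Bil t S T" "Bil t S T'"]
    by eventually_elim (simp add: PT_diff_right d scaleR_diff_right)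
qed

section \<open>Weighted estimates\<close>

text \<open>|xi|^(1/4), worth t^(-1/8) under parabolic scaling: -3/4 - 1/8 = -7/8 is still
  integrable. Four such factors make one derivative, so \<open>qp 4\<close> is |xi| and
  \<open>qp 8\<close> is the symbol of minus the Laplacian.\<close>

definition qw :: "real^3 \<Rightarrow> real" where "qw xi = sqrt (sqrt (norm xi))"

abbreviation qp :: "nat \<Rightarrow> real^3 \<Rightarrow> real" where "qp n \<equiv> (\<lambda>xi. qw xi ^ n)"

lemma qw_nonneg[simp]: "0 \<le> qw xi" by (simp add: qw_def)
lemma qw_uminus[simp]: "qw (- xi) = qw xi" by (simp add: qw_def)
lemma qw_measurable[measurable]: "qw \<in> borel_measurable borel"
  unfolding qw_def[abs_def] by measurable

lemma qw_pow4: "qw xi ^ 4 = norm xi"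
proof -
  have "qw xi ^ 4 = ((qw xi)\<^sup>2)\<^sup>2" by (simp add: power_mult[symmetric])
  then show ?thesis by (simp add: qw_def)
qed

lemma qw_pow8: "qw xi ^ 8 = (norm xi)\<^sup>2"
  unfolding qw_pow4[symmetric] by (simp add: power_mult[symmetric])

lemma qw_add: "qw (xi + eta) \<le> qw xi + qw eta"
proof -
  have "qw (xi + eta) \<le> sqrt (sqrt (norm xi + norm eta))"
    unfolding qw_def by (intro real_sqrt_le_mono norm_triangle_ineq)
  also have "\<dots> \<le> sqrt (sqrt (norm xi) + sqrt (norm eta))"
    by (intro real_sqrt_le_mono sqrt_add_le_add_sqrt) auto
  also have "\<dots> \<le> qw xi + qw eta" unfolding qw_def by (intro sqrt_add_le_add_sqrt) auto
  finally show ?thesis .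
qed

lemma powr_eighth_pow: "t > 0 \<Longrightarrow> (t powr (1/8)) ^ 8 = (t::real)"
  using powr_realpow[of "t powr (1/8)" 8] by (simp add: powr_powr)

text \<open>The eighth power of the left side is t |xi|^2. Only half of the heat exponent is spent
  on the weight; the other half remains as a kernel.\<close>

lemma qw_heat: "t > 0 \<Longrightarrow> qw xi * t powr (1/8) \<le> 2 * exp (t * (norm xi)\<^sup>2 / 2)"
proof -
  assume t: "t > 0"
  define s where "s = qw xi * t powr (1/8)"
  have s: "s \<ge> 0" "s ^ 8 = t * (norm xi)\<^sup>2"
    using t by (simp_all add: s_def power_mult_distrib qw_pow8 powr_eighth_pow mult.commute)
  have "s \<le> 1 + s ^ 8"
  proof (cases "s \<le> 1")
    case True
    have "0 \<le> s ^ 8" using s(1) by simp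
    then show ?thesis using True by linarith
  next
    case False
    then have "s ^ 1 \<le> s ^ 8" by (intro power_increasing) auto
    then show ?thesis by simp
  qed
  also have "\<dots> \<le> 2 * (1 + s ^ 8 / 2)" by simp
  also have "\<dots> \<le> 2 * exp (s ^ 8 / 2)" by (intro mult_left_mono exp_ge_add_one_self) auto
  finally show ?thesis unfolding s by (simp add: s_def)
qed

text \<open>Truncation at height \<open>R\<close> puts every element of L^2 into the domain and lets
  the operator commute with the time integral, while the subadditivity constant 2^n of its powers
  does not depend on \<open>R\<close>.\<close>

definition wt :: "real \<Rightarrow> nat \<Rightarrow> real^3 \<Rightarrow> real" where "wt R n xi = (min (qw xi) R) ^ n"

lemma wt_even: "even_weight (wt R n)"
  by (simp add: even_weight_def wt_def[abs_def])

lemma wt_nonneg: "R \<ge> 0 \<Longrightarrow> 0 \<le> wt R n xi" by (simp add: wt_def)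

lemma wt_le: "R \<ge> 0 \<Longrightarrow> wt R n xi \<le> R ^ n" by (simp add: wt_def power_mono)

lemma wt_abs_le: "R \<ge> 0 \<Longrightarrow> \<bar>wt R n xi\<bar> \<le> R ^ n" using wt_le wt_nonneg by simp

lemma wt_subadd:
  assumes "R \<ge> 0" shows "subadd_weight (2 ^ n) (wt R n)"
  unfolding subadd_weight_def
proof (intro conjI allI)
  show "\<exists>C. \<forall>xi. wt R n xi \<le> C" using wt_le[OF assms] by blast
  fix xi eta :: "real^3"
  have "min (qw (xi + eta)) R \<le> min (qw xi) R + min (qw eta) R"
    using qw_add[of xi eta] assms qw_nonneg[of xi] qw_nonneg[of eta] by linarith
  then have "wt R n (xi + eta) \<le> (min (qw xi) R + min (qw eta) R) ^ n"
    unfolding wt_def using assms by (intro power_mono) auto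
  also have "\<dots> \<le> 2 ^ n * (wt R n xi + wt R n eta)"
    unfolding wt_def using assms by (intro add_power_le) auto
  finally show "wt R n (xi + eta) \<le> 2 ^ n * (wt R n xi + wt R n eta)" .
qed (use wt_even wt_nonneg[OF assms] in auto)

lemma wt_0[simp]: "wt R 0 = (\<lambda>xi. 1)" by (simp add: wt_def fun_eq_iff)

lemma wt_Suc_le: "R \<ge> 0 \<Longrightarrow> wt R (Suc n) xi \<le> qw xi * wt R n xi"
  unfolding wt_def power_Suc by (intro mult_right_mono) auto

lemma wt_dom: "R \<ge> 0 \<Longrightarrow> mul_dom (wt R n) S"
  by (rule mul_dom_bounded[OF wt_even wt_abs_le])

lemma wt_bounded_linear: "R \<ge> 0 \<Longrightarrow> bounded_linear (mul (wt R n))"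
  by (rule bounded_linear_mul[OF wt_even wt_abs_le])

section \<open>Norms of weighted heat kernels and bounds for the interaction term\<close>

lemma qw_heat_l2:
  assumes t: "t > 0"
  shows "square_integrable (\<lambda>xi. qw xi * exp (- t * (norm xi)\<^sup>2))"
    "l2norm (\<lambda>xi. qw xi * exp (- t * (norm xi)\<^sup>2)) \<le> 4 * sqrt cG * t powr (-7/8)"
proof -
  let ?c = "2 / t powr (1/8)"
  have c: "?c \<ge> 0" by simp
  have t2: "t / 2 > 0" using t by simp
  have le: "norm (qw xi * exp (- t * (norm xi)\<^sup>2)) \<le> norm (?c *\<^sub>R exp (- (t / 2) * (norm xi)\<^sup>2))" for xi
  proof -
    have "qw xi \<le> ?c * exp (t * (norm xi)\<^sup>2 / 2)" using qw_heat[OF t, of xi] t by (simp add: field_simps)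
    then have "qw xi * exp (- t * (norm xi)\<^sup>2) \<le> ?c * exp (t * (norm xi)\<^sup>2 / 2) * exp (- t * (norm xi)\<^sup>2)"
      by (rule mult_right_mono) simp
    also have "\<dots> = ?c * exp (- (t / 2) * (norm xi)\<^sup>2)"
      unfolding mult.assoc exp_add[symmetric] by (simp add: field_simps)
    finally show ?thesis by (simp add: abs_mult)
  qed
  have s: "square_integrable (\<lambda>xi::real^3. ?c *\<^sub>R exp (- (t / 2) * (norm xi)\<^sup>2))"
    by (intro square_integrable_scaleR heat_kernel_l2(1) t2)
  show "square_integrable (\<lambda>xi. qw xi * exp (- t * (norm xi)\<^sup>2))"
    by (rule square_integrable_bound(1)[OF s]) (use le in auto)
  have "l2norm (\<lambda>xi. qw xi * exp (- t * (norm xi)\<^sup>2)) \<le> l2norm (\<lambda>xi::real^3. ?c *\<^sub>R exp (- (t / 2) * (norm xi)\<^sup>2))"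
    by (rule square_integrable_bound(2)[OF s]) (use le in auto)
  also have "\<dots> = ?c * l2norm (\<lambda>xi::real^3. exp (- (t / 2) * (norm xi)\<^sup>2))" by (rule l2norm_scaled[OF c])
  also have "\<dots> \<le> ?c * (sqrt cG * (t / 2) powr (-3/4))"
    by (intro mult_left_mono heat_kernel_l2(2) t2 c)
  also have "\<dots> \<le> ?c * (sqrt cG * (2 * t powr (-3/4)))"
  proof (intro mult_left_mono c)
    have "(t / 2) powr (-3/4) = t powr (-3/4) * (1/2) powr (-3/4)"
      using t by (simp add: powr_mult[symmetric])
    also have "(1/2::real) powr (-3/4) \<le> (1/2) powr (-1)" by (intro powr_mono') auto
    also have "(1/2::real) powr (-1) = 2" by (simp add: powr_minus)
    finally show "(t / 2) powr (-3/4) \<le> 2 * t powr (-3/4)" using t by (simp add: mult.commute mult_left_mono)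
  qed (use cG_pos in simp)
  also have "?c * (sqrt cG * (2 * t powr (-3/4))) = 4 * sqrt cG * (t powr (-3/4) / t powr (1/8))" by simp
  also have "t powr (-3/4) / t powr (1/8) = t powr (-7/8)" unfolding powr_diff[symmetric] by simp
  finally show "l2norm (\<lambda>xi. qw xi * exp (- t * (norm xi)\<^sup>2)) \<le> 4 * sqrt cG * t powr (-7/8)" .
qed

definition lowK :: real where "lowK = l2norm (\<lambda>xi::real^3. indicator (ball 0 1) xi * inverse (norm xi))"

text \<open>\<open>wt 1 4\<close> is min(|xi|, 1). Its inverse is square integrable on the unit ball
  of three-dimensional space and equals 1 outside, where the heat kernel takes over.\<close>

lemma low_heat_l2:
  assumes t: "t > 0"
  shows "square_integrable (\<lambda>xi. inverse (wt 1 4 xi) * exp (- t * (norm xi)\<^sup>2))"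
    "l2norm (\<lambda>xi. inverse (wt 1 4 xi) * exp (- t * (norm xi)\<^sup>2)) \<le> lowK + sqrt cG * t powr (-3/4)"
proof -
  let ?a = "\<lambda>xi::real^3. indicator (ball 0 1) xi * inverse (norm xi) :: real"
  let ?b = "\<lambda>xi::real^3. exp (- t * (norm xi)\<^sup>2)"
  have [measurable]: "wt R n \<in> borel_measurable borel" for R n by (rule even_weightD[OF wt_even])
  have w4: "wt 1 4 xi = min (norm xi) 1" for xi
  proof (cases "qw xi \<le> 1")
    case True
    then have "qw xi ^ 4 \<le> 1" by (intro power_le_one) auto
    then show ?thesis using True by (simp add: wt_def qw_pow4)
  next
    case False
    then have "1 ^ 4 \<le> qw xi ^ 4" by (intro power_mono) auto
    then show ?thesis using False by (simp add: wt_def qw_pow4)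
  qed
  have le: "norm (inverse (wt 1 4 xi) * ?b xi) \<le> norm (?a xi + ?b xi)" for xi
  proof (cases "norm xi < 1")
    case True
    have "inverse (norm xi) * ?b xi \<le> inverse (norm xi) * 1" using t by (intro mult_left_mono) auto
    then show ?thesis using True exp_gt_zero[of "- t * (norm xi)\<^sup>2"]
      by (simp add: w4 min_def add_increasing2 del: exp_gt_zero)
  qed (simp add: w4 min_def)
  have s: "square_integrable (\<lambda>xi. ?a xi + ?b xi)"
    by (intro square_integrable_add square_integrable_inverse_norm heat_kernel_l2(1) t)
  show "square_integrable (\<lambda>xi. inverse (wt 1 4 xi) * ?b xi)"
    by (rule square_integrable_bound(1)[OF s]) (use le in auto)
  have "l2norm (\<lambda>xi. inverse (wt 1 4 xi) * ?b xi) \<le> l2norm (\<lambda>xi. ?a xi + ?b xi)"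
    by (rule square_integrable_bound(2)[OF s]) (use le in auto)
  also have "\<dots> \<le> lowK + l2norm ?b"
    unfolding lowK_def by (intro l2norm_triangle square_integrable_inverse_norm heat_kernel_l2(1) t)
  also have "\<dots> \<le> lowK + sqrt cG * t powr (-3/4)" using heat_kernel_l2(2)[OF t] by simp
  finally show "l2norm (\<lambda>xi. inverse (wt 1 4 xi) * ?b xi) \<le> lowK + sqrt cG * t powr (-3/4)" .
qed

definition bN :: "(real^3 \<Rightarrow> real) \<Rightarrow> matrix_l2 \<Rightarrow> matrix_l2 \<Rightarrow> real" where
  "bN k S T = norm (mul k S) * norm T + norm S * norm (mul k T)"

lemma bN_nonneg[simp]: "0 \<le> bN k S T" by (simp add: bN_def)

text \<open>One constant that dominates the plain kernel, the kernel times \<open>qw\<close> and the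
  low-frequency kernel; 216 comes from the projection symbol and 1296 from the convolution.\<close>

definition CB :: real where "CB = 216 * 1296 / cG * 16 * (4 * sqrt cG + lowK + 1)"

lemma lowK_nonneg: "0 \<le> lowK" by (simp add: lowK_def)

lemma CB_pos: "CB > 0"
  unfolding CB_def using cG_pos lowK_nonneg by (intro mult_pos_pos divide_pos_pos) (auto intro: add_nonneg_pos)

lemma CB_bound:
  assumes "x \<le> (4 * sqrt cG + lowK + 1) * y" "0 \<le> y" "0 \<le> c"
  shows "216 * 1296 / cG * c * x * bN k S T \<le> CB * c * y * bN k S T"
proof -
  have a: "0 \<le> (4 * sqrt cG + lowK + 1) * y" using assms(2) lowK_nonneg cG_pos by simp
  have "216 * 1296 / cG * c * x * bN k S T \<le> 216 * 1296 / cG * c * ((4 * sqrt cG + lowK + 1) * y) * bN k S T"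
    using assms cG_pos by (intro mult_right_mono mult_left_mono) auto
  also have "\<dots> \<le> 16 * (216 * 1296 / cG * c * ((4 * sqrt cG + lowK + 1) * y) * bN k S T)"
  proof -
    have "0 \<le> 216 * 1296 / cG * c * ((4 * sqrt cG + lowK + 1) * y) * bN k S T"
      using a assms cG_pos by (intro mult_nonneg_nonneg[OF mult_nonneg_nonneg[OF mult_nonneg_nonneg]]) auto
    moreover have "X \<le> 16 * X" if "0 \<le> X" for X :: real using that by simp
    ultimately show ?thesis by blast
  qed
  also have "\<dots> = CB * c * y * bN k S T" by (simp add: CB_def)
  finally show ?thesis .
qed

lemma Bil_wt:
  assumes t: "t > 0" and R: "R \<ge> 0"
  shows "norm (mul (wt R n) (Bil t S T)) \<le> CB * 2 ^ n * t powr (-3/4) * bN (wt R n) S T"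
proof -
  have "norm (mul (wt R n) (Bil t S T)) \<le> 216 * 1296 / cG * 2 ^ n * l2norm (\<lambda>xi::real^3. 1 * exp (- t * (norm xi)\<^sup>2)) * bN (wt R n) S T"
    unfolding bN_def
    by (rule Bil_weight(2)[OF t wt_subadd[OF R] wt_even]) (use heat_kernel_l2(1)[OF t] wt_nonneg[OF R] in auto)
  also have "\<dots> \<le> CB * 2 ^ n * t powr (-3/4) * bN (wt R n) S T"
  proof (rule CB_bound)
    have "sqrt cG * t powr (-3/4) \<le> (4 * sqrt cG + lowK + 1) * t powr (-3/4)"
      using lowK_nonneg cG_pos by (intro mult_right_mono) auto
    then show "l2norm (\<lambda>xi::real^3. 1 * exp (- t * (norm xi)\<^sup>2)) \<le> (4 * sqrt cG + lowK + 1) * t powr (-3/4)"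
      using heat_kernel_l2(2)[OF t] by simp
  qed auto
  finally show ?thesis .
qed

text \<open>The extra factor \<open>qw\<close> is charged to the heat kernel, so a quarter of a
  derivative is gained at the price of the singularity t^(-7/8).\<close>

lemma Bil_wt_gain:
  assumes t: "t > 0" and R: "R \<ge> 0"
  shows "norm (mul (wt R (Suc n)) (Bil t S T)) \<le> CB * 2 ^ n * t powr (-7/8) * bN (wt R n) S T"
proof -
  have "norm (mul (wt R (Suc n)) (Bil t S T)) \<le> 216 * 1296 / cG * 2 ^ n * l2norm (\<lambda>xi. qw xi * exp (- t * (norm xi)\<^sup>2)) * bN (wt R n) S T"
    unfolding bN_def
    by (rule Bil_weight(2)[OF t wt_subadd[OF R] wt_even qw_heat_l2(1)[OF t]]) (use wt_nonneg[OF R] wt_Suc_le[OF R] in auto)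
  also have "\<dots> \<le> CB * 2 ^ n * t powr (-7/8) * bN (wt R n) S T"
  proof (rule CB_bound)
    have "4 * sqrt cG * t powr (-7/8) \<le> (4 * sqrt cG + lowK + 1) * t powr (-7/8)"
      using lowK_nonneg cG_pos by (intro mult_right_mono) auto
    then show "l2norm (\<lambda>xi. qw xi * exp (- t * (norm xi)\<^sup>2)) \<le> (4 * sqrt cG + lowK + 1) * t powr (-7/8)"
      using qw_heat_l2(2)[OF t] by simp
  qed auto
  finally show ?thesis .
qed

text \<open>\<open>Bil_weight\<close> with \<open>m = 1\<close>, \<open>k\<close> = min(|xi|, 1) and
  \<open>p\<close> its inverse: in each term of the bound one factor is measured only through |xi|,
  so a bound on the H^1 norm makes the estimate linear in the L^2 norm.\<close>

lemma Bil_low: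
  assumes t: "t > 0"
  shows "norm (Bil t S T) \<le> CB * 16 * (1 + t powr (-3/4)) * bN (wt 1 4) S T"
proof -
  have "norm (mul (\<lambda>xi. 1) (Bil t S T)) \<le> 216 * 1296 / cG * 2 ^ 4 * l2norm (\<lambda>xi. inverse (wt 1 4 xi) * exp (- t * (norm xi)\<^sup>2)) * bN (wt 1 4) S T"
    unfolding bN_def
  proof (rule Bil_weight(2)[OF t wt_subadd _ low_heat_l2(1)[OF t]])
    \<comment> \<open>The origin has to be excepted, as the weight and its inverse both vanish
      there.\<close>
    show "AE xi in lborel. \<bar>1\<bar> \<le> inverse (wt 1 4 xi) * wt 1 4 xi"
      using AE_neq_0 by eventually_elim (simp add: wt_def qw_def min_def)
  qed (auto simp: even_weight_def wt_nonneg)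
  also have "\<dots> \<le> CB * 2 ^ 4 * (1 + t powr (-3/4)) * bN (wt 1 4) S T"
  proof (rule CB_bound)
    have p: "t powr (-3/4) \<ge> 0" by simp
    have "lowK + sqrt cG * t powr (-3/4) \<le> (4 * sqrt cG + lowK + 1) * (1 + t powr (-3/4))"
      using lowK_nonneg cG_pos p mult_nonneg_nonneg[OF lowK_nonneg p] by (simp add: algebra_simps)
    then show "l2norm (\<lambda>xi. inverse (wt 1 4 xi) * exp (- t * (norm xi)\<^sup>2)) \<le> (4 * sqrt cG + lowK + 1) * (1 + t powr (-3/4))"
      using low_heat_l2(2)[OF t] by simp
  qed auto
  finally show ?thesis by (simp add: mul_1)
qed

lemma bN_1: "bN (\<lambda>xi. 1) S T = 2 * norm S * norm T"
  by (simp add: bN_def mul_1)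

lemma Bil_bound:
  assumes t: "t > 0"
  shows "norm (Bil t S T) \<le> 2 * CB * t powr (-3/4) * norm S * norm T"
  using Bil_wt[OF t, of 0 0 S T] by (simp add: mul_1 bN_1 mult_ac)

section \<open>Heat semigroup, regularity in time, projection\<close>

lemma heat_weight: "even_weight (\<lambda>xi. exp (- t * (norm xi)\<^sup>2))"
  by (simp add: even_weight_def)

lemma heat_weight_le: "t \<ge> 0 \<Longrightarrow> \<bar>exp (- t * (norm xi)\<^sup>2)\<bar> \<le> 1"
  by simp

lemma FM_heat: "t \<ge> 0 \<Longrightarrow> AE xi in lborel. FM (heat t S) xi = exp (- t * (norm xi)\<^sup>2) *\<^sub>R FM S xi"
  unfolding heat_eq_mul by (rule FM_mul[OF heat_weight mul_dom_bounded[OF heat_weight heat_weight_le]])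

lemma heat_bounded_linear: "t \<ge> 0 \<Longrightarrow> bounded_linear (heat t)"
  unfolding heat_eq_mul by (rule bounded_linear_mul[OF heat_weight heat_weight_le])

lemma norm_heat: "t \<ge> 0 \<Longrightarrow> norm (heat t S) \<le> norm S"
  using norm_mul_bounded[OF heat_weight heat_weight_le, of t S] by (simp add: heat_eq_mul)

lemma heat_0: "heat 0 S = S"
  by (simp add: heat_eq_mul mul_1)

lemma heat_heat: "s \<ge> 0 \<Longrightarrow> t \<ge> 0 \<Longrightarrow> heat s (heat t S) = heat (s + t) S"
proof (rule FM_eqI)
  assume st: "s \<ge> 0" "t \<ge> 0"
  show "AE xi in lborel. FM (heat s (heat t S)) xi = FM (heat (s + t) S) xi"
    using FM_heat[OF st(1), of "heat t S"] FM_heat[OF st(2), of S] FM_heat[OF add_nonneg_nonneg[OF st], of S]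
    by eventually_elim (simp add: exp_add[symmetric] algebra_simps)
qed

lemma heat_Bil: "s \<ge> 0 \<Longrightarrow> t > 0 \<Longrightarrow> heat s (Bil t S T) = Bil (s + t) S T"
proof (rule FM_eqI)
  assume st: "s \<ge> 0" "t > 0"
  show "AE xi in lborel. FM (heat s (Bil t S T)) xi = FM (Bil (s + t) S T) xi"
    using FM_heat[OF st(1), of "Bil t S T"] FM_Bil[OF st(2), of S T] FM_Bil[OF add_nonneg_pos[OF st], of S T]
    by eventually_elim (simp add: exp_add[symmetric] algebra_simps)
qed

text \<open>The difference is \<open>Bil t S T\<close> under the multiplier exp (- h |xi|^2) - 1,
  whose modulus 1 - exp (- s^8) is at most s = h^(1/8) |xi|^(1/4). Half a step of smoothing in time
  is thus bought with the integrable singularity t^(-7/8).\<close>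

lemma Bil_holder:
  assumes t: "t > 0" and h: "h > 0"
  shows "norm (Bil (t + h) S T - Bil t S T) \<le> 2 * CB * h powr (1/8) * t powr (-7/8) * norm S * norm T"
proof -
  let ?m = "\<lambda>xi::real^3. exp (- h * (norm xi)\<^sup>2) - 1"
  have em: "even_weight ?m" by (simp add: even_weight_def)
  have "AE xi in lborel. FM (Bil (t + h) S T - Bil t S T) xi = ?m xi *\<^sub>R FM (Bil t S T) xi"
    using FM_diff[of "Bil (t + h) S T" "Bil t S T"] FM_Bil[OF t, of S T] FM_Bil[OF add_pos_pos[OF t h], of S T]
    by eventually_elim (simp add: scaleR_left_diff_distrib exp_add[symmetric] algebra_simps)
  from mul_eqI(1)[OF this em] have e: "Bil (t + h) S T - Bil t S T = mul ?m (Bil t S T)" by simp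
  let ?p = "\<lambda>xi. h powr (1/8) * qw xi"
  have pe: "(\<lambda>xi. ?p xi * exp (- t * (norm xi)\<^sup>2)) = (\<lambda>xi. h powr (1/8) *\<^sub>R (qw xi * exp (- t * (norm xi)\<^sup>2)))"
    by (simp add: mult.assoc)
  have le: "\<bar>?m xi\<bar> \<le> ?p xi * 1" for xi
  proof -
    define s where "s = ?p xi"
    have s: "s \<ge> 0" "s ^ 8 = h * (norm xi)\<^sup>2"
      using h by (simp_all add: s_def power_mult_distrib qw_pow8 powr_eighth_pow)
    have 1: "\<bar>?m xi\<bar> = 1 - exp (- (s ^ 8))" using h s by simp
    have 2: "1 - exp (- (s ^ 8)) \<le> s ^ 8" using exp_ge_add_one_self[of "- (s ^ 8)"] by linarith
    have "1 - exp (- (s ^ 8)) \<le> s"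
    proof (cases "s \<le> 1")
      case True
      then have "s ^ 8 \<le> s ^ 1" using s(1) by (intro power_decreasing) auto
      then show ?thesis using 2 by simp
    next
      case False then show ?thesis using exp_gt_zero[of "- (s ^ 8)"] by linarith
    qed
    then show ?thesis unfolding 1 by (simp add: s_def)
  qed
  have sq: "square_integrable (\<lambda>xi. ?p xi * exp (- t * (norm xi)\<^sup>2))"
    unfolding pe by (intro square_integrable_scaleR qw_heat_l2(1) t)
  have "norm (mul ?m (Bil t S T)) \<le> 216 * 1296 / cG * 1 * l2norm (\<lambda>xi. ?p xi * exp (- t * (norm xi)\<^sup>2)) * bN (\<lambda>xi. 1) S T"
    unfolding bN_def
    by (rule Bil_weight(2)[OF t subadd_weight_1 em sq]) (use le in auto)
  also have "\<dots> \<le> CB * 1 * (h powr (1/8) * t powr (-7/8)) * bN (\<lambda>xi. 1) S T"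
  proof (rule CB_bound)
    have "l2norm (\<lambda>xi. ?p xi * exp (- t * (norm xi)\<^sup>2)) = h powr (1/8) * l2norm (\<lambda>xi. qw xi * exp (- t * (norm xi)\<^sup>2))"
      unfolding pe by (rule l2norm_scaled) simp
    also have "\<dots> \<le> h powr (1/8) * (4 * sqrt cG * t powr (-7/8))"
      by (intro mult_left_mono qw_heat_l2(2) t) simp
    also have "\<dots> = 4 * sqrt cG * (h powr (1/8) * t powr (-7/8))" by simp
    also have "\<dots> \<le> (4 * sqrt cG + lowK + 1) * (h powr (1/8) * t powr (-7/8))"
      using lowK_nonneg by (intro mult_right_mono) auto
    finally show "l2norm (\<lambda>xi. ?p xi * exp (- t * (norm xi)\<^sup>2)) \<le> (4 * sqrt cG + lowK + 1) * (h powr (1/8) * t powr (-7/8))" .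
  qed auto
  finally show ?thesis unfolding e by (simp add: bN_1 mult_ac)
qed

lemma heat_wt:
  assumes "t \<ge> 0" "R \<ge> 0"
  shows "norm (mul (wt R n) (heat t S)) \<le> norm (mul (wt R n) S)"
proof (rule norm_mul_mono(2)[OF wt_even wt_dom[OF assms(2)] wt_even])
  show "AE xi in lborel. norm (wt R n xi *\<^sub>R FM (heat t S) xi) \<le> norm (wt R n xi *\<^sub>R FM S xi)"
    using FM_heat[OF assms(1), of S]
  proof eventually_elim
    case (elim xi)
    have "exp (- t * (norm xi)\<^sup>2) * norm (FM S xi) \<le> 1 * norm (FM S xi)"
      using assms(1) by (intro mult_right_mono) auto
    from mult_left_mono[OF this, of "\<bar>wt R n xi\<bar>"] show ?case unfolding elim by (simp add: abs_mult mult.assoc)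
  qed
qed

lemma heat_wt_gain:
  assumes t: "t > 0" and R: "R \<ge> 0"
  shows "norm (mul (wt R (Suc n)) (heat t S)) \<le> 2 * t powr (-1/8) * norm (mul (wt R n) S)"
proof -
  let ?c = "2 * t powr (-1/8)"
  have d: "mul_dom (wt R n) (?c *\<^sub>R S)" by (rule wt_dom[OF R])
  have "norm (mul (wt R (Suc n)) (heat t S)) \<le> norm (mul (wt R n) (?c *\<^sub>R S))"
  proof (rule norm_mul_mono(2)[OF wt_even d wt_even])
    show "AE xi in lborel. norm (wt R (Suc n) xi *\<^sub>R FM (heat t S) xi) \<le> norm (wt R n xi *\<^sub>R FM (?c *\<^sub>R S) xi)"
      using FM_heat[OF less_imp_le[OF t], of S] FM_scaleR[of ?c S]
    proof eventually_elim
      case (elim xi)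
      have "qw xi * t powr (1/8) * exp (- t * (norm xi)\<^sup>2) \<le> 2 * exp (t * (norm xi)\<^sup>2 / 2) * exp (- t * (norm xi)\<^sup>2)"
        by (intro mult_right_mono qw_heat t) simp
      also have "\<dots> = 2 * exp (- (t * (norm xi)\<^sup>2 / 2))"
        unfolding mult.assoc exp_add[symmetric] by (simp add: field_simps)
      also have "\<dots> \<le> 2 * 1" using t by (intro mult_left_mono) auto
      finally have a: "qw xi * exp (- t * (norm xi)\<^sup>2) \<le> ?c"
        using t by (simp add: powr_minus field_simps)
      have "wt R (Suc n) xi * exp (- t * (norm xi)\<^sup>2) \<le> (qw xi * wt R n xi) * exp (- t * (norm xi)\<^sup>2)"
        by (intro mult_right_mono wt_Suc_le R) simp
      also have "\<dots> = wt R n xi * (qw xi * exp (- t * (norm xi)\<^sup>2))" by simp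
      also have "\<dots> \<le> wt R n xi * ?c" by (intro mult_left_mono a wt_nonneg R)
      finally have "wt R (Suc n) xi * exp (- t * (norm xi)\<^sup>2) * norm (FM S xi) \<le> wt R n xi * ?c * norm (FM S xi)"
        by (rule mult_right_mono) simp
      then show ?case using elim wt_nonneg[OF R] by (simp add: mult_ac)
    qed
  qed
  also have "\<dots> = ?c * norm (mul (wt R n) S)"
    by (simp add: mul_scaleR(1)[OF wt_even wt_dom[OF R]])
  finally show ?thesis .
qed

text \<open>Dominated convergence on the Fourier side, with the squared transform of
  \<open>S\<close> itself as majorant. The endpoint 0 is included.\<close>

lemma heat_continuous: "continuous_on {0..} (\<lambda>t. heat t S)"
  unfolding continuous_on_sequentially o_def
proof (intro ballI allI impI)
  fix x :: "nat \<Rightarrow> real" and a assume a: "a \<in> {0..}" and "(\<forall>n. x n \<in> {0..}) \<and> x \<longlonglongrightarrow> a"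
  then have x: "\<And>n. x n \<ge> 0" "x \<longlonglongrightarrow> a" by auto
  let ?F = "\<lambda>n xi. exp (- x n * (norm xi)\<^sup>2) *\<^sub>R FM S xi" and ?G = "\<lambda>xi. exp (- a * (norm xi)\<^sup>2) *\<^sub>R FM S xi"
  have "(\<lambda>n. l2norm (\<lambda>xi. ?F n xi - ?G xi)) \<longlonglongrightarrow> 0"
  proof (rule dominated_l2[where w="\<lambda>xi. (norm (FM S xi))\<^sup>2"])
    show "AE xi in lborel. (\<lambda>n. ?F n xi) \<longlonglongrightarrow> ?G xi"
      by (intro AE_I2 tendsto_intros x)
    show "integrable lborel (\<lambda>xi. (norm (FM S xi))\<^sup>2)" by (rule square_integrableD(2)[OF square_integrable_FM])
    have "norm (?F n xi - ?G xi) \<le> norm (FM S xi)" for n xi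
    proof -
      have "\<bar>exp (- x n * (norm xi)\<^sup>2) - exp (- a * (norm xi)\<^sup>2)\<bar> \<le> 1"
      proof -
        have "exp (- x n * (norm xi)\<^sup>2) \<le> 1" "exp (- a * (norm xi)\<^sup>2) \<le> 1" using a x(1)[of n] by auto
        then show ?thesis using exp_gt_zero[of "- x n * (norm xi)\<^sup>2"] exp_gt_zero[of "- a * (norm xi)\<^sup>2"] by linarith
      qed
      from mult_right_mono[OF this, of "norm (FM S xi)"] show ?thesis
        unfolding scaleR_left_diff_distrib[symmetric] by simp
    qed
    then show "AE xi in lborel. (norm (?F n xi - ?G xi))\<^sup>2 \<le> (norm (FM S xi))\<^sup>2" for n
      by (auto intro!: AE_I2 power_mono)
  qed auto
  moreover have "l2norm (\<lambda>xi. ?F n xi - ?G xi) = cG * norm (heat (x n) S - heat a S)" for n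
  proof -
    have "AE xi in lborel. norm (?F n xi - ?G xi) = norm (FM (heat (x n) S - heat a S) xi)"
      using FM_heat[OF x(1), of n S] FM_heat[of a S, OF a[unfolded atLeast_iff]] FM_diff[of "heat (x n) S" "heat a S"]
      by eventually_elim simp
    from l2norm_cong_AE[OF this] show ?thesis by (simp add: l2norm_FM)
  qed
  ultimately have "(\<lambda>n. cG * norm (heat (x n) S - heat a S)) \<longlonglongrightarrow> 0" by simp
  from tendsto_mult_left[OF this, of "1 / cG"] cG_pos
  have "(\<lambda>n. norm (heat (x n) S - heat a S)) \<longlonglongrightarrow> 0" by simp
  then show "(\<lambda>n. heat (x n) S) \<longlonglongrightarrow> heat a S" by (rule LIM_zero_cancel[OF tendsto_norm_zero_cancel])
qed

text \<open>The projection on L^2, where it is a bounded operator. Its fixed points are the strain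
  matrices, so the projection can be pulled through integrals to keep solutions in that
  space.\<close>

definition Pst :: "matrix_l2 \<Rightarrow> matrix_l2" where "Pst S = multiplier Pst_symbol (rep_l2 S)"

lemma FM_Pst: "AE xi in lborel. FM (Pst S) xi = Pst_symbol xi (FM S xi)"
  unfolding Pst_def
proof (rule multiplier_fourier[of Pst_symbol "rep_l2 S", folded FM_def])
  show "square_integrable (\<lambda>xi. Pst_symbol xi (FM S xi))"
    by (rule square_integrable_bound(1)[OF square_integrable_scaleR[OF square_integrable_FM, of 216]])
      (use Pst_symbol_bound in auto)
  show "hermitian_mat (\<lambda>xi. Pst_symbol xi (FM S xi))"
    using FM_hermitian[of S] unfolding hermitian_mat_def by eventually_elim (simp add: Pst_symbol_hermitian)
qed

lemma L2_st_Pst: "S \<in> L2_st \<longleftrightarrow> Pst S = S"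
proof
  assume "S \<in> L2_st"
  then have "AE xi in lborel. FM (Pst S) xi = FM S xi"
    using FM_Pst[of S] unfolding L2_st_iff by eventually_elim simp
  then show "Pst S = S" by (rule FM_eqI)
next
  assume "Pst S = S"
  then show "S \<in> L2_st" using FM_Pst[of S] unfolding L2_st_iff by (simp add: eq_commute)
qed

lemma Pst_bounded_linear: "bounded_linear Pst"
proof (rule bounded_linear_intro[of _ 216])
  show "Pst (S + T) = Pst S + Pst T" for S T
    by (rule FM_eqI) (use FM_Pst[of "S + T"] FM_Pst[of S] FM_Pst[of T] FM_add[of S T] FM_add[of "Pst S" "Pst T"] in eventually_elim, simp add: Pst_symbol_add)
  show "Pst (r *\<^sub>R S) = r *\<^sub>R Pst S" for r S
    by (rule FM_eqI) (use FM_Pst[of "r *\<^sub>R S"] FM_Pst[of S] FM_scaleR[of r S] FM_scaleR[of r "Pst S"] in eventually_elim, simp add: Pst_symbol_scaleR)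
  show "norm (Pst S) \<le> norm S * 216" for S
  proof -
    have "l2norm (FM (Pst S)) \<le> l2norm (\<lambda>xi. 216 *\<^sub>R FM S xi)"
    proof (rule square_integrable_bound(2)[OF square_integrable_scaleR[OF square_integrable_FM]])
      show "AE xi in lborel. norm (FM (Pst S) xi) \<le> norm (216 *\<^sub>R FM S xi)"
        using FM_Pst[of S] by eventually_elim (use Pst_symbol_bound in simp)
    qed measurable
    also have "\<dots> = 216 * l2norm (FM S)" by (rule l2norm_scaled) simp
    finally show ?thesis using cG_pos by (simp add: l2norm_FM)
  qed
qed

lemma L2_st_subspace: "subspace L2_st"
proof -
  interpret bounded_linear Pst by (rule Pst_bounded_linear)
  show ?thesis unfolding subspace_def using L2_st_Pst add scaleR zero by auto
qed

lemma heat_L2_st: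
  assumes "t \<ge> 0" "S \<in> L2_st"
  shows "heat t S \<in> L2_st"
  unfolding L2_st_iff using FM_heat[OF assms(1), of S] assms(2)[unfolded L2_st_iff]
  by eventually_elim (simp add: Pst_symbol_scaleR)

lemma Bil_L2_st:
  assumes "t > 0"
  shows "Bil t S T \<in> L2_st"
  unfolding L2_st_iff using FM_Bil[OF assms, of S T]
  by eventually_elim (simp add: Pst_symbol_scaleR Pst_symbol_idem)

section \<open>The Duhamel integral\<close>

lemma kernel_has_integral:
  fixes a b d p :: real
  assumes "a \<le> d" "d \<le> b" "-1 < p"
  shows "((\<lambda>x. (b - x) powr p) has_integral (((b - a) powr (p + 1) - (b - d) powr (p + 1)) / (p + 1))) {a..d}"
proof -
  let ?G = "\<lambda>x. - ((b - x) powr (p + 1) / (p + 1))"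
  have "((\<lambda>x. (b - x) powr p) has_integral (?G d - ?G a)) {a..d}"
  proof (rule fundamental_theorem_of_calculus_interior[OF assms(1)])
    show "continuous_on {a..d} ?G"
      using assms by (intro continuous_intros continuous_on_powr') auto
    fix x assume x: "x \<in> {a<..<d}"
    then have "b - x > 0" using assms by auto
    then have "(?G has_real_derivative (b - x) powr p) (at x)"
      using assms(3) by (auto intro!: derivative_eq_intros)
    then show "(?G has_vector_derivative (b - x) powr p) (at x)"
      by (simp add: has_real_derivative_iff_has_vector_derivative)
  qed
  then show ?thesis by (simp add: diff_divide_distrib)
qed

text \<open>The integrand is controlled only on [a, b). Increments of its primitive \<open>F\<close>
  are dominated by those of the primitive \<open>G\<close> of the scalar kernel, so \<open>F\<close>
  has a limit at b. The extended primitive \<open>H\<close> is continuous with derivative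
  \<open>f\<close> inside, and the fundamental theorem of calculus yields integrability.\<close>

lemma improper_integral:
  fixes f :: "real \<Rightarrow> 'a::banach"
  assumes ab: "a \<le> b" and p: "-1 < p" and K: "0 \<le> K" and f: "continuous_on {a..<b} f"
    and le: "\<And>x. a \<le> x \<Longrightarrow> x < b \<Longrightarrow> norm (f x) \<le> K * (b - x) powr p"
  shows "f integrable_on {a..b}" "norm (integral {a..b} f) \<le> K * ((b - a) powr (p + 1) / (p + 1))"
proof -
  define G where "G x = - (K * ((b - x) powr (p + 1) / (p + 1)))" for x
  define F where "F x = integral {a..x} f" for x
  have contG: "continuous_on {a..b} G"
    unfolding G_def using p by (intro continuous_intros continuous_on_powr') auto
  have kern: "((\<lambda>x. K * (b - x) powr p) has_integral (G d - G c)) {c..d}" if "c \<le> d" "d \<le> b" for c d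
    using has_integral_mult_right[OF kernel_has_integral[OF that p], of K]
    by (simp add: G_def right_diff_distrib diff_divide_distrib)
  have fi: "f integrable_on {a..c}" if "c < b" for c
    by (rule integrable_continuous_real) (rule continuous_on_subset[OF f], use that in auto)
  have FG: "norm (F d - F c) \<le> G d - G c" if "a \<le> c" "c \<le> d" "d < b" for c d
  proof -
    have "F d - F c = integral {c..d} f"
      using Henstock_Kurzweil_Integration.integral_combine[OF that(1,2) fi[OF that(3)]] by (simp add: F_def algebra_simps)
    also have "norm \<dots> \<le> integral {c..d} (\<lambda>x. K * (b - x) powr p)"
      by (rule integral_norm_bound_integral)
        (use that le kern[of c d] integrable_on_subinterval[OF fi[OF that(3)], of c d] in \<open>auto simp: has_integral_iff\<close>)
    also have "\<dots> = G d - G c" using integral_unique[OF kern[of c d]] that by auto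
    finally show ?thesis .
  qed
  have main: "f integrable_on {a..b}"
  proof (cases "a = b")
    case True then show ?thesis using integrable_on_refl[of f b] by auto
  next
    case False
    then have lt: "a < b" using ab by simp
    define c where "c n = b - (b - a) / real (Suc n)" for n
    have cn: "a \<le> c n" "c n < b" for n
    proof -
      have "(b - a) / real (Suc n) \<le> (b - a) / 1" using lt by (intro divide_left_mono) auto
      then show "a \<le> c n" by (simp add: c_def)
      show "c n < b" using lt by (simp add: c_def)
    qed
    have clim: "c \<longlonglongrightarrow> b"
    proof -
      have "(\<lambda>n. b - (b - a) * inverse (real (Suc n))) \<longlonglongrightarrow> b - (b - a) * 0"
        by (intro tendsto_intros LIMSEQ_inverse_real_of_nat)
      then show ?thesis by (simp add: c_def[abs_def] divide_inverse)
    qed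
    have Gc: "(\<lambda>n. G (c n)) \<longlonglongrightarrow> G b"
      using continuous_on_tendsto_compose[OF contG clim] cn ab by (auto simp: less_imp_le)
    have FG': "norm (F d - F c) \<le> \<bar>G d - G c\<bar>" if "a \<le> c" "a \<le> d" "c < b" "d < b" for c d
    proof (cases "c \<le> d")
      case True then show ?thesis using FG[of c d] that by linarith
    next
      case False then show ?thesis using FG[of d c] that norm_minus_commute[of "F d" "F c"] by linarith
    qed
    have "Cauchy (\<lambda>n. F (c n))"
    proof (rule metric_CauchyI)
      fix e :: real assume "e > 0"
      then obtain M where M: "\<And>m n. m \<ge> M \<Longrightarrow> n \<ge> M \<Longrightarrow> dist (G (c m)) (G (c n)) < e"
        using metric_CauchyD[OF LIMSEQ_imp_Cauchy[OF Gc]] by metis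
      have "dist (F (c m)) (F (c n)) < e" if "m \<ge> M" "n \<ge> M" for m n
        using M[OF that] FG'[OF cn(1)[of n] cn(1)[of m] cn(2) cn(2)] by (simp add: dist_norm dist_real_def)
      then show "\<exists>M. \<forall>m\<ge>M. \<forall>n\<ge>M. dist (F (c m)) (F (c n)) < e" by blast
    qed
    then obtain L where L: "(\<lambda>n. F (c n)) \<longlonglongrightarrow> L" using Cauchy_convergent convergent_def by blast
    define H where "H x = (if x < b then F x else L)" for x
    have Hb: "norm (L - F x) \<le> \<bar>G b - G x\<bar>" if "a \<le> x" "x < b" for x
    proof (rule tendsto_le[OF sequentially_bot])
      show "(\<lambda>n. \<bar>G (c n) - G x\<bar>) \<longlonglongrightarrow> \<bar>G b - G x\<bar>" by (intro tendsto_intros Gc)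
      show "(\<lambda>n. norm (F (c n) - F x)) \<longlonglongrightarrow> norm (L - F x)" by (intro tendsto_intros L)
      show "\<forall>\<^sub>F n in sequentially. norm (F (c n) - F x) \<le> \<bar>G (c n) - G x\<bar>"
        using FG'[OF that(1) cn(1) that(2) cn(2)] by simp
    qed
    have HG: "norm (H d - H c) \<le> \<bar>G d - G c\<bar>" if "c \<in> {a..b}" "d \<in> {a..b}" for c d
    proof -
      have e: "x < b \<or> x = b" if "x \<in> {a..b}" for x using that by auto
      show ?thesis using e[OF that(1)] e[OF that(2)] that FG'[of c d] Hb[of c] Hb[of d]
        by (elim disjE) (auto simp: H_def norm_minus_commute abs_minus_commute)
    qed
    have contH: "continuous_on {a..b} H"
      unfolding continuous_on_def
    proof
      fix x assume x: "x \<in> {a..b}"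
      have "((\<lambda>y. G y - G x) \<longlongrightarrow> 0) (at x within {a..b})"
        using contG x unfolding continuous_on_def by (auto intro: LIM_zero)
      then have "((\<lambda>y. H y - H x) \<longlongrightarrow> 0) (at x within {a..b})"
        by (rule Lim_transform_bound[rotated])
          (use HG[OF x] in \<open>auto simp: eventually_at_filter intro!: always_eventually\<close>)
      then show "(H \<longlongrightarrow> H x) (at x within {a..b})" by (rule LIM_zero_cancel)
    qed
    have "(f has_integral (H b - H a)) {a..b}"
    proof (rule fundamental_theorem_of_calculus_interior[OF ab contH])
      fix x assume x: "x \<in> {a<..<b}"
      define e where "e = (x + b) / 2"
      have e: "x < e" "e < b" using x by (auto simp: e_def)
      have "(F has_vector_derivative f x) (at x within {a..e})"
        unfolding F_def
        by (rule integral_has_vector_derivative) (use x e in \<open>auto intro: continuous_on_subset[OF f]\<close>)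
      then have "(F has_vector_derivative f x) (at x)"
        using at_within_interior[of x "{a..e}"] x e by simp
      then show "(H has_vector_derivative f x) (at x)"
        by (rule has_vector_derivative_transform_within_open[of _ _ _ "{a<..<b}"]) (use x in \<open>auto simp: H_def\<close>)
    qed
    then show ?thesis by blast
  qed
  show "f integrable_on {a..b}" by (rule main)
  \<comment> \<open>At b the kernel is \<open>0 powr p = 0\<close>, a bound that the arbitrary value
    \<open>f b\<close> may violate; changing one point leaves the integral alone.\<close>
  define f' where "f' x = (if x = b then 0 else f x)" for x
  have ne: "negligible {b}" by simp
  have i': "f' integrable_on {a..b}" and e': "integral {a..b} f' = integral {a..b} f"
    using integrable_spike[OF main ne] integral_spike[OF ne, of "{a..b}" f' f] by (auto simp: f'_def)
  have "norm (integral {a..b} f') \<le> integral {a..b} (\<lambda>x. K * (b - x) powr p)"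
  proof (rule integral_norm_bound_integral[OF i'])
    show "(\<lambda>x. K * (b - x) powr p) integrable_on {a..b}" using kern[OF ab] by blast
    show "norm (f' x) \<le> K * (b - x) powr p" if "x \<in> {a..b}" for x using that le[of x] K by (simp add: f'_def)
  qed
  also have "\<dots> = G b - G a" using integral_unique[OF kern[OF ab]] by auto
  finally show "norm (integral {a..b} f) \<le> K * ((b - a) powr (p + 1) / (p + 1))"
    unfolding e' by (simp add: G_def)
qed

lemma Bil_lipschitz:
  assumes t: "t > 0"
  shows "norm (Bil t S S - Bil t T T) \<le> 2 * CB * t powr (-3/4) * (norm (S - T) * (norm S + norm T))"
proof -
  have "Bil t S S - Bil t T T = Bil t (S - T) S + Bil t T (S - T)"
    by (simp add: Bil_diff_left[OF t] Bil_diff_right[OF t])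
  then have "norm (Bil t S S - Bil t T T) \<le> norm (Bil t (S - T) S) + norm (Bil t T (S - T))"
    by (simp add: norm_triangle_ineq)
  also have "\<dots> \<le> 2 * CB * t powr (-3/4) * norm (S - T) * norm S + 2 * CB * t powr (-3/4) * norm T * norm (S - T)"
    by (intro add_mono Bil_bound t)
  finally show ?thesis by (simp add: algebra_simps)
qed

lemma Bil_holder':
  assumes s: "0 < s" "s \<le> t"
  shows "norm (Bil t S T - Bil s S T) \<le> 2 * CB * (t - s) powr (1/8) * s powr (-7/8) * norm S * norm T"
  using Bil_holder[OF s(1), of "t - s" S T] s(2) by (cases "s = t") auto

text \<open>A change of state is handled by the Lipschitz bound at the moving time, a change of time
  by the Hoelder bound at the fixed state. The latter is singular in the smaller of the two times,
  hence the minimum.\<close>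

lemma tendsto_Bil:
  assumes g: "(g \<longlongrightarrow> t) F" and t: "t > 0" and S: "(S \<longlongrightarrow> S0) F"
  shows "((\<lambda>x. Bil (g x) (S x) (S x)) \<longlongrightarrow> Bil t S0 S0) F"
proof -
  have m: "((\<lambda>x. min (g x) t) \<longlongrightarrow> t) F" using tendsto_min[OF g tendsto_const, of t] by simp
  have "((\<lambda>x. 2 * CB * g x powr (-3/4) * (norm (S x - S0) * (norm (S x) + norm S0)) +
      2 * CB * \<bar>g x - t\<bar> powr (1/8) * (min (g x) t) powr (-7/8) * norm S0 * norm S0) \<longlongrightarrow>
      2 * CB * t powr (-3/4) * (norm (S0 - S0) * (norm S0 + norm S0)) + 2 * CB * \<bar>t - t\<bar> powr (1/8) * t powr (-7/8) * norm S0 * norm S0) F"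
    using t by (intro tendsto_intros g S m tendsto_powr') auto
  then have z: "((\<lambda>x. 2 * CB * g x powr (-3/4) * (norm (S x - S0) * (norm (S x) + norm S0)) +
      2 * CB * \<bar>g x - t\<bar> powr (1/8) * (min (g x) t) powr (-7/8) * norm S0 * norm S0) \<longlongrightarrow> 0) F" by simp
  have "\<forall>\<^sub>F x in F. norm (Bil (g x) (S x) (S x) - Bil t S0 S0) \<le> 2 * CB * g x powr (-3/4) * (norm (S x - S0) * (norm (S x) + norm S0)) +
      2 * CB * \<bar>g x - t\<bar> powr (1/8) * (min (g x) t) powr (-7/8) * norm S0 * norm S0"
    using order_tendstoD(1)[OF g t]
  proof eventually_elim
    case (elim x)
    have "norm (Bil (g x) S0 S0 - Bil t S0 S0) \<le> 2 * CB * \<bar>g x - t\<bar> powr (1/8) * (min (g x) t) powr (-7/8) * norm S0 * norm S0"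
    proof (cases "g x \<le> t")
      case True
      then show ?thesis using Bil_holder'[of "g x" t S0 S0] elim
        by (simp add: norm_minus_commute[of "Bil (g x) S0 S0"] abs_minus_commute[of "g x"])
    next
      case False
      then show ?thesis using Bil_holder'[of t "g x" S0 S0] t by simp
    qed
    moreover have "norm (Bil (g x) (S x) (S x) - Bil t S0 S0) \<le> norm (Bil (g x) (S x) (S x) - Bil (g x) S0 S0) + norm (Bil (g x) S0 S0 - Bil t S0 S0)"
      using norm_triangle_ineq[of "Bil (g x) (S x) (S x) - Bil (g x) S0 S0" "Bil (g x) S0 S0 - Bil t S0 S0"] by simp
    ultimately show ?case using Bil_lipschitz[OF elim, of "S x" S0] by linarith
  qed
  then show ?thesis by (rule LIM_zero_cancel[OF Lim_null_comparison[OF _ z]])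
qed

text \<open>At \<open>\<tau> = t\<close> no heat factor is left and the projected product need not
  lie in L^2. Continuity and bounds are therefore stated on half-open intervals.\<close>

definition duh :: "(real \<Rightarrow> matrix_l2) \<Rightarrow> real \<Rightarrow> real \<Rightarrow> matrix_l2" where
  "duh S t \<tau> = Bil (t - \<tau>) (S \<tau>) (S \<tau>)"

lemma duh_continuous:
  assumes S: "continuous_on {a..b} S"
  shows "continuous_on {a..<b} (duh S b)"
  unfolding continuous_on_def duh_def
proof
  fix x assume x: "x \<in> {a..<b}"
  have "(S \<longlongrightarrow> S x) (at x within {a..<b})"
    using S x unfolding continuous_on_def by (auto intro: tendsto_within_subset[of S _ _ "{a..b}"])
  then show "((\<lambda>\<tau>. Bil (b - \<tau>) (S \<tau>) (S \<tau>)) \<longlongrightarrow> Bil (b - x) (S x) (S x)) (at x within {a..<b})"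
    using x by (intro tendsto_Bil tendsto_intros) auto
qed

lemma duh_integral:
  assumes ab: "a \<le> b" and S: "continuous_on {a..b} S" and K: "\<And>\<tau>. \<tau> \<in> {a..b} \<Longrightarrow> norm (S \<tau>) \<le> K"
  shows "duh S b integrable_on {a..b}" "norm (integral {a..b} (duh S b)) \<le> 8 * CB * K\<^sup>2 * (b - a) powr (1/4)"
proof -
  have K0: "K \<ge> 0" using K[of a] ab norm_ge_zero order_trans by (metis atLeastAtMost_iff order_refl)
  have le: "norm (duh S b x) \<le> 2 * CB * K\<^sup>2 * (b - x) powr (-3/4)" if "a \<le> x" "x < b" for x
  proof -
    have "norm (duh S b x) \<le> 2 * CB * (b - x) powr (-3/4) * (norm (S x) * norm (S x))"
      using Bil_bound[of "b - x" "S x" "S x"] that by (simp add: duh_def mult.assoc)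
    also have "\<dots> \<le> 2 * CB * (b - x) powr (-3/4) * (K * K)"
      using K[of x] that CB_pos K0 by (intro mult_left_mono mult_mono) auto
    finally show ?thesis by (simp add: power2_eq_square mult_ac)
  qed
  have c: "0 \<le> 2 * CB * K\<^sup>2" using CB_pos by simp
  note i = improper_integral[OF ab _ c duh_continuous[OF S] le]
  show "duh S b integrable_on {a..b}" by (rule i(1)) auto
  show "norm (integral {a..b} (duh S b)) \<le> 8 * CB * K\<^sup>2 * (b - a) powr (1/4)"
    using i(2) by simp
qed

lemma duh_integrable:
  assumes ab: "a \<le> b" and S: "continuous_on {a..b} S"
  shows "duh S b integrable_on {a..b}"
proof -
  have "bounded (S ` {a..b})" by (intro compact_imp_bounded compact_continuous_image S compact_Icc)
  then obtain K where "\<And>\<tau>. \<tau> \<in> {a..b} \<Longrightarrow> norm (S \<tau>) \<le> K" unfolding bounded_iff by blast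
  from duh_integral(1)[OF ab S this] show ?thesis .
qed

lemma duh_integral_diff:
  assumes ab: "a \<le> b" and S: "continuous_on {a..b} S" "continuous_on {a..b} T"
    and K: "\<And>\<tau>. \<tau> \<in> {a..b} \<Longrightarrow> norm (S \<tau>) \<le> K" "\<And>\<tau>. \<tau> \<in> {a..b} \<Longrightarrow> norm (T \<tau>) \<le> K"
    and d: "\<And>\<tau>. \<tau> \<in> {a..b} \<Longrightarrow> norm (S \<tau> - T \<tau>) \<le> d"
  shows "norm (integral {a..b} (duh S b) - integral {a..b} (duh T b)) \<le> 16 * CB * K * d * (b - a) powr (1/4)"
proof -
  have K0: "K \<ge> 0" using K[of a] ab norm_ge_zero order_trans by (metis atLeastAtMost_iff order_refl)
  have d0: "d \<ge> 0" using d[of a] ab norm_ge_zero order_trans by (metis atLeastAtMost_iff order_refl)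
  have le: "norm (duh S b x - duh T b x) \<le> 4 * CB * K * d * (b - x) powr (-3/4)" if "a \<le> x" "x < b" for x
  proof -
    have "norm (duh S b x - duh T b x) \<le> 2 * CB * (b - x) powr (-3/4) * (norm (S x - T x) * (norm (S x) + norm (T x)))"
      using Bil_lipschitz[of "b - x" "S x" "T x"] that by (simp add: duh_def)
    also have "\<dots> \<le> 2 * CB * (b - x) powr (-3/4) * (d * (K + K))"
      using K[of x] d[of x] that CB_pos d0 by (intro mult_left_mono mult_mono add_mono) auto
    finally show ?thesis by (simp add: algebra_simps)
  qed
  have c: "0 \<le> 4 * CB * K * d" using CB_pos K0 d0 by simp
  have cont: "continuous_on {a..<b} (\<lambda>x. duh S b x - duh T b x)" by (intro continuous_intros duh_continuous S)
  have "norm (integral {a..b} (\<lambda>x. duh S b x - duh T b x)) \<le> 16 * CB * K * d * (b - a) powr (1/4)"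
    using improper_integral(2)[OF ab _ c cont le] by simp
  then show ?thesis using duh_integrable[OF ab S(1)] duh_integrable[OF ab S(2)] by (simp add: integral_diff)
qed

text \<open>On [a, s] the same states appear under heat factors at two times, and
  \<open>Bil_holder'\<close> bounds the difference by an integrable singularity; on [s, t] the
  integral is short. The result is a modulus of continuity in t - s.\<close>

lemma duh_increment:
  assumes st: "a \<le> s" "s \<le> t" and S: "continuous_on {a..t} S" and K: "\<And>\<tau>. \<tau> \<in> {a..t} \<Longrightarrow> norm (S \<tau>) \<le> K"
  shows "norm (integral {a..t} (duh S t) - integral {a..s} (duh S s)) \<le>
    16 * CB * K\<^sup>2 * (s - a) powr (1/8) * (t - s) powr (1/8) + 8 * CB * K\<^sup>2 * (t - s) powr (1/4)"
proof -
  have K0: "K \<ge> 0" using K[of a] st norm_ge_zero order_trans by (metis atLeastAtMost_iff order_refl)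
  have S': "continuous_on {a..s} S" "continuous_on {s..t} S" using S st by (auto intro: continuous_on_subset)
  have it: "duh S t integrable_on {a..t}" by (rule duh_integrable) (use st S in auto)
  have is': "duh S t integrable_on {a..s}" by (rule integrable_on_subinterval[OF it]) (use st in auto)
  have iss: "duh S s integrable_on {a..s}" by (rule duh_integrable) (use st S' in auto)
  have e: "integral {a..t} (duh S t) - integral {a..s} (duh S s) = integral {a..s} (\<lambda>\<tau>. duh S t \<tau> - duh S s \<tau>) + integral {s..t} (duh S t)"
    using Henstock_Kurzweil_Integration.integral_combine[OF st it] is' iss by (simp add: integral_diff)
  have le: "norm (duh S t x - duh S s x) \<le> (2 * CB * (t - s) powr (1/8) * K\<^sup>2) * (s - x) powr (-7/8)" if "a \<le> x" "x < s" for x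
  proof -
    have "norm (duh S t x - duh S s x) \<le> 2 * CB * ((t - x) - (s - x)) powr (1/8) * (s - x) powr (-7/8) * norm (S x) * norm (S x)"
      unfolding duh_def by (rule Bil_holder') (use that st in auto)
    also have "\<dots> = 2 * CB * (t - s) powr (1/8) * (s - x) powr (-7/8) * (norm (S x) * norm (S x))" by simp
    also have "\<dots> \<le> 2 * CB * (t - s) powr (1/8) * (s - x) powr (-7/8) * (K * K)"
      using K[of x] that st CB_pos K0 by (intro mult_left_mono mult_mono) auto
    finally show ?thesis by (simp add: power2_eq_square mult_ac)
  qed
  have c: "0 \<le> 2 * CB * (t - s) powr (1/8) * K\<^sup>2" using CB_pos by simp
  have cont: "continuous_on {a..<s} (\<lambda>\<tau>. duh S t \<tau> - duh S s \<tau>)"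
    by (intro continuous_on_diff duh_continuous[OF S'(1)] continuous_on_subset[OF duh_continuous[OF S]]) (use st in auto)
  have "norm (integral {a..s} (\<lambda>\<tau>. duh S t \<tau> - duh S s \<tau>)) \<le> 16 * CB * K\<^sup>2 * (s - a) powr (1/8) * (t - s) powr (1/8)"
    using improper_integral(2)[OF st(1) _ c cont le] by (simp add: mult_ac)
  moreover have "norm (integral {s..t} (duh S t)) \<le> 8 * CB * K\<^sup>2 * (t - s) powr (1/4)"
    by (rule duh_integral(2)[OF st(2) S'(2)]) (use K st in auto)
  ultimately show ?thesis unfolding e by (intro order_trans[OF norm_triangle_ineq] add_mono)
qed

lemma duh_integral_continuous:
  assumes S: "continuous_on {a..b} S"
  shows "continuous_on {a..b} (\<lambda>t. integral {a..t} (duh S t))"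
proof -
  have "bounded (S ` {a..b})" by (intro compact_imp_bounded compact_continuous_image S compact_Icc)
  then obtain K where K: "\<And>\<tau>. \<tau> \<in> {a..b} \<Longrightarrow> norm (S \<tau>) \<le> K" unfolding bounded_iff by blast
  let ?I = "\<lambda>t. integral {a..t} (duh S t)"
  let ?w = "\<lambda>d. 16 * CB * K\<^sup>2 * (b - a) powr (1/8) * d powr (1/8) + 8 * CB * K\<^sup>2 * d powr (1/4)"
  have inc: "norm (?I t - ?I s) \<le> ?w \<bar>t - s\<bar>" if "a \<le> s" "s \<le> t" "t \<le> b" for s t
  proof -
    have "norm (?I t - ?I s) \<le> 16 * CB * K\<^sup>2 * (s - a) powr (1/8) * (t - s) powr (1/8) + 8 * CB * K\<^sup>2 * (t - s) powr (1/4)"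
      by (rule duh_increment) (use that K in \<open>auto intro: continuous_on_subset[OF S]\<close>)
    also have "\<dots> \<le> 16 * CB * K\<^sup>2 * (b - a) powr (1/8) * (t - s) powr (1/8) + 8 * CB * K\<^sup>2 * (t - s) powr (1/4)"
      using that CB_pos by (intro add_right_mono mult_right_mono mult_left_mono powr_mono2) auto
    finally show ?thesis using that by simp
  qed
  show ?thesis
    unfolding continuous_on_def
  proof
    fix x assume x: "x \<in> {a..b}"
    have "((\<lambda>y. ?w \<bar>y - x\<bar>) \<longlongrightarrow> 16 * CB * K\<^sup>2 * (b - a) powr (1/8) * \<bar>x - x\<bar> powr (1/8) + 8 * CB * K\<^sup>2 * \<bar>x - x\<bar> powr (1/4)) (at x within {a..b})"
      by (intro tendsto_intros tendsto_powr') auto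
    then have z: "((\<lambda>y. ?w \<bar>y - x\<bar>) \<longlongrightarrow> 0) (at x within {a..b})" by simp
    have "norm (?I y - ?I x) \<le> ?w \<bar>y - x\<bar>" if "y \<in> {a..b}" for y
      using inc[of x y] inc[of y x] x that by (cases "x \<le> y") (auto simp: norm_minus_commute abs_minus_commute)
    then have "\<forall>\<^sub>F y in at x within {a..b}. norm (?I y - ?I x) \<le> ?w \<bar>y - x\<bar>"
      by (auto simp: eventually_at_filter)
    then show "(?I \<longlongrightarrow> ?I x) (at x within {a..b})" by (rule LIM_zero_cancel[OF Lim_null_comparison[OF _ z]])
  qed
qed

text \<open>The datum is read off as \<open>S a\<close> and the time origin is free, so that
  solutions can be restarted and concatenated. At t = a the equation is trivial, which permits a
  closed interval.\<close>

definition sol :: "real \<Rightarrow> real \<Rightarrow> (real \<Rightarrow> matrix_l2) \<Rightarrow> bool" where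
  "sol a b S \<longleftrightarrow> continuous_on {a..b} S \<and>
    (\<forall>t\<in>{a..b}. S t = heat (t - a) (S a) + (1/2) *\<^sub>R integral {a..t} (duh S t))"

lemma solD:
  assumes "sol a b S"
  shows "continuous_on {a..b} S" "t \<in> {a..b} \<Longrightarrow> S t = heat (t - a) (S a) + (1/2) *\<^sub>R integral {a..t} (duh S t)"
proof -
  show "continuous_on {a..b} S" by (rule assms[unfolded sol_def, THEN conjunct1])
  show "S t = heat (t - a) (S a) + (1/2) *\<^sub>R integral {a..t} (duh S t)" if "t \<in> {a..b}"
    by (rule assms[unfolded sol_def, THEN conjunct2, THEN bspec, OF that])
qed

section \<open>Restriction, restart and concatenation of solutions\<close>

lemma sol_bounded:
  assumes "sol a b S"
  obtains K where "K > 0" "\<And>\<tau>. \<tau> \<in> {a..b} \<Longrightarrow> norm (S \<tau>) \<le> K"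
proof -
  have "bounded (S ` {a..b})" by (intro compact_imp_bounded compact_continuous_image solD(1)[OF assms] compact_Icc)
  then obtain K where "\<And>\<tau>. \<tau> \<in> {a..b} \<Longrightarrow> norm (S \<tau>) \<le> K" unfolding bounded_iff by blast
  then show ?thesis using that[of "max K 1"] by (simp add: le_max_iff_disj)
qed

lemma integral_bounded_linear_comp:
  assumes "f integrable_on X" "bounded_linear h"
  shows "(\<lambda>x. h (f x)) integrable_on X" "integral X (\<lambda>x. h (f x)) = h (integral X f)"
  using integrable_linear[OF assms] integral_linear[OF assms] by (simp_all add: o_def)

text \<open>The heat operator passes through the integral and its time adds to that of the
  integrand. This semigroup identity is the content of restarting and of concatenating.\<close>

lemma heat_duh_integral:
  assumes st: "a \<le> s" "s \<le> t" and S: "continuous_on {a..s} S"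
  shows "heat (t - s) (integral {a..s} (duh S s)) = integral {a..s} (duh S t)"
proof -
  have bl: "bounded_linear (heat (t - s))" by (rule heat_bounded_linear) (use st in auto)
  have "heat (t - s) (integral {a..s} (duh S s)) = integral {a..s} (\<lambda>\<tau>. heat (t - s) (duh S s \<tau>))"
    using integral_bounded_linear_comp(2)[OF duh_integrable[OF st(1) S] bl] by simp
  also have "\<dots> = integral {a..s} (duh S t)"
  proof (rule integral_spike[of "{s}"])
    fix \<tau> assume "\<tau> \<in> {a..s} - {s}"
    then have "\<tau> < s" by auto
    then show "duh S t \<tau> = heat (t - s) (duh S s \<tau>)"
      unfolding duh_def using heat_Bil[of "t - s" "s - \<tau>" "S \<tau>" "S \<tau>"] st by simp
  qed simp
  finally show ?thesis .
qed

lemma sol_restart: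
  assumes S: "sol a b S" and s: "a \<le> s" "s \<le> b"
  shows "sol s b S"
  unfolding sol_def
proof (intro conjI ballI)
  note cS = solD(1)[OF S]
  show "continuous_on {s..b} S" by (rule continuous_on_subset[OF cS]) (use s in auto)
  fix t assume t: "t \<in> {s..b}"
  have ct: "continuous_on {a..t} S" "continuous_on {a..s} S" using cS s t by (auto intro: continuous_on_subset)
  have it: "duh S t integrable_on {a..t}" by (rule duh_integrable) (use s t ct in auto)
  have bl: "bounded_linear (heat (t - s))" by (rule heat_bounded_linear) (use t in auto)
  interpret h: bounded_linear "heat (t - s)" by (rule bl)
  have 1: "heat (t - s) (integral {a..s} (duh S s)) = integral {a..s} (duh S t)"
    by (rule heat_duh_integral) (use s t ct in auto)
  have "heat (t - s) (S s) = heat (t - s) (heat (s - a) (S a)) + (1/2) *\<^sub>R integral {a..s} (duh S t)"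
    using solD(2)[OF S, of s] s by (simp add: h.add h.scaleR 1)
  also have "heat (t - s) (heat (s - a) (S a)) = heat (t - a) (S a)"
    using heat_heat[of "t - s" "s - a" "S a"] s t by simp
  finally have 2: "heat (t - s) (S s) = heat (t - a) (S a) + (1/2) *\<^sub>R integral {a..s} (duh S t)" .
  have "S t = heat (t - a) (S a) + (1/2) *\<^sub>R (integral {a..s} (duh S t) + integral {s..t} (duh S t))"
    using solD(2)[OF S, of t] Henstock_Kurzweil_Integration.integral_combine[OF s(1) _ it] s t by simp
  then show "S t = heat (t - s) (S s) + (1/2) *\<^sub>R integral {s..t} (duh S t)"
    unfolding 2 by (simp add: scaleR_add_right)
qed

lemma sol_subinterval:
  assumes S: "sol a b S" and c: "a \<le> c" "d \<le> b" "c \<le> d"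
  shows "sol c d S"
  unfolding sol_def
proof (intro conjI ballI)
  have S': "sol c b S" by (rule sol_restart[OF S]) (use c in auto)
  show "continuous_on {c..d} S" by (rule continuous_on_subset[OF solD(1)[OF S']]) (use c in auto)
  show "S t = heat (t - c) (S c) + (1/2) *\<^sub>R integral {c..t} (duh S t)" if "t \<in> {c..d}" for t
    by (rule solD(2)[OF S']) (use that c in auto)
qed

lemma sol_cong:
  assumes S: "sol a b S" and eq: "\<And>t. t \<in> {a..b} \<Longrightarrow> T t = S t"
  shows "sol a b T"
  unfolding sol_def
proof (intro conjI ballI)
  show "continuous_on {a..b} T" using iffD2[OF continuous_on_cong[OF refl eq] solD(1)[OF S]] .
  fix t assume t: "t \<in> {a..b}"
  have "integral {a..t} (duh T t) = integral {a..t} (duh S t)"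
    by (rule integral_cong) (use t eq in \<open>auto simp: duh_def\<close>)
  then show "T t = heat (t - a) (T a) + (1/2) *\<^sub>R integral {a..t} (duh T t)"
    using solD(2)[OF S t] t eq by simp
qed

lemma sol_concat:
  assumes S: "sol a s S" and T: "sol s b T" and st: "a \<le> s" "s \<le> b" and eq: "S s = T s"
  shows "sol a b (\<lambda>t. if t \<le> s then S t else T t)"
proof -
  define U where "U t = (if t \<le> s then S t else T t)" for t
  have U1: "sol a s U" by (rule sol_cong[OF S]) (simp add: U_def)
  have U2: "sol s b U" by (rule sol_cong[OF T]) (use eq in \<open>auto simp: U_def\<close>)
  have "sol a b U"
  unfolding sol_def
proof (intro conjI ballI)
  have "continuous_on ({a..s} \<union> {s..b}) U"
    by (intro continuous_on_closed_Un solD(1)[OF U1] solD(1)[OF U2]) auto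
  then show c: "continuous_on {a..b} U" using st by (simp add: ivl_disj_un_two_touch)
  fix t assume t: "t \<in> {a..b}"
  show "U t = heat (t - a) (U a) + (1/2) *\<^sub>R integral {a..t} (duh U t)"
  proof (cases "t \<le> s")
    case True
    then show ?thesis using solD(2)[OF U1, of t] t by simp
  next
    case False
    then have ts: "s \<le> t" by simp
    have ct: "continuous_on {a..t} U" "continuous_on {a..s} U" using c st t by (auto intro: continuous_on_subset)
    have it: "duh U t integrable_on {a..t}" by (rule duh_integrable) (use t ct in auto)
    have bl: "bounded_linear (heat (t - s))" by (rule heat_bounded_linear) (use ts in auto)
    interpret h: bounded_linear "heat (t - s)" by (rule bl)
    have 1: "heat (t - s) (integral {a..s} (duh U s)) = integral {a..s} (duh U t)"
      by (rule heat_duh_integral[OF st(1) ts ct(2)])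
    have Us: "U s = heat (s - a) (U a) + (1/2) *\<^sub>R integral {a..s} (duh U s)"
      by (rule solD(2)[OF U1]) (use st in auto)
    have "U t = heat (t - s) (U s) + (1/2) *\<^sub>R integral {s..t} (duh U t)"
      by (rule solD(2)[OF U2]) (use ts t in auto)
    also have "heat (t - s) (U s) = heat (t - a) (U a) + (1/2) *\<^sub>R integral {a..s} (duh U t)"
      unfolding Us h.add h.scaleR 1 using heat_heat[of "t - s" "s - a" "U a"] st ts by simp
    finally have "U t = heat (t - a) (U a) + (1/2) *\<^sub>R (integral {a..s} (duh U t) + integral {s..t} (duh U t))"
      by (simp only: scaleR_add_right add.assoc)
    then show ?thesis using Henstock_Kurzweil_Integration.integral_combine[OF st(1) ts it] by simp
  qed
qed
  then show ?thesis unfolding U_def[abs_def] .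
qed

section \<open>Local existence, uniqueness and smoothing\<close>

lemma power4_powr: "x > 0 \<Longrightarrow> (x ^ 4) powr (1/4) = (x::real)"
  using powr_powr[of x 4 "1/4"] by simp

text \<open>With h^(1/4) = 1 / (32 CB K) half the Duhamel term has norm at most K / 2 on the ball of
  radius 2 K, and the fixed point map has Lipschitz constant 1/2.\<close>

lemma local_solution:
  assumes K: "K > 0" and x: "norm x \<le> K"
  defines "h \<equiv> (1 / (32 * CB * K)) ^ 4"
  obtains S where "sol a (a + h) S" "S a = x"
proof -
  have h: "h > 0" using K CB_pos by (simp add: h_def)
  have h4: "h powr (1/4) = 1 / (32 * CB * K)"
    unfolding h_def by (rule power4_powr) (use K CB_pos in simp)
  \<comment> \<open>Clamping time to [a, a + h] lets the fixed point be sought among bounded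
    continuous functions on the whole line.\<close>
  define c where "c t = max a (min t (a + h))" for t
  have c: "a \<le> c t" "c t \<le> a + h" for t using h by (auto simp: c_def)
  have cid: "c t = t" if "t \<in> {a..a + h}" for t using that by (auto simp: c_def)
  have contc: "continuous_on UNIV c" unfolding c_def[abs_def] by (intro continuous_intros)
  define P where "P u t = heat (c t - a) x + (1/2) *\<^sub>R integral {a..c t} (duh u (c t))" for u t
  have kb: "(c t - a) powr (1/4) \<le> 1 / (32 * CB * K)" for t
    using powr_mono2[of "1/4" "c t - a" h] c[of t] h4 by simp
  have contP: "continuous_on UNIV (P u)" if u: "continuous_on UNIV u" for u
  proof -
    have 1: "continuous_on UNIV (\<lambda>t. heat (c t - a) x)"
      by (rule continuous_on_compose2[OF heat_continuous]) (use c in \<open>auto intro!: continuous_intros contc\<close>)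
    have 2: "continuous_on UNIV (\<lambda>t. integral {a..c t} (duh u (c t)))"
      by (rule continuous_on_compose2[OF duh_integral_continuous[of a "a + h"] contc])
        (use c in \<open>auto intro: continuous_on_subset[OF u]\<close>)
    show ?thesis unfolding P_def[abs_def] by (intro continuous_intros 1 2)
  qed
  have bP: "norm (P u t) \<le> 2 * K" if u: "continuous_on UNIV u" "\<And>t. norm (u t) \<le> 2 * K" for u t
  proof -
    have "norm (integral {a..c t} (duh u (c t))) \<le> 8 * CB * (2 * K)\<^sup>2 * (c t - a) powr (1/4)"
      by (rule duh_integral(2)) (use c u in \<open>auto intro: continuous_on_subset[OF u(1)]\<close>)
    also have "\<dots> \<le> 8 * CB * (2 * K)\<^sup>2 * (1 / (32 * CB * K))"
      by (rule mult_left_mono[OF kb]) (use CB_pos in simp)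
    also have "\<dots> = K" using K CB_pos by (simp add: power2_eq_square field_simps)
    finally have i: "norm ((1/2) *\<^sub>R integral {a..c t} (duh u (c t))) \<le> K / 2" by simp
    have "norm (heat (c t - a) x) \<le> K" using norm_heat[of "c t - a" x] c[of t] x by simp
    then show ?thesis unfolding P_def using norm_triangle_ineq[of "heat (c t - a) x" "(1/2) *\<^sub>R integral {a..c t} (duh u (c t))"] i K by linarith
  qed
  \<comment> \<open>The ball of radius 2 K, twice the bound on the datum; it is closed in a complete
    space and contains the zero function.\<close>
  define X :: "(real \<Rightarrow>\<^sub>C matrix_l2) set" where "X = PiC UNIV (\<lambda>_. cball 0 (2 * K))"
  have XD: "continuous_on UNIV (apply_bcontfun u)" "norm (apply_bcontfun u t) \<le> 2 * K" if "u \<in> X" for u t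
    using that by (auto simp: X_def mem_PiC_iff Pi_iff)
  have Pb: "P (apply_bcontfun u) \<in> bcontfun" if "u \<in> X" for u
    by (rule bcontfun_normI[OF contP bP]) (use XD[OF that] in auto)
  define Q where "Q u = Bcontfun (P (apply_bcontfun u))" for u
  have Q: "apply_bcontfun (Q u) = P (apply_bcontfun u)" if "u \<in> X" for u
    unfolding Q_def by (rule Bcontfun_inverse[OF Pb[OF that]])
  have QX: "Q ` X \<subseteq> X"
  proof
    fix v assume "v \<in> Q ` X"
    then obtain u where u: "u \<in> X" "v = Q u" by blast
    have "norm (apply_bcontfun v t) \<le> 2 * K" for t
      unfolding u(2) Q[OF u(1)] by (rule bP) (use XD[OF u(1)] in auto)
    then show "v \<in> X" by (auto simp: X_def mem_PiC_iff Pi_iff)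
  qed
  have lip: "dist (Q u) (Q v) \<le> (1/2) * dist u v" if uv: "u \<in> X" "v \<in> X" for u v
  proof (rule dist_bound)
    fix t
    let ?u = "apply_bcontfun u" and ?v = "apply_bcontfun v"
    have "P ?u t - P ?v t = (1/2) *\<^sub>R (integral {a..c t} (duh ?u (c t)) - integral {a..c t} (duh ?v (c t)))"
      by (simp add: P_def scaleR_diff_right)
    moreover have "norm (integral {a..c t} (duh ?u (c t)) - integral {a..c t} (duh ?v (c t))) \<le> 16 * CB * (2 * K) * dist u v * (c t - a) powr (1/4)"
    proof (rule duh_integral_diff)
      show "norm (?u \<tau> - ?v \<tau>) \<le> dist u v" for \<tau> using dist_bounded[of u \<tau> v] by (simp add: dist_norm)
    qed (use c XD uv in \<open>auto intro: continuous_on_subset[OF XD(1)]\<close>)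
    moreover have "16 * CB * (2 * K) * dist u v * (c t - a) powr (1/4) \<le> 16 * CB * (2 * K) * dist u v * (1 / (32 * CB * K))"
      by (rule mult_left_mono[OF kb]) (use CB_pos K in simp)
    moreover have "16 * CB * (2 * K) * dist u v * (1 / (32 * CB * K)) = dist u v" using K CB_pos by simp
    ultimately show "dist (apply_bcontfun (Q u) t) (apply_bcontfun (Q v) t) \<le> (1/2) * dist u v"
      unfolding Q[OF uv(1)] Q[OF uv(2)] dist_norm[of "P ?u t"] by simp
  qed
  have "closed X" unfolding X_def by (rule closed_PiC) simp
  note cX = iffD2[OF complete_eq_closed this]
  have "const_bcontfun 0 \<in> X" using K by (auto simp: X_def mem_PiC_iff)
  then have "X \<noteq> {}" by blast
  then have "\<exists>!u\<in>X. Q u = u"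
    by (rule Banach_fix[OF cX _ _ _ QX lip]) simp_all
  then obtain u where u: "u \<in> X" "Q u = u" by blast
  define S where "S = apply_bcontfun u"
  have fx: "S t = P S t" for t using Q[OF u(1)] u(2) by (simp add: S_def)
  have Sa: "S a = x" using fx[of a] h by (simp add: P_def c_def heat_0)
  have "sol a (a + h) S"
    unfolding sol_def Sa
  proof (intro conjI ballI)
    show "continuous_on {a..a + h} S" unfolding S_def by simp
    show "S t = heat (t - a) x + (1/2) *\<^sub>R integral {a..t} (duh S t)" if "t \<in> {a..a + h}" for t
      using fx[of t] unfolding P_def cid[OF that] .
  qed
  then show ?thesis using Sa that by blast
qed

lemma continuous_attains_norm_sup:
  fixes f :: "real \<Rightarrow> 'a::real_normed_vector"
  assumes "a \<le> b" "continuous_on {a..b} f"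
  obtains t where "t \<in> {a..b}" "\<And>x. x \<in> {a..b} \<Longrightarrow> norm (f x) \<le> norm (f t)"
proof -
  have "\<exists>t\<in>{a..b}. \<forall>x\<in>{a..b}. norm (f x) \<le> norm (f t)"
    by (rule continuous_attains_sup) (use assms in \<open>auto intro: continuous_on_norm\<close>)
  then show ?thesis using that by blast
qed

text \<open>The largest value m of the norm of the difference is attained, and on so short an
  interval the equation there reads m <= m / 2.\<close>

lemma sol_unique_step:
  assumes S: "sol a b S" and T: "sol a b T" and eq: "S a = T a"
    and K: "\<And>\<tau>. \<tau> \<in> {a..b} \<Longrightarrow> norm (S \<tau>) \<le> K" "\<And>\<tau>. \<tau> \<in> {a..b} \<Longrightarrow> norm (T \<tau>) \<le> K"
    and small: "16 * CB * K * (b - a) powr (1/4) \<le> 1" and t: "t \<in> {a..b}"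
  shows "S t = T t"
proof -
  have ab: "a \<le> b" using t by simp
  have K0: "K \<ge> 0" using K(1)[of a] ab norm_ge_zero[of "S a"] by (metis atLeastAtMost_iff order_refl order_trans)
  obtain t0 where t0: "t0 \<in> {a..b}" "\<And>x. x \<in> {a..b} \<Longrightarrow> norm (S x - T x) \<le> norm (S t0 - T t0)"
    using continuous_attains_norm_sup[OF ab continuous_on_diff[OF solD(1)[OF S] solD(1)[OF T]]] by metis
  define m where "m = norm (S t0 - T t0)"
  have c: "continuous_on {a..t0} S" "continuous_on {a..t0} T"
    using t0(1) by (auto intro: continuous_on_subset[OF solD(1)[OF S]] continuous_on_subset[OF solD(1)[OF T]])
  have "norm (integral {a..t0} (duh S t0) - integral {a..t0} (duh T t0)) \<le> 16 * CB * K * m * (t0 - a) powr (1/4)"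
    by (rule duh_integral_diff[OF _ c]) (use t0 K in \<open>auto simp: m_def\<close>)
  also have "\<dots> \<le> 16 * CB * K * m * (b - a) powr (1/4)"
    using t0(1) CB_pos K0 by (intro mult_left_mono powr_mono2) (auto simp: m_def)
  also have "\<dots> = (16 * CB * K * (b - a) powr (1/4)) * m" by simp
  also have "\<dots> \<le> 1 * m" by (rule mult_right_mono[OF small]) (simp add: m_def)
  finally have le: "norm (integral {a..t0} (duh S t0) - integral {a..t0} (duh T t0)) \<le> m" by simp
  have "S t0 - T t0 = (1/2) *\<^sub>R (integral {a..t0} (duh S t0) - integral {a..t0} (duh T t0))"
    by (subst solD(2)[OF S t0(1)], subst solD(2)[OF T t0(1)]) (simp add: eq scaleR_diff_right)
  then have "m = (1/2) * norm (integral {a..t0} (duh S t0) - integral {a..t0} (duh T t0))"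
    by (simp add: m_def)
  then have "m \<le> 0" using le by simp
  then show ?thesis using t0(2)[OF t] by (simp add: m_def)
qed

lemma sol_unique:
  assumes S: "sol a b S" and T: "sol a b T" and eq: "S a = T a" and t: "t \<in> {a..b}"
  shows "S t = T t"
proof -
  obtain K1 where K1: "K1 > 0" "\<And>\<tau>. \<tau> \<in> {a..b} \<Longrightarrow> norm (S \<tau>) \<le> K1" using sol_bounded[OF S] by metis
  obtain K2 where K2: "K2 > 0" "\<And>\<tau>. \<tau> \<in> {a..b} \<Longrightarrow> norm (T \<tau>) \<le> K2" using sol_bounded[OF T] by metis
  define K where "K = max K1 K2"
  have K: "K > 0" "\<And>\<tau>. \<tau> \<in> {a..b} \<Longrightarrow> norm (S \<tau>) \<le> K" "\<And>\<tau>. \<tau> \<in> {a..b} \<Longrightarrow> norm (T \<tau>) \<le> K"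
    using K1 K2 by (auto simp: K_def le_max_iff_disj)
  \<comment> \<open>The step depends only on a bound common to both solutions on all of [a, b], so
    finitely many steps reach t.\<close>
  define d where "d = (1 / (16 * CB * K)) ^ 4"
  have d: "d > 0" using K CB_pos by (simp add: d_def)
  have d4: "d powr (1/4) = 1 / (16 * CB * K)" unfolding d_def by (rule power4_powr) (use K CB_pos in simp)
  have main: "\<forall>t\<in>{a..b}. t \<le> a + real n * d \<longrightarrow> S t = T t" for n
  proof (induction n)
    case 0 then show ?case using eq by auto
  next
    case (Suc n)
    show ?case
    proof (intro ballI impI)
      fix t assume t: "t \<in> {a..b}" "t \<le> a + real (Suc n) * d"
      show "S t = T t"
      proof (cases "t \<le> a + real n * d")
        case True then show ?thesis using Suc t by blast
      next
        case False
        define c where "c = a + real n * d"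
        have c: "a \<le> c" "c \<le> t" "t - c \<le> d" using False t d by (auto simp: c_def algebra_simps)
        have "16 * CB * K * (t - c) powr (1/4) \<le> 16 * CB * K * d powr (1/4)"
          using c CB_pos K(1) by (intro mult_left_mono powr_mono2) auto
        also have "\<dots> = 1" unfolding d4 using CB_pos K(1) by simp
        finally have small: "16 * CB * K * (t - c) powr (1/4) \<le> 1" .
        have "S c = T c" using Suc c t by (auto simp: c_def)
        moreover have "sol c t S" "sol c t T"
          by (rule sol_subinterval[OF S], use c t in auto) (rule sol_subinterval[OF T], use c t in auto)
        ultimately show ?thesis
          by (intro sol_unique_step[of c t S T K t]) (use c t K small in auto)
      qed
    qed
  qed
  obtain n where "(t - a) / d < real n" using reals_Archimedean2 by blast
  then have "t \<le> a + real n * d" using d by (simp add: field_simps)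
  then show ?thesis using main[of n] t by blast
qed

text \<open>The truncated weight is a bounded operator, so it may be applied under the time
  integral, and on the heat part it acts without loss.\<close>

lemma sol_mul_bound:
  assumes S: "sol a b S" and t: "t \<in> {a..b}" and R: "R \<ge> 0" and p: "-1 < p" and A: "A \<ge> 0"
    and le: "\<And>\<tau>. a \<le> \<tau> \<Longrightarrow> \<tau> < t \<Longrightarrow> norm (mul (wt R n) (Bil (t - \<tau>) (S \<tau>) (S \<tau>))) \<le> A * (t - \<tau>) powr p"
  shows "norm (mul (wt R n) (S t)) \<le> norm (mul (wt R n) (S a)) + (1/2) * (A * ((t - a) powr (p + 1) / (p + 1)))"
proof -
  have at: "a \<le> t" using t by simp
  interpret m: bounded_linear "mul (wt R n)" by (rule wt_bounded_linear[OF R])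
  have c: "continuous_on {a..t} S" by (rule continuous_on_subset[OF solD(1)[OF S]]) (use t in auto)
  have i: "duh S t integrable_on {a..t}" by (rule duh_integrable[OF at c])
  have c': "continuous_on {a..<t} (\<lambda>\<tau>. mul (wt R n) (duh S t \<tau>))"
    by (rule m.continuous_on[OF duh_continuous[OF c]])
  have "mul (wt R n) (integral {a..t} (duh S t)) = integral {a..t} (\<lambda>\<tau>. mul (wt R n) (duh S t \<tau>))"
    using integral_bounded_linear_comp(2)[OF i m.bounded_linear_axioms] by simp
  also have "norm \<dots> \<le> A * ((t - a) powr (p + 1) / (p + 1))"
    by (rule improper_integral(2)[OF at p A c']) (simp add: duh_def le)
  finally have 1: "norm (mul (wt R n) (integral {a..t} (duh S t))) \<le> A * ((t - a) powr (p + 1) / (p + 1))" .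
  have "norm (mul (wt R n) (S t)) = norm (mul (wt R n) (heat (t - a) (S a)) + (1/2) *\<^sub>R mul (wt R n) (integral {a..t} (duh S t)))"
    by (subst solD(2)[OF S t]) (simp add: m.add m.scaleR)
  also have "\<dots> \<le> norm (mul (wt R n) (heat (t - a) (S a))) + (1/2) * norm (mul (wt R n) (integral {a..t} (duh S t)))"
    by (rule order_trans[OF norm_triangle_ineq]) simp
  also have "\<dots> \<le> norm (mul (wt R n) (S a)) + (1/2) * (A * ((t - a) powr (p + 1) / (p + 1)))"
    by (intro add_mono mult_left_mono 1 heat_wt) (use at R in auto)
  finally show ?thesis .
qed

section \<open>A priori bounds along a solution\<close>

lemma bN_self: "bN k S S = 2 * (norm (mul k S) * norm S)"
  by (simp add: bN_def)

text \<open>Each induction step restarts at a slightly later time, where the previous weight is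
  already bounded. Both terms then gain a quarter of a derivative, with the integrable factor (t -
  tau)^(-7/8) in the Duhamel term. The bounds are uniform in \<open>R\<close>, as the passage to
  untruncated weights requires.\<close>

lemma sol_smooth:
  assumes S: "sol a b S" and s: "a < s"
  shows "\<exists>M\<ge>0. \<forall>R\<ge>0. \<forall>t\<in>{s..b}. norm (mul (wt R n) (S t)) \<le> M"
  using s
proof (induction n arbitrary: s)
  case 0
  obtain K where "K > 0" "\<And>\<tau>. \<tau> \<in> {a..b} \<Longrightarrow> norm (S \<tau>) \<le> K" using sol_bounded[OF S] by metis
  then show ?case using 0 by (intro exI[of _ K]) (auto simp: mul_1)
next
  case (Suc n)
  \<comment> \<open>The midpoint keeps a positive distance s - c for the heat factor (t -
    c)^(-1/8).\<close>
  define c where "c = (a + s) / 2"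
  have c: "a < c" "c < s" using Suc.prems by (auto simp: c_def)
  obtain M where M: "M \<ge> 0" "\<And>R t. R \<ge> 0 \<Longrightarrow> t \<in> {c..b} \<Longrightarrow> norm (mul (wt R n) (S t)) \<le> M"
    using Suc.IH[OF c(1)] by metis
  obtain K where K: "K > 0" "\<And>\<tau>. \<tau> \<in> {a..b} \<Longrightarrow> norm (S \<tau>) \<le> K" using sol_bounded[OF S] by metis
  define A where "A = CB * 2 ^ n * (2 * (M * K))"
  have A: "A \<ge> 0" using M K CB_pos by (simp add: A_def)
  define B where "B = 2 * (s - c) powr (-1/8) * M + (1/2) * (A * ((b - a) powr (-7/8 + 1) / (-7/8 + 1)))"
  have "norm (mul (wt R (Suc n)) (S t)) \<le> B" if R: "R \<ge> 0" and t: "t \<in> {s..b}" for R t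
  proof -
    have ct: "c \<le> t" using c t by simp
    have Sc: "sol c b S" by (rule sol_restart[OF S]) (use c t in auto)
    interpret m: bounded_linear "mul (wt R (Suc n))" by (rule wt_bounded_linear[OF R])
    have cc: "continuous_on {c..t} S" by (rule continuous_on_subset[OF solD(1)[OF Sc]]) (use t in auto)
    have i: "duh S t integrable_on {c..t}" by (rule duh_integrable[OF ct cc])
    have c': "continuous_on {c..<t} (\<lambda>\<tau>. mul (wt R (Suc n)) (duh S t \<tau>))"
      by (rule m.continuous_on[OF duh_continuous[OF cc]])
    have le: "norm (mul (wt R (Suc n)) (duh S t \<tau>)) \<le> A * (t - \<tau>) powr (-7/8)" if "c \<le> \<tau>" "\<tau> < t" for \<tau>
    proof -
      have "norm (mul (wt R (Suc n)) (duh S t \<tau>)) \<le> CB * 2 ^ n * (t - \<tau>) powr (-7/8) * (2 * (norm (mul (wt R n) (S \<tau>)) * norm (S \<tau>)))"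
        unfolding duh_def using Bil_wt_gain[of "t - \<tau>" R n "S \<tau>" "S \<tau>"] that R by (simp add: bN_self)
      also have "\<dots> \<le> CB * 2 ^ n * (t - \<tau>) powr (-7/8) * (2 * (M * K))"
        using M(2)[OF R, of \<tau>] K(2)[of \<tau>] that c t CB_pos M(1) by (intro mult_left_mono mult_mono) auto
      finally show ?thesis by (simp add: A_def mult_ac)
    qed
    have "mul (wt R (Suc n)) (integral {c..t} (duh S t)) = integral {c..t} (\<lambda>\<tau>. mul (wt R (Suc n)) (duh S t \<tau>))"
      using integral_bounded_linear_comp(2)[OF i m.bounded_linear_axioms] by simp
    also have "norm \<dots> \<le> A * ((t - c) powr (-7/8 + 1) / (-7/8 + 1))"
      by (rule improper_integral(2)[OF ct _ A c']) (use le in auto)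
    also have "\<dots> \<le> A * ((b - a) powr (-7/8 + 1) / (-7/8 + 1))"
      using c t A by (intro mult_left_mono divide_right_mono powr_mono2) auto
    finally have 1: "norm (mul (wt R (Suc n)) (integral {c..t} (duh S t))) \<le> A * ((b - a) powr (-7/8 + 1) / (-7/8 + 1))" .
    have "norm (mul (wt R (Suc n)) (heat (t - c) (S c))) \<le> 2 * (t - c) powr (-1/8) * norm (mul (wt R n) (S c))"
      by (rule heat_wt_gain) (use c t R in auto)
    also have "\<dots> \<le> 2 * (s - c) powr (-1/8) * M"
      using M(2)[OF R, of c] c t by (intro mult_mono powr_mono2') auto
    finally have 2: "norm (mul (wt R (Suc n)) (heat (t - c) (S c))) \<le> 2 * (s - c) powr (-1/8) * M" .
    have "S t = heat (t - c) (S c) + (1/2) *\<^sub>R integral {c..t} (duh S t)"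
      by (rule solD(2)[OF Sc]) (use ct t in auto)
    then have "norm (mul (wt R (Suc n)) (S t)) = norm (mul (wt R (Suc n)) (heat (t - c) (S c)) + (1/2) *\<^sub>R mul (wt R (Suc n)) (integral {c..t} (duh S t)))"
      by (simp only: m.add[symmetric] m.scaleR[symmetric])
    also have "\<dots> \<le> norm (mul (wt R (Suc n)) (heat (t - c) (S c))) + (1/2) * norm (mul (wt R (Suc n)) (integral {c..t} (duh S t)))"
      by (rule order_trans[OF norm_triangle_ineq]) simp
    also have "\<dots> \<le> B" unfolding B_def by (intro add_mono 2 mult_left_mono 1) auto
    finally show ?thesis .
  qed
  then show ?case by (intro exI[of _ "max B 0"]) (auto simp: le_max_iff_disj)
qed

text \<open>No smoothing is used, so the bound survives down to the initial time; its factor tends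
  to 1 there, which gives continuity of the H^1 norm from above.\<close>

lemma sol_persistence:
  assumes S: "sol a b S" and K: "\<And>\<tau>. \<tau> \<in> {a..b} \<Longrightarrow> norm (S \<tau>) \<le> K" and R: "R \<ge> 0"
    and small: "128 * CB * K * (b - a) powr (1/4) \<le> 1" and N: "norm (mul (wt R 4) (S a)) \<le> N" and t: "t \<in> {a..b}"
  shows "norm (mul (wt R 4) (S t)) \<le> N * (1 + 128 * CB * K * (t - a) powr (1/4))"
proof -
  have ab: "a \<le> b" using t by simp
  have K0: "K \<ge> 0" using K[of a] ab norm_ge_zero[of "S a"] by (metis atLeastAtMost_iff order_refl order_trans)
  interpret m: bounded_linear "mul (wt R 4)" by (rule wt_bounded_linear[OF R])
  obtain t0 where t0: "t0 \<in> {a..b}" "\<And>x. x \<in> {a..b} \<Longrightarrow> norm (mul (wt R 4) (S x)) \<le> norm (mul (wt R 4) (S t0))"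
    using continuous_attains_norm_sup[OF ab m.continuous_on[OF solD(1)[OF S]]] by metis
  define M where "M = norm (mul (wt R 4) (S t0))"
  have M0: "M \<ge> 0" by (simp add: M_def)
  have step: "norm (mul (wt R 4) (S x)) \<le> N + 64 * CB * K * M * (x - a) powr (1/4)" if x: "x \<in> {a..b}" for x
  proof -
    have A: "0 \<le> 32 * CB * K * M" using CB_pos K0 M0 by simp
    have "norm (mul (wt R 4) (S x)) \<le> norm (mul (wt R 4) (S a)) + (1/2) * (32 * CB * K * M * ((x - a) powr (-3/4 + 1) / (-3/4 + 1)))"
    proof (rule sol_mul_bound[OF S x R _ A])
      fix \<tau> assume \<tau>: "a \<le> \<tau>" "\<tau> < x"
      have "norm (mul (wt R 4) (Bil (x - \<tau>) (S \<tau>) (S \<tau>))) \<le> CB * 2 ^ 4 * (x - \<tau>) powr (-3/4) * (2 * (norm (mul (wt R 4) (S \<tau>)) * norm (S \<tau>)))"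
        using Bil_wt[of "x - \<tau>" R 4 "S \<tau>" "S \<tau>"] \<tau> R by (simp add: bN_self)
      also have "\<dots> \<le> CB * 2 ^ 4 * (x - \<tau>) powr (-3/4) * (2 * (M * K))"
        using t0(2)[of \<tau>] K[of \<tau>] \<tau> x CB_pos M0 by (intro mult_left_mono mult_mono) (auto simp: M_def)
      finally show "norm (mul (wt R 4) (Bil (x - \<tau>) (S \<tau>) (S \<tau>))) \<le> 32 * CB * K * M * (x - \<tau>) powr (-3/4)"
        by (simp add: mult_ac)
    qed simp
    also have "(1/2) * (32 * CB * K * M * ((x - a) powr (-3/4 + 1) / (-3/4 + 1))) = 64 * CB * K * M * (x - a) powr (1/4)"
      by simp
    finally show ?thesis using N by linarith
  qed
  have "64 * CB * K * M * (t0 - a) powr (1/4) \<le> 64 * CB * K * M * (b - a) powr (1/4)"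
    using t0(1) CB_pos K0 M0 by (intro mult_left_mono powr_mono2) auto
  also have "\<dots> = (128 * CB * K * (b - a) powr (1/4)) * (M / 2)" by simp
  also have "\<dots> \<le> 1 * (M / 2)" by (rule mult_right_mono[OF small]) (use M0 in simp)
  \<comment> \<open>The crude bound M <= 2 N is fed back into \<open>step\<close>, which replaces
    the unknown maximum by the initial value.\<close>
  finally have "M \<le> N + M / 2" using step[OF t0(1)] by (simp add: M_def)
  then have M: "M \<le> 2 * N" by simp
  have "64 * CB * K * M * (t - a) powr (1/4) \<le> 64 * CB * K * (2 * N) * (t - a) powr (1/4)"
    using M CB_pos K0 by (intro mult_right_mono mult_left_mono) auto
  with step[OF t] show ?thesis by (simp add: algebra_simps)
qed

text \<open>With min(|xi|, 1) S bounded by \<open>B\<close>, the Duhamel term is linear in the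
  maximum M of the L^2 norm, and a short interval yields M <= |S a| + M / 2. The admissible length
  depends on \<open>B\<close> and not on the L^2 norm.\<close>

lemma sol_growth:
  assumes S: "sol a b S" and B: "\<And>\<tau>. \<tau> \<in> {a..b} \<Longrightarrow> norm (mul (wt 1 4) (S \<tau>)) \<le> B"
    and small: "256 * CB * B * (b - a) powr (1/4) \<le> 1" "b - a \<le> 1" and t: "t \<in> {a..b}"
  shows "norm (S t) \<le> 2 * norm (S a)"
proof -
  have ab: "a \<le> b" using t by simp
  have B0: "B \<ge> 0" using B[of a] ab norm_ge_zero[of "mul (wt 1 4) (S a)"] by (metis atLeastAtMost_iff order_refl order_trans)
  obtain t0 where t0: "t0 \<in> {a..b}" "\<And>x. x \<in> {a..b} \<Longrightarrow> norm (S x) \<le> norm (S t0)"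
    using continuous_attains_norm_sup[OF ab solD(1)[OF S]] by metis
  define M where "M = norm (S t0)"
  have M0: "M \<ge> 0" by (simp add: M_def)
  have A: "0 \<le> 64 * CB * B * M" using CB_pos B0 M0 by simp
  have "norm (mul (wt 1 0) (S t0)) \<le> norm (mul (wt 1 0) (S a)) + (1/2) * (64 * CB * B * M * ((t0 - a) powr (-3/4 + 1) / (-3/4 + 1)))"
  proof (rule sol_mul_bound[OF S t0(1) _ _ A])
    fix \<tau> assume \<tau>: "a \<le> \<tau>" "\<tau> < t0"
    \<comment> \<open>An interval of length at most 1 lets the constant in 1 + (t0 - tau)^(-3/4) be
      absorbed by the singular term.\<close>
    have "1 \<le> (t0 - \<tau>) powr (-3/4)"
      using powr_mono2'[of "-3/4" "t0 - \<tau>" 1] \<tau> t0(1) small(2) by simp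
    then have "CB * 16 * (1 + (t0 - \<tau>) powr (-3/4)) * (2 * (norm (mul (wt 1 4) (S \<tau>)) * norm (S \<tau>))) \<le>
       CB * 16 * (2 * (t0 - \<tau>) powr (-3/4)) * (2 * (B * M))"
      using B[of \<tau>] t0(2)[of \<tau>] \<tau> t0(1) CB_pos B0 by (intro mult_mono) (auto simp: M_def)
    then show "norm (mul (wt 1 0) (Bil (t0 - \<tau>) (S \<tau>) (S \<tau>))) \<le> 64 * CB * B * M * (t0 - \<tau>) powr (-3/4)"
      using Bil_low[of "t0 - \<tau>" "S \<tau>" "S \<tau>"] \<tau> by (simp add: bN_self mul_1 mult_ac)
  qed auto
  then have "M \<le> norm (S a) + 128 * CB * B * M * (t0 - a) powr (1/4)" by (simp add: mul_1 M_def mult_ac)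
  also have "128 * CB * B * M * (t0 - a) powr (1/4) \<le> 128 * CB * B * M * (b - a) powr (1/4)"
    using t0(1) CB_pos B0 M0 by (intro mult_left_mono powr_mono2) auto
  also have "\<dots> = (256 * CB * B * (b - a) powr (1/4)) * (M / 2)" by simp
  also have "\<dots> \<le> 1 * (M / 2)" by (rule mult_right_mono[OF small(1)]) (use M0 in simp)
  finally show ?thesis using t0(2)[OF t] by (simp add: M_def)
qed

section \<open>Sobolev norms\<close>

lemma qw_pow_even: "even_weight (qp n)"
  by (simp add: even_weight_def)

lemma qw_pow_dom_0[simp]: "mul_dom (qp 0) S"
  by (simp add: mul_dom_def square_integrable_FM)

lemma wt_le_qw: "R \<ge> 0 \<Longrightarrow> wt R n xi \<le> qw xi ^ n"
  by (simp add: wt_def power_mono)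

lemma mul_wt_le:
  assumes "R \<ge> 0" "mul_dom (qp n) S"
  shows "norm (mul (wt R n) S) \<le> norm (mul (qp n) S)"
proof (rule norm_mul_mono(2)[OF qw_pow_even assms(2) wt_even])
  show "AE xi in lborel. norm (wt R n xi *\<^sub>R FM S xi) \<le> norm (qw xi ^ n *\<^sub>R FM S xi)"
    using wt_le_qw[OF assms(1)] wt_nonneg[OF assms(1)] by (auto intro!: mult_right_mono)
qed

lemma wt_tendsto: "(\<lambda>k. wt (real k) n xi) \<longlonglongrightarrow> qw xi ^ n"
proof (rule tendsto_eventually)
  obtain N where N: "qw xi \<le> real N" using real_arch_simple by blast
  show "\<forall>\<^sub>F k in sequentially. wt (real k) n xi = qw xi ^ n"
    by (rule eventually_sequentiallyI[of N]) (use N in \<open>simp add: wt_def min_absorb1\<close>)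
qed

text \<open>Fatou's lemma along the truncations R = 0, 1, 2, ...: a bound uniform in
  \<open>R\<close> yields finiteness and the same bound for the full weight.\<close>

lemma mul_dom_limit:
  assumes M: "\<And>R. R \<ge> 0 \<Longrightarrow> norm (mul (wt R n) S) \<le> M"
  shows "mul_dom (qp n) S" "norm (mul (qp n) S) \<le> M"
proof -
  have M0: "M \<ge> 0" using M[of 0] norm_ge_zero order_trans by blast
  let ?f = "\<lambda>m xi. (norm (m xi *\<^sub>R FM S xi))\<^sup>2"
  have q[measurable]: "(qp n) \<in> borel_measurable borel" by simp
  have w[measurable]: "wt R n \<in> borel_measurable borel" for R using wt_even by (simp add: even_weight_def)
  have b: "(\<integral>\<^sup>+xi. ennreal (?f (wt (real k) n) xi) \<partial>(lborel::(real^3) measure)) \<le> ennreal ((cG * M)\<^sup>2)" for k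
  proof -
    have d: "mul_dom (wt (real k) n) S" by (rule wt_dom) simp
    have "(\<integral>\<^sup>+xi. ennreal (?f (wt (real k) n) xi) \<partial>(lborel::(real^3) measure)) = ennreal (LBINT xi. ?f (wt (real k) n) xi)"
      by (rule nn_integral_eq_integral) (use d in \<open>auto simp: mul_dom_def square_integrable_def\<close>)
    also have "(LBINT xi. ?f (wt (real k) n) xi) = (cG * norm (mul (wt (real k) n) S))\<^sup>2"
      unfolding norm_mul[OF wt_even d] l2norm_power2 ..
    also have "ennreal \<dots> \<le> ennreal ((cG * M)\<^sup>2)"
      using M[of "real k"] cG_pos by (intro ennreal_leI power_mono mult_left_mono) auto
    finally show ?thesis .
  qed
  have "(\<integral>\<^sup>+xi. ennreal (?f (qp n) xi) \<partial>(lborel::(real^3) measure)) =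
      (\<integral>\<^sup>+xi. liminf (\<lambda>k. ennreal (?f (wt (real k) n) xi)) \<partial>(lborel::(real^3) measure))"
  proof (rule nn_integral_cong)
    fix xi :: "real^3"
    have "(\<lambda>k. ennreal (?f (wt (real k) n) xi)) \<longlonglongrightarrow> ennreal (?f (qp n) xi)"
      by (intro tendsto_intros wt_tendsto)
    then show "ennreal (?f (qp n) xi) = liminf (\<lambda>k. ennreal (?f (wt (real k) n) xi))"
      by (rule lim_imp_Liminf[OF sequentially_bot, symmetric])
  qed
  also have "\<dots> \<le> liminf (\<lambda>k. \<integral>\<^sup>+xi. ennreal (?f (wt (real k) n) xi) \<partial>(lborel::(real^3) measure))"
    by (rule nn_integral_liminf) measurable
  also have "\<dots> \<le> liminf (\<lambda>k. ennreal ((cG * M)\<^sup>2))"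
    by (rule Liminf_mono) (use b in simp)
  finally have fin: "(\<integral>\<^sup>+xi. ennreal (?f (qp n) xi) \<partial>(lborel::(real^3) measure)) \<le> ennreal ((cG * M)\<^sup>2)"
    by (simp add: Liminf_const)
  have int: "integrable lborel (?f (qp n))"
    by (rule integrableI_bounded) (use fin in \<open>auto intro: le_less_trans\<close>)
  then show d: "mul_dom (qp n) S"
    unfolding mul_dom_def square_integrable_def by auto
  have "ennreal ((cG * norm (mul (qp n) S))\<^sup>2) \<le> ennreal ((cG * M)\<^sup>2)"
    using fin nn_integral_eq_integral[OF int] unfolding norm_mul[OF qw_pow_even d] l2norm_power2 by simp
  then have "(cG * norm (mul (qp n) S))\<^sup>2 \<le> (cG * M)\<^sup>2" by (simp add: ennreal_le_iff)
  then have "cG * norm (mul (qp n) S) \<le> cG * M"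
    by (rule power2_le_imp_le) (use M0 cG_pos in simp)
  then show "norm (mul (qp n) S) \<le> M" using cG_pos by simp
qed

text \<open>Membership in all H^k, expressed by powers of |xi|^(1/4) so that the steps of the
  regularity induction can be used directly.\<close>

definition smooth :: "matrix_l2 \<Rightarrow> bool" where
  "smooth S \<longleftrightarrow> (\<forall>n. mul_dom (qp n) S)"

lemma smoothD: "smooth S \<Longrightarrow> mul_dom (qp n) S"
  by (simp add: smooth_def)

lemma mul_qw_mult:
  assumes "smooth S"
  shows "mul (qp m) (mul (qp n) S) = mul (qp (m + n)) S"
    "mul_dom (qp m) (mul (qp n) S)"
proof -
  have "AE xi in lborel. FM (mul (qp (m + n)) S) xi = qw xi ^ m *\<^sub>R FM (mul (qp n) S) xi"
    using FM_mul[OF qw_pow_even smoothD[OF assms], of "m + n"] FM_mul[OF qw_pow_even smoothD[OF assms], of n]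
  proof eventually_elim
    case (elim xi) show ?case unfolding elim by (simp add: power_add)
  qed
  from mul_eqI[OF this qw_pow_even] show "mul (qp m) (mul (qp n) S) = mul (qp (m + n)) S"
    "mul_dom (qp m) (mul (qp n) S)" .
qed

lemma smooth_mul: "smooth S \<Longrightarrow> smooth (mul (qp n) S)"
  using mul_qw_mult(2) by (simp add: smooth_def)

lemma smooth_diff: "smooth S \<Longrightarrow> smooth T \<Longrightarrow> smooth (S - T)"
  using mul_diff(2)[OF qw_pow_even] by (simp add: smooth_def)

lemma mul_qw_inner:
  assumes "smooth S" "smooth T"
  shows "mul (qp m) S \<bullet> mul (qp n) T = S \<bullet> mul (qp (m + n)) T"
  using inner_mul[OF qw_pow_even smoothD[OF assms(1)] smoothD[OF smooth_mul[OF assms(2)]]] mul_qw_mult(1)[OF assms(2)] by simp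

text \<open>Cauchy-Schwarz after one weight has been moved across the inner product. With a bound in
  the higher norm it upgrades L^2 continuity in time to weighted norms.\<close>

lemma interpolation:
  assumes "smooth S"
  shows "(norm (mul (qp n) S))\<^sup>2 \<le> norm S * norm (mul (qp (n + n)) S)"
  unfolding power2_norm_eq_inner mul_qw_inner[OF assms assms] by (rule norm_cauchy_schwarz)

text \<open>The hypothesis makes the prospective transform of the derivative square integrable, so
  the description in \<open>l2_partial\<close> has a witness; the transform rule for weak
  derivatives makes it unique.\<close>

lemma partial_exists:
  assumes d: "mul_dom norm f"
  obtains g :: matrix_l2 where "l2_partial i f = g"
    "AE xi in lborel. FM g xi = (\<chi> a b. \<i> * cor (xi $ i) * FM f xi $ a $ b)"
proof -
  let ?N = "\<lambda>xi::real^3. (\<chi> a b. \<i> * cor (xi $ i) * FM f xi $ a $ b) :: complex^3^3"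
  have Nm[measurable]: "?N \<in> borel_measurable borel"
    unfolding vec_borel_measurable_iff by simp
  have nN: "norm (?N xi) = \<bar>xi $ i\<bar> * norm (FM f xi)" for xi
  proof -
    have "(norm (?N xi))\<^sup>2 = (\<bar>xi $ i\<bar> * norm (FM f xi))\<^sup>2"
      unfolding norm_vec_power2 power_mult_distrib by (simp add: norm_mult power_mult_distrib sum_distrib_left)
    then show ?thesis by (simp add: power2_eq_iff_nonneg)
  qed
  have "square_integrable ?N"
    by (rule square_integrable_bound(1)[OF d[unfolded mul_dom_def]])
      (auto simp: nN intro!: AE_I2 mult_right_mono component_le_norm_cart)
  moreover have "hermitian_mat ?N"
    using FM_hermitian[of f] unfolding hermitian_mat_def
    by eventually_elim (simp add: cnj_mat_def vec_eq_iff)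
  ultimately obtain g :: matrix_l2 where g: "has_fourier_mat (rep_l2 g) ?N"
    by (rule mat_fourier_surj)
  have hp: "has_partial i (rep_l2 f) (rep_l2 g)"
    unfolding has_partial_vec_iff
  proof (intro allI)
    fix a b
    have F: "has_fourier (\<lambda>x. cor (rep_l2 f x $ a $ b)) (\<lambda>xi. FM f xi $ a $ b)"
      using FM[of f] by (simp add: has_fourier_mat_def)
    have G: "has_fourier (\<lambda>x. cor (rep_l2 g x $ a $ b)) (\<lambda>xi. \<i> * cor (xi $ i) * FM f xi $ a $ b)"
      using g by (simp add: has_fourier_mat_def)
    show "has_partial i (\<lambda>x. rep_l2 f x $ a $ b) (\<lambda>x. rep_l2 g x $ a $ b)"
      by (rule fourier_has_partial[OF F G])
  qed
  have "l2_partial i f = g"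
    unfolding l2_partial_def
  proof (rule the_equality)
    show "has_partial i (rep_l2 f) (rep_l2 g)" by (rule hp)
    fix h :: matrix_l2 assume h: "has_partial i (rep_l2 f) (rep_l2 h)"
    have "has_fourier_mat (rep_l2 h) ?N"
      unfolding has_fourier_mat_def
    proof (intro allI)
      fix a b
      have F: "has_fourier (\<lambda>x. cor (rep_l2 f x $ a $ b)) (\<lambda>xi. FM f xi $ a $ b)"
        using FM[of f] by (simp add: has_fourier_mat_def)
      have "has_partial i (\<lambda>x. rep_l2 f x $ a $ b) (\<lambda>x. rep_l2 h x $ a $ b)"
        using h unfolding has_partial_vec_iff by blast
      from has_partial_fourier[OF this F]
      show "has_fourier (\<lambda>x. cor (rep_l2 h x $ a $ b)) (\<lambda>xi. ?N xi $ a $ b)" by simp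
    qed
    from has_fourier_mat_inj[OF this g] show "h = g" by (rule rep_l2_eqI)
  qed
  then show ?thesis using that has_fourier_mat_FM[OF g] by blast
qed

section \<open>Derivatives and Sobolev norms through weights\<close>

lemma qw4: "(qp 4) = norm" by (simp add: fun_eq_iff qw_pow4)
lemma norm_partial_vec:
  "norm (\<chi> a b. \<i> * cor c * (A::complex^3^3) $ a $ b) = \<bar>c\<bar> * norm A"
proof -
  have "(norm (\<chi> a b. \<i> * cor c * A $ a $ b))\<^sup>2 = (\<bar>c\<bar> * norm A)\<^sup>2"
    unfolding norm_vec_power2 power_mult_distrib by (simp add: norm_mult power_mult_distrib sum_distrib_left)
  then show ?thesis by (simp add: power2_eq_iff_nonneg)
qed

lemma Hdot1_norm_mul:
  assumes d: "mul_dom (qp 4) f"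
  shows "Hdot1_norm f = norm (mul (qp 4) f)"
proof -
  have d': "mul_dom norm f" using d by (simp add: qw4)
  have FMp: "AE xi in lborel. norm (FM (l2_partial i f) xi) = \<bar>xi $ i\<bar> * norm (FM f xi)" for i
  proof -
    obtain g where g: "l2_partial i f = g" "AE xi in lborel. FM g xi = (\<chi> a b. \<i> * cor (xi $ i) * FM f xi $ a $ b)"
      using partial_exists[OF d'] by blast
    show ?thesis unfolding g(1) using g(2) by eventually_elim (simp only: norm_partial_vec)
  qed
  have e: "(cG * norm (l2_partial i f))\<^sup>2 = (LBINT xi. (\<bar>xi $ i\<bar> * norm (FM f xi))\<^sup>2)"
    and I: "integrable lborel (\<lambda>xi::real^3. (\<bar>xi $ i\<bar> * norm (FM f xi))\<^sup>2)" for i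
  proof -
    have s: "integrable lborel (\<lambda>xi. (norm (FM (l2_partial i f) xi))\<^sup>2)"
      using square_integrable_FM[of "l2_partial i f"] by (simp add: square_integrable_def)
    have ae: "AE xi in lborel. (norm (FM (l2_partial i f) xi))\<^sup>2 = (\<bar>xi $ i\<bar> * norm (FM f xi))\<^sup>2"
      using FMp[of i] by eventually_elim simp
    show "(cG * norm (l2_partial i f))\<^sup>2 = (LBINT xi. (\<bar>xi $ i\<bar> * norm (FM f xi))\<^sup>2)"
      unfolding l2norm_FM[symmetric] l2norm_power2 by (rule integral_cong_AE) (use ae in \<open>auto\<close>)
    show "integrable lborel (\<lambda>xi::real^3. (\<bar>xi $ i\<bar> * norm (FM f xi))\<^sup>2)"
      by (rule integrable_cong_AE_imp[OF s]) (use ae in \<open>auto elim: eventually_mono\<close>)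
  qed
  have "cG\<^sup>2 * (\<Sum>i\<in>UNIV. (norm (l2_partial i f))\<^sup>2) = (\<Sum>i\<in>UNIV. (cG * norm (l2_partial i f))\<^sup>2)"
    by (simp add: sum_distrib_left power_mult_distrib)
  also have "\<dots> = (\<integral>xi. (\<Sum>i\<in>UNIV. (\<bar>xi $ i\<bar> * norm (FM f xi))\<^sup>2) \<partial>lborel)"
    unfolding e by (rule Bochner_Integration.integral_sum[symmetric]) (rule I)
  also have "\<dots> = (LBINT xi. (norm (norm xi *\<^sub>R FM f xi))\<^sup>2)"
    by (rule Bochner_Integration.integral_cong)
      (auto simp: power_mult_distrib sum_distrib_right[symmetric] norm_vec_power2[where 'b=real])
  also have "\<dots> = (cG * norm (mul norm f))\<^sup>2"
    unfolding norm_mul[OF qw_pow_even[of 4, unfolded qw4] d'] l2norm_power2 ..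
  finally have "(\<Sum>i\<in>UNIV. (norm (l2_partial i f))\<^sup>2) = (norm (mul norm f))\<^sup>2"
    using cG_pos by (simp add: power_mult_distrib)
  then show ?thesis unfolding Hdot1_norm_def qw4 by simp
qed

lemma FM_sum: "finite I \<Longrightarrow> AE xi in lborel. FM (\<Sum>i\<in>I. f i) xi = (\<Sum>i\<in>I. FM (f i) xi)"
proof (induction I rule: finite_induct)
  case empty then show ?case using FM_0 by simp
next
  case (insert x F)
  show ?case using insert.IH FM_add[of "f x" "\<Sum>i\<in>F. f i"] by eventually_elim (simp add: insert.hyps)
qed

lemma laplacian_mul:
  assumes d: "mul_dom (qp 4) f" "mul_dom (qp 8) f"
  shows "- l2_laplacian f = mul (qp 8) f"
proof -
  have d': "mul_dom norm f" using d by (simp add: qw4)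
  have p: "AE xi in lborel. FM (l2_partial i (l2_partial i f)) xi = - (xi $ i)\<^sup>2 *\<^sub>R FM f xi" for i
  proof -
    obtain g where g: "l2_partial i f = g" "AE xi in lborel. FM g xi = (\<chi> a b. \<i> * cor (xi $ i) * FM f xi $ a $ b)"
      using partial_exists[OF d'] by blast
    have "mul_dom norm g"
    proof (rule norm_mul_mono(1)[OF qw_pow_even d(2) qw_pow_even[of 4, unfolded qw4]])
      show "AE xi in lborel. norm (norm xi *\<^sub>R FM g xi) \<le> norm (qw xi ^ 8 *\<^sub>R FM f xi)"
        using g(2)
      proof eventually_elim
        case (elim xi)
        have "norm xi * (\<bar>xi $ i\<bar> * norm (FM f xi)) \<le> norm xi * (norm xi * norm (FM f xi))"
          by (intro mult_left_mono mult_right_mono component_le_norm_cart) auto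
        then show ?case unfolding elim qw_pow8 norm_scaleR norm_partial_vec by (simp add: power2_eq_square mult_ac)
      qed
    qed
    then obtain k where k: "l2_partial i g = k" "AE xi in lborel. FM k xi = (\<chi> a b. \<i> * cor (xi $ i) * FM g xi $ a $ b)"
      using partial_exists by blast
    show ?thesis unfolding g(1) k(1) using g(2) k(2)
    proof eventually_elim
      case (elim xi)
      show ?case unfolding elim(2) unfolding elim(1)
        by (simp add: vec_eq_iff scaleR_conv_of_real[where 'a=complex] power2_eq_square algebra_simps)
    qed
  qed
  have all: "AE xi in lborel. \<forall>i. FM (l2_partial i (l2_partial i f)) xi = - (xi $ i)\<^sup>2 *\<^sub>R FM f xi"
    using p by (simp add: AE_all_countable)
  have sum: "AE xi in lborel. FM (l2_laplacian f) xi = (\<Sum>i\<in>UNIV. FM (l2_partial i (l2_partial i f)) xi)"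
    unfolding l2_laplacian_def by (rule FM_sum) simp
  have "AE xi in lborel. FM (- l2_laplacian f) xi = qw xi ^ 8 *\<^sub>R FM f xi"
    using all sum FM_scaleR[of "-1" "l2_laplacian f"]
  proof eventually_elim
    case (elim xi)
    have "FM (- l2_laplacian f) xi = - (\<Sum>i\<in>UNIV. - (xi $ i)\<^sup>2 *\<^sub>R FM f xi)"
      using elim by simp
    also have "\<dots> = (\<Sum>i\<in>UNIV. (xi $ i)\<^sup>2) *\<^sub>R FM f xi"
      by (simp add: sum_negf scaleR_sum_left)
    also have "(\<Sum>i\<in>UNIV. (xi $ i)\<^sup>2) = qw xi ^ 8"
      unfolding qw_pow8 norm_vec_power2 by simp
    finally show ?case .
  qed
  from mul_eqI(1)[OF this qw_pow_even] show ?thesis by simp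
qed

lemma bessel_weight_le: "(1 + (norm xi)\<^sup>2) powr real k \<le> 2 ^ k * (1 + (qw xi ^ (4 * k))\<^sup>2)"
proof -
  have "(1 + (norm xi)\<^sup>2) powr real k = (1 + (norm xi)\<^sup>2) ^ k"
    by (rule powr_realpow) (simp add: add_pos_nonneg)
  also have "\<dots> \<le> 2 ^ k * (1 ^ k + ((norm xi)\<^sup>2) ^ k)" by (rule add_power_le) auto
  also have "((norm xi)\<^sup>2) ^ k = (qw xi ^ (4 * k))\<^sup>2"
    unfolding power_mult qw_pow4 by (simp add: power_mult[symmetric] mult.commute)
  finally show ?thesis by simp
qed

lemma Hs_bound:
  assumes d: "mul_dom (qp (4 * k)) S"
  shows "S \<in> Hs (real k)"
    "(Hs_norm (real k) S)\<^sup>2 \<le> 2 ^ k * cG\<^sup>2 * ((norm S)\<^sup>2 + (norm (mul (qp (4 * k)) S))\<^sup>2)"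
proof -
  let ?h = "\<lambda>xi. (1 + (norm xi)\<^sup>2) powr real k * (norm (FM S xi))\<^sup>2"
  let ?g = "\<lambda>xi. 2 ^ k * ((norm (FM S xi))\<^sup>2 + (norm (qw xi ^ (4 * k) *\<^sub>R FM S xi))\<^sup>2)"
  have i1: "integrable lborel (\<lambda>xi. (norm (FM S xi))\<^sup>2)"
    using square_integrable_FM[of S] by (simp add: square_integrable_def)
  have i2: "integrable lborel (\<lambda>xi. (norm (qw xi ^ (4 * k) *\<^sub>R FM S xi))\<^sup>2)"
    using d by (simp only: mul_dom_def square_integrable_def)
  have ig: "integrable lborel ?g" by (intro integrable_mult_right Bochner_Integration.integrable_add i1 i2)
  have le: "?h xi \<le> ?g xi" for xi
    using mult_right_mono[OF bessel_weight_le[of xi k], of "(norm (FM S xi))\<^sup>2"]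
    by (simp add: power_mult_distrib algebra_simps)
  have h0: "0 \<le> ?h xi" for xi by simp
  have ih: "integrable lborel ?h"
    by (rule Bochner_Integration.integrable_bound[OF ig]) (use le in \<open>auto intro!: AE_I2 order_trans[OF le]\<close>)
  then show "S \<in> Hs (real k)" by (simp add: Hs_def FM_def)
  have "(Hs_norm (real k) S)\<^sup>2 = (LBINT xi. ?h xi)"
    unfolding Hs_norm_def FM_def[symmetric] by (simp add: integral_nonneg_AE)
  also have "\<dots> \<le> (LBINT xi. ?g xi)" by (rule integral_mono[OF ih ig le])
  also have "\<dots> = 2 ^ k * ((LBINT xi. (norm (FM S xi))\<^sup>2) + (LBINT xi. (norm (qw xi ^ (4 * k) *\<^sub>R FM S xi))\<^sup>2))"
    by (simp only: integral_mult_right_zero Bochner_Integration.integral_add[OF i1 i2])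
  also have "\<dots> = 2 ^ k * cG\<^sup>2 * ((norm S)\<^sup>2 + (norm (mul (qp (4 * k)) S))\<^sup>2)"
    unfolding l2norm_power2[symmetric] l2norm_FM norm_mul[OF qw_pow_even d, symmetric]
    by (simp add: power_mult_distrib algebra_simps)
  finally show "(Hs_norm (real k) S)\<^sup>2 \<le> 2 ^ k * cG\<^sup>2 * ((norm S)\<^sup>2 + (norm (mul (qp (4 * k)) S))\<^sup>2)" .
qed

lemma Hs_1_dom:
  assumes "S \<in> Hs 1"
  shows "mul_dom (qp 4) S"
  unfolding mul_dom_def square_integrable_def qw_pow4
proof
  have "integrable lborel (\<lambda>xi. (1 + (norm xi)\<^sup>2) powr 1 * (norm (FM S xi))\<^sup>2)"
    using assms by (simp add: Hs_def FM_def)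
  then show "integrable lborel (\<lambda>xi. (norm (norm xi *\<^sub>R FM S xi))\<^sup>2)"
    by (rule Bochner_Integration.integrable_bound)
      (auto intro!: AE_I2 mult_right_mono simp: power_mult_distrib abs_mult add_pos_nonneg powr_one)
qed simp

section \<open>Cancellation in the energy balance\<close>

text \<open>(1 + |xi|^2)^(-3/2), which is square integrable and whose inverse is at most 2 (1 +
  |xi|^4); in powers of \<open>qw\<close> that is exponent 16.\<close>

definition wL :: "real^3 \<Rightarrow> real" where "wL xi = sqrt (decay_weight xi)"

lemma wL: "square_integrable wL" "1 \<le> wL xi * (2 * (1 + qw xi ^ 16))"
proof -
  have [measurable]: "wL \<in> borel_measurable borel" unfolding wL_def[abs_def] by measurable
  have "(\<lambda>xi. (norm (wL xi))\<^sup>2) = decay_weight"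
    using decay_weight_pos by (simp add: wL_def fun_eq_iff less_imp_le)
  then show "square_integrable wL" by (simp add: square_integrable_def integrable_decay_weight)
  let ?a = "1 + (norm xi)\<^sup>2"
  have a: "?a \<ge> 1" by simp
  have q: "qw xi ^ 16 = ((norm xi)\<^sup>2)\<^sup>2"
    using qw_pow8[of xi] power_mult[of "qw xi" 8 2] by simp
  have "?a\<^sup>2 \<le> 2 ^ 2 * (1 + ((norm xi)\<^sup>2)\<^sup>2) / 2"
    using sum_squares_ge_zero[of "1 - (norm xi)\<^sup>2" 0] by (simp add: power2_eq_square algebra_simps)
  then have le: "?a\<^sup>2 \<le> 2 * (1 + qw xi ^ 16)" unfolding q by simp
  have "sqrt (?a ^ 3) \<le> sqrt (?a ^ 4)" using a by (intro real_sqrt_le_mono power_increasing) auto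
  also have "sqrt (?a ^ 4) = ?a\<^sup>2" by (rule real_sqrt_unique) (simp_all flip: power_mult)
  finally have s: "sqrt (?a ^ 3) \<le> 2 * (1 + qw xi ^ 16)" using le by simp
  have p: "sqrt (?a ^ 3) > 0" by (simp add: add_pos_nonneg)
  have "wL xi = inverse (sqrt (?a ^ 3))" by (simp add: wL_def decay_weight_def real_sqrt_inverse)
  then have "1 = wL xi * sqrt (?a ^ 3)" using p by (simp add: field_simps)
  moreover have "wL xi \<ge> 0" using decay_weight_pos[of xi] by (simp add: wL_def)
  ultimately show "1 \<le> wL xi * (2 * (1 + qw xi ^ 16))" using mult_left_mono[OF s] by metis
qed

definition CW :: real where "CW = cG * l2norm wL"

text \<open>Cauchy-Schwarz against \<open>wL\<close>: four more derivatives in L^2 buy integrability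
  of the transform.\<close>

lemma smooth_L1:
  assumes "smooth T"
  shows "integrable lborel (\<lambda>xi. qw xi ^ n * norm (FM T xi))"
    "(LBINT xi. qw xi ^ n * norm (FM T xi)) \<le> 2 * CW * (norm (mul (qp n) T) + norm (mul (qp (n + 16)) T))"
proof -
  let ?a = "\<lambda>n xi. norm (qw xi ^ n *\<^sub>R FM T xi)"
  let ?F = "\<lambda>xi. ?a n xi + ?a (n + 16) xi"
  have sq: "square_integrable (?a n)" "l2norm (?a n) = cG * norm (mul (qp n) T)" for n
  proof -
    have d: "square_integrable (\<lambda>xi. qw xi ^ n *\<^sub>R FM T xi)" using smoothD[OF assms, of n] by (simp add: mul_dom_def)
    have m: "(\<lambda>xi. qw xi ^ n *\<^sub>R FM T xi) \<in> borel_measurable borel" by measurable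
    show "square_integrable (?a n)"
      by (rule square_integrable_bound(1)[OF d]) (use m in auto)
    show "l2norm (?a n) = cG * norm (mul (qp n) T)"
      unfolding norm_mul[OF qw_pow_even smoothD[OF assms]] by (rule l2norm_cong_AE) (use m in auto)
  qed
  have F: "square_integrable ?F" by (rule square_integrable_add[OF sq(1) sq(1)])
  have lF: "l2norm ?F \<le> cG * (norm (mul (qp n) T) + norm (mul (qp (n + 16)) T))"
    using l2norm_triangle[OF sq(1)[of n] sq(1)[of "n + 16"]] unfolding sq(2) by (simp add: algebra_simps)
  note cs = l2norm_Cauchy_Schwarz[OF wL(1) F]
  have le: "qw xi ^ n * norm (FM T xi) \<le> 2 * (norm (wL xi) * norm (?F xi))" for xi
  proof -
    have w: "wL xi \<ge> 0" using decay_weight_pos[of xi] by (simp add: wL_def)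
    have "1 * (qw xi ^ n * norm (FM T xi)) \<le> (wL xi * (2 * (1 + qw xi ^ 16))) * (qw xi ^ n * norm (FM T xi))"
      by (rule mult_right_mono[OF wL(2)]) simp
    then show ?thesis using w by (simp add: power_add algebra_simps)
  qed
  have i: "integrable lborel (\<lambda>xi. 2 * (norm (wL xi) * norm (?F xi)))" by (rule integrable_mult_right[OF cs(1)])
  show int: "integrable lborel (\<lambda>xi. qw xi ^ n * norm (FM T xi))"
    by (rule Bochner_Integration.integrable_bound[OF i]) (use le in \<open>auto intro!: AE_I2\<close>)
  have "(LBINT xi. qw xi ^ n * norm (FM T xi)) \<le> (LBINT xi. 2 * (norm (wL xi) * norm (?F xi)))"
    by (rule integral_mono[OF int i le])
  also have "\<dots> \<le> 2 * (l2norm wL * l2norm ?F)" using cs(2) by simp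
  also have "\<dots> \<le> 2 * (l2norm wL * (cG * (norm (mul (qp n) T) + norm (mul (qp (n + 16)) T))))"
    by (intro mult_left_mono lF) auto
  finally show "(LBINT xi. qw xi ^ n * norm (FM T xi)) \<le> 2 * CW * (norm (mul (qp n) T) + norm (mul (qp (n + 16)) T))"
    by (simp add: CW_def mult_ac)
qed

section \<open>Algebra of the strain and curl symbols\<close>

lemma curl_symbol_orth: "(\<Sum>i\<in>UNIV. cor (xi $ i) * curl_symbol xi U $ i) = 0"
  by (simp add: curl_symbol_def sum_3 algebra_simps)

lemma curl_curl_symbol:
  assumes "(\<Sum>i\<in>UNIV. cor (xi $ i) * U $ i) = 0"
  shows "curl_symbol xi (curl_symbol xi U) $ k = cor ((norm xi)\<^sup>2) * U $ k"
proof -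
  let ?x = "\<lambda>i. cor (xi $ i)"
  have N: "cor ((norm xi)\<^sup>2) = ?x 1 * ?x 1 + ?x 2 * ?x 2 + ?x 3 * ?x 3"
    using sum_coords_squared[of xi] by (simp add: sum_3)
  have o: "?x 1 * U $ 1 + ?x 2 * U $ 2 + ?x 3 * U $ 3 = 0" using assms by (simp add: sum_3)
  have i: "\<i> * a * (\<i> * b) = - (a * b)" for a b :: complex by (simp add: algebra_simps)
  have "curl_symbol xi (curl_symbol xi U) $ 1 = cor ((norm xi)\<^sup>2) * U $ 1 - ?x 1 * (?x 1 * U $ 1 + ?x 2 * U $ 2 + ?x 3 * U $ 3)"
    "curl_symbol xi (curl_symbol xi U) $ 2 = cor ((norm xi)\<^sup>2) * U $ 2 - ?x 2 * (?x 1 * U $ 1 + ?x 2 * U $ 2 + ?x 3 * U $ 3)"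
    "curl_symbol xi (curl_symbol xi U) $ 3 = cor ((norm xi)\<^sup>2) * U $ 3 - ?x 3 * (?x 1 * U $ 1 + ?x 2 * U $ 2 + ?x 3 * U $ 3)"
    unfolding N by (simp_all add: curl_symbol_def algebra_simps)
  then show ?thesis unfolding o using exhaust_3[of k] by auto
qed

text \<open>Here \<open>b\<close> is A xi. The second identity recovers a strain from its
  divergence; the third is curl omega = - Laplacian u = - 2 div S.\<close>

lemma strain_form:
  assumes xi: "xi \<noteq> 0" and A: "Pst_symbol xi A = A"
  defines "b \<equiv> \<lambda>i. \<Sum>k\<in>UNIV. A $ i $ k * cor (xi $ k)"
  shows "(\<Sum>i\<in>UNIV. cor (xi $ i) * b i) = 0"
    "cor ((norm xi)\<^sup>2) * A $ i $ j = cor (xi $ i) * b j + b i * cor (xi $ j)"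
    "curl_symbol xi (vort_symbol xi A) $ i = - 2 * \<i> * b i"
proof -
  have N: "cor ((norm xi)\<^sup>2) \<noteq> 0" using xi by simp
  show o: "(\<Sum>i\<in>UNIV. cor (xi $ i) * b i) = 0"
    using Pst_symbol_vec(2)[OF xi, of A] by (simp add: A b_def)
  show "cor ((norm xi)\<^sup>2) * A $ i $ j = cor (xi $ i) * b j + b i * cor (xi $ j)"
    using Pst_symbol_form[OF xi o[unfolded b_def], of i j] N unfolding A b_def by (simp add: field_simps)
  have U: "velocity_symbol xi A $ i = (- 2 * \<i> / cor ((norm xi)\<^sup>2)) * b i" for i
  proof -
    have "(\<Sum>j\<in>UNIV. \<i> * cor (xi $ j) * A $ i $ j) = \<i> * b i"
      unfolding b_def sum_distrib_left by (simp add: mult_ac)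
    then show ?thesis by (simp add: velocity_symbol_def)
  qed
  have "(\<Sum>i\<in>UNIV. cor (xi $ i) * velocity_symbol xi A $ i) = (- 2 * \<i> / cor ((norm xi)\<^sup>2)) * (\<Sum>i\<in>UNIV. cor (xi $ i) * b i)"
    unfolding U sum_distrib_left by (rule sum.cong) (simp_all add: mult_ac)
  then have "(\<Sum>i\<in>UNIV. cor (xi $ i) * velocity_symbol xi A $ i) = 0" by (simp add: o)
  from curl_curl_symbol[OF this, of i] show "curl_symbol xi (vort_symbol xi A) $ i = - 2 * \<i> * b i"
    using N by (simp add: vort_symbol_def U)
qed

lemma inner_mat: "(A::complex^3^3) \<bullet> B = Re (\<Sum>i\<in>UNIV. \<Sum>j\<in>UNIV. A $ i $ j * cnj (B $ i $ j))"
  by (simp add: inner_vec_def inner_complex_def)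

text \<open>Insert |xi|^2 A = xi (x) b + b (x) xi; the symmetry of \<open>Q\<close> makes both
  halves equal. In physical space one derivative of the Laplacian of S is moved onto
  \<open>Q\<close> as a divergence.\<close>

lemma inner_strain:
  assumes xi: "xi \<noteq> 0" and A: "Pst_symbol xi A = A" and Q: "\<And>i j. Q $ i $ j = Q $ j $ i"
  shows "cor ((norm xi)\<^sup>2) * (\<Sum>i\<in>UNIV. \<Sum>j\<in>UNIV. Q $ i $ j * cnj (A $ i $ j)) =
    2 * (\<Sum>i\<in>UNIV. (\<Sum>j\<in>UNIV. Q $ i $ j * cor (xi $ j)) * cnj (\<Sum>k\<in>UNIV. A $ i $ k * cor (xi $ k)))"
proof -
  define b where "b i = cnj (\<Sum>k\<in>UNIV. A $ i $ k * cor (xi $ k))" for i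
  have "cor ((norm xi)\<^sup>2) * cnj (A $ i $ j) = cnj (cor ((norm xi)\<^sup>2) * A $ i $ j)" for i j by simp
  then have A': "cor ((norm xi)\<^sup>2) * cnj (A $ i $ j) = cor (xi $ i) * b j + b i * cor (xi $ j)" for i j
    unfolding strain_form(2)[OF xi A] b_def by simp
  have "cor ((norm xi)\<^sup>2) * (\<Sum>i\<in>UNIV. \<Sum>j\<in>UNIV. Q $ i $ j * cnj (A $ i $ j)) =
      (\<Sum>i\<in>UNIV. \<Sum>j\<in>UNIV. Q $ i $ j * (cor ((norm xi)\<^sup>2) * cnj (A $ i $ j)))"
    unfolding sum_distrib_left by (intro sum.cong refl) (simp add: mult_ac)
  also have "\<dots> = 2 * (\<Sum>i\<in>UNIV. (\<Sum>j\<in>UNIV. Q $ i $ j * cor (xi $ j)) * b i)"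
    unfolding A' sum_3 using Q[of 1 2] Q[of 1 3] Q[of 2 3] by (simp add: algebra_simps)
  finally show ?thesis unfolding b_def .
qed

lemma Pst_symbol_sym: "Pst_symbol xi A $ i $ j = Pst_symbol xi A $ j $ i"
  by (simp only: Pst_symbol_nth mult.commute add.commute)

text \<open>The projection is orthogonal: it alters Q xi only along xi, to which the vector A xi of
  a strain is orthogonal. Against a strain the projection in the interaction term can therefore be
  dropped.\<close>

lemma Pst_symbol_inner:
  assumes xi: "xi \<noteq> 0" and A: "Pst_symbol xi A = A" and Q: "\<And>i j. Q $ i $ j = Q $ j $ i"
  shows "Pst_symbol xi Q \<bullet> A = Q \<bullet> A"
proof -
  let ?x = "\<lambda>i. cor (xi $ i)"
  define b where "b i = (\<Sum>k\<in>UNIV. A $ i $ k * ?x k)" for i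
  have o: "(\<Sum>i\<in>UNIV. ?x i * cnj (b i)) = 0"
    using arg_cong[OF strain_form(1)[OF xi A], of cnj] by (simp add: b_def)
  define z where "z = (\<Sum>k\<in>UNIV. ?x k * (\<Sum>j\<in>UNIV. Q $ k $ j * ?x j)) / cor ((norm xi)\<^sup>2)"
  have g: "(c - x * S / N) * w = c * w - (S / N) * (x * w)" for c x S N w :: complex by (simp add: algebra_simps)
  have e: "(\<Sum>j\<in>UNIV. Pst_symbol xi Q $ i $ j * ?x j) * cnj (b i) = (\<Sum>j\<in>UNIV. Q $ i $ j * ?x j) * cnj (b i) - z * (?x i * cnj (b i))" for i
    unfolding Pst_symbol_vec(1)[OF xi] z_def by (rule g)
  have "(\<Sum>i\<in>UNIV. (\<Sum>j\<in>UNIV. Pst_symbol xi Q $ i $ j * ?x j) * cnj (b i)) =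
      (\<Sum>i\<in>UNIV. (\<Sum>j\<in>UNIV. Q $ i $ j * ?x j) * cnj (b i)) - z * (\<Sum>i\<in>UNIV. ?x i * cnj (b i))"
    by (simp only: e sum_subtractf sum_distrib_left[of z])
  then have "cor ((norm xi)\<^sup>2) * (\<Sum>i\<in>UNIV. \<Sum>j\<in>UNIV. Pst_symbol xi Q $ i $ j * cnj (A $ i $ j)) =
     cor ((norm xi)\<^sup>2) * (\<Sum>i\<in>UNIV. \<Sum>j\<in>UNIV. Q $ i $ j * cnj (A $ i $ j))"
    unfolding inner_strain[OF xi A Q] inner_strain[OF xi A Pst_symbol_sym] b_def[symmetric] o by simp
  then show ?thesis using xi by (simp add: inner_mat)
qed

lemma fourier_pairing:
  assumes h: "integrable lborel h" and c: "has_fourier (\<lambda>x. cor (c x)) C" and C: "integrable lborel C"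
  shows "integrable lborel (\<lambda>xi. fourier_L1 h xi * cnj (C xi))" "integrable lborel (\<lambda>x. h x * cor (c x))"
    "(LBINT xi. fourier_L1 h xi * cnj (C xi)) = cor (cG\<^sup>2) * (LBINT x. h x * cor (c x))"
proof -
  have C': "integrable lborel (\<lambda>xi. cnj (C xi))" using C by simp
  have [measurable]: "(\<lambda>x. cor (c x)) \<in> borel_measurable borel" "h \<in> borel_measurable borel"
    using has_fourier_measurable(2)[OF c] h by auto
  have ae: "AE x in lborel. fourier_L1 (\<lambda>xi. cnj (C xi)) x = cor (cG\<^sup>2) * cor (c x)"
    using has_fourier_inj[OF c has_fourier_inverse_L1[OF C]]
  proof eventually_elim
    case (elim x)
    have "cor (c x) = cnj (cor (c x))" by simp
    also have "\<dots> = cnj (fourier_L1 C (- x)) / cor (cG\<^sup>2)" unfolding elim by simp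
    finally show ?case using cG_pos by (simp add: fourier_L1_cnj)
  qed
  show "integrable lborel (\<lambda>xi. fourier_L1 h xi * cnj (C xi))"
    using fourier_L1_times_integrable[OF C' h] by (simp add: mult.commute)
  have i: "integrable lborel (\<lambda>x. h x * fourier_L1 (\<lambda>xi. cnj (C xi)) x)" by (rule fourier_L1_times_integrable[OF h C'])
  have ae': "AE x in lborel. h x * fourier_L1 (\<lambda>xi. cnj (C xi)) x = cor (cG\<^sup>2) * (h x * cor (c x))"
    using ae by eventually_elim (simp add: mult_ac)
  have "integrable lborel (\<lambda>x. cor (cG\<^sup>2) * (h x * cor (c x)))"
    by (rule integrable_cong_AE_imp[OF i]) (use ae' in \<open>auto elim: eventually_mono\<close>)
  from integrable_mult_right[OF this, of "1 / cor (cG\<^sup>2)"]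
  show "integrable lborel (\<lambda>x. h x * cor (c x))" using cG_pos by simp
  have "(LBINT xi. fourier_L1 h xi * cnj (C xi)) = (LBINT x. h x * fourier_L1 (\<lambda>xi. cnj (C xi)) x)"
    by (rule fourier_L1_multiplication[OF h C', symmetric])
  also have "\<dots> = (LBINT x. cor (cG\<^sup>2) * (h x * cor (c x)))"
    by (rule integral_cong_AE) (use i ae' in \<open>auto intro: borel_measurable_integrable\<close>)
  finally show "(LBINT xi. fourier_L1 h xi * cnj (C xi)) = cor (cG\<^sup>2) * (LBINT x. h x * cor (c x))"
    by simp
qed

section \<open>Product rule and cancellation\<close>

lemma fourier_L1_add:
  "integrable lborel f \<Longrightarrow> integrable lborel g \<Longrightarrow> fourier_L1 (\<lambda>x. f x + g x) xi = fourier_L1 f xi + fourier_L1 g xi"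
  unfolding fourier_L1_def distrib_right
  by (intro Bochner_Integration.integral_add fourier_L1_integrable)

text \<open>In the convolution integral the component of xi is the sum of those of
  \<open>eta + xi\<close> and \<open>- eta\<close>, which distributes the derivative over the two
  factors.\<close>

lemma fourier_product_rule:
  assumes f: "square_integrable f" "has_fourier f F" and g: "square_integrable g" "has_fourier g G"
    and f': "square_integrable f'" "has_fourier f' (\<lambda>xi. \<i> * cor (xi $ k) * F xi)"
    and g': "square_integrable g'" "has_fourier g' (\<lambda>xi. \<i> * cor (xi $ k) * G xi)"
  shows "\<i> * cor (xi $ k) * fourier_L1 (\<lambda>x. f x * g x) xi = fourier_L1 (\<lambda>x. f' x * g x + f x * g' x) xi"
proof -
  let ?F = "\<lambda>eta. F (eta + xi)" and ?G = "\<lambda>eta. G (- eta)"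
  let ?F' = "\<lambda>eta. \<i> * cor ((eta + xi) $ k) * F (eta + xi)" and ?G' = "\<lambda>eta. \<i> * cor ((- eta) $ k) * G (- eta)"
  note sF = square_integrable_shift(1)[OF has_fourier_l2(1)[OF f], of xi] square_integrable_shift(1)[OF has_fourier_l2(1)[OF f'], of xi]
  note sG = square_integrable_reflect(1)[OF has_fourier_l2(1)[OF g]] square_integrable_reflect(1)[OF has_fourier_l2(1)[OF g']]
  have e: "\<i> * cor (xi $ k) * (?F eta * ?G eta) = ?F' eta * ?G eta + ?F eta * ?G' eta" for eta
    by (simp add: algebra_simps)
  have "cor (cG\<^sup>2) * (\<i> * cor (xi $ k) * fourier_L1 (\<lambda>x. f x * g x) xi) =
      \<i> * cor (xi $ k) * (LBINT eta. ?F eta * ?G eta)"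
    unfolding fourier_L1_convolution[OF f g, symmetric] by (simp add: mult_ac)
  also have "\<dots> = (LBINT eta. ?F' eta * ?G eta + ?F eta * ?G' eta)"
    unfolding integral_mult_right_zero[symmetric] e ..
  also have "\<dots> = (LBINT eta. ?F' eta * ?G eta) + (LBINT eta. ?F eta * ?G' eta)"
    by (rule Bochner_Integration.integral_add[OF l2_mult(1)[OF sF(2) sG(1)] l2_mult(1)[OF sF(1) sG(2)]])
  also have "\<dots> = cor (cG\<^sup>2) * fourier_L1 (\<lambda>x. f' x * g x) xi + cor (cG\<^sup>2) * fourier_L1 (\<lambda>x. f x * g' x) xi"
    unfolding fourier_L1_convolution[OF f' g] fourier_L1_convolution[OF f g'] ..
  also have "\<dots> = cor (cG\<^sup>2) * fourier_L1 (\<lambda>x. f' x * g x + f x * g' x) xi"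
    by (simp only: fourier_L1_add[OF l2_mult(1)[OF f'(1) g(1)] l2_mult(1)[OF f(1) g'(1)]] distrib_left)
  finally show ?thesis using cG_pos by simp
qed

lemma derivative_data:
  assumes F: "has_fourier (\<lambda>x. cor (f x)) F" and sq: "square_integrable (\<lambda>xi. norm xi *\<^sub>R F xi)"
  obtains g :: "real^3 \<Rightarrow> real" where "square_integrable (\<lambda>x. cor (g x))"
    "has_fourier (\<lambda>x. cor (g x)) (\<lambda>xi. \<i> * cor (xi $ k) * F xi)"
proof -
  have [measurable]: "F \<in> borel_measurable borel" by (rule has_fourier_measurable(1)[OF F])
  have "square_integrable (\<lambda>xi. \<i> * cor (xi $ k) * F xi)"
    by (rule square_integrable_bound(1)[OF sq]) (auto simp: norm_mult intro!: AE_I2 mult_right_mono component_le_norm_cart)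
  moreover have "AE xi in lborel. \<i> * cor ((- xi) $ k) * F (- xi) = cnj (\<i> * cor (xi $ k) * F xi)"
    using real_fourier_hermitian[OF F] by eventually_elim simp
  ultimately obtain g :: "real^3 \<Rightarrow> real" where "square_integrable g" "has_fourier (\<lambda>x. cor (g x)) (\<lambda>xi. \<i> * cor (xi $ k) * F xi)"
    by (rule hermitian_fourier_surj)
  then show ?thesis using that by (simp add: square_integrable_of_real)
qed

text \<open>In physical space this is \<open>\<langle>\<omega> \<otimes> \<omega>, -\<Delta> S\<rangle> = \<langle>\<omega> \<otimes> \<omega>, \<nabla>\<^sub>s\<^sub>y\<^sub>m curl \<omega>\<rangle> = 0\<close>: one integrates by parts and uses
  \<open>(\<omega> \<cdot> \<nabla>) \<omega> = \<nabla> |\<omega>|\<^sup>2 / 2 - \<omega> \<times> curl \<omega>\<close>.\<close>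

lemma vortex_stretching_cancellation:
  assumes st: "T \<in> L2_st" and sm: "smooth T"
  shows "(LBINT xi. PT T T xi \<bullet> (qw xi ^ 8 *\<^sub>R FM T xi)) = 0"
proof -
  let ?x = "\<lambda>xi k. cor ((xi::real^3) $ k)"
  define w where "w i x = cor (rep_l2 (vorticity T) x $ i)" for i x
  have w: "square_integrable (w i)" "has_fourier (w i) (\<lambda>xi. WV T xi $ i)" for i
    unfolding w_def[abs_def] by (rule square_integrable_vort has_fourier_vort)+
  have "\<exists>g::real^3 \<Rightarrow> real. square_integrable (\<lambda>x. cor (g x)) \<and>
      has_fourier (\<lambda>x. cor (g x)) (\<lambda>xi. \<i> * ?x xi k * WV T xi $ j)" for k j
  proof -
    have d: "even_weight norm" "mul_dom norm T" using qw_pow_even[of 4] smoothD[OF sm, of 4] by (simp_all add: qw4)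
    obtain g :: "real^3 \<Rightarrow> real" where "square_integrable (\<lambda>x. cor (g x))"
      "has_fourier (\<lambda>x. cor (g x)) (\<lambda>xi. \<i> * ?x xi k * WV T xi $ j)"
      by (rule derivative_data[OF has_fourier_vort[of T j] weighted_WV(1)[OF d, of j], of k]) blast
    then show ?thesis by blast
  qed
  then obtain ar :: "3 \<Rightarrow> 3 \<Rightarrow> real^3 \<Rightarrow> real" where ar: "\<And>k j. square_integrable (\<lambda>x. cor (ar k j x))"
    "\<And>k j. has_fourier (\<lambda>x. cor (ar k j x)) (\<lambda>xi. \<i> * ?x xi k * WV T xi $ j)" by metis
  define a where "a k j x = cor (ar k j x)" for k j x
  have a: "square_integrable (a k j)" "has_fourier (a k j) (\<lambda>xi. \<i> * ?x xi k * WV T xi $ j)" for k j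
    unfolding a_def[abs_def] by (rule ar)+
  define cr where "cr x = (vector [ar 2 3 x - ar 3 2 x, ar 3 1 x - ar 1 3 x, ar 1 2 x - ar 2 1 x] :: real^3)" for x
  define C where "C xi = curl_symbol xi (WV T xi)" for xi
  have cr: "has_fourier (\<lambda>x. cor (cr x $ j)) (\<lambda>xi. C xi $ j)" for j
  proof -
    have "has_fourier_vec cr C"
      using curl_fourier[of "\<lambda>i x. \<chi> j. ar i j x" "WV T"] ar(2) by (simp add: cr_def[abs_def] C_def[abs_def])
    then show ?thesis by (simp add: has_fourier_vec_def)
  qed
  have W_le: "norm (WV T xi $ k) \<le> 12 * norm (FM T xi)" for xi k by (rule WV_bound)
  \<comment> \<open>\<open>fourier_pairing\<close> asks for an integrable transform of curl omega;
    the smoothness of \<open>T\<close> supplies it.\<close>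
  have C_int: "integrable lborel (\<lambda>xi. C xi $ j)" for j
  proof (rule Bochner_Integration.integrable_bound[OF integrable_mult_right[OF smooth_L1(1)[OF sm, of 4], of 24]])
    show "(\<lambda>xi. C xi $ j) \<in> borel_measurable lborel" using has_fourier_measurable(1)[OF cr] by simp
    have t: "norm (\<i> * ?x xi k * WV T xi $ l) \<le> norm xi * (12 * norm (FM T xi))" for xi k l
      unfolding norm_mult by (intro mult_mono W_le) (auto simp: component_le_norm_cart)
    have "norm (\<i> * ?x xi k * WV T xi $ l - \<i> * ?x xi k' * WV T xi $ l') \<le> 24 * (norm xi * norm (FM T xi))" for xi k k' l l'
      using norm_triangle_ineq4[of "\<i> * ?x xi k * WV T xi $ l" "\<i> * ?x xi k' * WV T xi $ l'"] t[of xi k l] t[of xi k' l'] by linarith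
    then have "norm (C xi $ j) \<le> 24 * (norm xi * norm (FM T xi))" for xi
      using exhaust_3[of j] by (auto simp: C_def curl_symbol_def)
    then show "AE xi in lborel. norm (C xi $ j) \<le> norm (24 * (qw xi ^ 4 * norm (FM T xi)))"
      by (simp add: qw_pow4)
  qed
  define h where "h k i j x = a k i x * w j x + w i x * a k j x" for k i j x
  have h_int: "integrable lborel (h k i j)" for k i j
    unfolding h_def[abs_def] by (intro Bochner_Integration.integrable_add l2_mult(1) a w)
  define P where "P i j xi = fourier_L1 (\<lambda>x. w i x * w j x) xi" for i j xi
  have PT: "PT T T xi $ i $ j = P i j xi" for xi i j by (simp add: PT_def P_def w_def)
  have Psym: "P i j xi = P j i xi" for i j xi by (simp add: P_def mult.commute)
  have prod: "\<i> * ?x xi k * P i j xi = fourier_L1 (h k i j) xi" for k i j xi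
    unfolding P_def h_def[abs_def] by (rule fourier_product_rule[OF w w a a])
  define c where "c j x = cor (cr x $ j)" for j x
  note pair = fourier_pairing[OF h_int cr C_int, folded c_def]
  have divC: "(\<Sum>j\<in>UNIV. ?x xi j * cnj (C xi $ j)) = 0" for xi
    using arg_cong[OF curl_symbol_orth[of xi "WV T xi"], of cnj] by (simp add: C_def)
  \<comment> \<open>The gradient of |omega|^2 is orthogonal to curl omega, which is divergence
    free.\<close>
  have Y: "(\<Sum>i\<in>UNIV. \<Sum>j\<in>UNIV. \<integral>x. h j i i x * c j x \<partial>lborel) = 0"
  proof -
    have "cor (cG\<^sup>2) * (\<Sum>i\<in>UNIV. \<Sum>j\<in>UNIV. \<integral>x. h j i i x * c j x \<partial>lborel) =
        (\<Sum>i\<in>UNIV. \<Sum>j\<in>UNIV. \<integral>xi. fourier_L1 (h j i i) xi * cnj (C xi $ j) \<partial>lborel)"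
      unfolding pair(3) sum_distrib_left ..
    also have "\<dots> = (\<Sum>i\<in>UNIV. \<integral>xi. (\<Sum>j\<in>UNIV. fourier_L1 (h j i i) xi * cnj (C xi $ j)) \<partial>lborel)"
      by (intro sum.cong refl Bochner_Integration.integral_sum[symmetric] pair(1))
    also have "(\<lambda>i xi. \<Sum>j\<in>UNIV. fourier_L1 (h j i i) xi * cnj (C xi $ j)) = (\<lambda>i xi. 0)"
    proof (intro ext)
      fix i xi
      have "(\<Sum>j\<in>UNIV. fourier_L1 (h j i i) xi * cnj (C xi $ j)) = (\<Sum>j\<in>UNIV. (\<i> * P i i xi) * (?x xi j * cnj (C xi $ j)))"
        unfolding prod[symmetric] by (simp add: mult_ac)
      then show "(\<Sum>j\<in>UNIV. fourier_L1 (h j i i) xi * cnj (C xi $ j)) = 0"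
        unfolding sum_distrib_left[symmetric] divC by simp
    qed
    finally show ?thesis using cG_pos by simp
  qed
  have div: "AE x in lborel. (\<Sum>i\<in>UNIV. a i i x) = 0"
  proof (rule has_fourier_inj[OF _ has_fourier_0])
    have "has_fourier (\<lambda>x. \<Sum>i\<in>UNIV. a i i x) (\<lambda>xi. \<Sum>i\<in>UNIV. \<i> * ?x xi i * WV T xi $ i)"
      by (rule has_fourier_sum) (rule a(2))
    moreover have "(\<Sum>i\<in>UNIV. \<i> * ?x xi i * WV T xi $ i) = 0" for xi
      using arg_cong[OF curl_symbol_orth[of xi "velocity_symbol xi (FM T xi)"], of "\<lambda>z. \<i> * z"]
      unfolding WV_def vort_symbol_def sum_distrib_left by (simp add: mult_ac)
    ultimately show "has_fourier (\<lambda>x. \<Sum>i\<in>UNIV. a i i x) (\<lambda>xi. 0)" by simp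
  qed
  \<comment> \<open>With \<open>a k j\<close> for the k-th derivative of omega_j this is 2 ((omega .
    grad) omega) . curl omega = grad |omega|^2 . curl omega: div omega = 0 removes one term, and
    omega x curl omega is orthogonal to curl omega.\<close>
  have pw: "AE x in lborel. 2 * (\<Sum>i\<in>UNIV. \<Sum>j\<in>UNIV. h i i j x * c j x) = (\<Sum>i\<in>UNIV. \<Sum>j\<in>UNIV. h j i i x * c j x)"
    using div
  proof eventually_elim
    case (elim x)
    have d: "a 3 3 x = - a 1 1 x - a 2 2 x" using elim by (simp add: sum_3 algebra_simps eq_neg_iff_add_eq_0)
    have cs: "c 1 x = a 2 3 x - a 3 2 x" "c 2 x = a 3 1 x - a 1 3 x" "c 3 x = a 1 2 x - a 2 1 x"
      by (simp_all add: c_def cr_def a_def)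
    show ?case unfolding sum_3 h_def cs d by (simp add: algebra_simps)
  qed
  have X: "(\<Sum>i\<in>UNIV. \<Sum>j\<in>UNIV. \<integral>x. h i i j x * c j x \<partial>lborel) = 0"
  proof -
    have i: "integrable lborel (\<lambda>x. h k i j x * c l x)" for k i j l by (rule pair(2))
    have "2 * (\<Sum>i\<in>UNIV. \<Sum>j\<in>UNIV. \<integral>x. h i i j x * c j x \<partial>lborel) = (LBINT x. 2 * (\<Sum>i\<in>UNIV. \<Sum>j\<in>UNIV. h i i j x * c j x))"
      by (simp add: Bochner_Integration.integral_sum Bochner_Integration.integrable_sum i)
    also have "\<dots> = (\<integral>x. (\<Sum>i\<in>UNIV. \<Sum>j\<in>UNIV. h j i i x * c j x) \<partial>lborel)"
      by (rule integral_cong_AE) (use i pw in \<open>auto intro!: borel_measurable_integrable Bochner_Integration.integrable_sum integrable_mult_right\<close>)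
    also have "\<dots> = 0"
      using Y by (simp add: Bochner_Integration.integral_sum Bochner_Integration.integrable_sum i)
    finally show ?thesis by simp
  qed
  \<comment> \<open>On the Fourier side: \<open>inner_strain\<close> turns the Laplacian of the
    strain into its divergence, which is - curl omega / 2, and the remaining factor xi becomes the
    derivative of the product.\<close>
  have ae: "AE xi in lborel. PT T T xi \<bullet> (qw xi ^ 8 *\<^sub>R FM T xi) = Re (- (\<Sum>i\<in>UNIV. \<Sum>j\<in>UNIV. fourier_L1 (h i i j) xi * cnj (C xi $ j)))"
    using AE_neq_0 st[unfolded L2_st_iff]
  proof eventually_elim
    case (elim xi)
    let ?b = "\<lambda>i. \<Sum>k\<in>UNIV. FM T xi $ i $ k * ?x xi k"
    have b: "cnj (?b i) = - (\<i> / 2) * cnj (C xi $ i)" for i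
    proof -
      have "?b i = (\<i> / 2) * C xi $ i"
        using strain_form(3)[OF elim, of i] by (simp add: C_def WV_def field_simps)
      from arg_cong[OF this, of cnj] show ?thesis by simp
    qed
    have Re_mult: "Re (cor r * z) = r * Re z" for r z by simp
    have "PT T T xi \<bullet> (qw xi ^ 8 *\<^sub>R FM T xi) = Re (cor ((norm xi)\<^sup>2) * (\<Sum>i\<in>UNIV. \<Sum>j\<in>UNIV. PT T T xi $ i $ j * cnj (FM T xi $ i $ j)))"
      unfolding inner_scaleR_right qw_pow8 Re_mult inner_mat[symmetric] ..
    also have "\<dots> = Re (2 * (\<Sum>i\<in>UNIV. (\<Sum>j\<in>UNIV. P i j xi * ?x xi j) * (- (\<i> / 2) * cnj (C xi $ i))))"
      using inner_strain[OF elim, of "PT T T xi"] Psym[of _ _ xi] unfolding PT b by (simp only: PT)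
    also have "2 * (\<Sum>i\<in>UNIV. (\<Sum>j\<in>UNIV. P i j xi * ?x xi j) * (- (\<i> / 2) * cnj (C xi $ i))) =
        - (\<Sum>i\<in>UNIV. \<Sum>j\<in>UNIV. (\<i> * ?x xi i * P i j xi) * cnj (C xi $ j))"
      unfolding sum_3 using Psym[of 2 1 xi] Psym[of 3 1 xi] Psym[of 3 2 xi] by (simp add: algebra_simps)
    finally show ?case unfolding prod .
  qed
  have "(LBINT xi. PT T T xi \<bullet> (qw xi ^ 8 *\<^sub>R FM T xi)) =
      (LBINT xi. Re (- (\<Sum>i\<in>UNIV. \<Sum>j\<in>UNIV. fourier_L1 (h i i j) xi * cnj (C xi $ j))))"
  proof (rule integral_cong_AE[OF _ _ ae])
    have "integrable lborel (\<lambda>xi. Re (- (\<Sum>i\<in>UNIV. \<Sum>j\<in>UNIV. fourier_L1 (h i i j) xi * cnj (C xi $ j))))"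
      by (intro integrable_Re integrable_minus Bochner_Integration.integrable_sum pair(1))
    then show "(\<lambda>xi. Re (- (\<Sum>i\<in>UNIV. \<Sum>j\<in>UNIV. fourier_L1 (h i i j) xi * cnj (C xi $ j)))) \<in> borel_measurable lborel"
      by (rule borel_measurable_integrable)
  qed measurable
  also have "\<dots> = Re (LBINT xi. - (\<Sum>i\<in>UNIV. \<Sum>j\<in>UNIV. fourier_L1 (h i i j) xi * cnj (C xi $ j)))"
    by (rule integral_Re) (intro integrable_minus Bochner_Integration.integrable_sum pair(1))
  also have "(LBINT xi. - (\<Sum>i\<in>UNIV. \<Sum>j\<in>UNIV. fourier_L1 (h i i j) xi * cnj (C xi $ j))) =
      - cor (cG\<^sup>2) * (\<Sum>i\<in>UNIV. \<Sum>j\<in>UNIV. \<integral>x. h i i j x * c j x \<partial>lborel)"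
    by (simp add: Bochner_Integration.integral_sum Bochner_Integration.integrable_sum pair sum_distrib_left sum_negf)
  also have "\<dots> = 0" unfolding X by simp
  finally show ?thesis by simp
qed

definition CI :: real where "CI = 216 * 2592 / cG\<^sup>2 * (2 * CW)"

lemma CI_nonneg: "0 \<le> CI"
  using cG_pos by (simp add: CI_def CW_def)

section \<open>Pairing the interaction term with the Laplacian\<close>

lemma PT_bound: "norm (PT S T xi) \<le> 2592 * (norm S * norm T)"
  using PT_weighted_bound[OF subadd_weight_1, where xi=xi and S=S and T=T] by (simp add: mul_1)

text \<open>The weighted transform of a smooth \<open>D\<close> is integrable, so polynomial growth
  of \<open>Q\<close> suffices, without any L^2 bound on it.\<close>

lemma inner_bound:
  assumes t: "t > 0" and D: "smooth D" and [measurable]: "Q \<in> borel_measurable borel"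
    and Q: "\<And>xi. norm (Q xi) \<le> B * qw xi ^ n" and B: "B \<ge> 0"
    and eq: "cG\<^sup>2 * r = (LBINT xi. Q xi \<bullet> (qw xi ^ 8 *\<^sub>R FM D xi))"
  shows "\<bar>r\<bar> \<le> B / cG\<^sup>2 * (2 * CW) * (norm (mul (qp (n + 8)) D) + norm (mul (qp (n + 24)) D))"
proof -
  have "norm (LBINT xi. Q xi \<bullet> (qw xi ^ 8 *\<^sub>R FM D xi)) \<le> (LBINT xi. B * (qw xi ^ (n + 8) * norm (FM D xi)))"
  proof (rule lint_norm_bound[OF integrable_mult_right[OF smooth_L1(1)[OF D]]])
    fix xi
    have "norm (Q xi \<bullet> (qw xi ^ 8 *\<^sub>R FM D xi)) \<le> norm (Q xi) * norm (qw xi ^ 8 *\<^sub>R FM D xi)"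
      unfolding real_norm_def by (rule Cauchy_Schwarz_ineq2)
    also have "\<dots> \<le> (B * qw xi ^ n) * norm (qw xi ^ 8 *\<^sub>R FM D xi)" by (intro mult_right_mono Q) simp
    finally show "norm (Q xi \<bullet> (qw xi ^ 8 *\<^sub>R FM D xi)) \<le> B * (qw xi ^ (n + 8) * norm (FM D xi))"
      by (simp add: power_add mult_ac)
  qed
  also have "\<dots> \<le> B * (2 * CW * (norm (mul (qp (n + 8)) D) + norm (mul (qp (n + 24)) D)))"
    using mult_left_mono[OF smooth_L1(2)[OF D, of "n + 8"] B] by (simp add: add.assoc)
  finally have "cG\<^sup>2 * \<bar>r\<bar> \<le> B * (2 * CW * (norm (mul (qp (n + 8)) D) + norm (mul (qp (n + 24)) D)))"
    unfolding eq[symmetric] by (simp add: abs_mult)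
  then show ?thesis using cG_pos by (simp add: field_simps)
qed

lemma Bil_inner_fourier:
  assumes t: "t > 0" and D: "smooth D"
  shows "cG\<^sup>2 * (Bil t S T \<bullet> mul (qp 8) D) =
    (LBINT xi. (exp (- t * (norm xi)\<^sup>2) *\<^sub>R Pst_symbol xi (PT S T xi)) \<bullet> (qw xi ^ 8 *\<^sub>R FM D xi))"
  unfolding inner_FM
proof (rule integral_cong_AE)
  show "AE xi in lborel. FM (Bil t S T) xi \<bullet> FM (mul (qp 8) D) xi =
      (exp (- t * (norm xi)\<^sup>2) *\<^sub>R Pst_symbol xi (PT S T xi)) \<bullet> (qw xi ^ 8 *\<^sub>R FM D xi)"
    using FM_Bil[OF t, of S T] FM_mul[OF qw_pow_even smoothD[OF D], of 8] by eventually_elim simp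
qed auto

text \<open>Tested against smooth elements the interaction term loses its singularity at t = 0,
  unlike its L^2 norm. This uniformity makes increments of the energy tractable.\<close>

lemma Bil_inner_bound:
  assumes t: "t > 0" and D: "smooth D"
  shows "\<bar>Bil t S T \<bullet> mul (qp 8) D\<bar> \<le> CI * (norm S * norm T) * (norm (mul (qp 8) D) + norm (mul (qp 24) D))"
proof -
  have "norm (exp (- t * (norm xi)\<^sup>2) *\<^sub>R Pst_symbol xi (PT S T xi)) \<le> 216 * 2592 * (norm S * norm T) * qw xi ^ 0" for xi
  proof -
    have "norm (exp (- t * (norm xi)\<^sup>2) *\<^sub>R Pst_symbol xi (PT S T xi)) \<le> 1 * (216 * norm (PT S T xi))"
      unfolding norm_scaleR by (intro mult_mono Pst_symbol_bound) (use t in auto)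
    then show ?thesis using PT_bound[of S T xi] by simp
  qed
  from inner_bound[OF t D _ this _ Bil_inner_fourier[OF t D]]
  show ?thesis by (simp add: CI_def mult_ac)
qed

text \<open>Without the heat factor the pairing vanishes by cancellation, so exp (- t |xi|^2) may be
  replaced by exp (- t |xi|^2) - 1, which is of order t |xi|^2.\<close>

lemma Bil_inner_small:
  assumes t: "t > 0" and T: "smooth T" "T \<in> L2_st"
  shows "\<bar>Bil t T T \<bullet> mul (qp 8) T\<bar> \<le> t * CI * (norm T * norm T) * (norm (mul (qp 16) T) + norm (mul (qp 32) T))"
proof -
  let ?e = "\<lambda>xi::real^3. exp (- t * (norm xi)\<^sup>2)" and ?D = "\<lambda>xi. qw xi ^ 8 *\<^sub>R FM T xi"
  have int: "integrable lborel (\<lambda>xi. PT T T xi \<bullet> ?D xi)" "integrable lborel (\<lambda>xi. (?e xi *\<^sub>R PT T T xi) \<bullet> ?D xi)"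
  proof -
    have i: "integrable lborel (\<lambda>xi. 2592 * (norm T * norm T) * (qw xi ^ 8 * norm (FM T xi)))"
      by (rule integrable_mult_right[OF smooth_L1(1)[OF T(1)]])
    have le: "norm (PT T T xi \<bullet> ?D xi) \<le> 2592 * (norm T * norm T) * (qw xi ^ 8 * norm (FM T xi))" for xi
      using order_trans[OF Cauchy_Schwarz_ineq2[of "PT T T xi" "?D xi"] mult_right_mono[OF PT_bound[of T T xi] norm_ge_zero[of "?D xi"]]] by simp
    have le2: "norm ((?e xi *\<^sub>R PT T T xi) \<bullet> ?D xi) \<le> 2592 * (norm T * norm T) * (qw xi ^ 8 * norm (FM T xi))" for xi
    proof -
      have "norm ((?e xi *\<^sub>R PT T T xi) \<bullet> ?D xi) = ?e xi * norm (PT T T xi \<bullet> ?D xi)" by (simp add: abs_mult)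
      also have "\<dots> \<le> 1 * norm (PT T T xi \<bullet> ?D xi)" by (rule mult_right_mono) (use t in auto)
      finally show ?thesis using le[of xi] by simp
    qed
    show "integrable lborel (\<lambda>xi. PT T T xi \<bullet> ?D xi)"
      by (rule Bochner_Integration.integrable_bound[OF i]) (use order_trans[OF le abs_ge_self] in \<open>auto intro!: AE_I2\<close>)
    show "integrable lborel (\<lambda>xi. (?e xi *\<^sub>R PT T T xi) \<bullet> ?D xi)"
      by (rule Bochner_Integration.integrable_bound[OF i], measurable) (use order_trans[OF le2 abs_ge_self] in \<open>auto intro!: AE_I2\<close>)
  qed
  have ae: "AE xi in lborel. (?e xi *\<^sub>R Pst_symbol xi (PT T T xi)) \<bullet> ?D xi = (?e xi *\<^sub>R PT T T xi) \<bullet> ?D xi"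
    using AE_neq_0 T(2)[unfolded L2_st_iff]
  proof eventually_elim
    case (elim xi)
    have "Pst_symbol xi (PT T T xi) \<bullet> FM T xi = PT T T xi \<bullet> FM T xi"
      by (rule Pst_symbol_inner[OF elim]) (simp add: PT_def mult.commute)
    then show ?case by simp
  qed
  have "cG\<^sup>2 * (Bil t T T \<bullet> mul (qp 8) T) = (LBINT xi. (?e xi *\<^sub>R PT T T xi) \<bullet> ?D xi)"
    unfolding Bil_inner_fourier[OF t T(1)] by (rule integral_cong_AE) (use ae in auto)
  also have "\<dots> = (LBINT xi. (?e xi *\<^sub>R PT T T xi) \<bullet> ?D xi) - (LBINT xi. PT T T xi \<bullet> ?D xi)"
    unfolding vortex_stretching_cancellation[OF T(2,1)] by simp
  also have "\<dots> = (LBINT xi. ((?e xi - 1) *\<^sub>R PT T T xi) \<bullet> ?D xi)"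
    by (subst Bochner_Integration.integral_diff[OF int(2,1), symmetric]) (simp add: inner_diff_left scaleR_diff_left algebra_simps)
  finally have eq: "cG\<^sup>2 * (Bil t T T \<bullet> mul (qp 8) T) = (LBINT xi. ((?e xi - 1) *\<^sub>R PT T T xi) \<bullet> ?D xi)" .
  have le: "norm ((?e xi - 1) *\<^sub>R PT T T xi) \<le> t * (2592 * (norm T * norm T)) * qw xi ^ 8" for xi
  proof -
    have "\<bar>?e xi - 1\<bar> \<le> t * (norm xi)\<^sup>2"
      using exp_ge_add_one_self[of "- t * (norm xi)\<^sup>2"] t by (simp add: abs_le_iff)
    then have "\<bar>?e xi - 1\<bar> * norm (PT T T xi) \<le> (t * (norm xi)\<^sup>2) * (2592 * (norm T * norm T))"
      by (intro mult_mono PT_bound) (use t in auto)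
    then show ?thesis by (simp add: qw_pow8 mult_ac)
  qed
  have "\<bar>Bil t T T \<bullet> mul (qp 8) T\<bar> \<le> t * (2592 * (norm T * norm T)) / cG\<^sup>2 * (2 * CW) * (norm (mul (qp 16) T) + norm (mul (qp 32) T))"
    using inner_bound[OF t T(1) _ le _ eq] t by simp
  also have "\<dots> \<le> t * (216 * 2592 * (norm T * norm T)) / cG\<^sup>2 * (2 * CW) * (norm (mul (qp 16) T) + norm (mul (qp 32) T))"
    using t cG_pos by (intro mult_right_mono divide_right_mono mult_left_mono) (auto simp: CW_def)
  finally show ?thesis by (simp add: CI_def mult_ac)
qed

section \<open>The energy equality\<close>

lemma sol_smoothness:
  assumes S: "sol a b S" and s: "a < s" and t: "t \<in> {s..b}"
  shows "smooth (S t)"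
  unfolding smooth_def using sol_smooth[OF S s] mul_dom_limit(1) t by metis

lemma sol_smooth_bound:
  assumes S: "sol a b S" and s: "a < s"
  obtains M where "M \<ge> 0" "\<And>t. t \<in> {s..b} \<Longrightarrow> norm (mul (qp n) (S t)) \<le> M"
proof -
  obtain M where "M \<ge> 0" "\<forall>R\<ge>0. \<forall>t\<in>{s..b}. norm (mul (wt R n) (S t)) \<le> M"
    using sol_smooth[OF S s] by blast
  then show ?thesis using that mul_dom_limit(2) by metis
qed

text \<open>Continuity in L^2 interpolates with the uniform bound on the weight of double
  order.\<close>

lemma sol_mul_continuous:
  assumes S: "sol a b S" and s: "a < s"
  shows "continuous_on {s..b} (\<lambda>t. mul (qp n) (S t))"
  unfolding continuous_on_def
proof
  fix t assume t: "t \<in> {s..b}"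
  obtain M where M: "M \<ge> 0" "\<And>t. t \<in> {s..b} \<Longrightarrow> norm (mul (qp (n + n)) (S t)) \<le> M"
    using sol_smooth_bound[OF S s] by metis
  have le: "norm (mul (qp n) (S x) - mul (qp n) (S t)) \<le> sqrt (norm (S x - S t) * (2 * M))" if x: "x \<in> {s..b}" for x
  proof -
    note sm = sol_smoothness[OF S s x] sol_smoothness[OF S s t]
    have d: "mul (qp k) (S x - S t) = mul (qp k) (S x) - mul (qp k) (S t)" for k
      by (rule mul_diff(1)[OF qw_pow_even smoothD[OF sm(1)] smoothD[OF sm(2)]])
    have "norm (mul (qp (n + n)) (S x - S t)) \<le> 2 * M"
      unfolding d using norm_triangle_ineq4 M(2)[OF x] M(2)[OF t] by (smt (verit))
    then have "norm (S x - S t) * norm (mul (qp (n + n)) (S x - S t)) \<le> norm (S x - S t) * (2 * M)"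
      by (rule mult_left_mono) simp
    then have "(norm (mul (qp n) (S x - S t)))\<^sup>2 \<le> norm (S x - S t) * (2 * M)"
      using interpolation[OF smooth_diff[OF sm], of n] by simp
    then show ?thesis unfolding d[symmetric] by (rule real_le_rsqrt)
  qed
  have "(S \<longlongrightarrow> S t) (at t within {s..b})"
    using continuous_on_subset[OF solD(1)[OF S], of "{s..b}"] s t unfolding continuous_on_def by auto
  then have "((\<lambda>x. sqrt (norm (S x - S t) * (2 * M))) \<longlongrightarrow> sqrt (norm (S t - S t) * (2 * M))) (at t within {s..b})"
    by (intro tendsto_intros)
  then have z: "((\<lambda>x. sqrt (norm (S x - S t) * (2 * M))) \<longlongrightarrow> 0) (at t within {s..b})" by simp
  have "\<forall>\<^sub>F x in at t within {s..b}. norm (mul (qp n) (S x) - mul (qp n) (S t)) \<le> sqrt (norm (S x - S t) * (2 * M))"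
    using le by (auto simp: eventually_at_filter)
  then show "((\<lambda>t. mul (qp n) (S t)) \<longlongrightarrow> mul (qp n) (S t)) (at t within {s..b})"
    by (rule LIM_zero_cancel[OF Lim_null_comparison[OF _ z]])
qed

lemma sol_L2_st:
  assumes S: "sol a b S" and Sa: "S a \<in> L2_st" and t: "t \<in> {a..b}"
  shows "S t \<in> L2_st"
proof -
  have at: "a \<le> t" using t by simp
  have c: "continuous_on {a..t} S" by (rule continuous_on_subset[OF solD(1)[OF S]]) (use t in auto)
  have "Pst (integral {a..t} (duh S t)) = integral {a..t} (\<lambda>\<tau>. Pst (duh S t \<tau>))"
    using integral_bounded_linear_comp(2)[OF duh_integrable[OF at c] Pst_bounded_linear] by simp
  also have "\<dots> = integral {a..t} (duh S t)"
  proof (rule integral_spike[of "{t}"])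
    fix \<tau> assume "\<tau> \<in> {a..t} - {t}"
    then show "duh S t \<tau> = Pst (duh S t \<tau>)"
      unfolding duh_def using Bil_L2_st[of "t - \<tau>" "S \<tau>" "S \<tau>"] by (simp add: L2_st_Pst)
  qed simp
  finally have "integral {a..t} (duh S t) \<in> L2_st" by (simp add: L2_st_Pst)
  moreover have "heat (t - a) (S a) \<in> L2_st" by (rule heat_L2_st[OF _ Sa]) (use at in simp)
  ultimately have "heat (t - a) (S a) + (1/2) *\<^sub>R integral {a..t} (duh S t) \<in> L2_st"
    using L2_st_subspace by (intro subspace_add subspace_scale)
  then show ?thesis by (subst solD(2)[OF S t])
qed

lemma exp_second_order: "0 \<le> u \<Longrightarrow> \<bar>exp (- u) - 1 + u\<bar> \<le> (u::real)\<^sup>2"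
proof -
  assume u: "0 \<le> u"
  have "exp (- u) = inverse (exp u)" by (simp add: exp_minus)
  also have "\<dots> \<le> inverse (1 + u)" using u exp_ge_add_one_self[of u] by (intro le_imp_inverse_le) auto
  also have "inverse (1 + u) - 1 + u = u\<^sup>2 / (1 + u)" using u by (simp add: field_simps power2_eq_square)
  then have "inverse (1 + u) = u\<^sup>2 / (1 + u) + 1 - u" by simp
  finally have "exp (- u) - 1 + u \<le> u\<^sup>2 / (1 + u)" by simp
  also have "\<dots> \<le> u\<^sup>2 / 1" using u by (intro divide_left_mono) auto
  finally show ?thesis using exp_ge_add_one_self[of "- u"] by (simp add: abs_le_iff)
qed

lemma heat_second_order:
  assumes h: "h \<ge> 0" and x: "smooth x"
  shows "norm (heat h x - x + h *\<^sub>R mul (qp 8) x) \<le> h\<^sup>2 * norm (mul (qp 16) x)"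
proof -
  let ?E = "heat h x - x + h *\<^sub>R mul (qp 8) x"
  have ae: "AE xi in lborel. norm (1 *\<^sub>R FM ?E xi) \<le> norm (qw xi ^ 16 *\<^sub>R FM (h\<^sup>2 *\<^sub>R x) xi)"
    using FM_add[of "heat h x - x" "h *\<^sub>R mul (qp 8) x"] FM_diff[of "heat h x" x] FM_heat[OF h, of x]
      FM_scaleR[of h "mul (qp 8) x"] FM_mul[OF qw_pow_even smoothD[OF x], of 8] FM_scaleR[of "h\<^sup>2" x]
  proof eventually_elim
    case (elim xi)
    let ?u = "h * (norm xi)\<^sup>2"
    have "FM ?E xi = (exp (- ?u) - 1 + ?u) *\<^sub>R FM x xi"
      using elim by (simp add: qw_pow8 scaleR_diff_left scaleR_add_left)
    then have "norm (1 *\<^sub>R FM ?E xi) = \<bar>exp (- ?u) - 1 + ?u\<bar> * norm (FM x xi)" by simp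
    also have "\<dots> \<le> ?u\<^sup>2 * norm (FM x xi)" by (intro mult_right_mono exp_second_order) (use h in auto)
    also have "?u\<^sup>2 = qw xi ^ 16 * h\<^sup>2"
      using qw_pow8[of xi] power_mult[of "qw xi" 8 2] by (simp add: power_mult_distrib)
    finally show ?case using elim(6) by (simp add: mult_ac)
  qed
  have d: "mul_dom (qp 16) (h\<^sup>2 *\<^sub>R x)" by (rule mul_scaleR(2)[OF qw_pow_even smoothD[OF x]])
  have e1: "even_weight (\<lambda>xi::real^3. 1)" by (simp add: even_weight_def)
  have "norm (mul (\<lambda>xi. 1) ?E) \<le> norm (mul (qp 16) (h\<^sup>2 *\<^sub>R x))"
    by (rule norm_mul_mono(2)[OF qw_pow_even d e1 ae])
  then show ?thesis by (simp add: mul_1 mul_scaleR(1)[OF qw_pow_even smoothD[OF x]])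
qed

text \<open>A first-order expansion of the energy, uniform on [s, b], that replaces differentiation
  of S in time. The increment of S splits into the heat part to second order, the linear term and
  the Duhamel integral; in the last one the cancellation applies to the state at each intermediate
  time.\<close>

lemma energy_increment:
  assumes S: "sol a b S" and Sa: "S a \<in> L2_st" and s: "a < s" and e: "e > 0"
  obtains d where "d > 0" "\<And>t t'. s \<le> t \<Longrightarrow> t < t' \<Longrightarrow> t' \<le> b \<Longrightarrow> t' - t < d \<Longrightarrow>
    \<bar>1/2 * (norm (mul (qp 4) (S t')))\<^sup>2 - 1/2 * (norm (mul (qp 4) (S t)))\<^sup>2
      + (t' - t) * (norm (mul (qp 8) (S t)))\<^sup>2\<bar> \<le> e * (t' - t)"
proof -
  define q where "q n = mul (qp n)" for n
  obtain M0 M8 M16 M32 where M': "M0 \<ge> 0" "\<And>t. t \<in> {s..b} \<Longrightarrow> norm (q 0 (S t)) \<le> M0" "M8 \<ge> 0" "\<And>t. t \<in> {s..b} \<Longrightarrow> norm (q 8 (S t)) \<le> M8"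
    "M16 \<ge> 0" "\<And>t. t \<in> {s..b} \<Longrightarrow> norm (q 16 (S t)) \<le> M16" "M32 \<ge> 0" "\<And>t. t \<in> {s..b} \<Longrightarrow> norm (q 32 (S t)) \<le> M32"
    unfolding q_def using sol_smooth_bound[OF S s] by metis
  define M where "M = M0 + M8 + M16 + M32"
  have M0: "M \<ge> 0" using M' by (simp add: M_def)
  have M: "norm (S t) \<le> M" "norm (q 8 (S t)) \<le> M" "norm (q 16 (S t)) \<le> M" "norm (q 32 (S t)) \<le> M" if "t \<in> {s..b}" for t
    using M'(1,3,5,7) M'(2,4,6,8)[OF that] by (auto simp: M_def q_def mul_1)
  \<comment> \<open>\<open>eta\<close> and \<open>d\<close> are chosen backwards so that the terms
    with \<open>eta\<close> and those with an additional factor h contribute e / 2 each; the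
    summands 1 keep the denominators positive.\<close>
  define eta where "eta = e / (2 * (M + CI * M\<^sup>2 + 1))"
  have den: "M + CI * M\<^sup>2 + 1 > 0" "M\<^sup>2 + CI * M ^ 3 + 1 > 0" using M0 CI_nonneg by (simp_all add: add_nonneg_pos)
  have eta: "eta > 0" using den e by (simp add: eta_def)
  have uc: "uniformly_continuous_on {s..b} (\<lambda>t. q n (S t))" for n
    unfolding q_def by (intro compact_uniformly_continuous sol_mul_continuous[OF S s] compact_Icc)
  \<comment> \<open>Uniform continuity is needed in the weights 8 and 24, because
    \<open>Bil_inner_bound\<close> measures its argument in these two.\<close>
  obtain d1 where d1: "d1 > 0" "\<And>x y. x \<in> {s..b} \<Longrightarrow> y \<in> {s..b} \<Longrightarrow> dist y x < d1 \<Longrightarrow> dist (q 8 (S y)) (q 8 (S x)) < eta"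
    using uc[of 8] eta unfolding uniformly_continuous_on_def by metis
  obtain d2 where d2: "d2 > 0" "\<And>x y. x \<in> {s..b} \<Longrightarrow> y \<in> {s..b} \<Longrightarrow> dist y x < d2 \<Longrightarrow> dist (q 24 (S y)) (q 24 (S x)) < eta"
    using uc[of 24] eta unfolding uniformly_continuous_on_def by metis
  define d where "d = min (min d1 d2) (e / (2 * (M\<^sup>2 + CI * M ^ 3 + 1)))"
  have d: "d > 0" using d1 d2 den e by (simp add: d_def)
  have main: "\<bar>1/2 * (norm (q 4 (S t')))\<^sup>2 - 1/2 * (norm (q 4 (S t)))\<^sup>2 + (t' - t) * (norm (q 8 (S t)))\<^sup>2\<bar> \<le> e * (t' - t)"
    if t: "s \<le> t" "t < t'" "t' \<le> b" "t' - t < d" for t t'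
  proof -
    define h where "h = t' - t"
    have h: "h > 0" "h < d" using t by (simp_all add: h_def)
    define x where "x = S t"
    define y where "y = S t'"
    have tI: "t \<in> {s..b}" "t' \<in> {s..b}" using t by auto
    have sx: "smooth x" and sy: "smooth y" unfolding x_def y_def by (rule sol_smoothness[OF S s], use tI in simp)+
    have qadd: "q n (u + v) = q n u + q n v" "q n (u - v) = q n u - q n v" if "smooth u" "smooth v" for n u v
      unfolding q_def using mul_add(1)[OF qw_pow_even smoothD[OF that(1)] smoothD[OF that(2)]] mul_diff(1)[OF qw_pow_even smoothD[OF that(1)] smoothD[OF that(2)]] by simp_all
    have modu: "norm (q n (S \<tau>) - q n (S \<tau>')) \<le> eta" if "\<tau> \<in> {t..t'}" "\<tau>' \<in> {t..t'}" "n = 8 \<or> n = 24" for n \<tau> \<tau>'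
    proof -
      have "dist \<tau> \<tau>' < d" using that t by (auto simp: dist_real_def)
      then have "dist \<tau> \<tau>' < d1" "dist \<tau> \<tau>' < d2" by (simp_all add: d_def)
      then show ?thesis using d1(2)[of \<tau>' \<tau>] d2(2)[of \<tau>' \<tau>] that t by (auto simp: dist_norm)
    qed
    have St: "sol t b S" by (rule sol_restart[OF S]) (use s t in auto)
    define I where "I = integral {t..t'} (duh S t')"
    define E where "E = heat h x - x + h *\<^sub>R q 8 x"
    have yx: "y - x = E - h *\<^sub>R q 8 x + (1/2) *\<^sub>R I"
    proof -
      have "y = heat h x + (1/2) *\<^sub>R I" unfolding y_def h_def x_def I_def by (rule solD(2)[OF St]) (use t in auto)
      then show ?thesis by (simp add: E_def)
    qed
    have sym: "y \<bullet> q 8 x = x \<bullet> q 8 y"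
      unfolding q_def using inner_mul[OF qw_pow_even smoothD[OF sx] smoothD[OF sy], of 8] by (simp add: inner_commute)
    have sq: "(norm (q 4 u))\<^sup>2 = u \<bullet> q 8 u" if "smooth u" for u
      unfolding power2_norm_eq_inner q_def mul_qw_inner[OF that that] by simp
    \<comment> \<open>The symmetry of the weight gives the form of a difference of squares, so the
      increment is paired with the sum of both endpoint values.\<close>
    have f: "1/2 * (norm (q 4 y))\<^sup>2 - 1/2 * (norm (q 4 x))\<^sup>2 = 1/2 * ((y - x) \<bullet> (q 8 y + q 8 x))"
      unfolding sq[OF sx] sq[OF sy] using sym by (simp add: inner_diff_left inner_add_right)
    have "1/2 * (norm (q 4 y))\<^sup>2 - 1/2 * (norm (q 4 x))\<^sup>2 + h * (norm (q 8 x))\<^sup>2 =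
        1/2 * (E \<bullet> (q 8 y + q 8 x)) - 1/2 * h * (q 8 x \<bullet> (q 8 y - q 8 x)) + 1/4 * (I \<bullet> (q 8 y + q 8 x))"
      unfolding f unfolding yx power2_norm_eq_inner by (simp add: inner_add_left inner_diff_left inner_add_right inner_diff_right algebra_simps)
    moreover have "\<bar>E \<bullet> (q 8 y + q 8 x)\<bar> \<le> (h\<^sup>2 * M) * (M + M)"
    proof (rule order_trans[OF Cauchy_Schwarz_ineq2 mult_mono])
      show "norm E \<le> h\<^sup>2 * M"
        unfolding E_def q_def
        by (rule order_trans[OF heat_second_order[OF _ sx]], use h in simp)
          (rule mult_left_mono, use M(3)[OF tI(1)] in \<open>simp_all add: q_def x_def\<close>)
      show "norm (q 8 y + q 8 x) \<le> M + M"
        unfolding x_def y_def by (rule norm_triangle_le) (rule add_mono[OF M(2)[OF tI(2)] M(2)[OF tI(1)]])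
    qed (use M0 in auto)
    moreover have "\<bar>q 8 x \<bullet> (q 8 y - q 8 x)\<bar> \<le> M * eta"
      by (rule order_trans[OF Cauchy_Schwarz_ineq2 mult_mono]) (use M(2)[OF tI(1)] modu[of t' t 8] M0 t in \<open>auto simp: x_def y_def\<close>)
    moreover have "\<bar>I \<bullet> (q 8 y + q 8 x)\<bar> \<le> 4 * CI * M\<^sup>2 * (eta + h * M) * h"
    proof -
      have bl: "bounded_linear (\<lambda>z. z \<bullet> (q 8 y + q 8 x))" by (rule bounded_linear_inner_left)
      have c: "continuous_on {t..t'} S" by (rule continuous_on_subset[OF solD(1)[OF St]]) (use t in auto)
      \<comment> \<open>The pairing is bounded without any singularity; \<open>powr 0\<close> brings
        it into the form that \<open>improper_integral\<close> expects.\<close>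
      have le: "norm (duh S t' \<tau> \<bullet> (q 8 y + q 8 x)) \<le> 4 * CI * M\<^sup>2 * (eta + h * M) * (t' - \<tau>) powr 0" if \<tau>: "t \<le> \<tau>" "\<tau> < t'" for \<tau>
      proof -
        define z where "z = S \<tau>"
        define B where "B = Bil (t' - \<tau>) z z"
        have \<tau>I: "\<tau> \<in> {s..b}" "\<tau> \<in> {t..t'}" using \<tau> t by auto
        have sz: "smooth z" unfolding z_def by (rule sol_smoothness[OF S s \<tau>I(1)])
        have zst: "z \<in> L2_st" unfolding z_def by (rule sol_L2_st[OF S Sa]) (use \<tau>I s in auto)
        have \<sigma>: "t' - \<tau> > 0" "t' - \<tau> \<le> h" using \<tau> by (auto simp: h_def)
        have Mz: "norm z * norm z \<le> M * M" using M(1)[OF \<tau>I(1)] by (intro mult_mono) (auto simp: z_def M0)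
        \<comment> \<open>The endpoint values are compared with the intermediate state
          \<open>z\<close>: the differences are small by uniform continuity, and the pairing with
          \<open>z\<close> itself is small by cancellation.\<close>
        have split: "q 8 y + q 8 x = q 8 (y - z) + q 8 (x - z) + 2 *\<^sub>R q 8 z"
          unfolding qadd[OF sy sz] qadd[OF sx sz] by (simp add: scaleR_2)
        have b: "\<bar>B \<bullet> q 8 (u - z)\<bar> \<le> CI * (M * M) * (2 * eta)" if u: "u = S \<tau>'" "\<tau>' \<in> {t..t'}" for u \<tau>'
        proof -
          have su: "smooth u" unfolding u(1) by (rule sol_smoothness[OF S s]) (use u t in auto)
          have n: "norm (q 8 (u - z)) \<le> eta" "norm (q 24 (u - z)) \<le> eta"
            unfolding qadd(2)[OF su sz] unfolding u(1) z_def by (rule modu, use u \<tau>I in auto)+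
          have "\<bar>B \<bullet> q 8 (u - z)\<bar> \<le> CI * (norm z * norm z) * (norm (q 8 (u - z)) + norm (q 24 (u - z)))"
            unfolding q_def B_def by (rule Bil_inner_bound[OF \<sigma>(1) smooth_diff[OF su sz]])
          also have "\<dots> \<le> CI * (M * M) * (eta + eta)"
            by (intro mult_mono add_mono n mult_left_mono Mz) (use CI_nonneg M0 in auto)
          finally show ?thesis by simp
        qed
        have "\<bar>B \<bullet> q 8 z\<bar> \<le> (t' - \<tau>) * CI * (norm z * norm z) * (norm (q 16 z) + norm (q 32 z))"
          unfolding q_def B_def by (rule Bil_inner_small[OF \<sigma>(1) sz zst])
        also have "\<dots> \<le> h * CI * (M * M) * (M + M)"
          by (intro mult_mono add_mono Mz \<sigma> mult_nonneg_nonneg) (use CI_nonneg M0 M[OF \<tau>I(1)] h in \<open>auto simp: z_def\<close>)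
        finally have "\<bar>B \<bullet> q 8 z\<bar> \<le> h * CI * (M * M) * (M + M)" .
        moreover have "\<bar>B \<bullet> (q 8 y + q 8 x)\<bar> \<le> \<bar>B \<bullet> q 8 (y - z)\<bar> + \<bar>B \<bullet> q 8 (x - z)\<bar> + 2 * \<bar>B \<bullet> q 8 z\<bar>"
          unfolding split inner_add_right inner_scaleR_right by linarith
        moreover have "\<bar>B \<bullet> q 8 (y - z)\<bar> \<le> CI * (M * M) * (2 * eta)" "\<bar>B \<bullet> q 8 (x - z)\<bar> \<le> CI * (M * M) * (2 * eta)"
          using b[of y t'] b[of x t] t by (auto simp: x_def y_def)
        ultimately have "\<bar>B \<bullet> (q 8 y + q 8 x)\<bar> \<le> CI * (M * M) * (2 * eta) + CI * (M * M) * (2 * eta) + 2 * (h * CI * (M * M) * (M + M))"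
          by linarith
        also have "\<dots> = 4 * CI * M\<^sup>2 * (eta + h * M)" by (simp add: power2_eq_square algebra_simps)
        finally show ?thesis using \<sigma> by (simp add: duh_def B_def z_def)
      qed
      have "norm (integral {t..t'} (\<lambda>\<tau>. duh S t' \<tau> \<bullet> (q 8 y + q 8 x))) \<le> 4 * CI * M\<^sup>2 * (eta + h * M) * ((t' - t) powr (0 + 1) / (0 + 1))"
      proof (rule improper_integral(2)[OF _ _ _ _ le])
        show "continuous_on {t..<t'} (\<lambda>\<tau>. duh S t' \<tau> \<bullet> (q 8 y + q 8 x))"
          by (intro continuous_intros duh_continuous[OF c])
        show "0 \<le> 4 * CI * M\<^sup>2 * (eta + h * M)" using CI_nonneg eta h M0 by simp
      qed (use t in auto)
      then show ?thesis
        unfolding I_def integral_bounded_linear_comp(2)[OF duh_integrable[OF _ c] bl, OF less_imp_le[OF t(2)], symmetric]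
        using h by (simp add: h_def)
    qed
    ultimately have "\<bar>1/2 * (norm (q 4 y))\<^sup>2 - 1/2 * (norm (q 4 x))\<^sup>2 + h * (norm (q 8 x))\<^sup>2\<bar> \<le>
        1/2 * ((h\<^sup>2 * M) * (M + M)) + 1/2 * h * (M * eta) + 1/4 * (4 * CI * M\<^sup>2 * (eta + h * M) * h)"
    proof -
      have gen: "\<bar>1/2 * A - 1/2 * h * B + 1/4 * D\<bar> \<le> 1/2 * A' + 1/2 * h * B' + 1/4 * D'" if "\<bar>A\<bar> \<le> A'" "\<bar>B\<bar> \<le> B'" "\<bar>D\<bar> \<le> D'" for A B D A' B' D'
      proof -
        have "\<bar>1/2 * h * B\<bar> \<le> 1/2 * h * B'" using that(2) h(1) by (simp add: abs_mult)
        then show ?thesis using that by linarith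
      qed
      assume a: "1/2 * (norm (q 4 y))\<^sup>2 - 1/2 * (norm (q 4 x))\<^sup>2 + h * (norm (q 8 x))\<^sup>2 =
        1/2 * (E \<bullet> (q 8 y + q 8 x)) - 1/2 * h * (q 8 x \<bullet> (q 8 y - q 8 x)) + 1/4 * (I \<bullet> (q 8 y + q 8 x))"
        "\<bar>E \<bullet> (q 8 y + q 8 x)\<bar> \<le> (h\<^sup>2 * M) * (M + M)" "\<bar>q 8 x \<bullet> (q 8 y - q 8 x)\<bar> \<le> M * eta"
        "\<bar>I \<bullet> (q 8 y + q 8 x)\<bar> \<le> 4 * CI * M\<^sup>2 * (eta + h * M) * h"
      show ?thesis unfolding a(1) by (rule gen[OF a(2-4)])
    qed
    also have "\<dots> \<le> (eta * (M + CI * M\<^sup>2 + 1) + h * (M\<^sup>2 + CI * M ^ 3 + 1)) * h"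
    proof -
      have "0 \<le> 1/2 * M * eta * h + eta * h + h * h" using M0 eta h by simp
      then show ?thesis by (simp add: power2_eq_square power3_eq_cube algebra_simps)
    qed
    also have "\<dots> \<le> (e / 2 + e / 2) * h"
    proof (intro mult_right_mono add_mono)
      have half: "e / (2 * D) * D = e / 2" if "D > 0" for D using that by simp
      show "eta * (M + CI * M\<^sup>2 + 1) \<le> e / 2" unfolding eta_def half[OF den(1)] ..
      have "h \<le> e / (2 * (M\<^sup>2 + CI * M ^ 3 + 1))" using h by (simp add: d_def)
      from mult_right_mono[OF this less_imp_le[OF den(2)]] show "h * (M\<^sup>2 + CI * M ^ 3 + 1) \<le> e / 2" unfolding half[OF den(2)] .
    qed (use h in simp)
    finally show ?thesis by (simp add: x_def y_def h_def)
  qed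
  show ?thesis by (rule that[OF d main[unfolded q_def]])
qed

text \<open>The increments carry the coefficient \<open>g t\<close> at the left endpoint. For the
  right derivative this is the value at x; for the left derivative the continuity of
  \<open>g\<close> shifts it to x.\<close>

lemma has_derivative_of_increments:
  fixes f g :: "real \<Rightarrow> real"
  assumes sb: "s \<le> b" and g: "continuous_on {s..b} g"
    and inc: "\<And>e. e > 0 \<Longrightarrow> \<exists>d>0. \<forall>t t'. s \<le> t \<longrightarrow> t < t' \<longrightarrow> t' \<le> b \<longrightarrow> t' - t < d \<longrightarrow> \<bar>f t' - f t + (t' - t) * g t\<bar> \<le> e * (t' - t)"
    and x: "x \<in> {s..b}"
  shows "((\<lambda>t. - f t) has_vector_derivative g x) (at x within {s..b})"
  unfolding has_vector_derivative_def has_derivative_within_alt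
proof (intro conjI allI impI)
  show "bounded_linear (\<lambda>h. h *\<^sub>R g x)" by (rule bounded_linear_scaleR_left)
  fix e :: real assume e: "e > 0"
  obtain d1 where d1: "d1 > 0" "\<And>t t'. s \<le> t \<Longrightarrow> t < t' \<Longrightarrow> t' \<le> b \<Longrightarrow> t' - t < d1 \<Longrightarrow> \<bar>f t' - f t + (t' - t) * g t\<bar> \<le> e / 2 * (t' - t)"
    using inc[of "e / 2"] e by auto
  obtain d2 where d2: "d2 > 0" "\<And>y. y \<in> {s..b} \<Longrightarrow> dist y x < d2 \<Longrightarrow> dist (g y) (g x) < e / 2"
    using g x e unfolding continuous_on_iff by (metis half_gt_zero)
  show "\<exists>d>0. \<forall>y\<in>{s..b}. norm (y - x) < d \<longrightarrow> norm (- f y - - f x - (y - x) *\<^sub>R g x) \<le> e * norm (y - x)"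
  proof (intro exI[of _ "min d1 d2"] conjI ballI impI)
    fix y assume y: "y \<in> {s..b}" "norm (y - x) < min d1 d2"
    consider "y = x" | "x < y" | "y < x" by linarith
    then show "norm (- f y - - f x - (y - x) *\<^sub>R g x) \<le> e * norm (y - x)"
    proof cases
      case 2
      have "\<bar>f y - f x + (y - x) * g x\<bar> \<le> e / 2 * (y - x)" by (rule d1(2)) (use 2 x y in auto)
      also have "\<dots> \<le> e * (y - x)" using 2 e by (intro mult_right_mono) auto
      finally show ?thesis using 2 by (simp add: abs_le_iff)
    next
      case 3
      have 1: "\<bar>f x - f y + (x - y) * g y\<bar> \<le> e / 2 * (x - y)" by (rule d1(2)) (use 3 x y in auto)
      have "\<bar>g y - g x\<bar> \<le> e / 2" using d2(2)[of y] y by (simp add: dist_real_def)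
      then have 2: "\<bar>(x - y) * (g y - g x)\<bar> \<le> (x - y) * (e / 2)" using 3 by (simp add: abs_mult)
      have "- f y - - f x - (y - x) *\<^sub>R g x = (f x - f y + (x - y) * g y) - (x - y) * (g y - g x)"
        by (simp add: algebra_simps)
      then have "\<bar>- f y - - f x - (y - x) *\<^sub>R g x\<bar> \<le> e / 2 * (x - y) + (x - y) * (e / 2)" using 1 2 by linarith
      then show ?thesis using 3 by (simp add: algebra_simps)
    qed simp
  qed (use d1 d2 in simp)
qed

lemma energy_derivative:
  assumes S: "sol a b S" and Sa: "S a \<in> L2_st" and x: "a < x" "x < b"
  shows "((\<lambda>t. - (1/2 * (norm (mul (qp 4) (S t)))\<^sup>2)) has_vector_derivative (norm (mul (qp 8) (S x)))\<^sup>2) (at x)"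
proof -
  define s where "s = (a + x) / 2"
  have s: "a < s" "s < x" using x by (auto simp: s_def)
  have "((\<lambda>t. - (1/2 * (norm (mul (qp 4) (S t)))\<^sup>2)) has_vector_derivative (norm (mul (qp 8) (S x)))\<^sup>2) (at x within {s..b})"
  proof (rule has_derivative_of_increments)
    show "continuous_on {s..b} (\<lambda>x. (norm (mul (qp 8) (S x)))\<^sup>2)"
      by (intro continuous_intros sol_mul_continuous[OF S s(1)])
    fix e :: real assume e: "e > 0"
    show "\<exists>d>0. \<forall>t t'. s \<le> t \<longrightarrow> t < t' \<longrightarrow> t' \<le> b \<longrightarrow> t' - t < d \<longrightarrow>
      \<bar>1/2 * (norm (mul (qp 4) (S t')))\<^sup>2 - 1/2 * (norm (mul (qp 4) (S t)))\<^sup>2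
      + (t' - t) * (norm (mul (qp 8) (S t)))\<^sup>2\<bar> \<le> e * (t' - t)"
      using energy_increment[OF S Sa s(1) e] by metis
  qed (use s x in auto)
  then show ?thesis using at_within_interior[of x "{s..b}"] s x by simp
qed

text \<open>Smoothing gives continuity at positive distance from a. At a itself
  \<open>sol_persistence\<close> bounds the norm from above, while from below each truncated norm is
  continuous and the truncations come arbitrarily close to the full norm.\<close>

lemma norm_H1_continuous:
  assumes S: "sol a b S" and d: "mul_dom (qp 4) (S a)"
  shows "continuous_on {a..b} (\<lambda>t. norm (mul (qp 4) (S t)))"
  unfolding continuous_on_def
proof
  let ?n = "\<lambda>t. norm (mul (qp 4) (S t))"
  fix t assume t: "t \<in> {a..b}"
  show "(?n \<longlongrightarrow> ?n t) (at t within {a..b})"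
  proof (cases "t = a")
    case False
    define s where "s = (a + t) / 2"
    have s: "a < s" "s < t" using t False by (auto simp: s_def)
    have "continuous_on {s..b} ?n" by (intro continuous_intros sol_mul_continuous[OF S s(1)])
    then have "(?n \<longlongrightarrow> ?n t) (at t within {s..b})" using t s by (simp add: continuous_on_def)
    also have "at t within {s..b} = at t within {a..b}"
      by (rule at_within_nhd[of _ "{s<..}"]) (use s in auto)
    finally show ?thesis .
  next
    case True
    obtain K where K: "K > 0" "\<And>\<tau>. \<tau> \<in> {a..b} \<Longrightarrow> norm (S \<tau>) \<le> K" using sol_bounded[OF S] by metis
    define N where "N = ?n a"
    define h where "h = (1 / (128 * CB * K)) ^ 4"
    have h: "h > 0" using K CB_pos by (simp add: h_def)
    have h4: "h powr (1/4) = 1 / (128 * CB * K)"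
      unfolding h_def by (rule power4_powr) (use K CB_pos in simp)
    \<comment> \<open>Persistence holds for every truncation with the same bound, hence also for the
      full weight.\<close>
    have up: "?n x \<le> N * (1 + 128 * CB * K * (x - a) powr (1/4))" if x: "x \<in> {a..b}" "x - a < h" for x
    proof (rule mul_dom_limit(2))
      fix R :: real assume R: "R \<ge> 0"
      show "norm (mul (wt R 4) (S x)) \<le> N * (1 + 128 * CB * K * (x - a) powr (1/4))"
      proof (rule sol_persistence[OF _ _ R])
        show "sol a x S" by (rule sol_subinterval[OF S]) (use x in auto)
        show "norm (mul (wt R 4) (S a)) \<le> N" unfolding N_def by (rule mul_wt_le[OF R d])
        have "128 * CB * K * (x - a) powr (1/4) \<le> 128 * CB * K * h powr (1/4)"
          using x K CB_pos by (intro mult_left_mono powr_mono2) auto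
        also have "\<dots> = 1" unfolding h4 using K CB_pos by simp
        finally show "128 * CB * K * (x - a) powr (1/4) \<le> 1" .
      qed (use K x in auto)
    qed
    have dom: "mul_dom (qp 4) (S x)" if "x \<in> {a..b}" for x
      using d smoothD[OF sol_smoothness[OF S, of x x]] that by (cases "x = a") auto
    have near: "\<forall>\<^sub>F x in at a within {a..b}. x \<in> {a..b} \<and> x - a < h"
      unfolding eventually_at by (rule exI[of _ h]) (use h in \<open>auto simp: dist_real_def\<close>)
    show ?thesis
      unfolding True N_def[symmetric]
    proof (rule order_tendstoI)
      fix l assume l: "N < l"
      have "((\<lambda>x. N * (1 + 128 * CB * K * (x - a) powr (1/4))) \<longlongrightarrow> N * (1 + 128 * CB * K * (a - a) powr (1/4))) (at a within {a..b})"
        by (intro tendsto_intros tendsto_powr') (auto simp: eventually_at_filter)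
      then have "\<forall>\<^sub>F x in at a within {a..b}. N * (1 + 128 * CB * K * (x - a) powr (1/4)) < l"
        by (rule order_tendstoD(2)) (use l in simp)
      then show "\<forall>\<^sub>F x in at a within {a..b}. ?n x < l"
        using near
      proof eventually_elim
        case (elim x) then show ?case using up[of x] by linarith
      qed
    next
      fix l assume l: "l < N"
      have "\<exists>R\<ge>0. norm (mul (wt R 4) (S a)) > l"
      proof (rule ccontr)
        assume "\<not> ?thesis"
        then have "\<And>R. R \<ge> 0 \<Longrightarrow> norm (mul (wt R 4) (S a)) \<le> l" by force
        from mul_dom_limit(2)[OF this] show False using l by (simp add: N_def)
      qed
      then obtain R where R: "R \<ge> 0" "l < norm (mul (wt R 4) (S a))" by blast
      have "continuous_on {a..b} (\<lambda>x. norm (mul (wt R 4) (S x)))"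
        by (intro continuous_on_norm bounded_linear.continuous_on[OF wt_bounded_linear[OF R(1)]] solD(1)[OF S])
      then have "((\<lambda>x. norm (mul (wt R 4) (S x))) \<longlongrightarrow> norm (mul (wt R 4) (S a))) (at a within {a..b})"
        using t True by (simp add: continuous_on_def)
      from order_tendstoD(1)[OF this R(2)] near
      show "\<forall>\<^sub>F x in at a within {a..b}. l < ?n x"
      proof eventually_elim
        case (elim x)
        then show ?case using mul_wt_le[OF R(1) dom[of x]] by linarith
      qed
    qed
  qed
qed

text \<open>The derivative is known in the open interval only; continuity of the H^1 norm up to a is
  what admits initial data in H^1, for which the integrand may be singular there.\<close>

lemma energy_equality:
  assumes S: "sol a b S" and ab: "a \<le> b" and Sa: "S a \<in> L2_st" "mul_dom (qp 4) (S a)"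
  shows "((\<lambda>\<tau>. (norm (mul (qp 8) (S \<tau>)))\<^sup>2) has_integral
    (1/2 * (norm (mul (qp 4) (S a)))\<^sup>2 - 1/2 * (norm (mul (qp 4) (S b)))\<^sup>2)) {a..b}"
proof -
  let ?F = "\<lambda>t. - (1/2 * (norm (mul (qp 4) (S t)))\<^sup>2)"
  have "((\<lambda>\<tau>. (norm (mul (qp 8) (S \<tau>)))\<^sup>2) has_integral (?F b - ?F a)) {a..b}"
  proof (rule fundamental_theorem_of_calculus_interior[OF ab])
    show "continuous_on {a..b} ?F" by (intro continuous_intros norm_H1_continuous[OF S Sa(2)])
    show "(?F has_vector_derivative (norm (mul (qp 8) (S x)))\<^sup>2) (at x)" if "x \<in> {a<..<b}" for x
      by (rule energy_derivative[OF S Sa(1)]) (use that in auto)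
  qed
  then show ?thesis by simp
qed

lemma H1_nonincreasing:
  assumes S: "sol a b S" and ab: "a \<le> b" and Sa: "S a \<in> L2_st" "mul_dom (qp 4) (S a)"
  shows "norm (mul (qp 4) (S b)) \<le> norm (mul (qp 4) (S a))"
proof -
  have "0 \<le> 1/2 * (norm (mul (qp 4) (S a)))\<^sup>2 - 1/2 * (norm (mul (qp 4) (S b)))\<^sup>2"
    by (rule has_integral_nonneg[OF energy_equality[OF assms]]) simp
  then have "(norm (mul (qp 4) (S b)))\<^sup>2 \<le> (norm (mul (qp 4) (S a)))\<^sup>2" by simp
  then show ?thesis by (rule power2_le_imp_le) simp
qed

section \<open>Global existence\<close>

text \<open>\<open>\<delta>\<close> depends on the H^1 bound \<open>B\<close> alone, and
  \<open>B\<close> is handed on unchanged, so the step can be repeated indefinitely. The summand 1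
  in the denominator allows B = 0 and keeps \<open>\<delta>\<close> at most 1, as
  \<open>sol_growth\<close> requires.\<close>

lemma extension_step:
  assumes T: "sol 0 T S" "T > 0" and S0: "S 0 \<in> L2_st" and B: "norm (mul (qp 4) (S T)) \<le> B"
  defines "\<delta> \<equiv> (1 / (256 * CB * B + 1)) ^ 4"
  obtains V where "sol 0 (T + \<delta>) V" "V 0 = S 0" "norm (mul (qp 4) (V (T + \<delta>))) \<le> B"
proof -
  have B0: "B \<ge> 0" using B norm_ge_zero order_trans by blast
  have r: "0 < 1 / (256 * CB * B + 1)" "1 / (256 * CB * B + 1) \<le> 1"
    using B0 CB_pos by (simp_all add: add_nonneg_pos divide_le_eq)
  have \<delta>: "0 < \<delta>" "\<delta> \<le> 1" unfolding \<delta>_def using r by (simp_all add: power_le_one)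
  have \<delta>4: "\<delta> powr (1/4) = 1 / (256 * CB * B + 1)" unfolding \<delta>_def by (rule power4_powr[OF r(1)])
  have ST: "S T \<in> L2_st" by (rule sol_L2_st[OF T(1) S0]) (use T in simp)
  have STd: "mul_dom (qp 4) (S T)" by (rule smoothD[OF sol_smoothness[OF T]]) (use T in simp)
  have H1: "norm (mul (qp 4) (U t)) \<le> B" if U: "sol T c U" "U T = S T" "t \<in> {T..c}" for U c t
  proof -
    have "sol T t U" by (rule sol_subinterval[OF U(1)]) (use U in auto)
    then have "norm (mul (qp 4) (U t)) \<le> norm (mul (qp 4) (U T))"
      by (rule H1_nonincreasing) (use U ST STd in auto)
    then show ?thesis using B U(2) by simp
  qed
  have grow: "norm (U t) \<le> 2 * norm (S T)" if U: "sol T c U" "U T = S T" "t \<in> {T..c}" "c \<le> T + \<delta>" for U c t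
  proof -
    have "norm (U t) \<le> 2 * norm (U T)"
    proof (rule sol_growth[OF U(1) _ _ _ U(3)])
      fix \<tau> assume \<tau>: "\<tau> \<in> {T..c}"
      have "mul_dom (qp 4) (U \<tau>)"
        using STd U(2) smoothD[OF sol_smoothness[OF U(1), of \<tau> \<tau>]] \<tau> by (cases "\<tau> = T") auto
      then show "norm (mul (wt 1 4) (U \<tau>)) \<le> B" using mul_wt_le[of 1 4 "U \<tau>"] H1[OF U(1,2) \<tau>] by simp
    next
      have "256 * CB * B * (c - T) powr (1/4) \<le> 256 * CB * B * \<delta> powr (1/4)"
        using U CB_pos B0 by (intro mult_left_mono powr_mono2) auto
      also have "\<dots> \<le> 1" unfolding \<delta>4 using B0 CB_pos by (simp add: divide_le_eq add_nonneg_pos)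
      finally show "256 * CB * B * (c - T) powr (1/4) \<le> 1" .
    qed (use U \<delta> in auto)
    then show ?thesis using U(2) by simp
  qed
  \<comment> \<open>On a window of length \<open>\<delta>\<close> every continuation keeps its L^2
    norm below \<open>K\<close>, so the local existence time \<open>e\<close> is the same at each
    inner step and finitely many steps fill the window.\<close>
  define K where "K = 2 * norm (S T) + 1"
  have K: "K > 0" by (simp add: K_def add_nonneg_pos)
  define e where "e = (1 / (32 * CB * K)) ^ 4"
  have e: "e > 0" using K CB_pos by (simp add: e_def)
  have main: "\<exists>U. sol T (min (T + real n * e) (T + \<delta>)) U \<and> U T = S T" for n
  proof (induction n)
    case 0
    have "sol T T S" by (rule sol_subinterval[OF T(1)]) (use T in auto)
    then show ?case using \<delta> by auto
  next
    case (Suc n)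
    define c where "c = min (T + real n * e) (T + \<delta>)"
    have c: "T \<le> c" "c \<le> T + \<delta>" using e \<delta> by (auto simp: c_def)
    obtain U where U: "sol T c U" "U T = S T" using Suc by (auto simp: c_def)
    have "norm (U c) \<le> K" using grow[OF U, of c] c by (simp add: K_def)
    then obtain W where W: "sol c (c + e) W" "W c = U c"
      using local_solution[OF K, of "U c" c] unfolding e_def by metis
    have "sol T (c + e) (\<lambda>t. if t \<le> c then U t else W t)"
      by (rule sol_concat[OF U(1) W(1)]) (use c e W in auto)
    then have "sol T (min (T + real (Suc n) * e) (T + \<delta>)) (\<lambda>t. if t \<le> c then U t else W t)"
      by (rule sol_subinterval) (use e \<delta> in \<open>auto simp: c_def min_def algebra_simps\<close>)
    then show ?case using U(2) c by (intro exI[of _ "\<lambda>t. if t \<le> c then U t else W t"]) simp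
  qed
  obtain n where "\<delta> / e < real n" using reals_Archimedean2 by blast
  then have "\<delta> \<le> real n * e" using e by (simp add: field_simps)
  then obtain U where U: "sol T (T + \<delta>) U" "U T = S T" using main[of n] by (auto simp: min_absorb2)
  have "sol 0 (T + \<delta>) (\<lambda>t. if t \<le> T then S t else U t)"
    by (rule sol_concat[OF T(1) U(1)]) (use T \<delta> U in auto)
  then show ?thesis
    by (rule that) (use T \<delta> H1[OF U, of "T + \<delta>"] in auto)
qed

lemma global_solution:
  assumes S0: "S\<^sub>0 \<in> L2_st"
  obtains G where "G 0 = S\<^sub>0" "\<And>T. T \<ge> 0 \<Longrightarrow> sol 0 T G"
proof -
  define K where "K = norm S\<^sub>0 + 1"
  have K: "K > 0" "norm S\<^sub>0 \<le> K" by (simp_all add: K_def add_nonneg_pos)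
  define h where "h = (1 / (32 * CB * K)) ^ 4"
  have h: "h > 0" using K CB_pos by (simp add: h_def)
  obtain S1 where S1: "sol 0 h S1" "S1 0 = S\<^sub>0" using local_solution[OF K, of 0] by (auto simp: h_def)
  \<comment> \<open>The H^1 norm is read off at the positive time \<open>h\<close>, where smoothing
    makes it finite; the datum itself need not have one.\<close>
  define B where "B = norm (mul (qp 4) (S1 h))"
  define \<delta> where "\<delta> = (1 / (256 * CB * B + 1)) ^ 4"
  have "256 * CB * B + 1 > 0" using CB_pos by (simp add: B_def add_nonneg_pos)
  then have \<delta>: "\<delta> > 0" by (simp add: \<delta>_def)
  have steps: "\<exists>S. sol 0 (h + real n * \<delta>) S \<and> S 0 = S\<^sub>0 \<and> norm (mul (qp 4) (S (h + real n * \<delta>))) \<le> B" for n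
  proof (induction n)
    case 0 then show ?case using S1 by (auto simp: B_def)
  next
    case (Suc n)
    then obtain S where S: "sol 0 (h + real n * \<delta>) S" "S 0 = S\<^sub>0" "norm (mul (qp 4) (S (h + real n * \<delta>))) \<le> B" by blast
    have T: "h + real n * \<delta> > 0" using h \<delta> by (simp add: add_pos_nonneg)
    have "S 0 \<in> L2_st" using S(2) S0 by simp
    from extension_step[OF S(1) T this S(3), folded \<delta>_def]
    obtain V where V: "sol 0 (h + real n * \<delta> + \<delta>) V" "V 0 = S 0" "norm (mul (qp 4) (V (h + real n * \<delta> + \<delta>))) \<le> B" .
    have e: "h + real (Suc n) * \<delta> = h + real n * \<delta> + \<delta>" by (simp add: algebra_simps)
    show ?case unfolding e using V S(2) by (intro exI[of _ V]) simp
  qed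
  have ex: "\<exists>S. sol 0 T S \<and> S 0 = S\<^sub>0" if T: "T \<ge> 0" for T
  proof -
    obtain n where "T / \<delta> < real n" using reals_Archimedean2 by blast
    then have n: "T \<le> h + real n * \<delta>" using \<delta> h by (simp add: field_simps)
    obtain S where "sol 0 (h + real n * \<delta>) S" "S 0 = S\<^sub>0" using steps by blast
    then show ?thesis using sol_subinterval[of 0 "h + real n * \<delta>" S 0 T] n T by blast
  qed
  then obtain F where F: "\<And>T. T \<ge> 0 \<Longrightarrow> sol 0 T (F T)" "\<And>T. T \<ge> 0 \<Longrightarrow> F T 0 = S\<^sub>0" by metis
  \<comment> \<open>The diagonal of a family of solutions on growing intervals; uniqueness makes the
    family consistent.\<close>
  define G where "G t = F t t" for t
  have "sol 0 T G" if T: "T \<ge> 0" for T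
  proof (rule sol_cong[OF F(1)[OF T]])
    fix t assume t: "t \<in> {0..T}"
    have s: "sol 0 t (F T)" by (rule sol_subinterval[OF F(1)[OF T]]) (use t in auto)
    have "F t t = F T t" by (rule sol_unique[OF F(1)[of t] s]) (use t T F(2) in auto)
    then show "G t = F T t" by (simp add: G_def)
  qed
  moreover have "G 0 = S\<^sub>0" by (simp add: G_def F)
  ultimately show ?thesis using that by blast
qed

section \<open>Mild solutions and solutions on bounded intervals\<close>

lemma heat_Pst_duh: "(\<lambda>\<tau>. heat_Pst (t - \<tau>) (vort_tensor (S \<tau>))) = duh S t"
  by (simp add: fun_eq_iff heat_Pst_vort_tensor duh_def)

lemma time_axis: "{t. 0 \<le> t \<and> ereal t < \<infinity>} = {0..}"
  by auto

lemma sol_imp_mild_solution: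
  assumes S0: "S\<^sub>0 \<in> L2_st" and G: "G 0 = S\<^sub>0" "\<And>T. T \<ge> 0 \<Longrightarrow> sol 0 T G"
  shows "mild_solution \<infinity> S\<^sub>0 G"
  unfolding mild_solution_def heat_Pst_duh time_axis
proof (intro conjI allI impI)
  show "G t \<in> L2_st" if "0 \<le> t \<and> ereal t < \<infinity>" for t
    using sol_L2_st[OF G(2)[of t], of t] G(1) S0 that by simp
  show "continuous_on {0..} G"
    unfolding continuous_on_def
  proof
    fix t :: real assume t: "t \<in> {0..}"
    have "(G \<longlongrightarrow> G t) (at t within {0..t + 1})"
      using solD(1)[OF G(2)[of "t + 1"]] t by (simp add: continuous_on_def)
    also have "at t within {0..t + 1} = at t within {0..}"
      by (rule at_within_nhd[of _ "{..<t + 1}"]) auto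
    finally show "(G \<longlongrightarrow> G t) (at t within {0..})" .
  qed
  fix t assume t: "0 < t \<and> ereal t < \<infinity>"
  then have s: "sol 0 t G" by (intro G) simp
  show "duh G t integrable_on {0..t}" by (rule duh_integrable[OF _ solD(1)[OF s]]) (use t in simp)
  have "G t = heat (t - 0) (G 0) + (1/2) *\<^sub>R integral {0..t} (duh G t)"
    by (rule solD(2)[OF s]) (use t in simp)
  then show "G t = heat t S\<^sub>0 + (1/2) *\<^sub>R integral {0..t} (duh G t)" by (simp only: G(1) diff_zero)
qed

lemma mild_solution_imp_sol:
  assumes m: "mild_solution \<infinity> S\<^sub>0 S"
  shows "S 0 = S\<^sub>0" "T \<ge> 0 \<Longrightarrow> sol 0 T S"
proof -
  have c: "continuous_on {0..} S" using m unfolding mild_solution_def time_axis by blast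
  have eq: "S t = heat t S\<^sub>0 + (1/2) *\<^sub>R integral {0..t} (duh S t)" if "t > 0" for t
    using m that unfolding mild_solution_def heat_Pst_duh by simp
  have c1: "continuous_on {0..1} S" by (rule continuous_on_subset[OF c]) auto
  \<comment> \<open>The mild equation speaks of t > 0 only. Its right side is continuous up to 0
    with limit the datum, and so is \<open>S\<close>.\<close>
  show S0: "S 0 = S\<^sub>0"
  proof (rule tendsto_unique)
    show "at (0::real) within {0..1} \<noteq> bot" by (simp add: trivial_limit_within islimpt_Icc)
    show "(S \<longlongrightarrow> S 0) (at 0 within {0..1})" using c1 by (simp add: continuous_on_def)
    have "continuous_on {0..1} (\<lambda>t. heat t S\<^sub>0 + (1/2) *\<^sub>R integral {0..t} (duh S t))"
      by (intro continuous_intros duh_integral_continuous[OF c1] continuous_on_subset[OF heat_continuous]) auto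
    then have "((\<lambda>t. heat t S\<^sub>0 + (1/2) *\<^sub>R integral {0..t} (duh S t)) \<longlongrightarrow> heat 0 S\<^sub>0 + (1/2) *\<^sub>R integral {0..0} (duh S 0)) (at 0 within {0..1})"
      unfolding continuous_on_def by (rule bspec) simp
    then have "((\<lambda>t. heat t S\<^sub>0 + (1/2) *\<^sub>R integral {0..t} (duh S t)) \<longlongrightarrow> S\<^sub>0) (at 0 within {0..1})"
      by (simp add: heat_0)
    then show "(S \<longlongrightarrow> S\<^sub>0) (at 0 within {0..1})"
      by (rule Lim_transform_eventually) (auto simp: eventually_at_filter eq[symmetric])
  qed
  show "sol 0 T S" if "T \<ge> 0"
    unfolding sol_def S0
  proof (intro conjI ballI)
    show "continuous_on {0..T} S" by (rule continuous_on_subset[OF c]) auto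
    fix t assume t: "t \<in> {0..T}"
    show "S t = heat (t - 0) S\<^sub>0 + (1/2) *\<^sub>R integral {0..t} (duh S t)"
    proof (cases "t = 0")
      case True then show ?thesis by (simp add: heat_0 S0)
    next
      case False then show ?thesis using eq[of t] t by (simp only: diff_zero) auto
    qed
  qed
qed

lemma solution_Hinf:
  assumes G: "\<And>T. T \<ge> 0 \<Longrightarrow> sol 0 T G"
  shows "continuous_on_Hinf {0<..} G"
  unfolding continuous_on_Hinf_def
proof (intro allI conjI ballI)
  fix k :: nat and t :: real assume "t \<in> {0<..}"
  then have t: "t > 0" by simp
  have sm: "smooth (G s)" if "s > 0" for s
    by (rule sol_smoothness[OF G[of s] that]) (use that in simp_all)
  show "G t \<in> Hs (real k)" by (rule Hs_bound(1)[OF smoothD[OF sm[OF t]]])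
  let ?q = "mul (qp (4 * k))"
  let ?b = "\<lambda>s. sqrt (2 ^ k * cG\<^sup>2 * ((norm (G s - G t))\<^sup>2 + (norm (?q (G s) - ?q (G t)))\<^sup>2))"
  have le: "norm (Hs_norm (real k) (G s - G t)) \<le> ?b s" if s: "s > 0" for s
  proof -
    note d = mul_diff[OF qw_pow_even smoothD[OF sm[OF s]] smoothD[OF sm[OF t]], of "4 * k"]
    have "norm (Hs_norm (real k) (G s - G t)) = sqrt ((Hs_norm (real k) (G s - G t))\<^sup>2)" by simp
    also have "\<dots> \<le> ?b s" unfolding d(1)[symmetric] by (rule real_sqrt_le_mono[OF Hs_bound(2)[OF d(2)]])
    finally show ?thesis .
  qed
  have "t / 2 > 0" "t + 1 \<ge> 0" using t by simp_all
  note cq = sol_mul_continuous[OF G[OF this(2)] this(1)]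
  have c: "continuous_on {t / 2..t + 1} G" using cq[of 0] by (simp add: mul_1)
  have "continuous_on {t / 2..t + 1} ?b" by (intro continuous_intros c cq)
  then have "(?b \<longlongrightarrow> ?b t) (at t within {t / 2..t + 1})" unfolding continuous_on_def by (rule bspec) (use t in simp)
  also have "at t within {t / 2..t + 1} = at t within {0<..}"
    by (rule at_within_nhd[of _ "{t / 2<..<t + 1}"]) (use t in auto)
  finally have z: "(?b \<longlongrightarrow> 0) (at t within {0<..})" by simp
  show "((\<lambda>s. Hs_norm (real k) (G s - G t)) \<longlongrightarrow> 0) (at t within {0<..})"
    by (rule Lim_null_comparison[OF _ z]) (use le in \<open>auto simp: eventually_at_filter\<close>)
qed

lemma solution_energy:
  assumes S0: "S\<^sub>0 \<in> Hs_st 1" and G: "G 0 = S\<^sub>0" "\<And>T. T \<ge> 0 \<Longrightarrow> sol 0 T G" and t: "t > 0"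
  shows "((\<lambda>\<tau>. (norm (- l2_laplacian (G \<tau>)))\<^sup>2) has_integral
    (1 / 2 * (Hdot1_norm S\<^sub>0)\<^sup>2 - 1 / 2 * (Hdot1_norm (G t))\<^sup>2)) {0..t}"
proof -
  have sm: "smooth (G s)" if "s > 0" for s
    by (rule sol_smoothness[OF G(2)[of s] that]) (use that in simp_all)
  have S0': "G 0 \<in> L2_st" "mul_dom (qp 4) (G 0)"
    using S0 Hs_1_dom unfolding G(1) Hs_st_def by auto
  have "((\<lambda>\<tau>. (norm (mul (qp 8) (G \<tau>)))\<^sup>2) has_integral
    (1 / 2 * (Hdot1_norm S\<^sub>0)\<^sup>2 - 1 / 2 * (Hdot1_norm (G t))\<^sup>2)) {0..t}"
    using energy_equality[OF G(2)[OF less_imp_le[OF t]] less_imp_le[OF t] S0']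
    unfolding Hdot1_norm_mul[OF S0'(2)[unfolded G(1)]] Hdot1_norm_mul[OF smoothD[OF sm[OF t]]] G(1) .
  \<comment> \<open>At time 0 the datum is only in H^1 and its Laplacian need not exist in L^2, so
    the two integrands are identified for positive times and the point 0 is discarded.\<close>
  then show ?thesis
    by (rule has_integral_spike[of "{0}", rotated 2])
      (use laplacian_mul[OF smoothD[OF sm] smoothD[OF sm]] in auto)
qed

theorem theorem1p2:
  fixes S\<^sub>0 :: matrix_l2
  assumes "S\<^sub>0 \<in> L2_st"
  shows "\<exists>S. mild_solution \<infinity> S\<^sub>0 S \<and>
    (\<forall>S'. mild_solution \<infinity> S\<^sub>0 S' \<longrightarrow> (\<forall>t\<ge>0. S' t = S t)) \<and>
    continuous_on_Hinf {0<..} S \<and>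
    (S\<^sub>0 \<in> Hs_st 1 \<longrightarrow> (\<forall>t>0.
      (\<lambda>\<tau>. (norm (- l2_laplacian (S \<tau>)))\<^sup>2) integrable_on {0..t} \<and>
      1 / 2 * (Hdot1_norm (S t))\<^sup>2 + integral {0..t} (\<lambda>\<tau>. (norm (- l2_laplacian (S \<tau>)))\<^sup>2)
        = 1 / 2 * (Hdot1_norm S\<^sub>0)\<^sup>2))"
proof -
  obtain G where G: "G 0 = S\<^sub>0" "\<And>T. T \<ge> 0 \<Longrightarrow> sol 0 T G" using global_solution[OF assms] by metis
  show ?thesis
  proof (intro exI[of _ G] conjI allI impI)
    show "mild_solution \<infinity> S\<^sub>0 G" by (rule sol_imp_mild_solution[OF assms G])
    show "continuous_on_Hinf {0<..} G" by (rule solution_Hinf[OF G(2)])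
    show "S' t = G t" if S': "mild_solution \<infinity> S\<^sub>0 S'" and t: "0 \<le> t" for S' t
      by (rule sol_unique[OF mild_solution_imp_sol(2)[OF S' t] G(2)[OF t]])
        (use mild_solution_imp_sol(1)[OF S'] G(1) t in auto)
    fix t :: real assume S0: "S\<^sub>0 \<in> Hs_st 1" and t: "0 < t"
    note i = solution_energy[OF S0 G t]
    show "(\<lambda>\<tau>. (norm (- l2_laplacian (G \<tau>)))\<^sup>2) integrable_on {0..t}" using i by blast
    show "1 / 2 * (Hdot1_norm (G t))\<^sup>2 + integral {0..t} (\<lambda>\<tau>. (norm (- l2_laplacian (G \<tau>)))\<^sup>2) = 1 / 2 * (Hdot1_norm S\<^sub>0)\<^sup>2"
      using integral_unique[OF i] by simp
  qed
qed

end
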